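(* A seven-dimensional compact solvmanifold cannot admit invariant non-parallel strong $\mathrm{G}_2T$-structures.
   Context: A compact solvmanifold is a quotient $\Gamma\backslash G$ of a simply connected solvable Lie group $G$ by a co-compact discrete subgroup $\Gamma\subset G$; an invariant $\mathrm{G}_2$-structure on $\Gamma\backslash G$ is one induced by a left-invariant $\mathrm{G}_2$-structure on $G$. Write $e^{ij\cdots}=e^i\wedge e^j\wedge\cdots$. A $\mathrm{G}_2$-structure on a $7$-manifold $M$ is a definite $3$-form $\varphi$: at each point there is a coframe $(e^1,\dots,e^7)$ with $\varphi=e^{123}+e^1\wedge(e^{45}+e^{67})+e^2\wedge(e^{46}-e^{57})-e^3\wedge(e^{47}+e^{56})$. It induces the metric $g_\varphi$ for which this coframe is orthonormal, the orientation $e^{1234567}$, and a Hodge operator $\star$. It is a $\mathrm{G}_2T$-structure if $d\star\varphi=\theta\wedge\star\varphi$ for some $1$-form $\theta$ (the Lee form; necessarily $\theta=-\frac13\star(\star d\varphi\wedge\varphi)$). Its torsion $3$-form is $T=\frac16\star(d\varphi\wedge\varphi)\,\varphi-\star d\varphi+\star(\theta\wedge\varphi)$. A $\mathrm{G}_2T$-structure is strong if $dT=0$, and it is parallel if $d\varphi=0$ and $d\star\varphi=0$. *)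

theory Defs
  imports
    "HOL-Analysis.Analysis"
    "HOL-Algebra.Solvable_Groups"
    "HOL-Combinatorics.Permutations"
begin

section \<open>Smooth manifolds\<close>

text \<open>Both functions below are only meant for open sets \<open>S\<close>. For \<open>k > 0\<close>, \<open>f\<close> is of class \<open>C\<^sup>k\<close> iff it is
  differentiable and all its directional derivatives are of class \<open>C\<^sup>k\<^sup>-\<^sup>1\<close>.\<close>

fun Ck_on :: "nat \<Rightarrow> 'a::euclidean_space set \<Rightarrow> ('a \<Rightarrow> 'b::real_normed_vector) \<Rightarrow> bool" where
  "Ck_on 0 S f \<longleftrightarrow> continuous_on S f"
| "Ck_on (Suc k) S f \<longleftrightarrow> (\<forall>x\<in>S. f differentiable (at x)) \<and>
     (\<forall>v. Ck_on k S (\<lambda>x. frechet_derivative f (at x) v))"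

definition smooth_on :: "'a::euclidean_space set \<Rightarrow> ('a \<Rightarrow> 'b::real_normed_vector) \<Rightarrow> bool" where
  "smooth_on S f \<longleftrightarrow> (\<forall>k. Ck_on k S f)"

text \<open>A chart is a pair \<open>(U, f)\<close> of an open domain and a homeomorphism \<open>f\<close> of \<open>U\<close> onto an open subset of
  the model space; \<open>f\<close> is irrelevant outside \<open>U\<close>. Manifolds are types of class
  \<open>{t2_space, second_countable_topology}\<close> together with a (not necessarily maximal) smooth atlas.\<close>

type_synonym ('m, 'v) chart = "'m set \<times> ('m \<Rightarrow> 'v)"

definition smooth_atlas :: "('m::{t2_space,second_countable_topology}, 'v::euclidean_space) chart set \<Rightarrow> bool" where
  "smooth_atlas A \<longleftrightarrow>
     (\<forall>(U, f)\<in>A. open U \<and> open (f ` U) \<and> homeomorphism U (f ` U) f (inv_into U f)) \<and>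
     (\<Union>(U, f)\<in>A. U) = UNIV \<and>
     (\<forall>(U, f)\<in>A. \<forall>(V, g)\<in>A. smooth_on (f ` (U \<inter> V)) (g \<circ> inv_into U f))"

definition product_atlas ::
  "('m, 'v) chart set \<Rightarrow> ('n, 'w) chart set \<Rightarrow> ('m \<times> 'n, 'v \<times> 'w) chart set" where
  "product_atlas A B = {(U \<times> V, map_prod f g) | U f V g. (U, f) \<in> A \<and> (V, g) \<in> B}"

definition smooth_map_on ::
  "('m::topological_space, 'v::euclidean_space) chart set \<Rightarrow>
   ('n::topological_space, 'w::euclidean_space) chart set \<Rightarrow> 'm set \<Rightarrow> ('m \<Rightarrow> 'n) \<Rightarrow> bool" where
  "smooth_map_on A B S F \<longleftrightarrow> continuous_on S F \<and>
     (\<forall>(U, f)\<in>A. \<forall>(V, g)\<in>B. smooth_on (f ` (U \<inter> S \<inter> F -` V)) (g \<circ> F \<circ> inv_into U f))"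

definition local_diffeomorphism ::
  "('m::topological_space, 'v::euclidean_space) chart set \<Rightarrow>
   ('n::topological_space, 'w::euclidean_space) chart set \<Rightarrow> ('m \<Rightarrow> 'n) \<Rightarrow> bool" where
  "local_diffeomorphism A B F \<longleftrightarrow>
     (\<forall>p. \<exists>W. open W \<and> p \<in> W \<and> open (F ` W) \<and> inj_on F W \<and>
        smooth_map_on A B W F \<and> smooth_map_on B A (F ` W) (inv_into W F))"


section \<open>Alternating forms on a vector space\<close>

text \<open>A \<open>k\<close>-form is a function of a sequence of vectors of which only the first \<open>k\<close> entries matter.\<close>

type_synonym 'v mform = "(nat \<Rightarrow> 'v) \<Rightarrow> real"

definition alt_form :: "nat \<Rightarrow> 'v::real_vector mform \<Rightarrow> bool" where
  "alt_form k \<alpha> \<longleftrightarrow>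
     (\<forall>v w. (\<forall>i<k. v i = w i) \<longrightarrow> \<alpha> v = \<alpha> w) \<and>
     (\<forall>v. \<forall>i<k. linear (\<lambda>x. \<alpha> (v(i := x)))) \<and>
     (\<forall>v i j. i < j \<and> j < k \<and> v i = v j \<longrightarrow> \<alpha> v = 0)"

text \<open>The normalisation is the one with \<open>(e\<^sup>1 \<and> \<dots> \<and> e\<^sup>k)(e\<^sub>1, \<dots>, e\<^sub>k) = 1\<close> for dual bases.\<close>

definition wedge :: "nat \<Rightarrow> nat \<Rightarrow> 'v mform \<Rightarrow> 'v mform \<Rightarrow> 'v mform" where
  "wedge k l \<alpha> \<beta> = (\<lambda>v. (\<Sum>\<sigma> | \<sigma> permutes {..<k + l}.
      of_int (sign \<sigma>) * \<alpha> (\<lambda>i. v (\<sigma> i)) * \<beta> (\<lambda>i. v (\<sigma> (k + i)))) / (fact k * fact l))"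

text \<open>\<open>wedge_list e [i\<^sub>1, \<dots>, i\<^sub>k]\<close> is \<open>e\<^sup>i\<^sup>1 \<and> \<dots> \<and> e\<^sup>i\<^sup>k\<close>.\<close>

fun wedge_list :: "(nat \<Rightarrow> 'v \<Rightarrow> real) \<Rightarrow> nat list \<Rightarrow> 'v mform" where
  "wedge_list e [] = (\<lambda>v. 1)"
| "wedge_list e (i # is) = wedge 1 (length is) (\<lambda>v. e i (v 0)) (wedge_list e is)"


section \<open>Linear algebra of definite 3-forms in dimension seven\<close>

definition coframe :: "(nat \<Rightarrow> real^7 \<Rightarrow> real) \<Rightarrow> bool" where
  "coframe e \<longleftrightarrow> (\<forall>i\<in>{1..7}. linear (e i)) \<and> (\<forall>v. (\<forall>i\<in>{1..7}. e i v = 0) \<longrightarrow> v = 0)"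

definition dual_frame :: "(nat \<Rightarrow> real^7 \<Rightarrow> real) \<Rightarrow> nat \<Rightarrow> real^7" where
  "dual_frame e i = (THE v. \<forall>j\<in>{1..7}. e j v = (if j = i then 1 else 0))"

text \<open>The Hodge operator on \<open>k\<close>-forms of the inner product making \<open>e\<close> orthonormal and the orientation
  \<open>e\<^sup>1\<^sup>2\<^sup>3\<^sup>4\<^sup>5\<^sup>6\<^sup>7\<close>: the contraction of \<open>\<alpha>\<close> with the volume form, equivalently
  \<open>\<beta> \<and> \<star>\<alpha> = \<langle>\<beta>, \<alpha>\<rangle> vol\<close>. For \<open>k = 7\<close> the result is a 0-form, i.e. a constant function of \<open>v\<close>.\<close>

definition hodge :: "(nat \<Rightarrow> real^7 \<Rightarrow> real) \<Rightarrow> nat \<Rightarrow> (real^7) mform \<Rightarrow> (real^7) mform" where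
  "hodge e k \<alpha> = (\<lambda>v. (\<Sum>s \<in> {..<k} \<rightarrow>\<^sub>E {1..7}.
      \<alpha> (\<lambda>i. dual_frame e (s i)) *
      wedge_list e [1,2,3,4,5,6,7] (\<lambda>i. if i < k then dual_frame e (s i) else v (i - k))) / fact k)"

definition g2_model :: "(nat \<Rightarrow> real^7 \<Rightarrow> real) \<Rightarrow> (real^7) mform" where
  "g2_model e = (\<lambda>v. wedge_list e [1,2,3] v
     + wedge 1 2 (wedge_list e [1]) (\<lambda>w. wedge_list e [4,5] w + wedge_list e [6,7] w) v
     + wedge 1 2 (wedge_list e [2]) (\<lambda>w. wedge_list e [4,6] w - wedge_list e [5,7] w) v
     - wedge 1 2 (wedge_list e [3]) (\<lambda>w. wedge_list e [4,7] w + wedge_list e [5,6] w) v)"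

definition adapted_coframe :: "(real^7) mform \<Rightarrow> (nat \<Rightarrow> real^7 \<Rightarrow> real) \<Rightarrow> bool" where
  "adapted_coframe \<phi> e \<longleftrightarrow> coframe e \<and> \<phi> = g2_model e"

text \<open>Two coframes adapted to the same \<open>\<phi>\<close> differ by an element of \<open>G\<^sub>2 \<subseteq> SO(7)\<close>, so they define the
  same metric and orientation, and the Hodge operator does not depend on the choice made here.\<close>

definition g2_hodge :: "(real^7) mform \<Rightarrow> nat \<Rightarrow> (real^7) mform \<Rightarrow> (real^7) mform" where
  "g2_hodge \<phi> k \<alpha> = hodge (SOME e. adapted_coframe \<phi> e) k \<alpha>"


section \<open>Differential forms\<close>

text \<open>A differential form is given by its coordinate expressions: \<open>\<omega> (U, f) x\<close>, for \<open>x \<in> f ` U\<close>, is the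
  value at \<open>f\<^sup>-\<^sup>1(x)\<close>, with the tangent space identified with the model space through the chart.\<close>

type_synonym ('m, 'v) form = "('m, 'v) chart \<Rightarrow> 'v \<Rightarrow> 'v mform"

definition is_pullback ::
  "('m, 'v::euclidean_space) chart set \<Rightarrow> ('n, 'w::euclidean_space) chart set \<Rightarrow>
   ('m \<Rightarrow> 'n) \<Rightarrow> ('n, 'w) form \<Rightarrow> ('m, 'v) form \<Rightarrow> bool" where
  \<comment> \<open>\<open>F\<^sup>*\<omega> = \<eta>\<close>\<close>
  "is_pullback A B F \<omega> \<eta> \<longleftrightarrow>
     (\<forall>(U, f)\<in>A. \<forall>(V, g)\<in>B. \<forall>x \<in> f ` (U \<inter> F -` V). \<forall>v.
        \<eta> (U, f) x v =
        \<omega> (V, g) ((g \<circ> F \<circ> inv_into U f) x)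
          (\<lambda>i. frechet_derivative (g \<circ> F \<circ> inv_into U f) (at x) (v i)))"

text \<open>The last condition says that the coordinate expressions transform into each other under
  changes of charts.\<close>

definition diff_form ::
  "('m, 'v::euclidean_space) chart set \<Rightarrow> nat \<Rightarrow> ('m, 'v) form \<Rightarrow> bool" where
  "diff_form A k \<omega> \<longleftrightarrow>
     (\<forall>(U, f)\<in>A. (\<forall>x \<in> f ` U. alt_form k (\<omega> (U, f) x)) \<and>
                 (\<forall>v. smooth_on (f ` U) (\<lambda>x. \<omega> (U, f) x v))) \<and>
     is_pullback A A id \<omega> \<omega>"

definition form_eq :: "('m, 'v) chart set \<Rightarrow> ('m, 'v) form \<Rightarrow> ('m, 'v) form \<Rightarrow> bool" where
  "form_eq A \<omega> \<eta> \<longleftrightarrow> (\<forall>(U, f)\<in>A. \<forall>x \<in> f ` U. \<omega> (U, f) x = \<eta> (U, f) x)"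

definition zero_form :: "('m, 'v) form" where
  "zero_form = (\<lambda>c x v. 0)"

definition wedge_form :: "nat \<Rightarrow> nat \<Rightarrow> ('m, 'v) form \<Rightarrow> ('m, 'v) form \<Rightarrow> ('m, 'v) form" where
  "wedge_form k l \<omega> \<eta> = (\<lambda>c x. wedge k l (\<omega> c x) (\<eta> c x))"

definition ext_d :: "nat \<Rightarrow> ('m, 'v::euclidean_space) form \<Rightarrow> ('m, 'v) form" where
  "ext_d k \<omega> = (\<lambda>c x v. \<Sum>i\<le>k. (-1) ^ i *
      frechet_derivative (\<lambda>y. \<omega> c y (\<lambda>j. if j < i then v j else v (Suc j))) (at x) (v i))"


section \<open>\<open>G\<^sub>2\<close>-structures\<close>

definition G2_structure :: "('m, real^7) chart set \<Rightarrow> ('m, real^7) form \<Rightarrow> bool" where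
  "G2_structure A \<phi> \<longleftrightarrow> diff_form A 3 \<phi> \<and>
     (\<forall>(U, f)\<in>A. \<forall>x \<in> f ` U. \<exists>e. adapted_coframe (\<phi> (U, f) x) e)"

definition star :: "('m, real^7) form \<Rightarrow> nat \<Rightarrow> ('m, real^7) form \<Rightarrow> ('m, real^7) form" where
  "star \<phi> k \<omega> = (\<lambda>c x. g2_hodge (\<phi> c x) k (\<omega> c x))"

definition is_Lee_form ::
  "('m, real^7) chart set \<Rightarrow> ('m, real^7) form \<Rightarrow> ('m, real^7) form \<Rightarrow> bool" where
  "is_Lee_form A \<phi> \<theta> \<longleftrightarrow> diff_form A 1 \<theta> \<and>
     form_eq A (ext_d 4 (star \<phi> 3 \<phi>)) (wedge_form 1 4 \<theta> (star \<phi> 3 \<phi>))"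

definition G2T_structure :: "('m, real^7) chart set \<Rightarrow> ('m, real^7) form \<Rightarrow> bool" where
  "G2T_structure A \<phi> \<longleftrightarrow> G2_structure A \<phi> \<and> (\<exists>\<theta>. is_Lee_form A \<phi> \<theta>)"

definition torsion_form ::
  "('m, real^7) form \<Rightarrow> ('m, real^7) form \<Rightarrow> ('m, real^7) form" where
  "torsion_form \<phi> \<theta> = (\<lambda>c x v.
     1 / 6 * star \<phi> 7 (wedge_form 4 3 (ext_d 3 \<phi>) \<phi>) c x v * \<phi> c x v
     - star \<phi> 4 (ext_d 3 \<phi>) c x v
     + star \<phi> 4 (wedge_form 1 3 \<theta> \<phi>) c x v)"

text \<open>The Lee form is unique, since \<open>\<theta> \<and> \<star>\<phi> = 0\<close> implies \<open>\<theta> = 0\<close>; hence the existential quantifier.\<close>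

definition strong_G2T_structure :: "('m, real^7) chart set \<Rightarrow> ('m, real^7) form \<Rightarrow> bool" where
  "strong_G2T_structure A \<phi> \<longleftrightarrow> G2T_structure A \<phi> \<and>
     (\<exists>\<theta>. is_Lee_form A \<phi> \<theta> \<and> form_eq A (ext_d 3 (torsion_form \<phi> \<theta>)) zero_form)"

definition parallel_G2_structure :: "('m, real^7) chart set \<Rightarrow> ('m, real^7) form \<Rightarrow> bool" where
  "parallel_G2_structure A \<phi> \<longleftrightarrow> G2_structure A \<phi> \<and>
     form_eq A (ext_d 3 \<phi>) zero_form \<and> form_eq A (ext_d 4 (star \<phi> 3 \<phi>)) zero_form"


section \<open>Lie groups and solvmanifolds\<close>

definition lie_group ::
  "('g::{t2_space,second_countable_topology}) monoid \<Rightarrow> ('g, 'v::euclidean_space) chart set \<Rightarrow> bool" where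
  "lie_group G A \<longleftrightarrow> group G \<and> carrier G = UNIV \<and> smooth_atlas A \<and>
     smooth_map_on (product_atlas A A) A UNIV (\<lambda>(x, y). x \<otimes>\<^bsub>G\<^esub> y) \<and>
     smooth_map_on A A UNIV (\<lambda>x. inv\<^bsub>G\<^esub> x)"

text \<open>The manifold \<open>M\<close> with atlas \<open>B\<close> is the quotient \<open>\<Gamma>\<setminus>G\<close>, with projection \<open>\<pi>\<close>. The fibres of \<open>\<pi>\<close> are
  the cosets \<open>\<Gamma>x\<close>, and the smooth structure is the only one making \<open>\<pi>\<close> a local diffeomorphism.
  Simple connectedness of a nonempty space includes path-connectedness here.\<close>

definition compact_solvmanifold ::
  "('g::{t2_space,second_countable_topology}) monoid \<Rightarrow> ('g, 'v::euclidean_space) chart set \<Rightarrow> 'g set \<Rightarrow>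
   ('m::{t2_space,second_countable_topology}, 'v) chart set \<Rightarrow> ('g \<Rightarrow> 'm) \<Rightarrow> bool" where
  "compact_solvmanifold G A \<Gamma> B \<pi> \<longleftrightarrow>
     lie_group G A \<and> simply_connected (UNIV :: 'g set) \<and> solvable G \<and>
     subgroup \<Gamma> G \<and> discrete \<Gamma> \<and>
     smooth_atlas B \<and> local_diffeomorphism A B \<pi> \<and> surj \<pi> \<and>
     (\<forall>x y. \<pi> x = \<pi> y \<longleftrightarrow> \<Gamma> #>\<^bsub>G\<^esub> x = \<Gamma> #>\<^bsub>G\<^esub> y) \<and>
     compact (UNIV :: 'm set)"

definition left_invariant ::
  "'g monoid \<Rightarrow> ('g, 'v::euclidean_space) chart set \<Rightarrow> ('g, 'v) form \<Rightarrow> bool" where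
  "left_invariant G A \<omega> \<longleftrightarrow> (\<forall>a. is_pullback A A (\<lambda>x. a \<otimes>\<^bsub>G\<^esub> x) \<omega> \<omega>)"

definition invariant_G2_structure ::
  "'g monoid \<Rightarrow> ('g, real^7) chart set \<Rightarrow> ('m, real^7) chart set \<Rightarrow> ('g \<Rightarrow> 'm) \<Rightarrow>
   ('m, real^7) form \<Rightarrow> bool" where
  "invariant_G2_structure G A B \<pi> \<phi> \<longleftrightarrow> G2_structure B \<phi> \<and>
     (\<exists>\<psi>. G2_structure A \<psi> \<and> left_invariant G A \<psi> \<and> is_pullback A B \<pi> \<phi> \<psi>)"

end

theory Submission
  imports Defs
begin

text \<open>The argument is local. Pulled back along a local section of the
  projection, an invariant structure has constant coefficients in the Maurer--Cartan coframe, so the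
  exterior derivative becomes the Chevalley--Eilenberg differential and all conditions become algebraic
  conditions on the structure constants \<open>c\<close> of the Lie algebra in an adapted coframe. The connection with
  torsion \<open>T\<close> takes values in \<open>\<gg>\<^sub>2\<close>. Contracting \<open>dT = 0\<close> and the Jacobi identity with \<open>\<star>\<phi>\<close> then gives
  \<open>(P - 2 Q) / 2 + |T + \<iota>\<^sub>H\<star>\<phi> / 3|\<^sup>2 / 2 + 2 |H|\<^sup>2 / 3 = 0\<close>, where \<open>P = \<Sum> c\<^sub>i\<^sub>j\<^sub>k\<^sup>2\<close>, \<open>Q = \<Sum> c\<^sub>i\<^sub>j\<^sub>k c\<^sub>j\<^sub>k\<^sub>i\<close> and \<open>H\<close> is the
  trace of the connection. For a solvable Lie algebra \<open>Q \<le> P / 2\<close>, because it is an invariant of the metric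
  that can be computed in an orthonormal basis adapted to the derived series. Hence \<open>T = 0\<close>, the
  Levi-Civita connection preserves \<open>\<phi>\<close>, and the structure is parallel.\<close>

text \<open>The scalar identity is a contracted first Bianchi identity. Substitute c_ijk =
  \<open>Gam i j k\<close> - \<open>Gam j i k\<close> - T_ijk into the Jacobi identity and contract
  with \<star>\<phi>. Two facts evaluate the result: an element of g2 is an eigenvector of
  contraction with \<star>\<phi>, with eigenvalue -2, and since \<star>\<phi> is annihilated by the
  connection, a Christoffel symbol acting on one slot of \<star>\<phi> can be moved to the other
  slots. The trace H need not vanish a priori and its pairing with T has no sign; the weight 1/3 in
  the square absorbs this pairing. Expanding the square costs 4/3 |H|^2 of the 2 |H|^2 at hand and
  leaves 2/3. Two obstacles lie outside the algebra. The Lee form is an arbitrary 1-form on the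
  quotient, and its uniqueness has to make it invariant. The Hodge operator comes from a coframe
  picked by choice, so it must be recovered from \<phi> alone before it can be pulled back.\<close>

section \<open>The model forms in dimension seven\<close>

text \<open>Frame indices are the literals \<open>1, \<dots>, 7\<close>; the index \<open>1\<close> must not be rewritten to \<open>Suc 0\<close>.\<close>

declare One_nat_def [simp del]

definition I7 :: "nat set" where "I7 = {1..7}"

text \<open>The cross product \<open>e\<^sub>i \<times> e\<^sub>j = \<plusminus> e\<^sub>k\<close> of imaginary octonions, encoded as \<open>oct i j = \<plusminus> k\<close>; \<open>ph\<close> and \<open>ps\<close> are
  the coefficients of \<open>\<phi>\<close> and \<open>\<star>\<phi>\<close> in an adapted coframe.\<close>

definition oct :: "nat \<Rightarrow> nat \<Rightarrow> int" where
  "oct i j = ([[0, 3, -2, 5, -4, 7, -6],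
     [-3, 0, 1, 6, -7, -4, 5],
     [2, -1, 0, -7, -6, 5, 4],
     [-5, -6, 7, 0, 1, 2, -3],
     [4, 7, 6, -1, 0, -3, -2],
     [-7, 4, -5, -2, 3, 0, 1],
     [6, -5, -4, 3, 2, -1, 0]]) ! (i - 1) ! (j - 1)"

definition ph :: "nat \<Rightarrow> nat \<Rightarrow> nat \<Rightarrow> real" where
  "ph i j k = of_bool (oct i j = int k) - of_bool (oct i j = - int k)"

text \<open>The contraction identity for cross products: the sum of
  \<open>ph i j p * ph p k l\<close> over \<open>p\<close> is the coefficient of \<star>\<phi> plus
  delta_ik delta_jl - delta_il delta_jk. Here it is solved for \<star>\<phi>; that these numbers are
  the Hodge dual of the model form is proved in \<open>hodge_g2_frame'\<close>.\<close>

definition ps :: "nat \<Rightarrow> nat \<Rightarrow> nat \<Rightarrow> nat \<Rightarrow> real" where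
  "ps i j k l = (\<Sum>p\<in>I7. ph i j p * ph p k l)
     - of_bool (i = k) * of_bool (j = l) + of_bool (i = l) * of_bool (j = k)"

section \<open>Tables and contraction identities for the octonionic structure constants\<close>

lemma I7_eq: "I7 = {1, 2, 3, 4, 5, 6, 7}"
  by (auto simp: I7_def)

lemma I7_mem: "1 \<in> I7" "2 \<in> I7" "3 \<in> I7" "4 \<in> I7" "5 \<in> I7" "6 \<in> I7" "7 \<in> I7"
  by (simp_all add: I7_eq)

lemma finite_I7 [simp]: "finite I7"
  by (simp add: I7_def)

lemma sum_I7: "(\<Sum>i\<in>I7. f i) = f 1 + f 2 + f 3 + f 4 + f 5 + f 6 + (f 7 :: 'a::comm_monoid_add)"
  by (simp add: I7_eq add.assoc)

lemma ball_I7: "(\<forall>i\<in>I7. P i) \<longleftrightarrow> P 1 \<and> P 2 \<and> P 3 \<and> P 4 \<and> P 5 \<and> P 6 \<and> P 7"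
  by (simp add: I7_eq)

lemma oct_table:
    "oct 1 1 = 0" "oct 1 2 = 3" "oct 1 3 = -2" "oct 1 4 = 5" "oct 1 5 = -4" "oct 1 6 = 7" "oct 1 7 = -6"
    "oct 2 1 = -3" "oct 2 2 = 0" "oct 2 3 = 1" "oct 2 4 = 6" "oct 2 5 = -7" "oct 2 6 = -4" "oct 2 7 = 5"
    "oct 3 1 = 2" "oct 3 2 = -1" "oct 3 3 = 0" "oct 3 4 = -7" "oct 3 5 = -6" "oct 3 6 = 5" "oct 3 7 = 4"
    "oct 4 1 = -5" "oct 4 2 = -6" "oct 4 3 = 7" "oct 4 4 = 0" "oct 4 5 = 1" "oct 4 6 = 2" "oct 4 7 = -3"
    "oct 5 1 = 4" "oct 5 2 = 7" "oct 5 3 = 6" "oct 5 4 = -1" "oct 5 5 = 0" "oct 5 6 = -3" "oct 5 7 = -2"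
    "oct 6 1 = -7" "oct 6 2 = 4" "oct 6 3 = -5" "oct 6 4 = -2" "oct 6 5 = 3" "oct 6 6 = 0" "oct 6 7 = 1"
    "oct 7 1 = 6" "oct 7 2 = -5" "oct 7 3 = -4" "oct 7 4 = 3" "oct 7 5 = 2" "oct 7 6 = -1" "oct 7 7 = 0"
  by (simp_all add: oct_def)

text \<open>For given first two indices at most one entry of \<open>ph\<close> is nonzero, so a
  contraction picks a single value. Rewriting with this table keeps later nested sums from being
  expanded term by term.\<close>

lemma ph_sum_table:
  fixes f :: "nat \<Rightarrow> real"
  shows
    "(\<Sum>p\<in>I7. ph 1 1 p * f p) = 0" "(\<Sum>p\<in>I7. ph 1 2 p * f p) = f 3" "(\<Sum>p\<in>I7. ph 1 3 p * f p) = - f 2" "(\<Sum>p\<in>I7. ph 1 4 p * f p) = f 5" "(\<Sum>p\<in>I7. ph 1 5 p * f p) = - f 4" "(\<Sum>p\<in>I7. ph 1 6 p * f p) = f 7" "(\<Sum>p\<in>I7. ph 1 7 p * f p) = - f 6"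
    "(\<Sum>p\<in>I7. ph 2 1 p * f p) = - f 3" "(\<Sum>p\<in>I7. ph 2 2 p * f p) = 0" "(\<Sum>p\<in>I7. ph 2 3 p * f p) = f 1" "(\<Sum>p\<in>I7. ph 2 4 p * f p) = f 6" "(\<Sum>p\<in>I7. ph 2 5 p * f p) = - f 7" "(\<Sum>p\<in>I7. ph 2 6 p * f p) = - f 4" "(\<Sum>p\<in>I7. ph 2 7 p * f p) = f 5"
    "(\<Sum>p\<in>I7. ph 3 1 p * f p) = f 2" "(\<Sum>p\<in>I7. ph 3 2 p * f p) = - f 1" "(\<Sum>p\<in>I7. ph 3 3 p * f p) = 0" "(\<Sum>p\<in>I7. ph 3 4 p * f p) = - f 7" "(\<Sum>p\<in>I7. ph 3 5 p * f p) = - f 6" "(\<Sum>p\<in>I7. ph 3 6 p * f p) = f 5" "(\<Sum>p\<in>I7. ph 3 7 p * f p) = f 4"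
    "(\<Sum>p\<in>I7. ph 4 1 p * f p) = - f 5" "(\<Sum>p\<in>I7. ph 4 2 p * f p) = - f 6" "(\<Sum>p\<in>I7. ph 4 3 p * f p) = f 7" "(\<Sum>p\<in>I7. ph 4 4 p * f p) = 0" "(\<Sum>p\<in>I7. ph 4 5 p * f p) = f 1" "(\<Sum>p\<in>I7. ph 4 6 p * f p) = f 2" "(\<Sum>p\<in>I7. ph 4 7 p * f p) = - f 3"
    "(\<Sum>p\<in>I7. ph 5 1 p * f p) = f 4" "(\<Sum>p\<in>I7. ph 5 2 p * f p) = f 7" "(\<Sum>p\<in>I7. ph 5 3 p * f p) = f 6" "(\<Sum>p\<in>I7. ph 5 4 p * f p) = - f 1" "(\<Sum>p\<in>I7. ph 5 5 p * f p) = 0" "(\<Sum>p\<in>I7. ph 5 6 p * f p) = - f 3" "(\<Sum>p\<in>I7. ph 5 7 p * f p) = - f 2"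
    "(\<Sum>p\<in>I7. ph 6 1 p * f p) = - f 7" "(\<Sum>p\<in>I7. ph 6 2 p * f p) = f 4" "(\<Sum>p\<in>I7. ph 6 3 p * f p) = - f 5" "(\<Sum>p\<in>I7. ph 6 4 p * f p) = - f 2" "(\<Sum>p\<in>I7. ph 6 5 p * f p) = f 3" "(\<Sum>p\<in>I7. ph 6 6 p * f p) = 0" "(\<Sum>p\<in>I7. ph 6 7 p * f p) = f 1"
    "(\<Sum>p\<in>I7. ph 7 1 p * f p) = f 6" "(\<Sum>p\<in>I7. ph 7 2 p * f p) = - f 5" "(\<Sum>p\<in>I7. ph 7 3 p * f p) = - f 4" "(\<Sum>p\<in>I7. ph 7 4 p * f p) = f 3" "(\<Sum>p\<in>I7. ph 7 5 p * f p) = f 2" "(\<Sum>p\<in>I7. ph 7 6 p * f p) = - f 1" "(\<Sum>p\<in>I7. ph 7 7 p * f p) = 0"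
  by (simp_all add: sum_I7 ph_def oct_table)

lemma ph_antisym:
  assumes "i \<in> I7" "j \<in> I7" "k \<in> I7"
  shows "ph j i k = - ph i j k" "ph i k j = - ph i j k"
proof -
  have "\<forall>i\<in>I7. \<forall>j\<in>I7. \<forall>k\<in>I7. ph j i k = - ph i j k \<and> ph i k j = - ph i j k"
    unfolding ball_I7 by (simp add: ph_def oct_table)
  then show "ph j i k = - ph i j k" "ph i k j = - ph i j k"
    using assms by blast+
qed

lemma ps_table:
    "ps 1 2 k l = ph 3 k l - of_bool (1 = k) * of_bool (2 = l) + of_bool (1 = l) * of_bool (2 = k)" "ps 1 3 k l = - ph 2 k l - of_bool (1 = k) * of_bool (3 = l) + of_bool (1 = l) * of_bool (3 = k)" "ps 1 4 k l = ph 5 k l - of_bool (1 = k) * of_bool (4 = l) + of_bool (1 = l) * of_bool (4 = k)" "ps 1 5 k l = - ph 4 k l - of_bool (1 = k) * of_bool (5 = l) + of_bool (1 = l) * of_bool (5 = k)" "ps 1 6 k l = ph 7 k l - of_bool (1 = k) * of_bool (6 = l) + of_bool (1 = l) * of_bool (6 = k)" "ps 1 7 k l = - ph 6 k l - of_bool (1 = k) * of_bool (7 = l) + of_bool (1 = l) * of_bool (7 = k)"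
    "ps 2 1 k l = - ph 3 k l - of_bool (2 = k) * of_bool (1 = l) + of_bool (2 = l) * of_bool (1 = k)" "ps 2 3 k l = ph 1 k l - of_bool (2 = k) * of_bool (3 = l) + of_bool (2 = l) * of_bool (3 = k)" "ps 2 4 k l = ph 6 k l - of_bool (2 = k) * of_bool (4 = l) + of_bool (2 = l) * of_bool (4 = k)" "ps 2 5 k l = - ph 7 k l - of_bool (2 = k) * of_bool (5 = l) + of_bool (2 = l) * of_bool (5 = k)" "ps 2 6 k l = - ph 4 k l - of_bool (2 = k) * of_bool (6 = l) + of_bool (2 = l) * of_bool (6 = k)" "ps 2 7 k l = ph 5 k l - of_bool (2 = k) * of_bool (7 = l) + of_bool (2 = l) * of_bool (7 = k)"
    "ps 3 1 k l = ph 2 k l - of_bool (3 = k) * of_bool (1 = l) + of_bool (3 = l) * of_bool (1 = k)" "ps 3 2 k l = - ph 1 k l - of_bool (3 = k) * of_bool (2 = l) + of_bool (3 = l) * of_bool (2 = k)" "ps 3 4 k l = - ph 7 k l - of_bool (3 = k) * of_bool (4 = l) + of_bool (3 = l) * of_bool (4 = k)" "ps 3 5 k l = - ph 6 k l - of_bool (3 = k) * of_bool (5 = l) + of_bool (3 = l) * of_bool (5 = k)" "ps 3 6 k l = ph 5 k l - of_bool (3 = k) * of_bool (6 = l) + of_bool (3 = l) * of_bool (6 = k)" "ps 3 7 k l = ph 4 k l - of_bool (3 = k) * of_bool (7 = l) + of_bool (3 = l) * of_bool (7 = k)"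
    "ps 4 1 k l = - ph 5 k l - of_bool (4 = k) * of_bool (1 = l) + of_bool (4 = l) * of_bool (1 = k)" "ps 4 2 k l = - ph 6 k l - of_bool (4 = k) * of_bool (2 = l) + of_bool (4 = l) * of_bool (2 = k)" "ps 4 3 k l = ph 7 k l - of_bool (4 = k) * of_bool (3 = l) + of_bool (4 = l) * of_bool (3 = k)" "ps 4 5 k l = ph 1 k l - of_bool (4 = k) * of_bool (5 = l) + of_bool (4 = l) * of_bool (5 = k)" "ps 4 6 k l = ph 2 k l - of_bool (4 = k) * of_bool (6 = l) + of_bool (4 = l) * of_bool (6 = k)" "ps 4 7 k l = - ph 3 k l - of_bool (4 = k) * of_bool (7 = l) + of_bool (4 = l) * of_bool (7 = k)"
    "ps 5 1 k l = ph 4 k l - of_bool (5 = k) * of_bool (1 = l) + of_bool (5 = l) * of_bool (1 = k)" "ps 5 2 k l = ph 7 k l - of_bool (5 = k) * of_bool (2 = l) + of_bool (5 = l) * of_bool (2 = k)" "ps 5 3 k l = ph 6 k l - of_bool (5 = k) * of_bool (3 = l) + of_bool (5 = l) * of_bool (3 = k)" "ps 5 4 k l = - ph 1 k l - of_bool (5 = k) * of_bool (4 = l) + of_bool (5 = l) * of_bool (4 = k)" "ps 5 6 k l = - ph 3 k l - of_bool (5 = k) * of_bool (6 = l) + of_bool (5 = l) * of_bool (6 = k)" "ps 5 7 k l = - ph 2 k l - of_bool (5 = k) * of_bool (7 = l) + of_bool (5 = l) * of_bool (7 = k)"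
    "ps 6 1 k l = - ph 7 k l - of_bool (6 = k) * of_bool (1 = l) + of_bool (6 = l) * of_bool (1 = k)" "ps 6 2 k l = ph 4 k l - of_bool (6 = k) * of_bool (2 = l) + of_bool (6 = l) * of_bool (2 = k)" "ps 6 3 k l = - ph 5 k l - of_bool (6 = k) * of_bool (3 = l) + of_bool (6 = l) * of_bool (3 = k)" "ps 6 4 k l = - ph 2 k l - of_bool (6 = k) * of_bool (4 = l) + of_bool (6 = l) * of_bool (4 = k)" "ps 6 5 k l = ph 3 k l - of_bool (6 = k) * of_bool (5 = l) + of_bool (6 = l) * of_bool (5 = k)" "ps 6 7 k l = ph 1 k l - of_bool (6 = k) * of_bool (7 = l) + of_bool (6 = l) * of_bool (7 = k)"
    "ps 7 1 k l = ph 6 k l - of_bool (7 = k) * of_bool (1 = l) + of_bool (7 = l) * of_bool (1 = k)" "ps 7 2 k l = - ph 5 k l - of_bool (7 = k) * of_bool (2 = l) + of_bool (7 = l) * of_bool (2 = k)" "ps 7 3 k l = - ph 4 k l - of_bool (7 = k) * of_bool (3 = l) + of_bool (7 = l) * of_bool (3 = k)" "ps 7 4 k l = ph 3 k l - of_bool (7 = k) * of_bool (4 = l) + of_bool (7 = l) * of_bool (4 = k)" "ps 7 5 k l = ph 2 k l - of_bool (7 = k) * of_bool (5 = l) + of_bool (7 = l) * of_bool (5 = k)" "ps 7 6 k l = - ph 1 k l - of_bool (7 = k) * of_bool (6 = l) + of_bool (7 = l) * of_bool (6 = k)"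
    "ps 1 1 k l = 0" "ps 2 2 k l = 0" "ps 3 3 k l = 0" "ps 4 4 k l = 0" "ps 5 5 k l = 0" "ps 6 6 k l = 0" "ps 7 7 k l = 0"
  unfolding ps_def ph_sum_table by simp_all

text \<open>The outer two swaps are inherited from the factors \<open>ph i j p\<close> and
  \<open>ph p k l\<close>. The swap of the inner indices mixes the two factors and is checked entry
  by entry.\<close>

lemma ps_antisym:
  assumes "i \<in> I7" "j \<in> I7" "k \<in> I7" "l \<in> I7"
  shows "ps j i k l = - ps i j k l" "ps i k j l = - ps i j k l" "ps i j l k = - ps i j k l"
proof -
  have "\<forall>i\<in>I7. \<forall>j\<in>I7. \<forall>k\<in>I7. \<forall>l\<in>I7. ps i k j l = - ps i j k l"
    unfolding ps_def ball_I7 ph_sum_table by (simp add: ph_def oct_table)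
  then show "ps i k j l = - ps i j k l"
    using assms by blast
  show "ps j i k l = - ps i j k l"
    unfolding ps_def
    using assms by (simp add: ph_antisym(1)[of i j] sum_negf)
  show "ps i j l k = - ps i j k l"
    unfolding ps_def
    using assms by (simp add: ph_antisym(2)[of _ k l] sum_negf)
qed

text \<open>For p = q the sum counts the six ordered pairs whose cross product is plus or minus e_p;
  for p \<noteq> q no pair contributes, since a product of basis vectors is a single basis vector up
  to sign.\<close>

lemma ph_norm:
  assumes "p \<in> I7" "q \<in> I7"
  shows "(\<Sum>i\<in>I7. \<Sum>j\<in>I7. ph i j p * ph i j q) = 6 * of_bool (p = q)"
proof -
  have "\<forall>p\<in>I7. \<forall>q\<in>I7. (\<Sum>i\<in>I7. \<Sum>j\<in>I7. ph i j p * ph i j q) = 6 * of_bool (p = q)"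
    unfolding ball_I7 sum_I7 by (simp add: ph_def oct_table)
  then show ?thesis using assms by blast
qed

text \<open>The quadratic part of \<open>ps\<close> sees \<open>A\<close> only through its
  contraction with \<phi>, which vanishes on g2. The two delta terms give - A m n + A n m, hence the
  eigenvalue -2.\<close>

lemma ps_contract_g2:
  fixes A :: "nat \<Rightarrow> nat \<Rightarrow> real"
  assumes A: "\<And>i j. A j i = - A i j"
    and g2: "\<And>p. p \<in> I7 \<Longrightarrow> (\<Sum>k\<in>I7. \<Sum>l\<in>I7. A k l * ph k l p) = 0"
    and mn: "m \<in> I7" "n \<in> I7"
  shows "(\<Sum>k\<in>I7. \<Sum>l\<in>I7. A k l * ps k l m n) = - 2 * A m n"
proof -
  have "(\<Sum>k\<in>I7. \<Sum>l\<in>I7. A k l * (\<Sum>p\<in>I7. ph k l p * ph p m n))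
      = (\<Sum>p\<in>I7. (\<Sum>k\<in>I7. \<Sum>l\<in>I7. A k l * ph k l p) * ph p m n)"
    unfolding sum_distrib_left sum_distrib_right mult.assoc
    by (subst (2) sum.swap, subst sum.swap) (rule refl)
  also have "\<dots> = 0"
    by (simp add: g2)
  finally have 1: "(\<Sum>k\<in>I7. \<Sum>l\<in>I7. A k l * (\<Sum>p\<in>I7. ph k l p * ph p m n)) = 0" .
  have 2: "(\<Sum>k\<in>I7. \<Sum>l\<in>I7. A k l * (of_bool (k = m) * of_bool (l = n))) = A m n"
    "(\<Sum>k\<in>I7. \<Sum>l\<in>I7. A k l * (of_bool (k = n) * of_bool (l = m))) = A n m"
  proof -
    have *: "A k l * (of_bool (k = a) * of_bool (l = b)) = (if l = b then if k = a then A k l else 0 else 0)" for k l a b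
      by simp
    show "(\<Sum>k\<in>I7. \<Sum>l\<in>I7. A k l * (of_bool (k = m) * of_bool (l = n))) = A m n"
      "(\<Sum>k\<in>I7. \<Sum>l\<in>I7. A k l * (of_bool (k = n) * of_bool (l = m))) = A n m"
      unfolding * using mn by simp_all
  qed
  have "(\<Sum>k\<in>I7. \<Sum>l\<in>I7. A k l * ps k l m n)
     = (\<Sum>k\<in>I7. \<Sum>l\<in>I7. A k l * (\<Sum>p\<in>I7. ph k l p * ph p m n))
      - (\<Sum>k\<in>I7. \<Sum>l\<in>I7. A k l * (of_bool (k = m) * of_bool (l = n)))
      + (\<Sum>k\<in>I7. \<Sum>l\<in>I7. A k l * (of_bool (k = n) * of_bool (l = m)))"
    unfolding ps_def by (simp add: algebra_simps sum.distrib sum_subtractf)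
  then show ?thesis
    using A[of m n] by (simp add: 1 2)
qed

lemma ph_cyc:
  assumes "i \<in> I7" "j \<in> I7" "k \<in> I7"
  shows "ph j k i = ph i j k"
  using ph_antisym(2)[of j i k] ph_antisym(1)[of i j k] assms by simp

text \<open>Among skew matrices, the kernel of the contraction with \<phi> consists of infinitesimal
  symmetries of \<phi>, that is, of elements of g2.\<close>

lemma ph_derivation_g2:
  fixes A :: "nat \<Rightarrow> nat \<Rightarrow> real"
  assumes A: "\<And>i j. A j i = - A i j"
    and g2: "\<And>p. p \<in> I7 \<Longrightarrow> (\<Sum>k\<in>I7. \<Sum>l\<in>I7. A k l * ph k l p) = 0"
    and ijk: "i \<in> I7" "j \<in> I7" "k \<in> I7"
  shows "(\<Sum>p\<in>I7. A i p * ph p j k) + (\<Sum>p\<in>I7. A j p * ph i p k) + (\<Sum>p\<in>I7. A k p * ph i j p) = 0"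
proof -
  have low: "A 2 1 = - A 1 2" "A 3 1 = - A 1 3" "A 4 1 = - A 1 4" "A 5 1 = - A 1 5" "A 6 1 = - A 1 6" "A 7 1 = - A 1 7" "A 3 2 = - A 2 3" "A 4 2 = - A 2 4" "A 5 2 = - A 2 5" "A 6 2 = - A 2 6" "A 7 2 = - A 2 7" "A 4 3 = - A 3 4" "A 5 3 = - A 3 5" "A 6 3 = - A 3 6" "A 7 3 = - A 3 7" "A 5 4 = - A 4 5" "A 6 4 = - A 4 6" "A 7 4 = - A 4 7" "A 6 5 = - A 5 6" "A 7 5 = - A 5 7" "A 7 6 = - A 6 7"
    by (rule A)+
  have diag: "A i i = 0" for i
    using A[of i i] by simp
  have v: "(\<Sum>k\<in>I7. \<Sum>l\<in>I7. ph p k l * A k l) = 0" if "p \<in> I7" for p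
  proof -
    have "ph k l p = ph p k l" if "k \<in> I7" "l \<in> I7" for k l
      using ph_cyc[of p k l] that \<open>p \<in> I7\<close> by simp
    then show ?thesis
      using g2[OF that] by (simp add: mult.commute cong: sum.cong)
  qed
  \<comment> \<open>The seven linear conditions are solved for A 2 3 and A 1 2, ..., A 1 7. The
    remaining 14 entries above the diagonal are free, and the claim becomes an identity in
    them.\<close>
  have e1: "A 2 3 = - A 4 5 - A 6 7"
    using v[of 1] unfolding sum_I7[of "\<lambda>k. \<Sum>l\<in>I7. ph 1 k l * A k l"] ph_sum_table low by (simp add: I7_eq)
  have e2: "A 1 3 = A 4 6 - A 5 7"
    using v[of 2] unfolding sum_I7[of "\<lambda>k. \<Sum>l\<in>I7. ph 2 k l * A k l"] ph_sum_table low by (simp add: I7_eq)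
  have e3: "A 1 2 = A 4 7 + A 5 6"
    using v[of 3] unfolding sum_I7[of "\<lambda>k. \<Sum>l\<in>I7. ph 3 k l * A k l"] ph_sum_table low by (simp add: I7_eq)
  have e4: "A 1 5 = - A 2 6 + A 3 7"
    using v[of 4] unfolding sum_I7[of "\<lambda>k. \<Sum>l\<in>I7. ph 4 k l * A k l"] ph_sum_table low by (simp add: I7_eq)
  have e5: "A 1 4 = - A 2 7 - A 3 6"
    using v[of 5] unfolding sum_I7[of "\<lambda>k. \<Sum>l\<in>I7. ph 5 k l * A k l"] ph_sum_table low by (simp add: I7_eq)
  have e6: "A 1 7 = A 2 4 - A 3 5"
    using v[of 6] unfolding sum_I7[of "\<lambda>k. \<Sum>l\<in>I7. ph 6 k l * A k l"] ph_sum_table low by (simp add: I7_eq)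
  have e7: "A 1 6 = A 2 5 + A 3 4"
    using v[of 7] unfolding sum_I7[of "\<lambda>k. \<Sum>l\<in>I7. ph 7 k l * A k l"] ph_sum_table low by (simp add: I7_eq)

  have cyc: "ph p j k = ph j k p" "ph i p k = ph k i p" if "p \<in> I7" for p
    using ph_cyc[of p j k] ph_cyc[of k i p] that ijk by simp_all
  have "\<forall>i\<in>I7. \<forall>j\<in>I7. \<forall>k\<in>I7.
     (\<Sum>p\<in>I7. ph j k p * A i p) + (\<Sum>p\<in>I7. ph k i p * A j p) + (\<Sum>p\<in>I7. ph i j p * A k p) = 0"
    unfolding ball_I7 ph_sum_table low diag
    by (simp add: e1 e2 e3 e4 e5 e6 e7)
  then show ?thesis
    using ijk by (simp add: cyc mult.commute cong: sum.cong)
qed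

lemma sum_I7_delta:
  fixes f :: "nat \<Rightarrow> real"
  assumes "a \<in> I7"
  shows "(\<Sum>i\<in>I7. f i * of_bool (i = a)) = f a" "(\<Sum>i\<in>I7. f i * of_bool (a = i)) = f a"
    "(\<Sum>i\<in>I7. of_bool (i = a) * f i) = f a" "(\<Sum>i\<in>I7. of_bool (a = i) * f i) = f a"
proof -
  have *: "f i * of_bool (i = a) = (if i = a then f i else 0)" "f i * of_bool (a = i) = (if i = a then f i else 0)"
    "of_bool (i = a) * f i = (if i = a then f i else 0)" "of_bool (a = i) * f i = (if i = a then f i else 0)" for i
    by auto
  show "(\<Sum>i\<in>I7. f i * of_bool (i = a)) = f a" "(\<Sum>i\<in>I7. f i * of_bool (a = i)) = f a"
    "(\<Sum>i\<in>I7. of_bool (i = a) * f i) = f a" "(\<Sum>i\<in>I7. of_bool (a = i) * f i) = f a"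
    unfolding * using assms by simp_all
qed

text \<open>\<open>ps\<close> is built from \<open>ph\<close> and Kronecker deltas. The former is
  annihilated by g2 and the latter by every skew matrix, so \<open>ps\<close> is annihilated
  too.\<close>

lemma ps_derivation_g2:
  fixes A :: "nat \<Rightarrow> nat \<Rightarrow> real"
  assumes A: "\<And>i j. A j i = - A i j"
    and g2: "\<And>p. p \<in> I7 \<Longrightarrow> (\<Sum>k\<in>I7. \<Sum>l\<in>I7. A k l * ph k l p) = 0"
    and ijkl: "i \<in> I7" "j \<in> I7" "k \<in> I7" "l \<in> I7"
  shows "(\<Sum>p\<in>I7. A i p * ps p j k l) + (\<Sum>p\<in>I7. A j p * ps i p k l)
     + (\<Sum>p\<in>I7. A k p * ps i j p l) + (\<Sum>p\<in>I7. A l p * ps i j k p) = 0"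
proof -
  define B where "B x y q = (\<Sum>p\<in>I7. A x p * ph p y q)" for x y q
  define B2 where "B2 x y q = (\<Sum>p\<in>I7. A y p * ph x p q)" for x y q
  have t1: "(\<Sum>p\<in>I7. A i p * ps p j k l) = (\<Sum>q\<in>I7. B i j q * ph q k l) - A i k * of_bool (j = l) + A i l * of_bool (j = k)"
  proof -
    have "(\<Sum>p\<in>I7. A i p * ps p j k l) = (\<Sum>p\<in>I7. \<Sum>q\<in>I7. A i p * ph p j q * ph q k l)
       - (\<Sum>p\<in>I7. A i p * of_bool (p = k)) * of_bool (j = l) + (\<Sum>p\<in>I7. A i p * of_bool (p = l)) * of_bool (j = k)"
      unfolding ps_def by (simp add: sum_distrib_left sum_distrib_right sum.distrib sum_subtractf distrib_left right_diff_distrib mult.assoc del: sum_mult_of_bool_eq sum_of_bool_mult_eq)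
    also have "(\<Sum>p\<in>I7. \<Sum>q\<in>I7. A i p * ph p j q * ph q k l) = (\<Sum>q\<in>I7. B i j q * ph q k l)"
      unfolding B_def sum_distrib_right by (rule sum.swap)
    finally show ?thesis
      using ijkl by (simp add: sum_I7_delta del: sum_mult_of_bool_eq sum_of_bool_mult_eq)
  qed
  have t2: "(\<Sum>p\<in>I7. A j p * ps i p k l) = (\<Sum>q\<in>I7. B2 i j q * ph q k l) - of_bool (i = k) * A j l + of_bool (i = l) * A j k"
  proof -
    have "(\<Sum>p\<in>I7. A j p * ps i p k l) = (\<Sum>p\<in>I7. \<Sum>q\<in>I7. A j p * ph i p q * ph q k l)
       - of_bool (i = k) * (\<Sum>p\<in>I7. A j p * of_bool (p = l)) + of_bool (i = l) * (\<Sum>p\<in>I7. A j p * of_bool (p = k))"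
      unfolding ps_def by (simp add: sum_distrib_left sum_distrib_right sum.distrib sum_subtractf distrib_left right_diff_distrib mult_ac del: sum_mult_of_bool_eq sum_of_bool_mult_eq)
    also have "(\<Sum>p\<in>I7. \<Sum>q\<in>I7. A j p * ph i p q * ph q k l) = (\<Sum>q\<in>I7. B2 i j q * ph q k l)"
      unfolding B2_def sum_distrib_right by (rule sum.swap)
    finally show ?thesis
      using ijkl by (simp add: sum_I7_delta del: sum_mult_of_bool_eq sum_of_bool_mult_eq)
  qed
  \<comment> \<open>Exchanging the two index pairs reduces the action on the last two slots to the
    computation already made for the first two.\<close>
  have pair: "ps x y z w = ps z w x y" if "x \<in> I7" "y \<in> I7" "z \<in> I7" "w \<in> I7" for x y z w
  proof -
    have "ps x y z w = - ps x z y w" "ps x z y w = - ps z x y w" "ps z x y w = - ps z x w y" "ps z x w y = - ps z w x y"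
      using ps_antisym(2)[of x z y w] ps_antisym(1)[of z x y w] ps_antisym(3)[of z x w y] ps_antisym(2)[of z w x y] that by blast+
    then show ?thesis by simp
  qed
  have t3: "(\<Sum>p\<in>I7. A k p * ps i j p l) = (\<Sum>q\<in>I7. B k l q * ph q i j) - A k i * of_bool (l = j) + A k j * of_bool (l = i)"
  proof -
    have "(\<Sum>p\<in>I7. A k p * ps i j p l) = (\<Sum>p\<in>I7. A k p * ps p l i j)"
      using pair ijkl by (auto intro!: sum.cong)
    also have "\<dots> = (\<Sum>p\<in>I7. \<Sum>q\<in>I7. A k p * ph p l q * ph q i j)
       - (\<Sum>p\<in>I7. A k p * of_bool (p = i)) * of_bool (l = j) + (\<Sum>p\<in>I7. A k p * of_bool (p = j)) * of_bool (l = i)"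
      unfolding ps_def by (simp add: sum_distrib_left sum_distrib_right sum.distrib sum_subtractf distrib_left right_diff_distrib mult.assoc del: sum_mult_of_bool_eq sum_of_bool_mult_eq)
    also have "(\<Sum>p\<in>I7. \<Sum>q\<in>I7. A k p * ph p l q * ph q i j) = (\<Sum>q\<in>I7. B k l q * ph q i j)"
      unfolding B_def sum_distrib_right by (rule sum.swap)
    finally show ?thesis
      using ijkl by (simp add: sum_I7_delta del: sum_mult_of_bool_eq sum_of_bool_mult_eq)
  qed
  have t4: "(\<Sum>p\<in>I7. A l p * ps i j k p) = (\<Sum>q\<in>I7. B2 k l q * ph q i j) - of_bool (k = i) * A l j + of_bool (k = j) * A l i"
  proof -
    have "(\<Sum>p\<in>I7. A l p * ps i j k p) = (\<Sum>p\<in>I7. A l p * ps k p i j)"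
      using pair ijkl by (auto intro!: sum.cong)
    also have "\<dots> = (\<Sum>p\<in>I7. \<Sum>q\<in>I7. A l p * ph k p q * ph q i j)
       - of_bool (k = i) * (\<Sum>p\<in>I7. A l p * of_bool (p = j)) + of_bool (k = j) * (\<Sum>p\<in>I7. A l p * of_bool (p = i))"
      unfolding ps_def by (simp add: sum_distrib_left sum_distrib_right sum.distrib sum_subtractf distrib_left right_diff_distrib mult_ac del: sum_mult_of_bool_eq sum_of_bool_mult_eq)
    also have "(\<Sum>p\<in>I7. \<Sum>q\<in>I7. A l p * ph k p q * ph q i j) = (\<Sum>q\<in>I7. B2 k l q * ph q i j)"
      unfolding B2_def sum_distrib_right by (rule sum.swap)
    finally show ?thesis
      using ijkl by (simp add: sum_I7_delta del: sum_mult_of_bool_eq sum_of_bool_mult_eq)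
  qed
  \<comment> \<open>By \<open>ph_derivation_g2\<close> the action on the two free slots of
    \<open>ph\<close> is minus the action on the contracted slot. The sums that this produces from
    the two pairs, \<open>s1\<close> and \<open>s2\<close>, cancel because \<open>A\<close> is
    skew.\<close>
  have BB: "B x y q + B2 x y q = - (\<Sum>p\<in>I7. A q p * ph p x y)" if "x \<in> I7" "y \<in> I7" "q \<in> I7" for x y q
  proof -
    have "(\<Sum>p\<in>I7. A q p * ph p x y) = (\<Sum>p\<in>I7. A q p * ph x y p)"
      using that by (intro sum.cong) (simp_all add: ph_cyc)
    then show ?thesis
      using ph_derivation_g2[OF A g2 that] unfolding B_def B2_def by simp
  qed
  have "(\<Sum>q\<in>I7. B i j q * ph q k l) + (\<Sum>q\<in>I7. B2 i j q * ph q k l)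
     = (\<Sum>q\<in>I7. (B i j q + B2 i j q) * ph q k l)"
    by (simp add: sum.distrib distrib_right)
  also have "\<dots> = - (\<Sum>q\<in>I7. \<Sum>p\<in>I7. A q p * ph p i j * ph q k l)"
    using ijkl by (simp add: BB sum_distrib_right sum_negf cong: sum.cong)
  finally have s1: "(\<Sum>q\<in>I7. B i j q * ph q k l) + (\<Sum>q\<in>I7. B2 i j q * ph q k l)
     = - (\<Sum>q\<in>I7. \<Sum>p\<in>I7. A q p * ph p i j * ph q k l)" .
  have "(\<Sum>q\<in>I7. B k l q * ph q i j) + (\<Sum>q\<in>I7. B2 k l q * ph q i j)
     = (\<Sum>q\<in>I7. (B k l q + B2 k l q) * ph q i j)"
    by (simp add: sum.distrib distrib_right)
  also have "\<dots> = - (\<Sum>q\<in>I7. \<Sum>p\<in>I7. A q p * ph p k l * ph q i j)"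
    using ijkl by (simp add: BB sum_distrib_right sum_negf cong: sum.cong)
  also have "(\<Sum>q\<in>I7. \<Sum>p\<in>I7. A q p * ph p k l * ph q i j) = (\<Sum>p\<in>I7. \<Sum>q\<in>I7. A q p * ph p k l * ph q i j)"
    by (rule sum.swap)
  also have "\<dots> = - (\<Sum>q\<in>I7. \<Sum>p\<in>I7. A q p * ph p i j * ph q k l)"
    unfolding sum_negf[symmetric] using A by (intro sum.cong refl) (metis mult.commute mult.left_commute mult_minus_left)
  finally have s2: "(\<Sum>q\<in>I7. B k l q * ph q i j) + (\<Sum>q\<in>I7. B2 k l q * ph q i j)
     = (\<Sum>q\<in>I7. \<Sum>p\<in>I7. A q p * ph p i j * ph q k l)" by simp
  show ?thesis
    unfolding t1 t2 t3 t4
    using s1 s2 A[of i k] A[of i l] A[of j k] A[of j l]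
    by (simp add: eq_commute[of l j] eq_commute[of l i] eq_commute[of k i] eq_commute[of k j] algebra_simps)
qed

text \<open>The counterpart of \<open>ps_contract_g2\<close>: on the 7-dimensional complement of g2
  in the skew matrices, spanned by the contractions of \<phi> with a vector, the eigenvalue is
  4.\<close>

lemma ph_ps_contract:
  assumes "r \<in> I7" "m \<in> I7" "p \<in> I7"
  shows "(\<Sum>i\<in>I7. \<Sum>j\<in>I7. ph i j r * ps i j m p) = 4 * ph r m p"
proof -
  have "\<forall>r\<in>I7. \<forall>m\<in>I7. \<forall>p\<in>I7. (\<Sum>i\<in>I7. \<Sum>j\<in>I7. ph r i j * ps i j m p) = 4 * ph r m p"
    unfolding ball_I7 sum_I7[of "\<lambda>i. \<Sum>j\<in>I7. ph r i j * ps i j m p" for r m p] ph_sum_table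
    by (simp add: ps_table ph_def oct_table)
  then have "(\<Sum>i\<in>I7. \<Sum>j\<in>I7. ph r i j * ps i j m p) = 4 * ph r m p"
    using assms by blast
  then show ?thesis
    using assms by (simp add: ph_cyc[of r, symmetric] cong: sum.cong)
qed

text \<open>In the second factor the delta terms drop out, as they force a repeated index in the
  first factor. What remains is evaluated by eigenvalue 4 and then by \<open>ph_norm\<close>, so 24
  = 4 * 6.\<close>

lemma ps_norm:
  assumes "p \<in> I7" "q \<in> I7"
  shows "(\<Sum>m\<in>I7. \<Sum>i\<in>I7. \<Sum>j\<in>I7. ps i j m p * ps i j m q) = 24 * of_bool (p = q)"
proof -
  have z: "ps i j i p = 0" "ps i j j p = 0" if "i \<in> I7" "j \<in> I7" for i j
    using ps_antisym(1)[of i i j p] ps_antisym(2)[of i j i p] ps_antisym(2)[of i j j p] that assms by simp_all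
  have *: "(\<Sum>i\<in>I7. \<Sum>j\<in>I7. ps i j m p * ps i j m q) = (\<Sum>r\<in>I7. 4 * ph r m p * ph r m q)" if m: "m \<in> I7" for m
  proof -
    have "(\<Sum>i\<in>I7. \<Sum>j\<in>I7. ps i j m p * ps i j m q) = (\<Sum>i\<in>I7. \<Sum>j\<in>I7. ps i j m p * (\<Sum>r\<in>I7. ph i j r * ph r m q))"
    proof (intro sum.cong refl)
      fix i j assume ij: "i \<in> I7" "j \<in> I7"
      have "ps i j m p * ps i j m q = ps i j m p * (\<Sum>r\<in>I7. ph i j r * ph r m q) - (ps i j m p * of_bool (i = m)) * of_bool (j = q)
          + of_bool (i = q) * (ps i j m p * of_bool (j = m))"
        unfolding ps_def[of i j m q] by (simp add: algebra_simps)
      moreover have "ps i j m p * of_bool (i = m) = 0" "ps i j m p * of_bool (j = m) = 0"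
        using z ij by auto
      ultimately show "ps i j m p * ps i j m q = ps i j m p * (\<Sum>r\<in>I7. ph i j r * ph r m q)" by simp
    qed
    also have "\<dots> = (\<Sum>r\<in>I7. (\<Sum>i\<in>I7. \<Sum>j\<in>I7. ph i j r * ps i j m p) * ph r m q)"
      unfolding sum_distrib_left sum_distrib_right
      by (subst (2) sum.swap, subst sum.swap) (simp add: mult_ac)
    finally show ?thesis
      using assms m by (simp add: ph_ps_contract cong: sum.cong)
  qed
  have "(\<Sum>m\<in>I7. \<Sum>i\<in>I7. \<Sum>j\<in>I7. ps i j m p * ps i j m q) = (\<Sum>m\<in>I7. \<Sum>r\<in>I7. 4 * ph r m p * ph r m q)"
    using * by simp
  also have "\<dots> = 4 * (\<Sum>r\<in>I7. \<Sum>m\<in>I7. ph r m p * ph r m q)"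
    by (subst sum.swap) (simp add: sum_distrib_left mult.assoc)
  finally show ?thesis
    using ph_norm[OF assms] by simp
qed

section \<open>Structure constants of strong \<open>G\<^sub>2T\<close>-structures\<close>

text \<open>The coefficients of \<open>d\<alpha>\<close> for a left-invariant \<open>\<alpha>\<close>, where \<open>c i j m\<close> is the \<open>m\<close>-th coefficient of
  \<open>[e\<^sub>i, e\<^sub>j]\<close>.\<close>

definition ce3 :: "(nat \<Rightarrow> nat \<Rightarrow> nat \<Rightarrow> real) \<Rightarrow> (nat \<Rightarrow> nat \<Rightarrow> nat \<Rightarrow> real) \<Rightarrow> nat \<Rightarrow> nat \<Rightarrow> nat \<Rightarrow> nat \<Rightarrow> real" where
  "ce3 c \<alpha> i j k l = (\<Sum>m\<in>I7. - c i j m * \<alpha> m k l + c i k m * \<alpha> m j l - c i l m * \<alpha> m j k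
     - c j k m * \<alpha> m i l + c j l m * \<alpha> m i k - c k l m * \<alpha> m i j)"

definition ce4 :: "(nat \<Rightarrow> nat \<Rightarrow> nat \<Rightarrow> real) \<Rightarrow> (nat \<Rightarrow> nat \<Rightarrow> nat \<Rightarrow> nat \<Rightarrow> real) \<Rightarrow> nat \<Rightarrow> nat \<Rightarrow> nat \<Rightarrow> nat \<Rightarrow> nat \<Rightarrow> real" where
  "ce4 c \<alpha> i j k l n = (\<Sum>m\<in>I7. - c i j m * \<alpha> m k l n + c i k m * \<alpha> m j l n - c i l m * \<alpha> m j k n + c i n m * \<alpha> m j k l
     - c j k m * \<alpha> m i l n + c j l m * \<alpha> m i k n - c j n m * \<alpha> m i k l - c k l m * \<alpha> m i j n
     + c k n m * \<alpha> m i j l - c l n m * \<alpha> m i j k)"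

text \<open>The sign of the permutation that sorts the list, by counting inversions. This form is
  evaluated directly on literals and follows the recursion of insertion sort.\<close>

fun list_sign :: "nat list \<Rightarrow> real" where
  "list_sign [] = 1"
| "list_sign (x # xs) = (if even (length (filter (\<lambda>y. y < x) xs)) then 1 else - 1) * list_sign xs"

text \<open>The last assumption is the formula for the torsion, with the Hodge star of a 4-form written out on
  complementary indices; \<open>tau\<close> is \<open>\<star>(d\<phi> \<and> \<phi>)\<close>.\<close>

locale g2t_coefficients =
  fixes c :: "nat \<Rightarrow> nat \<Rightarrow> nat \<Rightarrow> real" and th :: "nat \<Rightarrow> real" and T :: "nat \<Rightarrow> nat \<Rightarrow> nat \<Rightarrow> real" and tau :: real
  assumes c_antisym: "c j i k = - c i j k"
    and Lee: "\<lbrakk>i \<in> I7; j \<in> I7; k \<in> I7; l \<in> I7; n \<in> I7\<rbrakk> \<Longrightarrow> ce4 c ps i j k l n =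
       th i * ps j k l n - th j * ps i k l n + th k * ps i j l n - th l * ps i j k n + th n * ps i j k l"
    and T_antisym: "T j i k = - T i j k" "T i k j = - T i j k"
    and tau: "tau = - ce3 c ph 1 2 4 7 - ce3 c ph 1 2 5 6 - ce3 c ph 1 3 4 6 + ce3 c ph 1 3 5 7 + ce3 c ph 2 3 4 5 + ce3 c ph 2 3 6 7 + ce3 c ph 4 5 6 7"
    and T: "\<lbrakk>distinct [i, j, k, l, p, q, r]; {i, j, k, l, p, q, r} = I7\<rbrakk> \<Longrightarrow> T p q r = tau / 6 * ph p q r
       + list_sign [i, j, k, l, p, q, r] * (th i * ph j k l - th j * ph i k l + th k * ph i j l - th l * ph i j k - ce3 c ph i j k l)"
begin

text \<open>The Christoffel symbols of the connection \<open>\<nabla> + T/2\<close>, with \<open>\<nabla>\<close> the Levi-Civita connection.\<close>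

definition Gam :: "nat \<Rightarrow> nat \<Rightarrow> nat \<Rightarrow> real" where
  "Gam i j k = (c i j k - c j k i + c k i j + T i j k) / 2"

lemma Gam_antisym: "Gam i k j = - Gam i j k"
  unfolding Gam_def using c_antisym[of k j i] c_antisym[of i k j] c_antisym[of j i k] T_antisym(2)[of i k j]
  by (simp add: field_simps)

lemma c_low:
    "c 2 1 k = - c 1 2 k"
    "c 3 1 k = - c 1 3 k" "c 3 2 k = - c 2 3 k"
    "c 4 1 k = - c 1 4 k" "c 4 2 k = - c 2 4 k" "c 4 3 k = - c 3 4 k"
    "c 5 1 k = - c 1 5 k" "c 5 2 k = - c 2 5 k" "c 5 3 k = - c 3 5 k" "c 5 4 k = - c 4 5 k"
    "c 6 1 k = - c 1 6 k" "c 6 2 k = - c 2 6 k" "c 6 3 k = - c 3 6 k" "c 6 4 k = - c 4 6 k" "c 6 5 k = - c 5 6 k"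
    "c 7 1 k = - c 1 7 k" "c 7 2 k = - c 2 7 k" "c 7 3 k = - c 3 7 k" "c 7 4 k = - c 4 7 k" "c 7 5 k = - c 5 7 k" "c 7 6 k = - c 6 7 k"
  by (rule c_antisym)+

lemma c_diag: "c i i k = 0"
  using c_antisym[of i i k] by simp

lemma T_diag: "T i i k = 0" "T i k k = 0" "T i k i = 0"
  using T_antisym(1)[of i i k] T_antisym(2)[of i k k] T_antisym(1)[of i k i] T_antisym(2)[of k i i] by simp_all

lemma T_low:
    "T 2 1 k = - T 1 2 k" "T k 2 1 = - T k 1 2"
    "T 3 1 k = - T 1 3 k" "T k 3 1 = - T k 1 3" "T 3 2 k = - T 2 3 k" "T k 3 2 = - T k 2 3"
    "T 4 1 k = - T 1 4 k" "T k 4 1 = - T k 1 4" "T 4 2 k = - T 2 4 k" "T k 4 2 = - T k 2 4" "T 4 3 k = - T 3 4 k" "T k 4 3 = - T k 3 4"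
    "T 5 1 k = - T 1 5 k" "T k 5 1 = - T k 1 5" "T 5 2 k = - T 2 5 k" "T k 5 2 = - T k 2 5" "T 5 3 k = - T 3 5 k" "T k 5 3 = - T k 3 5" "T 5 4 k = - T 4 5 k" "T k 5 4 = - T k 4 5"
    "T 6 1 k = - T 1 6 k" "T k 6 1 = - T k 1 6" "T 6 2 k = - T 2 6 k" "T k 6 2 = - T k 2 6" "T 6 3 k = - T 3 6 k" "T k 6 3 = - T k 3 6" "T 6 4 k = - T 4 6 k" "T k 6 4 = - T k 4 6" "T 6 5 k = - T 5 6 k" "T k 6 5 = - T k 5 6"
    "T 7 1 k = - T 1 7 k" "T k 7 1 = - T k 1 7" "T 7 2 k = - T 2 7 k" "T k 7 2 = - T k 2 7" "T 7 3 k = - T 3 7 k" "T k 7 3 = - T k 3 7" "T 7 4 k = - T 4 7 k" "T k 7 4 = - T k 4 7" "T 7 5 k = - T 5 7 k" "T k 7 5 = - T k 5 7" "T 7 6 k = - T 6 7 k" "T k 7 6 = - T k 6 7"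
  by (rule T_antisym)+

text \<open>\<open>ph_sum_table\<close> wants the contracted index in the last slot of
  \<open>ph\<close> and \<open>ph\<close> as the left factor; the terms are cycled and commuted into
  that shape.\<close>

lemma ce3_ph: "ce3 c ph i j k l = (\<Sum>m\<in>I7. - (ph k l m * c i j m) + ph j l m * c i k m - ph j k m * c i l m
     - ph i l m * c j k m + ph i k m * c j l m - ph i j m * c k l m)"
  if "i \<in> I7" "j \<in> I7" "k \<in> I7" "l \<in> I7"
  unfolding ce3_def using that by (intro sum.cong refl) (simp add: ph_cyc)

lemma ce3_ph_table:
    "ce3 c ph 1 2 3 4 = c 1 2 7 + c 1 3 6 - c 1 4 1 - c 2 3 5 - c 2 4 2 - c 3 4 3"
    "ce3 c ph 1 2 3 5 = c 1 2 6 - c 1 3 7 - c 1 5 1 + c 2 3 4 - c 2 5 2 - c 3 5 3"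
    "ce3 c ph 1 2 3 6 = - c 1 2 5 - c 1 3 4 - c 1 6 1 - c 2 3 7 - c 2 6 2 - c 3 6 3"
    "ce3 c ph 1 2 3 7 = - c 1 2 4 + c 1 3 5 - c 1 7 1 + c 2 3 6 - c 2 7 2 - c 3 7 3"
    "ce3 c ph 1 2 4 5 = - c 1 2 1 - c 1 4 7 - c 1 5 6 + c 2 4 4 + c 2 5 5 - c 4 5 3"
    "ce3 c ph 1 2 4 6 = - c 1 2 2 - c 1 4 4 - c 1 6 6 - c 2 4 7 + c 2 6 5 - c 4 6 3"
    "ce3 c ph 1 2 4 7 = c 1 2 3 + c 1 4 5 - c 1 7 6 + c 2 4 6 + c 2 7 5 - c 4 7 3"
    "ce3 c ph 1 2 5 6 = c 1 2 3 - c 1 5 4 + c 1 6 7 - c 2 5 7 - c 2 6 4 - c 5 6 3"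
    "ce3 c ph 1 2 5 7 = c 1 2 2 + c 1 5 5 + c 1 7 7 + c 2 5 6 - c 2 7 4 - c 5 7 3"
    "ce3 c ph 1 2 6 7 = - c 1 2 1 + c 1 6 5 + c 1 7 4 + c 2 6 6 + c 2 7 7 - c 6 7 3"
    "ce3 c ph 1 3 4 5 = - c 1 3 1 - c 1 4 6 + c 1 5 7 + c 3 4 4 + c 3 5 5 + c 4 5 2"
    "ce3 c ph 1 3 4 6 = - c 1 3 2 + c 1 4 5 + c 1 6 7 - c 3 4 7 + c 3 6 5 + c 4 6 2"
    "ce3 c ph 1 3 4 7 = c 1 3 3 + c 1 4 4 + c 1 7 7 + c 3 4 6 + c 3 7 5 + c 4 7 2"
    "ce3 c ph 1 3 5 6 = c 1 3 3 + c 1 5 5 + c 1 6 6 - c 3 5 7 - c 3 6 4 + c 5 6 2"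
    "ce3 c ph 1 3 5 7 = c 1 3 2 + c 1 5 4 + c 1 7 6 + c 3 5 6 - c 3 7 4 + c 5 7 2"
    "ce3 c ph 1 3 6 7 = - c 1 3 1 + c 1 6 4 - c 1 7 5 + c 3 6 6 + c 3 7 7 + c 6 7 2"
    "ce3 c ph 1 4 5 6 = c 1 4 3 + c 1 5 2 - c 1 6 1 - c 4 5 7 - c 4 6 4 - c 5 6 5"
    "ce3 c ph 1 4 5 7 = c 1 4 2 - c 1 5 3 - c 1 7 1 + c 4 5 6 - c 4 7 4 - c 5 7 5"
    "ce3 c ph 1 4 6 7 = - c 1 4 1 - c 1 6 3 - c 1 7 2 + c 4 6 6 + c 4 7 7 - c 6 7 5"
    "ce3 c ph 1 5 6 7 = - c 1 5 1 - c 1 6 2 + c 1 7 3 + c 5 6 6 + c 5 7 7 + c 6 7 4"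
    "ce3 c ph 2 3 4 5 = - c 2 3 1 - c 2 4 6 + c 2 5 7 + c 3 4 7 + c 3 5 6 - c 4 5 1"
    "ce3 c ph 2 3 4 6 = - c 2 3 2 + c 2 4 5 + c 2 6 7 + c 3 4 4 + c 3 6 6 - c 4 6 1"
    "ce3 c ph 2 3 4 7 = c 2 3 3 + c 2 4 4 + c 2 7 7 - c 3 4 5 + c 3 7 6 - c 4 7 1"
    "ce3 c ph 2 3 5 6 = c 2 3 3 + c 2 5 5 + c 2 6 6 + c 3 5 4 - c 3 6 7 - c 5 6 1"
    "ce3 c ph 2 3 5 7 = c 2 3 2 + c 2 5 4 + c 2 7 6 - c 3 5 5 - c 3 7 7 - c 5 7 1"
    "ce3 c ph 2 3 6 7 = - c 2 3 1 + c 2 6 4 - c 2 7 5 - c 3 6 5 - c 3 7 4 - c 6 7 1"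
    "ce3 c ph 2 4 5 6 = c 2 4 3 + c 2 5 2 - c 2 6 1 + c 4 5 4 - c 4 6 7 - c 5 6 6"
    "ce3 c ph 2 4 5 7 = c 2 4 2 - c 2 5 3 - c 2 7 1 - c 4 5 5 - c 4 7 7 - c 5 7 6"
    "ce3 c ph 2 4 6 7 = - c 2 4 1 - c 2 6 3 - c 2 7 2 - c 4 6 5 - c 4 7 4 - c 6 7 6"
    "ce3 c ph 2 5 6 7 = - c 2 5 1 - c 2 6 2 + c 2 7 3 - c 5 6 5 - c 5 7 4 + c 6 7 7"
    "ce3 c ph 3 4 5 6 = c 3 4 3 + c 3 5 2 - c 3 6 1 - c 4 5 5 - c 4 6 6 + c 5 6 7"
    "ce3 c ph 3 4 5 7 = c 3 4 2 - c 3 5 3 - c 3 7 1 - c 4 5 4 - c 4 7 6 + c 5 7 7"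
    "ce3 c ph 3 4 6 7 = - c 3 4 1 - c 3 6 3 - c 3 7 2 - c 4 6 4 + c 4 7 5 + c 6 7 7"
    "ce3 c ph 3 5 6 7 = - c 3 5 1 - c 3 6 2 + c 3 7 3 - c 5 6 4 + c 5 7 5 + c 6 7 6"
    "ce3 c ph 4 5 6 7 = - c 4 5 1 - c 4 6 2 + c 4 7 3 + c 5 6 3 + c 5 7 2 - c 6 7 1"
  by (simp_all add: ce3_ph I7_mem sum.distrib sum_subtractf sum_negf ph_sum_table)

text \<open>The 21 components with increasing indices, in lexicographic order of the five indices.
  Their positions are what \<open>Gam_g2\<close> refers to.\<close>

lemma Lee_table:
    "- c 1 2 2 - c 1 3 3 - c 1 4 4 - c 1 5 5 - c 2 4 7 - c 2 5 6 - c 3 4 6 + c 3 5 7 = th 1"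
    "c 1 2 1 + c 1 4 7 - c 1 6 5 - c 2 3 3 - c 2 4 4 - c 2 6 6 + c 3 4 5 + c 3 6 7 = th 2"
    "- c 1 3 1 - c 1 4 6 - c 1 7 5 - c 2 3 2 + c 2 4 5 - c 2 7 6 + c 3 4 4 + c 3 7 7 = - th 3"
    "- c 1 3 1 + c 1 5 7 + c 1 6 4 - c 2 3 2 - c 2 5 4 + c 2 6 7 + c 3 5 5 + c 3 6 6 = - th 3"
    "- c 1 2 1 - c 1 5 6 + c 1 7 4 + c 2 3 3 + c 2 5 5 + c 2 7 7 + c 3 5 4 + c 3 7 6 = - th 2"
    "- c 1 2 2 - c 1 3 3 - c 1 6 6 - c 1 7 7 + c 2 6 5 + c 2 7 4 + c 3 6 4 - c 3 7 5 = th 1"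
    "c 1 2 7 - c 1 4 1 - c 1 6 3 - c 2 4 2 + c 2 5 3 + c 4 5 5 + c 4 6 6 - c 5 6 7 = - th 4"
    "- c 1 2 6 + c 1 5 1 - c 1 7 3 + c 2 4 3 + c 2 5 2 + c 4 5 4 + c 4 7 6 - c 5 7 7 = th 5"
    "c 1 2 5 - c 1 4 3 + c 1 6 1 + c 2 6 2 - c 2 7 3 + c 4 6 4 - c 4 7 5 - c 6 7 7 = th 6"
    "- c 1 2 4 - c 1 5 3 - c 1 7 1 - c 2 6 3 - c 2 7 2 + c 5 6 4 - c 5 7 5 - c 6 7 6 = - th 7"
    "c 1 3 7 + c 1 5 1 + c 1 6 2 - c 3 4 2 + c 3 5 3 + c 4 5 4 - c 4 6 7 - c 5 6 6 = th 5"
    "- c 1 3 6 + c 1 4 1 + c 1 7 2 + c 3 4 3 + c 3 5 2 - c 4 5 5 - c 4 7 7 - c 5 7 6 = th 4"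
    "c 1 3 5 + c 1 4 2 - c 1 7 1 + c 3 6 2 - c 3 7 3 - c 4 6 5 - c 4 7 4 - c 6 7 6 = - th 7"
    "- c 1 3 4 + c 1 5 2 - c 1 6 1 - c 3 6 3 - c 3 7 2 - c 5 6 5 - c 5 7 4 + c 6 7 7 = - th 6"
    "- c 1 4 4 - c 1 5 5 - c 1 6 6 - c 1 7 7 - c 4 6 3 - c 4 7 2 - c 5 6 2 + c 5 7 3 = th 1"
    "c 2 3 7 + c 2 5 1 + c 2 6 2 + c 3 4 1 + c 3 6 3 + c 4 5 7 + c 4 6 4 + c 5 6 5 = th 6"
    "- c 2 3 6 + c 2 4 1 + c 2 7 2 - c 3 5 1 + c 3 7 3 - c 4 5 6 + c 4 7 4 + c 5 7 5 = th 7"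
    "c 2 3 5 + c 2 4 2 - c 2 7 1 + c 3 4 3 - c 3 6 1 - c 4 6 6 - c 4 7 7 + c 6 7 5 = th 4"
    "- c 2 3 4 + c 2 5 2 - c 2 6 1 + c 3 5 3 + c 3 7 1 - c 5 6 6 - c 5 7 7 - c 6 7 4 = th 5"
    "- c 2 4 4 - c 2 5 5 - c 2 6 6 - c 2 7 7 + c 4 5 3 + c 4 7 1 + c 5 6 1 + c 6 7 3 = th 2"
    "- c 3 4 4 - c 3 5 5 - c 3 6 6 - c 3 7 7 - c 4 5 2 + c 4 6 1 - c 5 7 1 - c 6 7 2 = th 3"
proof -
  show "- c 1 2 2 - c 1 3 3 - c 1 4 4 - c 1 5 5 - c 2 4 7 - c 2 5 6 - c 3 4 6 + c 3 5 7 = th 1"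
    using Lee[of 1 2 3 4 5] by (simp add: I7_mem ce4_def sum_I7 ps_table ph_def oct_table)
  show "c 1 2 1 + c 1 4 7 - c 1 6 5 - c 2 3 3 - c 2 4 4 - c 2 6 6 + c 3 4 5 + c 3 6 7 = th 2"
    using Lee[of 1 2 3 4 6] by (simp add: I7_mem ce4_def sum_I7 ps_table ph_def oct_table)
  show "- c 1 3 1 - c 1 4 6 - c 1 7 5 - c 2 3 2 + c 2 4 5 - c 2 7 6 + c 3 4 4 + c 3 7 7 = - th 3"
    using Lee[of 1 2 3 4 7] by (simp add: I7_mem ce4_def sum_I7 ps_table ph_def oct_table)
  show "- c 1 3 1 + c 1 5 7 + c 1 6 4 - c 2 3 2 - c 2 5 4 + c 2 6 7 + c 3 5 5 + c 3 6 6 = - th 3"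
    using Lee[of 1 2 3 5 6] by (simp add: I7_mem ce4_def sum_I7 ps_table ph_def oct_table)
  show "- c 1 2 1 - c 1 5 6 + c 1 7 4 + c 2 3 3 + c 2 5 5 + c 2 7 7 + c 3 5 4 + c 3 7 6 = - th 2"
    using Lee[of 1 2 3 5 7] by (simp add: I7_mem ce4_def sum_I7 ps_table ph_def oct_table)
  show "- c 1 2 2 - c 1 3 3 - c 1 6 6 - c 1 7 7 + c 2 6 5 + c 2 7 4 + c 3 6 4 - c 3 7 5 = th 1"
    using Lee[of 1 2 3 6 7] by (simp add: I7_mem ce4_def sum_I7 ps_table ph_def oct_table)
  show "c 1 2 7 - c 1 4 1 - c 1 6 3 - c 2 4 2 + c 2 5 3 + c 4 5 5 + c 4 6 6 - c 5 6 7 = - th 4"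
    using Lee[of 1 2 4 5 6] by (simp add: I7_mem ce4_def sum_I7 ps_table ph_def oct_table)
  show "- c 1 2 6 + c 1 5 1 - c 1 7 3 + c 2 4 3 + c 2 5 2 + c 4 5 4 + c 4 7 6 - c 5 7 7 = th 5"
    using Lee[of 1 2 4 5 7] by (simp add: I7_mem ce4_def sum_I7 ps_table ph_def oct_table)
  show "c 1 2 5 - c 1 4 3 + c 1 6 1 + c 2 6 2 - c 2 7 3 + c 4 6 4 - c 4 7 5 - c 6 7 7 = th 6"
    using Lee[of 1 2 4 6 7] by (simp add: I7_mem ce4_def sum_I7 ps_table ph_def oct_table)
  show "- c 1 2 4 - c 1 5 3 - c 1 7 1 - c 2 6 3 - c 2 7 2 + c 5 6 4 - c 5 7 5 - c 6 7 6 = - th 7"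
    using Lee[of 1 2 5 6 7] by (simp add: I7_mem ce4_def sum_I7 ps_table ph_def oct_table)
  show "c 1 3 7 + c 1 5 1 + c 1 6 2 - c 3 4 2 + c 3 5 3 + c 4 5 4 - c 4 6 7 - c 5 6 6 = th 5"
    using Lee[of 1 3 4 5 6] by (simp add: I7_mem ce4_def sum_I7 ps_table ph_def oct_table)
  show "- c 1 3 6 + c 1 4 1 + c 1 7 2 + c 3 4 3 + c 3 5 2 - c 4 5 5 - c 4 7 7 - c 5 7 6 = th 4"
    using Lee[of 1 3 4 5 7] by (simp add: I7_mem ce4_def sum_I7 ps_table ph_def oct_table)
  show "c 1 3 5 + c 1 4 2 - c 1 7 1 + c 3 6 2 - c 3 7 3 - c 4 6 5 - c 4 7 4 - c 6 7 6 = - th 7"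
    using Lee[of 1 3 4 6 7] by (simp add: I7_mem ce4_def sum_I7 ps_table ph_def oct_table)
  show "- c 1 3 4 + c 1 5 2 - c 1 6 1 - c 3 6 3 - c 3 7 2 - c 5 6 5 - c 5 7 4 + c 6 7 7 = - th 6"
    using Lee[of 1 3 5 6 7] by (simp add: I7_mem ce4_def sum_I7 ps_table ph_def oct_table)
  show "- c 1 4 4 - c 1 5 5 - c 1 6 6 - c 1 7 7 - c 4 6 3 - c 4 7 2 - c 5 6 2 + c 5 7 3 = th 1"
    using Lee[of 1 4 5 6 7] by (simp add: I7_mem ce4_def sum_I7 ps_table ph_def oct_table)
  show "c 2 3 7 + c 2 5 1 + c 2 6 2 + c 3 4 1 + c 3 6 3 + c 4 5 7 + c 4 6 4 + c 5 6 5 = th 6"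
    using Lee[of 2 3 4 5 6] by (simp add: I7_mem ce4_def sum_I7 ps_table ph_def oct_table)
  show "- c 2 3 6 + c 2 4 1 + c 2 7 2 - c 3 5 1 + c 3 7 3 - c 4 5 6 + c 4 7 4 + c 5 7 5 = th 7"
    using Lee[of 2 3 4 5 7] by (simp add: I7_mem ce4_def sum_I7 ps_table ph_def oct_table)
  show "c 2 3 5 + c 2 4 2 - c 2 7 1 + c 3 4 3 - c 3 6 1 - c 4 6 6 - c 4 7 7 + c 6 7 5 = th 4"
    using Lee[of 2 3 4 6 7] by (simp add: I7_mem ce4_def sum_I7 ps_table ph_def oct_table)
  show "- c 2 3 4 + c 2 5 2 - c 2 6 1 + c 3 5 3 + c 3 7 1 - c 5 6 6 - c 5 7 7 - c 6 7 4 = th 5"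
    using Lee[of 2 3 5 6 7] by (simp add: I7_mem ce4_def sum_I7 ps_table ph_def oct_table)
  show "- c 2 4 4 - c 2 5 5 - c 2 6 6 - c 2 7 7 + c 4 5 3 + c 4 7 1 + c 5 6 1 + c 6 7 3 = th 2"
    using Lee[of 2 4 5 6 7] by (simp add: I7_mem ce4_def sum_I7 ps_table ph_def oct_table)
  show "- c 3 4 4 - c 3 5 5 - c 3 6 6 - c 3 7 7 - c 4 5 2 + c 4 6 1 - c 5 7 1 - c 6 7 2 = th 3"
    using Lee[of 3 4 5 6 7] by (simp add: I7_mem ce4_def sum_I7 ps_table ph_def oct_table)
qed

lemma tau_eq: "tau = - 2 * c 1 2 3 + 2 * c 1 3 2 - 2 * c 1 4 5 + 2 * c 1 5 4 - 2 * c 1 6 7 + 2 * c 1 7 6 - 2 * c 2 3 1 - 2 * c 2 4 6 + 2 * c 2 5 7 + 2 * c 2 6 4 - 2 * c 2 7 5 + 2 * c 3 4 7 + 2 * c 3 5 6 - 2 * c 3 6 5 - 2 * c 3 7 4 - 2 * c 4 5 1 - 2 * c 4 6 2 + 2 * c 4 7 3 + 2 * c 5 6 3 + 2 * c 5 7 2 - 2 * c 6 7 1"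
  unfolding tau ce3_ph_table by simp

text \<open>The 35 entries with increasing indices in lexicographic order, each from the
  complementary quadruple in increasing order.\<close>

lemma T_table:
    "T 1 2 3 = c 4 5 1 + c 4 6 2 - c 4 7 3 - c 5 6 3 - c 5 7 2 + c 6 7 1 + tau / 6"
    "T 1 2 4 = - c 3 5 1 - c 3 6 2 + c 3 7 3 - c 5 6 4 + c 5 7 5 + c 6 7 6 - th 7"
    "T 1 2 5 = c 3 4 1 + c 3 6 3 + c 3 7 2 + c 4 6 4 - c 4 7 5 - c 6 7 7 - th 6"
    "T 1 2 6 = c 3 4 2 - c 3 5 3 - c 3 7 1 - c 4 5 4 - c 4 7 6 + c 5 7 7 + th 5"
    "T 1 2 7 = - c 3 4 3 - c 3 5 2 + c 3 6 1 + c 4 5 5 + c 4 6 6 - c 5 6 7 + th 4"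
    "T 1 3 4 = c 2 5 1 + c 2 6 2 - c 2 7 3 + c 5 6 5 + c 5 7 4 - c 6 7 7 - th 6"
    "T 1 3 5 = - c 2 4 1 - c 2 6 3 - c 2 7 2 - c 4 6 5 - c 4 7 4 - c 6 7 6 + th 7"
    "T 1 3 6 = - c 2 4 2 + c 2 5 3 + c 2 7 1 + c 4 5 5 + c 4 7 7 + c 5 7 6 + th 4"
    "T 1 3 7 = c 2 4 3 + c 2 5 2 - c 2 6 1 + c 4 5 4 - c 4 6 7 - c 5 6 6 - th 5"
    "T 1 4 5 = c 2 3 1 - c 2 6 4 + c 2 7 5 + c 3 6 5 + c 3 7 4 + c 6 7 1 + tau / 6"
    "T 1 4 6 = c 2 3 2 + c 2 5 4 + c 2 7 6 - c 3 5 5 - c 3 7 7 - c 5 7 1 - th 3"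
    "T 1 4 7 = - c 2 3 3 - c 2 5 5 - c 2 6 6 - c 3 5 4 + c 3 6 7 + c 5 6 1 - th 2"
    "T 1 5 6 = - c 2 3 3 - c 2 4 4 - c 2 7 7 + c 3 4 5 - c 3 7 6 + c 4 7 1 - th 2"
    "T 1 5 7 = - c 2 3 2 + c 2 4 5 + c 2 6 7 + c 3 4 4 + c 3 6 6 - c 4 6 1 + th 3"
    "T 1 6 7 = c 2 3 1 + c 2 4 6 - c 2 5 7 - c 3 4 7 - c 3 5 6 + c 4 5 1 + tau / 6"
    "T 2 3 4 = - c 1 5 1 - c 1 6 2 + c 1 7 3 + c 5 6 6 + c 5 7 7 + c 6 7 4 + th 5"
    "T 2 3 5 = c 1 4 1 + c 1 6 3 + c 1 7 2 - c 4 6 6 - c 4 7 7 + c 6 7 5 - th 4"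
    "T 2 3 6 = c 1 4 2 - c 1 5 3 - c 1 7 1 + c 4 5 6 - c 4 7 4 - c 5 7 5 + th 7"
    "T 2 3 7 = - c 1 4 3 - c 1 5 2 + c 1 6 1 + c 4 5 7 + c 4 6 4 + c 5 6 5 - th 6"
    "T 2 4 5 = - c 1 3 1 + c 1 6 4 - c 1 7 5 + c 3 6 6 + c 3 7 7 + c 6 7 2 + th 3"
    "T 2 4 6 = - c 1 3 2 - c 1 5 4 - c 1 7 6 - c 3 5 6 + c 3 7 4 - c 5 7 2 + tau / 6"
    "T 2 4 7 = c 1 3 3 + c 1 5 5 + c 1 6 6 - c 3 5 7 - c 3 6 4 + c 5 6 2 + th 1"
    "T 2 5 6 = c 1 3 3 + c 1 4 4 + c 1 7 7 + c 3 4 6 + c 3 7 5 + c 4 7 2 + th 1"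
    "T 2 5 7 = c 1 3 2 - c 1 4 5 - c 1 6 7 + c 3 4 7 - c 3 6 5 - c 4 6 2 - tau / 6"
    "T 2 6 7 = - c 1 3 1 - c 1 4 6 + c 1 5 7 + c 3 4 4 + c 3 5 5 + c 4 5 2 + th 3"
    "T 3 4 5 = c 1 2 1 - c 1 6 5 - c 1 7 4 - c 2 6 6 - c 2 7 7 + c 6 7 3 - th 2"
    "T 3 4 6 = c 1 2 2 + c 1 5 5 + c 1 7 7 + c 2 5 6 - c 2 7 4 - c 5 7 3 + th 1"
    "T 3 4 7 = - c 1 2 3 + c 1 5 4 - c 1 6 7 + c 2 5 7 + c 2 6 4 + c 5 6 3 - tau / 6"
    "T 3 5 6 = - c 1 2 3 - c 1 4 5 + c 1 7 6 - c 2 4 6 - c 2 7 5 + c 4 7 3 - tau / 6"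
    "T 3 5 7 = - c 1 2 2 - c 1 4 4 - c 1 6 6 - c 2 4 7 + c 2 6 5 - c 4 6 3 - th 1"
    "T 3 6 7 = c 1 2 1 + c 1 4 7 + c 1 5 6 - c 2 4 4 - c 2 5 5 + c 4 5 3 - th 2"
    "T 4 5 6 = - c 1 2 4 + c 1 3 5 - c 1 7 1 + c 2 3 6 - c 2 7 2 - c 3 7 3 + th 7"
    "T 4 5 7 = c 1 2 5 + c 1 3 4 + c 1 6 1 + c 2 3 7 + c 2 6 2 + c 3 6 3 - th 6"
    "T 4 6 7 = c 1 2 6 - c 1 3 7 - c 1 5 1 + c 2 3 4 - c 2 5 2 - c 3 5 3 + th 5"
    "T 5 6 7 = - c 1 2 7 - c 1 3 6 + c 1 4 1 + c 2 3 5 + c 2 4 2 + c 3 4 3 - th 4"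
proof -
  show "T 1 2 3 = c 4 5 1 + c 4 6 2 - c 4 7 3 - c 5 6 3 - c 5 7 2 + c 6 7 1 + tau / 6"
    using T[of 4 5 6 7 1 2 3] by (simp add: ce3_ph_table I7_eq insert_commute ph_def oct_table)
  show "T 1 2 4 = - c 3 5 1 - c 3 6 2 + c 3 7 3 - c 5 6 4 + c 5 7 5 + c 6 7 6 - th 7"
    using T[of 3 5 6 7 1 2 4] by (simp add: ce3_ph_table I7_eq insert_commute ph_def oct_table)
  show "T 1 2 5 = c 3 4 1 + c 3 6 3 + c 3 7 2 + c 4 6 4 - c 4 7 5 - c 6 7 7 - th 6"
    using T[of 3 4 6 7 1 2 5] by (simp add: ce3_ph_table I7_eq insert_commute ph_def oct_table)
  show "T 1 2 6 = c 3 4 2 - c 3 5 3 - c 3 7 1 - c 4 5 4 - c 4 7 6 + c 5 7 7 + th 5"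
    using T[of 3 4 5 7 1 2 6] by (simp add: ce3_ph_table I7_eq insert_commute ph_def oct_table)
  show "T 1 2 7 = - c 3 4 3 - c 3 5 2 + c 3 6 1 + c 4 5 5 + c 4 6 6 - c 5 6 7 + th 4"
    using T[of 3 4 5 6 1 2 7] by (simp add: ce3_ph_table I7_eq insert_commute ph_def oct_table)
  show "T 1 3 4 = c 2 5 1 + c 2 6 2 - c 2 7 3 + c 5 6 5 + c 5 7 4 - c 6 7 7 - th 6"
    using T[of 2 5 6 7 1 3 4] by (simp add: ce3_ph_table I7_eq insert_commute ph_def oct_table)
  show "T 1 3 5 = - c 2 4 1 - c 2 6 3 - c 2 7 2 - c 4 6 5 - c 4 7 4 - c 6 7 6 + th 7"
    using T[of 2 4 6 7 1 3 5] by (simp add: ce3_ph_table I7_eq insert_commute ph_def oct_table)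
  show "T 1 3 6 = - c 2 4 2 + c 2 5 3 + c 2 7 1 + c 4 5 5 + c 4 7 7 + c 5 7 6 + th 4"
    using T[of 2 4 5 7 1 3 6] by (simp add: ce3_ph_table I7_eq insert_commute ph_def oct_table)
  show "T 1 3 7 = c 2 4 3 + c 2 5 2 - c 2 6 1 + c 4 5 4 - c 4 6 7 - c 5 6 6 - th 5"
    using T[of 2 4 5 6 1 3 7] by (simp add: ce3_ph_table I7_eq insert_commute ph_def oct_table)
  show "T 1 4 5 = c 2 3 1 - c 2 6 4 + c 2 7 5 + c 3 6 5 + c 3 7 4 + c 6 7 1 + tau / 6"
    using T[of 2 3 6 7 1 4 5] by (simp add: ce3_ph_table I7_eq insert_commute ph_def oct_table)
  show "T 1 4 6 = c 2 3 2 + c 2 5 4 + c 2 7 6 - c 3 5 5 - c 3 7 7 - c 5 7 1 - th 3"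
    using T[of 2 3 5 7 1 4 6] by (simp add: ce3_ph_table I7_eq insert_commute ph_def oct_table)
  show "T 1 4 7 = - c 2 3 3 - c 2 5 5 - c 2 6 6 - c 3 5 4 + c 3 6 7 + c 5 6 1 - th 2"
    using T[of 2 3 5 6 1 4 7] by (simp add: ce3_ph_table I7_eq insert_commute ph_def oct_table)
  show "T 1 5 6 = - c 2 3 3 - c 2 4 4 - c 2 7 7 + c 3 4 5 - c 3 7 6 + c 4 7 1 - th 2"
    using T[of 2 3 4 7 1 5 6] by (simp add: ce3_ph_table I7_eq insert_commute ph_def oct_table)
  show "T 1 5 7 = - c 2 3 2 + c 2 4 5 + c 2 6 7 + c 3 4 4 + c 3 6 6 - c 4 6 1 + th 3"
    using T[of 2 3 4 6 1 5 7] by (simp add: ce3_ph_table I7_eq insert_commute ph_def oct_table)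
  show "T 1 6 7 = c 2 3 1 + c 2 4 6 - c 2 5 7 - c 3 4 7 - c 3 5 6 + c 4 5 1 + tau / 6"
    using T[of 2 3 4 5 1 6 7] by (simp add: ce3_ph_table I7_eq insert_commute ph_def oct_table)
  show "T 2 3 4 = - c 1 5 1 - c 1 6 2 + c 1 7 3 + c 5 6 6 + c 5 7 7 + c 6 7 4 + th 5"
    using T[of 1 5 6 7 2 3 4] by (simp add: ce3_ph_table I7_eq insert_commute ph_def oct_table)
  show "T 2 3 5 = c 1 4 1 + c 1 6 3 + c 1 7 2 - c 4 6 6 - c 4 7 7 + c 6 7 5 - th 4"
    using T[of 1 4 6 7 2 3 5] by (simp add: ce3_ph_table I7_eq insert_commute ph_def oct_table)
  show "T 2 3 6 = c 1 4 2 - c 1 5 3 - c 1 7 1 + c 4 5 6 - c 4 7 4 - c 5 7 5 + th 7"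
    using T[of 1 4 5 7 2 3 6] by (simp add: ce3_ph_table I7_eq insert_commute ph_def oct_table)
  show "T 2 3 7 = - c 1 4 3 - c 1 5 2 + c 1 6 1 + c 4 5 7 + c 4 6 4 + c 5 6 5 - th 6"
    using T[of 1 4 5 6 2 3 7] by (simp add: ce3_ph_table I7_eq insert_commute ph_def oct_table)
  show "T 2 4 5 = - c 1 3 1 + c 1 6 4 - c 1 7 5 + c 3 6 6 + c 3 7 7 + c 6 7 2 + th 3"
    using T[of 1 3 6 7 2 4 5] by (simp add: ce3_ph_table I7_eq insert_commute ph_def oct_table)
  show "T 2 4 6 = - c 1 3 2 - c 1 5 4 - c 1 7 6 - c 3 5 6 + c 3 7 4 - c 5 7 2 + tau / 6"
    using T[of 1 3 5 7 2 4 6] by (simp add: ce3_ph_table I7_eq insert_commute ph_def oct_table)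
  show "T 2 4 7 = c 1 3 3 + c 1 5 5 + c 1 6 6 - c 3 5 7 - c 3 6 4 + c 5 6 2 + th 1"
    using T[of 1 3 5 6 2 4 7] by (simp add: ce3_ph_table I7_eq insert_commute ph_def oct_table)
  show "T 2 5 6 = c 1 3 3 + c 1 4 4 + c 1 7 7 + c 3 4 6 + c 3 7 5 + c 4 7 2 + th 1"
    using T[of 1 3 4 7 2 5 6] by (simp add: ce3_ph_table I7_eq insert_commute ph_def oct_table)
  show "T 2 5 7 = c 1 3 2 - c 1 4 5 - c 1 6 7 + c 3 4 7 - c 3 6 5 - c 4 6 2 - tau / 6"
    using T[of 1 3 4 6 2 5 7] by (simp add: ce3_ph_table I7_eq insert_commute ph_def oct_table)
  show "T 2 6 7 = - c 1 3 1 - c 1 4 6 + c 1 5 7 + c 3 4 4 + c 3 5 5 + c 4 5 2 + th 3"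
    using T[of 1 3 4 5 2 6 7] by (simp add: ce3_ph_table I7_eq insert_commute ph_def oct_table)
  show "T 3 4 5 = c 1 2 1 - c 1 6 5 - c 1 7 4 - c 2 6 6 - c 2 7 7 + c 6 7 3 - th 2"
    using T[of 1 2 6 7 3 4 5] by (simp add: ce3_ph_table I7_eq insert_commute ph_def oct_table)
  show "T 3 4 6 = c 1 2 2 + c 1 5 5 + c 1 7 7 + c 2 5 6 - c 2 7 4 - c 5 7 3 + th 1"
    using T[of 1 2 5 7 3 4 6] by (simp add: ce3_ph_table I7_eq insert_commute ph_def oct_table)
  show "T 3 4 7 = - c 1 2 3 + c 1 5 4 - c 1 6 7 + c 2 5 7 + c 2 6 4 + c 5 6 3 - tau / 6"
    using T[of 1 2 5 6 3 4 7] by (simp add: ce3_ph_table I7_eq insert_commute ph_def oct_table)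
  show "T 3 5 6 = - c 1 2 3 - c 1 4 5 + c 1 7 6 - c 2 4 6 - c 2 7 5 + c 4 7 3 - tau / 6"
    using T[of 1 2 4 7 3 5 6] by (simp add: ce3_ph_table I7_eq insert_commute ph_def oct_table)
  show "T 3 5 7 = - c 1 2 2 - c 1 4 4 - c 1 6 6 - c 2 4 7 + c 2 6 5 - c 4 6 3 - th 1"
    using T[of 1 2 4 6 3 5 7] by (simp add: ce3_ph_table I7_eq insert_commute ph_def oct_table)
  show "T 3 6 7 = c 1 2 1 + c 1 4 7 + c 1 5 6 - c 2 4 4 - c 2 5 5 + c 4 5 3 - th 2"
    using T[of 1 2 4 5 3 6 7] by (simp add: ce3_ph_table I7_eq insert_commute ph_def oct_table)
  show "T 4 5 6 = - c 1 2 4 + c 1 3 5 - c 1 7 1 + c 2 3 6 - c 2 7 2 - c 3 7 3 + th 7"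
    using T[of 1 2 3 7 4 5 6] by (simp add: ce3_ph_table I7_eq insert_commute ph_def oct_table)
  show "T 4 5 7 = c 1 2 5 + c 1 3 4 + c 1 6 1 + c 2 3 7 + c 2 6 2 + c 3 6 3 - th 6"
    using T[of 1 2 3 6 4 5 7] by (simp add: ce3_ph_table I7_eq insert_commute ph_def oct_table)
  show "T 4 6 7 = c 1 2 6 - c 1 3 7 - c 1 5 1 + c 2 3 4 - c 2 5 2 - c 3 5 3 + th 5"
    using T[of 1 2 3 5 4 6 7] by (simp add: ce3_ph_table I7_eq insert_commute ph_def oct_table)
  show "T 5 6 7 = - c 1 2 7 - c 1 3 6 + c 1 4 1 + c 2 3 5 + c 2 4 2 + c 3 4 3 - th 4"
    using T[of 1 2 3 4 5 6 7] by (simp add: ce3_ph_table I7_eq insert_commute ph_def oct_table)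
qed

text \<open>The connection with torsion \<open>T\<close> preserves \<open>\<phi>\<close>: this is what the formula for \<open>T\<close> means.\<close>

lemma Gam_g2:
  assumes "i \<in> I7" "p \<in> I7"
  shows "(\<Sum>j\<in>I7. \<Sum>k\<in>I7. Gam i j k * ph j k p) = 0"
proof -
  let ?w = "\<lambda>i p. \<Sum>j\<in>I7. \<Sum>k\<in>I7. ph p j k * Gam i j k"
  note w = sum_I7[of "\<lambda>j. \<Sum>k\<in>I7. ph p j k * Gam i j k" for i p]
  note d = Gam_def c_low c_diag T_low T_diag
  \<comment> \<open>Each of the 49 components is a linear consequence of \<open>tau_eq\<close> and
    of three torsion entries if i = p, of two torsion entries and two Lee components otherwise.
    Supplying just these keeps the linear arithmetic small.\<close>
  have w11: "?w 1 1 = 0"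
    by (simp only: w ph_sum_table) (unfold d, use T_table(1) T_table(10) T_table(15) tau_eq in argo)
  have w12: "?w 1 2 = 0"
    by (simp only: w ph_sum_table) (unfold d, use Lee_table(3) Lee_table(4) T_table(11) T_table(14) tau_eq in argo)
  have w13: "?w 1 3 = 0"
    by (simp only: w ph_sum_table) (unfold d, use Lee_table(2) Lee_table(5) T_table(12) T_table(13) tau_eq in argo)
  have w14: "?w 1 4 = 0"
    by (simp only: w ph_sum_table) (unfold d, use Lee_table(8) Lee_table(11) T_table(4) T_table(9) tau_eq in argo)
  have w15: "?w 1 5 = 0"
    by (simp only: w ph_sum_table) (unfold d, use Lee_table(7) Lee_table(12) T_table(5) T_table(8) tau_eq in argo)
  have w16: "?w 1 6 = 0"
    by (simp only: w ph_sum_table) (unfold d, use Lee_table(10) Lee_table(13) T_table(2) T_table(7) tau_eq in argo)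
  have w17: "?w 1 7 = 0"
    by (simp only: w ph_sum_table) (unfold d, use Lee_table(9) Lee_table(14) T_table(3) T_table(6) tau_eq in argo)
  have w21: "?w 2 1 = 0"
    by (simp only: w ph_sum_table) (unfold d, use Lee_table(3) Lee_table(4) T_table(20) T_table(25) tau_eq in argo)
  have w22: "?w 2 2 = 0"
    by (simp only: w ph_sum_table) (unfold d, use T_table(1) T_table(21) T_table(24) tau_eq in argo)
  have w23: "?w 2 3 = 0"
    by (simp only: w ph_sum_table) (unfold d, use Lee_table(1) Lee_table(6) T_table(22) T_table(23) tau_eq in argo)
  have w24: "?w 2 4 = 0"
    by (simp only: w ph_sum_table) (unfold d, use Lee_table(9) Lee_table(16) T_table(3) T_table(19) tau_eq in argo)
  have w25: "?w 2 5 = 0"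
    by (simp only: w ph_sum_table) (unfold d, use Lee_table(10) Lee_table(17) T_table(2) T_table(18) tau_eq in argo)
  have w26: "?w 2 6 = 0"
    by (simp only: w ph_sum_table) (unfold d, use Lee_table(7) Lee_table(18) T_table(5) T_table(17) tau_eq in argo)
  have w27: "?w 2 7 = 0"
    by (simp only: w ph_sum_table) (unfold d, use Lee_table(8) Lee_table(19) T_table(4) T_table(16) tau_eq in argo)
  have w31: "?w 3 1 = 0"
    by (simp only: w ph_sum_table) (unfold d, use Lee_table(2) Lee_table(5) T_table(26) T_table(31) tau_eq in argo)
  have w32: "?w 3 2 = 0"
    by (simp only: w ph_sum_table) (unfold d, use Lee_table(1) Lee_table(6) T_table(27) T_table(30) tau_eq in argo)
  have w33: "?w 3 3 = 0"
    by (simp only: w ph_sum_table) (unfold d, use T_table(1) T_table(28) T_table(29) tau_eq in argo)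
  have w34: "?w 3 4 = 0"
    by (simp only: w ph_sum_table) (unfold d, use Lee_table(13) Lee_table(17) T_table(7) T_table(18) tau_eq in argo)
  have w35: "?w 3 5 = 0"
    by (simp only: w ph_sum_table) (unfold d, use Lee_table(14) Lee_table(16) T_table(6) T_table(19) tau_eq in argo)
  have w36: "?w 3 6 = 0"
    by (simp only: w ph_sum_table) (unfold d, use Lee_table(11) Lee_table(19) T_table(9) T_table(16) tau_eq in argo)
  have w37: "?w 3 7 = 0"
    by (simp only: w ph_sum_table) (unfold d, use Lee_table(12) Lee_table(18) T_table(8) T_table(17) tau_eq in argo)
  have w41: "?w 4 1 = 0"
    by (simp only: w ph_sum_table) (unfold d, use Lee_table(8) Lee_table(11) T_table(16) T_table(34) tau_eq in argo)
  have w42: "?w 4 2 = 0"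
    by (simp only: w ph_sum_table) (unfold d, use Lee_table(9) Lee_table(16) T_table(6) T_table(33) tau_eq in argo)
  have w43: "?w 4 3 = 0"
    by (simp only: w ph_sum_table) (unfold d, use Lee_table(13) Lee_table(17) T_table(2) T_table(32) tau_eq in argo)
  have w44: "?w 4 4 = 0"
    by (simp only: w ph_sum_table) (unfold d, use T_table(10) T_table(21) T_table(28) tau_eq in argo)
  have w45: "?w 4 5 = 0"
    by (simp only: w ph_sum_table) (unfold d, use Lee_table(1) Lee_table(15) T_table(22) T_table(27) tau_eq in argo)
  have w46: "?w 4 6 = 0"
    by (simp only: w ph_sum_table) (unfold d, use Lee_table(2) Lee_table(20) T_table(12) T_table(26) tau_eq in argo)
  have w47: "?w 4 7 = 0"
    by (simp only: w ph_sum_table) (unfold d, use Lee_table(3) Lee_table(21) T_table(11) T_table(20) tau_eq in argo)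
  have w51: "?w 5 1 = 0"
    by (simp only: w ph_sum_table) (unfold d, use Lee_table(7) Lee_table(12) T_table(17) T_table(35) tau_eq in argo)
  have w52: "?w 5 2 = 0"
    by (simp only: w ph_sum_table) (unfold d, use Lee_table(10) Lee_table(17) T_table(7) T_table(32) tau_eq in argo)
  have w53: "?w 5 3 = 0"
    by (simp only: w ph_sum_table) (unfold d, use Lee_table(14) Lee_table(16) T_table(3) T_table(33) tau_eq in argo)
  have w54: "?w 5 4 = 0"
    by (simp only: w ph_sum_table) (unfold d, use Lee_table(1) Lee_table(15) T_table(23) T_table(30) tau_eq in argo)
  have w55: "?w 5 5 = 0"
    by (simp only: w ph_sum_table) (unfold d, use T_table(10) T_table(24) T_table(29) tau_eq in argo)
  have w56: "?w 5 6 = 0"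
    by (simp only: w ph_sum_table) (unfold d, use Lee_table(4) Lee_table(21) T_table(14) T_table(20) tau_eq in argo)
  have w57: "?w 5 7 = 0"
    by (simp only: w ph_sum_table) (unfold d, use Lee_table(5) Lee_table(20) T_table(13) T_table(26) tau_eq in argo)
  have w61: "?w 6 1 = 0"
    by (simp only: w ph_sum_table) (unfold d, use Lee_table(10) Lee_table(13) T_table(18) T_table(32) tau_eq in argo)
  have w62: "?w 6 2 = 0"
    by (simp only: w ph_sum_table) (unfold d, use Lee_table(7) Lee_table(18) T_table(8) T_table(35) tau_eq in argo)
  have w63: "?w 6 3 = 0"
    by (simp only: w ph_sum_table) (unfold d, use Lee_table(11) Lee_table(19) T_table(4) T_table(34) tau_eq in argo)
  have w64: "?w 6 4 = 0"
    by (simp only: w ph_sum_table) (unfold d, use Lee_table(2) Lee_table(20) T_table(13) T_table(31) tau_eq in argo)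
  have w65: "?w 6 5 = 0"
    by (simp only: w ph_sum_table) (unfold d, use Lee_table(4) Lee_table(21) T_table(11) T_table(25) tau_eq in argo)
  have w66: "?w 6 6 = 0"
    by (simp only: w ph_sum_table) (unfold d, use T_table(15) T_table(21) T_table(29) tau_eq in argo)
  have w67: "?w 6 7 = 0"
    by (simp only: w ph_sum_table) (unfold d, use Lee_table(6) Lee_table(15) T_table(23) T_table(27) tau_eq in argo)
  have w71: "?w 7 1 = 0"
    by (simp only: w ph_sum_table) (unfold d, use Lee_table(9) Lee_table(14) T_table(19) T_table(33) tau_eq in argo)
  have w72: "?w 7 2 = 0"
    by (simp only: w ph_sum_table) (unfold d, use Lee_table(8) Lee_table(19) T_table(9) T_table(34) tau_eq in argo)
  have w73: "?w 7 3 = 0"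
    by (simp only: w ph_sum_table) (unfold d, use Lee_table(12) Lee_table(18) T_table(5) T_table(35) tau_eq in argo)
  have w74: "?w 7 4 = 0"
    by (simp only: w ph_sum_table) (unfold d, use Lee_table(3) Lee_table(21) T_table(14) T_table(25) tau_eq in argo)
  have w75: "?w 7 5 = 0"
    by (simp only: w ph_sum_table) (unfold d, use Lee_table(5) Lee_table(20) T_table(12) T_table(31) tau_eq in argo)
  have w76: "?w 7 6 = 0"
    by (simp only: w ph_sum_table) (unfold d, use Lee_table(6) Lee_table(15) T_table(22) T_table(30) tau_eq in argo)
  have w77: "?w 7 7 = 0"
    by (simp only: w ph_sum_table) (unfold d, use T_table(15) T_table(24) T_table(28) tau_eq in argo)
  have *: "(\<Sum>j\<in>I7. \<Sum>k\<in>I7. Gam i j k * ph j k p) = (\<Sum>j\<in>I7. \<Sum>k\<in>I7. ph p j k * Gam i j k)"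
    using ph_cyc[OF assms(2)] by (simp add: mult.commute)
  from w11 w12 w13 w14 w15 w16 w17 w21 w22 w23 w24 w25 w26 w27 w31 w32 w33 w34 w35 w36 w37 w41 w42 w43 w44 w45 w46 w47 w51 w52 w53 w54 w55 w56 w57 w61 w62 w63 w64 w65 w66 w67 w71 w72 w73 w74 w75 w76 w77
  have "\<forall>i\<in>I7. \<forall>p\<in>I7. (\<Sum>j\<in>I7. \<Sum>k\<in>I7. ph p j k * Gam i j k) = 0"
    unfolding ball_I7 by blast
  then show ?thesis
    using assms * by simp
qed

end

section \<open>Index permutations in full contractions\<close>

lemma ps_perms:
  assumes "i \<in> I7" "j \<in> I7" "k \<in> I7" "l \<in> I7"
  shows
    "ps i j l k = - ps i j k l"
    "ps i k j l = - ps i j k l"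
    "ps i k l j = ps i j k l"
    "ps i l j k = ps i j k l"
    "ps i l k j = - ps i j k l"
    "ps j i k l = - ps i j k l"
    "ps j i l k = ps i j k l"
    "ps j k i l = ps i j k l"
    "ps j k l i = - ps i j k l"
    "ps j l i k = - ps i j k l"
    "ps j l k i = ps i j k l"
    "ps k i j l = ps i j k l"
    "ps k i l j = - ps i j k l"
    "ps k j i l = - ps i j k l"
    "ps k j l i = ps i j k l"
    "ps k l i j = ps i j k l"
    "ps k l j i = - ps i j k l"
    "ps l i j k = - ps i j k l"
    "ps l i k j = ps i j k l"
    "ps l j i k = ps i j k l"
    "ps l j k i = - ps i j k l"
    "ps l k i j = - ps i j k l"
    "ps l k j i = ps i j k l"
  using ps_antisym(1)[OF assms(1) assms(2) assms(3) assms(4)]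
    ps_antisym(1)[OF assms(1) assms(2) assms(4) assms(3)]
    ps_antisym(1)[OF assms(1) assms(3) assms(2) assms(4)]
    ps_antisym(1)[OF assms(1) assms(3) assms(4) assms(2)]
    ps_antisym(1)[OF assms(1) assms(4) assms(2) assms(3)]
    ps_antisym(1)[OF assms(1) assms(4) assms(3) assms(2)]
    ps_antisym(1)[OF assms(2) assms(3) assms(1) assms(4)]
    ps_antisym(1)[OF assms(2) assms(3) assms(4) assms(1)]
    ps_antisym(1)[OF assms(2) assms(4) assms(1) assms(3)]
    ps_antisym(1)[OF assms(2) assms(4) assms(3) assms(1)]
    ps_antisym(1)[OF assms(3) assms(4) assms(1) assms(2)]
    ps_antisym(1)[OF assms(3) assms(4) assms(2) assms(1)]
    ps_antisym(2)[OF assms(1) assms(2) assms(3) assms(4)]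
    ps_antisym(2)[OF assms(1) assms(2) assms(4) assms(3)]
    ps_antisym(2)[OF assms(1) assms(3) assms(4) assms(2)]
    ps_antisym(2)[OF assms(2) assms(1) assms(3) assms(4)]
    ps_antisym(2)[OF assms(2) assms(1) assms(4) assms(3)]
    ps_antisym(2)[OF assms(2) assms(3) assms(4) assms(1)]
    ps_antisym(2)[OF assms(3) assms(1) assms(4) assms(2)]
    ps_antisym(2)[OF assms(3) assms(2) assms(4) assms(1)]
    ps_antisym(3)[OF assms(1) assms(2) assms(3) assms(4)]
    ps_antisym(3)[OF assms(1) assms(3) assms(2) assms(4)]
    ps_antisym(3)[OF assms(2) assms(1) assms(3) assms(4)]
    ps_antisym(3)[OF assms(2) assms(3) assms(1) assms(4)]
    ps_antisym(3)[OF assms(3) assms(1) assms(2) assms(4)]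
    ps_antisym(3)[OF assms(3) assms(2) assms(1) assms(4)]
  by linarith+

text \<open>One sum over a product set, rather than nested sums, so that any renaming of the
  summation indices is a single reindexing by a bijection.\<close>

definition S3 :: "(nat \<Rightarrow> nat \<Rightarrow> nat \<Rightarrow> real) \<Rightarrow> real" where
  "S3 f = (\<Sum>(i, j, k) \<in> I7 \<times> I7 \<times> I7. f i j k)"

definition S5 :: "(nat \<Rightarrow> nat \<Rightarrow> nat \<Rightarrow> nat \<Rightarrow> nat \<Rightarrow> real) \<Rightarrow> real" where
  "S5 f = (\<Sum>(i, j, k, l, m) \<in> I7 \<times> I7 \<times> I7 \<times> I7 \<times> I7. f i j k l m)"

lemma S3_nested: "S3 f = (\<Sum>i\<in>I7. \<Sum>j\<in>I7. \<Sum>k\<in>I7. f i j k)"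
  by (simp add: S3_def sum.cartesian_product)

lemma S5_nested: "S5 f = (\<Sum>i\<in>I7. \<Sum>j\<in>I7. \<Sum>k\<in>I7. \<Sum>l\<in>I7. \<Sum>m\<in>I7. f i j k l m)"
  by (simp add: S5_def sum.cartesian_product)

lemma S3_cong: "(\<And>i j k. \<lbrakk>i \<in> I7; j \<in> I7; k \<in> I7\<rbrakk> \<Longrightarrow> f i j k = g i j k) \<Longrightarrow> S3 f = S3 g"
  unfolding S3_def by (intro sum.cong) auto

lemma S5_cong: "(\<And>i j k l m. \<lbrakk>i \<in> I7; j \<in> I7; k \<in> I7; l \<in> I7; m \<in> I7\<rbrakk> \<Longrightarrow> f i j k l m = g i j k l m) \<Longrightarrow> S5 f = S5 g"
  unfolding S5_def by (intro sum.cong) auto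

lemma S3_linear:
  "S3 (\<lambda>i j k. f i j k + g i j k) = S3 f + S3 g" "S3 (\<lambda>i j k. f i j k - g i j k) = S3 f - S3 g"
  "S3 (\<lambda>i j k. - f i j k) = - S3 f" "S3 (\<lambda>i j k. r * f i j k) = r * S3 f"
  by (simp_all add: S3_def split_def sum.distrib sum_subtractf sum_negf sum_distrib_left)

lemma S5_linear:
  "S5 (\<lambda>i j k l m. f i j k l m + g i j k l m) = S5 f + S5 g"
  "S5 (\<lambda>i j k l m. f i j k l m - g i j k l m) = S5 f - S5 g"
  "S5 (\<lambda>i j k l m. - f i j k l m) = - S5 f"
  by (simp_all add: S5_def split_def sum.distrib sum_subtractf sum_negf)

lemma S3_cyc: "S3 (\<lambda>i j k. f j k i) = S3 f"
  unfolding S3_def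
  by (rule sum.reindex_bij_witness[of _ "\<lambda>(i, j, k). (k, i, j)" "\<lambda>(i, j, k). (j, k, i)"]) auto

lemma S5_perm:
  "S5 f = S5 (\<lambda>i j k l m. f i k j l m)" "S5 f = S5 (\<lambda>i j k l m. f i k l j m)"
  "S5 f = S5 (\<lambda>i j k l m. f k i j l m)" "S5 f = S5 (\<lambda>i j k l m. f k i l j m)"
  "S5 f = S5 (\<lambda>i j k l m. f k l i j m)" "S5 f = S5 (\<lambda>i j k l m. f j k i l m)"
  "S5 f = S5 (\<lambda>i j k l m. f j i k l m)" "S5 f = S5 (\<lambda>i j k l m. f i m k l j)"
  "S5 f = S5 (\<lambda>i j k l m. f m j k l i)" "S5 f = S5 (\<lambda>i j k m l. f i j k l m)"
  "S5 f = S5 (\<lambda>i j m k l. f i j k l m)" "S5 f = S5 (\<lambda>k i l j m. f i j k l m)"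
  "S5 f = S5 (\<lambda>l k m i j. f i j k l m)"
  unfolding S5_def
             apply (rule sum.reindex_bij_witness[of _ "\<lambda>(i, j, k, l, m). (i, k, j, l, m)" "\<lambda>(i, j, k, l, m). (i, k, j, l, m)"]; auto)
            apply (rule sum.reindex_bij_witness[of _ "\<lambda>(i, j, k, l, m). (i, k, l, j, m)" "\<lambda>(i, k, l, j, m). (i, j, k, l, m)"]; auto)
           apply (rule sum.reindex_bij_witness[of _ "\<lambda>(i, j, k, l, m). (k, i, j, l, m)" "\<lambda>(k, i, j, l, m). (i, j, k, l, m)"]; auto)
          apply (rule sum.reindex_bij_witness[of _ "\<lambda>(i, j, k, l, m). (k, i, l, j, m)" "\<lambda>(k, i, l, j, m). (i, j, k, l, m)"]; auto)
         apply (rule sum.reindex_bij_witness[of _ "\<lambda>(i, j, k, l, m). (k, l, i, j, m)" "\<lambda>(k, l, i, j, m). (i, j, k, l, m)"]; auto)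
        apply (rule sum.reindex_bij_witness[of _ "\<lambda>(i, j, k, l, m). (j, k, i, l, m)" "\<lambda>(j, k, i, l, m). (i, j, k, l, m)"]; auto)
       apply (rule sum.reindex_bij_witness[of _ "\<lambda>(i, j, k, l, m). (j, i, k, l, m)" "\<lambda>(j, i, k, l, m). (i, j, k, l, m)"]; auto)
      apply (rule sum.reindex_bij_witness[of _ "\<lambda>(i, j, k, l, m). (i, m, k, l, j)" "\<lambda>(i, m, k, l, j). (i, j, k, l, m)"]; auto)
     apply (rule sum.reindex_bij_witness[of _ "\<lambda>(i, j, k, l, m). (m, j, k, l, i)" "\<lambda>(m, j, k, l, i). (i, j, k, l, m)"]; auto)
    apply (rule sum.reindex_bij_witness[of _ "\<lambda>(i, j, k, m, l). (i, j, k, l, m)" "\<lambda>(i, j, k, l, m). (i, j, k, m, l)"]; auto)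
   apply (rule sum.reindex_bij_witness[of _ "\<lambda>(i, j, m, k, l). (i, j, k, l, m)" "\<lambda>(i, j, k, l, m). (i, j, m, k, l)"]; auto)
  apply (rule sum.reindex_bij_witness[of _ "\<lambda>(k, i, l, j, m). (i, j, k, l, m)" "\<lambda>(i, j, k, l, m). (k, i, l, j, m)"]; auto)
  apply (rule sum.reindex_bij_witness[of _ "\<lambda>(l, k, m, i, j). (i, j, k, l, m)" "\<lambda>(i, j, k, l, m). (l, k, m, i, j)"]; auto)
  done

lemma S5_inner2:
  "(\<And>i j k. \<lbrakk>i \<in> I7; j \<in> I7; k \<in> I7\<rbrakk> \<Longrightarrow> (\<Sum>l\<in>I7. \<Sum>m\<in>I7. f i j k l m) = g i j k) \<Longrightarrow> S5 f = S3 g"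
  unfolding S5_nested S3_nested by (intro sum.cong refl) auto

section \<open>The contracted Bianchi identity and the vanishing of the torsion\<close>

locale strong_g2t_coefficients = g2t_coefficients +
  assumes jacobi: "\<lbrakk>i \<in> I7; j \<in> I7; k \<in> I7; l \<in> I7\<rbrakk> \<Longrightarrow>
      (\<Sum>m\<in>I7. c i j m * c m k l + c j k m * c m i l + c k i m * c m j l) = 0"
    and dT: "\<lbrakk>i \<in> I7; j \<in> I7; k \<in> I7; l \<in> I7\<rbrakk> \<Longrightarrow> ce3 c T i j k l = 0"
    and PQ: "0 \<le> (\<Sum>i\<in>I7. \<Sum>j\<in>I7. \<Sum>k\<in>I7. (c i j k)\<^sup>2 - 2 * (c i j k * c j k i))"
begin

lemma c_Gam: "c i j k = Gam i j k - Gam j i k - T i j k"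
  unfolding Gam_def using c_antisym[of i j k] c_antisym[of j k i] c_antisym[of i k j] c_antisym[of k i j] T_antisym(1)[of i j k]
  by argo

definition "R = S3 (\<lambda>i j k. Gam i j k * Gam j k i)"
definition "H l = (\<Sum>k\<in>I7. Gam k k l)"
definition "HH = (\<Sum>l\<in>I7. H l * H l)"
text \<open>The adjoint of the map sending H to \<iota>_H \<star>\<phi>, applied to T. Hence
  \<open>HW\<close> is the pairing of T with \<iota>_H \<star>\<phi>, the cross term of the square
  completed in \<open>T_H_zero\<close>.\<close>

definition "Wt l = (\<Sum>m\<in>I7. \<Sum>i\<in>I7. \<Sum>j\<in>I7. T i j m * ps i j m l)"
definition "HW = (\<Sum>l\<in>I7. H l * Wt l)"

text \<open>Since \<open>ps\<close> is totally skew, the six terms of \<open>ce3\<close> contribute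
  equally to the full contraction, so that -6 times any one of them vanishes.\<close>

lemma dT_ps: "S5 (\<lambda>i j k l m. c i j m * T m k l * ps i j k l) = 0" (is "S5 ?E = 0")
proof -
  have 2: "S5 (\<lambda>i j k l m. c i k m * T m j l * ps i j k l) = - S5 ?E"
    by (subst S5_perm(1), subst S5_linear(3)[symmetric], rule S5_cong) (subst ps_perms(2), assumption+, simp)
  have 3: "S5 (\<lambda>i j k l m. c i l m * T m j k * ps i j k l) = S5 ?E"
    by (subst S5_perm(2), rule S5_cong) (subst ps_perms(3), assumption+, simp)
  have 4: "S5 (\<lambda>i j k l m. c j k m * T m i l * ps i j k l) = S5 ?E"
    by (subst S5_perm(3), rule S5_cong) (subst ps_perms(12), assumption+, simp)
  have 5: "S5 (\<lambda>i j k l m. c j l m * T m i k * ps i j k l) = - S5 ?E"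
    by (subst S5_perm(4), subst S5_linear(3)[symmetric], rule S5_cong) (subst ps_perms(13), assumption+, simp)
  have 6: "S5 (\<lambda>i j k l m. c k l m * T m i j * ps i j k l) = S5 ?E"
    by (subst S5_perm(5), rule S5_cong) (subst ps_perms(16), assumption+, simp)
  have "0 = (\<Sum>i\<in>I7. \<Sum>j\<in>I7. \<Sum>k\<in>I7. \<Sum>l\<in>I7. ce3 c T i j k l * ps i j k l)"
    using dT by (simp cong: sum.cong)
  also have "\<dots> = S5 (\<lambda>i j k l m. - (c i j m * T m k l * ps i j k l) + c i k m * T m j l * ps i j k l
     - c i l m * T m j k * ps i j k l - c j k m * T m i l * ps i j k l + c j l m * T m i k * ps i j k l
     - c k l m * T m i j * ps i j k l)"
    unfolding S5_nested ce3_def sum_distrib_right by (simp add: algebra_simps)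
  also have "\<dots> = - 6 * S5 ?E"
    unfolding S5_linear 2 3 4 5 6 by simp
  finally show ?thesis by simp
qed

text \<open>The three cyclic terms agree after renaming indices, because a cyclic permutation of
  three indices leaves \<open>ps\<close> unchanged.\<close>

lemma jacobi_ps: "S5 (\<lambda>i j k l m. c i j m * c m k l * ps i j k l) = 0" (is "S5 ?E = 0")
proof -
  have 2: "S5 (\<lambda>i j k l m. c j k m * c m i l * ps i j k l) = S5 ?E"
    by (subst S5_perm(3), rule S5_cong) (subst ps_perms(12), assumption+, simp)
  have 3: "S5 (\<lambda>i j k l m. c k i m * c m j l * ps i j k l) = S5 ?E"
    by (subst S5_perm(6), rule S5_cong) (subst ps_perms(8), assumption+, simp)
  have "0 = (\<Sum>i\<in>I7. \<Sum>j\<in>I7. \<Sum>k\<in>I7. \<Sum>l\<in>I7. (\<Sum>m\<in>I7. c i j m * c m k l + c j k m * c m i l + c k i m * c m j l) * ps i j k l)"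
    using jacobi by (simp cong: sum.cong)
  also have "\<dots> = S5 (\<lambda>i j k l m. c i j m * c m k l * ps i j k l + c j k m * c m i l * ps i j k l + c k i m * c m j l * ps i j k l)"
    unfolding S5_nested sum_distrib_right by (simp add: algebra_simps)
  also have "\<dots> = 3 * S5 ?E"
    unfolding S5_linear 2 3 by simp
  finally show ?thesis by simp
qed

lemma Gam_ps:
  assumes "i \<in> I7" "m \<in> I7" "n \<in> I7"
  shows "(\<Sum>k\<in>I7. \<Sum>l\<in>I7. Gam i k l * ps k l m n) = - 2 * Gam i m n"
  using ps_contract_g2[of "Gam i", OF Gam_antisym Gam_g2] assms by blast

lemma c_Gam_ps: "S5 (\<lambda>i j k l m. c i j m * Gam m k l * ps i j k l) = - 2 * S3 (\<lambda>i j m. c i j m * Gam m i j)"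
proof -
  have "S5 (\<lambda>i j k l m. c i j m * Gam m k l * ps i j k l) = S5 (\<lambda>i j m k l. c i j m * Gam m k l * ps i j k l)"
    by (rule S5_perm(11))
  also have "\<dots> = S3 (\<lambda>i j m. - 2 * (c i j m * Gam m i j))"
  proof (rule S5_inner2)
    fix i j m assume ijm: "i \<in> I7" "j \<in> I7" "m \<in> I7"
    have "(\<Sum>k\<in>I7. \<Sum>l\<in>I7. c i j m * Gam m k l * ps i j k l) = c i j m * (\<Sum>k\<in>I7. \<Sum>l\<in>I7. Gam m k l * ps k l i j)"
      unfolding sum_distrib_left using ijm ps_perms(16)[of i j] by (intro sum.cong refl) simp
    then show "(\<Sum>k\<in>I7. \<Sum>l\<in>I7. c i j m * Gam m k l * ps i j k l) = - 2 * (c i j m * Gam m i j)"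
      using ijm by (simp add: Gam_ps)
  qed
  finally show ?thesis by (simp add: S3_linear)
qed

text \<open>\<open>ps_derivation_g2\<close> for the matrix \<open>Gam k\<close>, applied to
  \<open>ps i j k m\<close> and contracted with \<open>F i j m\<close>. It trades the action on the
  slot m for the actions on the other three; the slot that carries k itself produces the trace
  \<open>H\<close>.\<close>

lemma derivation_S5:
  "S5 (\<lambda>i j k l m. F i j m * Gam k m l * ps i j k l) =
    - S5 (\<lambda>i j k l m. F i j m * Gam k i l * ps l j k m) - S5 (\<lambda>i j k l m. F i j m * Gam k j l * ps i l k m)
    - S5 (\<lambda>i j k l m. F i j m * Gam k k l * ps i j l m)"
proof -
  have "S5 (\<lambda>i j k l m. F i j m * Gam k i l * ps l j k m) + S5 (\<lambda>i j k l m. F i j m * Gam k j l * ps i l k m)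
    + S5 (\<lambda>i j k l m. F i j m * Gam k k l * ps i j l m) + S5 (\<lambda>i j k l m. F i j m * Gam k m l * ps i j k l)
    = S5 (\<lambda>i j k l m. F i j m * (Gam k i l * ps l j k m + Gam k j l * ps i l k m + Gam k k l * ps i j l m + Gam k m l * ps i j k l))"
    unfolding S5_linear[symmetric] by (simp add: algebra_simps)
  also have "\<dots> = S5 (\<lambda>i j k m l. F i j m * (Gam k i l * ps l j k m + Gam k j l * ps i l k m + Gam k k l * ps i j l m + Gam k m l * ps i j k l))"
    by (rule S5_perm(10))
  also have "\<dots> = (\<Sum>i\<in>I7. \<Sum>j\<in>I7. \<Sum>k\<in>I7. \<Sum>m\<in>I7. F i j m * ((\<Sum>l\<in>I7. Gam k i l * ps l j k m)
      + (\<Sum>l\<in>I7. Gam k j l * ps i l k m) + (\<Sum>l\<in>I7. Gam k k l * ps i j l m) + (\<Sum>l\<in>I7. Gam k m l * ps i j k l)))"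
    unfolding S5_nested sum_distrib_left[symmetric] by (simp add: sum.distrib)
  also have "\<dots> = 0"
    using ps_derivation_g2[of "Gam _", OF Gam_antisym Gam_g2] by (simp cong: sum.cong)
  finally show ?thesis by simp
qed

lemma HH_eq: "S3 (\<lambda>k l i. Gam k k l * Gam i i l) = HH"
  unfolding S3_nested HH_def H_def sum_product by (subst sum.swap) simp

text \<open>Of the three terms of \<open>derivation_S5\<close>, the outer two are evaluated by the
  eigenvalue -2 and the middle one is the original sum again, so X = - 2 R - X - 2 HH.\<close>

lemma Gam_Gam_ps: "S5 (\<lambda>i j k l m. Gam i j m * Gam k m l * ps i j k l) = - R - HH" (is "?X = _")
proof -
  have 1: "S5 (\<lambda>i j k l m. Gam i j m * Gam k i l * ps l j k m) = 2 * R"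
  proof -
    have "S5 (\<lambda>i j k l m. Gam i j m * Gam k i l * ps l j k m) = S5 (\<lambda>k i l j m. Gam i j m * Gam k i l * ps l j k m)"
      by (rule S5_perm(12))
    also have "\<dots> = S3 (\<lambda>k i l. 2 * (Gam k i l * Gam i l k))"
    proof (rule S5_inner2)
      fix k i l assume kil: "k \<in> I7" "i \<in> I7" "l \<in> I7"
      have "(\<Sum>j\<in>I7. \<Sum>m\<in>I7. Gam i j m * Gam k i l * ps l j k m) = - Gam k i l * (\<Sum>j\<in>I7. \<Sum>m\<in>I7. Gam i j m * ps j m l k)"
        unfolding sum_distrib_left using kil ps_perms(13)[of _ _ l k] by (intro sum.cong refl) simp
      then show "(\<Sum>j\<in>I7. \<Sum>m\<in>I7. Gam i j m * Gam k i l * ps l j k m) = 2 * (Gam k i l * Gam i l k)"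
        using kil by (simp add: Gam_ps)
    qed
    finally show ?thesis by (simp add: S3_linear R_def)
  qed
  have 2: "S5 (\<lambda>i j k l m. Gam i j m * Gam k j l * ps i l k m) = ?X"
    by (subst S5_perm(8), rule S5_cong) (subst ps_perms(5), assumption+, subst Gam_antisym, simp)
  have 3: "S5 (\<lambda>i j k l m. Gam i j m * Gam k k l * ps i j l m) = 2 * HH"
  proof -
    have "S5 (\<lambda>i j k l m. Gam i j m * Gam k k l * ps i j l m) = S5 (\<lambda>k i l j m. Gam i j m * Gam k k l * ps i j l m)"
      by (rule S5_perm(12))
    also have "\<dots> = S3 (\<lambda>k i l. 2 * (Gam k k l * Gam i i l))"
    proof (rule S5_inner2)
      fix k i l assume kil: "k \<in> I7" "i \<in> I7" "l \<in> I7"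
      have "(\<Sum>j\<in>I7. \<Sum>m\<in>I7. Gam i j m * Gam k k l * ps i j l m) = - Gam k k l * (\<Sum>j\<in>I7. \<Sum>m\<in>I7. Gam i j m * ps j m i l)"
        unfolding sum_distrib_left using kil ps_perms(13)[of _ _ i l] by (intro sum.cong refl) simp
      then show "(\<Sum>j\<in>I7. \<Sum>m\<in>I7. Gam i j m * Gam k k l * ps i j l m) = 2 * (Gam k k l * Gam i i l)"
        using kil by (simp add: Gam_ps)
    qed
    also have "\<dots> = 2 * S3 (\<lambda>k l i. Gam k k l * Gam i i l)"
      unfolding S3_linear S3_nested by (simp, rule sum.cong[OF refl], rule sum.swap)
    finally show ?thesis by (simp add: HH_eq)
  qed
  show ?thesis
    using derivation_S5[of Gam] unfolding 1 2 3 by simp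
qed

lemma T_rev: "T k j i = - T i j k"
  using T_antisym(1)[of k j i] T_antisym(2)[of j k i] T_antisym(1)[of j i k] by simp

text \<open>T is skew in all indices, so the first two terms of \<open>derivation_S5\<close> both
  reproduce the original sum: Y = - Y - Y + HW. No eigenvalue is available here, as T need not take
  values in g2.\<close>

lemma T_Gam_ps: "3 * S5 (\<lambda>i j k l m. T i j m * Gam k m l * ps i j k l) = HW" (is "3 * ?Y = _")
proof -
  have 1: "S5 (\<lambda>i j k l m. T i j m * Gam k i l * ps l j k m) = ?Y"
    by (subst S5_perm(9), rule S5_cong) (subst ps_perms(21), assumption+, subst T_rev, simp)
  have 2: "S5 (\<lambda>i j k l m. T i j m * Gam k j l * ps i l k m) = ?Y"
    by (subst S5_perm(8), rule S5_cong) (subst ps_perms(5), assumption+, subst T_antisym(2), simp)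
  have 3: "S5 (\<lambda>i j k l m. T i j m * Gam k k l * ps i j l m) = - HW"
  proof -
    have "S5 (\<lambda>i j k l m. T i j m * Gam k k l * ps i j l m) = S5 (\<lambda>l k m i j. T i j m * Gam k k l * ps i j l m)"
      by (rule S5_perm(13))
    also have "\<dots> = S3 (\<lambda>l k m. - (Gam k k l * (\<Sum>i\<in>I7. \<Sum>j\<in>I7. T i j m * ps i j m l)))"
      unfolding sum_distrib_left sum_negf[symmetric]
      by (intro S5_inner2 sum.cong refl) (subst ps_perms(1), assumption+, simp)
    also have "\<dots> = - HW"
      unfolding S3_linear HW_def Wt_def H_def S3_nested sum_product by simp
    finally show ?thesis .
  qed
  show ?thesis
    using derivation_S5[of T] unfolding 1 2 3 by simp
qed

definition "P = S3 (\<lambda>i j k. c i j k * c i j k)"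
definition "Q = S3 (\<lambda>i j k. c i j k * c j k i)"
definition "cT = S3 (\<lambda>i j k. c i j k * T i j k)"
definition "TT = S3 (\<lambda>i j k. T i j k * T i j k)"

lemma T_cyc: "T j k i = T i j k"
  using T_antisym(2)[of j i k] T_antisym(1)[of i j k] by simp

lemma C_eq: "S3 (\<lambda>i j m. c i j m * Gam m i j) = Q - P / 2 + cT / 2"
proof -
  have 1: "S3 (\<lambda>i j m. c i j m * c m i j) = Q"
    unfolding Q_def using S3_cyc[of "\<lambda>i j m. c i j m * c m i j"] by (simp add: mult.commute)
  have "S3 (\<lambda>i j m. c i j m * Gam m i j) = S3 (\<lambda>i j m. (1 / 2) * (c i j m * c m i j - c i j m * c i j m + c i j m * c j m i + c i j m * T i j m))"
  proof (rule S3_cong)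
    fix i j m
    show "c i j m * Gam m i j = (1 / 2) * (c i j m * c m i j - c i j m * c i j m + c i j m * c j m i + c i j m * T i j m)"
      unfolding Gam_def using T_cyc[of i j m] T_cyc[of m i j] by (simp add: field_simps)
  qed
  then show ?thesis
    unfolding S3_linear 1 P_def Q_def cT_def by simp
qed

lemma R_eq: "R = (2 * Q - P + 2 * cT + TT) / 4"
proof -
  have cyc: "S3 (\<lambda>i j k. c j k i * c j k i) = P" "S3 (\<lambda>i j k. c k i j * c k i j) = P"
    "S3 (\<lambda>i j k. c j k i * c k i j) = Q"
  proof -
    show p: "S3 (\<lambda>i j k. c j k i * c j k i) = P"
      unfolding P_def by (rule S3_cyc)
    show "S3 (\<lambda>i j k. c k i j * c k i j) = P"
      unfolding p[symmetric] by (rule S3_cyc[of "\<lambda>i j k. c j k i * c j k i"])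
    show "S3 (\<lambda>i j k. c j k i * c k i j) = Q"
      unfolding Q_def by (rule S3_cyc)
  qed
  have "R = S3 (\<lambda>i j k. (1 / 4) * (c i j k * c i j k + 2 * (c i j k * T i j k) + T i j k * T i j k
      - c j k i * c j k i + 2 * (c j k i * c k i j) - c k i j * c k i j))"
    unfolding R_def
  proof (rule S3_cong)
    fix i j k
    have "T j k i = T i j k" by (rule T_cyc)
    then show "Gam i j k * Gam j k i = (1 / 4) * (c i j k * c i j k + 2 * (c i j k * T i j k) + T i j k * T i j k
      - c j k i * c j k i + 2 * (c j k i * c k i j) - c k i j * c k i j)"
      unfolding Gam_def by (simp add: field_simps)
  qed
  then show ?thesis
    unfolding S3_linear cyc P_def[symmetric] cT_def[symmetric] TT_def[symmetric] by simp
qed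

text \<open>The second factor of the contracted Jacobi identity is split by \<open>c_Gam\<close>
  into three parts. The torsion part is removed by \<open>dT_ps\<close>, the part with
  \<open>Gam m\<close> is an eigenvalue computation, and the part with \<open>Gam k\<close> is
  handled by the derivation property. In the sum the pairing \<open>cT\<close> of c with T
  cancels.\<close>

lemma main_identity: "P / 2 - Q + TT / 2 + 2 * HH + HW / 3 = 0"
proof -
  let ?Y = "S5 (\<lambda>i j k l m. T i j m * Gam k m l * ps i j k l)"
  have X2: "S5 (\<lambda>i j k l m. c i j m * Gam k m l * ps i j k l) = 2 * (- R - HH) - ?Y"
  proof -
    have "S5 (\<lambda>i j k l m. Gam j i m * Gam k m l * ps i j k l) = - S5 (\<lambda>i j k l m. Gam i j m * Gam k m l * ps i j k l)"
      by (subst S5_perm(7), subst S5_linear(3)[symmetric], rule S5_cong) (subst ps_perms(6), assumption+, simp)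
    moreover have "S5 (\<lambda>i j k l m. c i j m * Gam k m l * ps i j k l) =
      S5 (\<lambda>i j k l m. Gam i j m * Gam k m l * ps i j k l - Gam j i m * Gam k m l * ps i j k l - T i j m * Gam k m l * ps i j k l)"
      by (rule S5_cong) (simp add: c_Gam algebra_simps)
    ultimately show ?thesis
      unfolding S5_linear Gam_Gam_ps by simp
  qed
  have "0 = S5 (\<lambda>i j k l m. c i j m * Gam m k l * ps i j k l - c i j m * Gam k m l * ps i j k l - c i j m * T m k l * ps i j k l)"
    unfolding jacobi_ps[symmetric] by (rule S5_cong) (subst (2) c_Gam, simp add: algebra_simps)
  also have "\<dots> = - 2 * (Q - P / 2 + cT / 2) - (2 * (- R - HH) - ?Y)"
    unfolding S5_linear c_Gam_ps X2 dT_ps C_eq by simp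
  finally show ?thesis
    using T_Gam_ps unfolding R_eq by argo
qed

lemma T_H_zero: "TT = 0" "HH = 0"
proof -
  \<comment> \<open>With weight 1/3 the cross term of N / 2 is exactly HW / 3. The last square
    contributes 24 / 9 * HH to N, so main_identity reads (P - 2 Q) / 2 + N / 2 + 2 / 3 * HH = 0 with
    all summands nonnegative.\<close>
  define N where "N = S3 (\<lambda>m i j. (T i j m + (1 / 3) * (\<Sum>l\<in>I7. H l * ps i j m l))\<^sup>2)"
  have "N \<ge> 0"
    unfolding N_def S3_nested by (intro sum_nonneg) simp
  have a: "S3 (\<lambda>m i j. T i j m * T i j m) = TT"
    unfolding TT_def by (rule S3_cyc)
  have b: "S3 (\<lambda>m i j. T i j m * (\<Sum>l\<in>I7. H l * ps i j m l)) = HW"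
  proof -
    have "S3 (\<lambda>m i j. T i j m * (\<Sum>l\<in>I7. H l * ps i j m l)) = (\<Sum>m\<in>I7. \<Sum>i\<in>I7. \<Sum>j\<in>I7. \<Sum>l\<in>I7. H l * (T i j m * ps i j m l))"
      unfolding S3_nested sum_distrib_left by (simp add: mult_ac)
    also have "\<dots> = (\<Sum>m\<in>I7. \<Sum>i\<in>I7. \<Sum>l\<in>I7. \<Sum>j\<in>I7. H l * (T i j m * ps i j m l))"
      by (rule sum.cong[OF refl], rule sum.cong[OF refl], rule sum.swap)
    also have "\<dots> = (\<Sum>m\<in>I7. \<Sum>l\<in>I7. \<Sum>i\<in>I7. \<Sum>j\<in>I7. H l * (T i j m * ps i j m l))"
      by (rule sum.cong[OF refl], rule sum.swap)
    also have "\<dots> = (\<Sum>l\<in>I7. \<Sum>m\<in>I7. \<Sum>i\<in>I7. \<Sum>j\<in>I7. H l * (T i j m * ps i j m l))"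
      by (rule sum.swap)
    finally show ?thesis
      unfolding HW_def Wt_def sum_distrib_left .
  qed
  have d: "S3 (\<lambda>m i j. (\<Sum>l\<in>I7. H l * ps i j m l)\<^sup>2) = 24 * HH"
  proof -
    have "S3 (\<lambda>m i j. (\<Sum>l\<in>I7. H l * ps i j m l)\<^sup>2) = (\<Sum>m\<in>I7. \<Sum>i\<in>I7. \<Sum>j\<in>I7. \<Sum>p\<in>I7. \<Sum>q\<in>I7. H p * H q * (ps i j m p * ps i j m q))"
      unfolding S3_nested power2_eq_square sum_product by (simp add: mult_ac)
    also have "\<dots> = (\<Sum>m\<in>I7. \<Sum>i\<in>I7. \<Sum>p\<in>I7. \<Sum>j\<in>I7. \<Sum>q\<in>I7. H p * H q * (ps i j m p * ps i j m q))"
      by (rule sum.cong[OF refl], rule sum.cong[OF refl], rule sum.swap)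
    also have "\<dots> = (\<Sum>m\<in>I7. \<Sum>i\<in>I7. \<Sum>p\<in>I7. \<Sum>q\<in>I7. \<Sum>j\<in>I7. H p * H q * (ps i j m p * ps i j m q))"
      by (rule sum.cong[OF refl], rule sum.cong[OF refl], rule sum.cong[OF refl], rule sum.swap)
    also have "\<dots> = (\<Sum>m\<in>I7. \<Sum>p\<in>I7. \<Sum>i\<in>I7. \<Sum>q\<in>I7. \<Sum>j\<in>I7. H p * H q * (ps i j m p * ps i j m q))"
      by (rule sum.cong[OF refl], rule sum.swap)
    also have "\<dots> = (\<Sum>m\<in>I7. \<Sum>p\<in>I7. \<Sum>q\<in>I7. \<Sum>i\<in>I7. \<Sum>j\<in>I7. H p * H q * (ps i j m p * ps i j m q))"
      by (rule sum.cong[OF refl], rule sum.cong[OF refl], rule sum.swap)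
    also have "\<dots> = (\<Sum>p\<in>I7. \<Sum>m\<in>I7. \<Sum>q\<in>I7. \<Sum>i\<in>I7. \<Sum>j\<in>I7. H p * H q * (ps i j m p * ps i j m q))"
      by (rule sum.swap)
    also have "\<dots> = (\<Sum>p\<in>I7. \<Sum>q\<in>I7. \<Sum>m\<in>I7. \<Sum>i\<in>I7. \<Sum>j\<in>I7. H p * H q * (ps i j m p * ps i j m q))"
      by (rule sum.cong[OF refl], rule sum.swap)
    also have "\<dots> = (\<Sum>p\<in>I7. \<Sum>q\<in>I7. 24 * ((H p * H q) * of_bool (p = q)))"
    proof (intro sum.cong refl)
      fix p q assume "p \<in> I7" "q \<in> I7"
      then show "(\<Sum>m\<in>I7. \<Sum>i\<in>I7. \<Sum>j\<in>I7. H p * H q * (ps i j m p * ps i j m q)) = 24 * ((H p * H q) * of_bool (p = q))"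
        unfolding sum_distrib_left[symmetric] by (simp add: ps_norm)
    qed
    also have "\<dots> = (\<Sum>p\<in>I7. 24 * (H p * H p))"
      unfolding sum_distrib_left[symmetric] by (intro arg_cong[where f = "(*) 24"] sum.cong refl sum_I7_delta(2))
    finally show ?thesis unfolding HH_def sum_distrib_left .
  qed
  have "N = S3 (\<lambda>m i j. T i j m * T i j m + (2 / 3) * (T i j m * (\<Sum>l\<in>I7. H l * ps i j m l)) + (1 / 9) * (\<Sum>l\<in>I7. H l * ps i j m l)\<^sup>2)"
    unfolding N_def by (rule S3_cong) (simp only: power2_eq_square, simp add: algebra_simps)
  then have N: "N = TT + (2 / 3) * HW + (24 / 9) * HH"
    unfolding S3_linear a b d by simp
  have PQ': "P - 2 * Q \<ge> 0"
  proof -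
    have "P - 2 * Q = S3 (\<lambda>i j k. (c i j k)\<^sup>2 - 2 * (c i j k * c j k i))"
      unfolding P_def Q_def S3_linear power2_eq_square by simp
    then show ?thesis using PQ unfolding S3_nested by simp
  qed
  have HHn: "HH \<ge> 0"
    unfolding HH_def by (intro sum_nonneg) simp
  show HH0: "HH = 0"
    using main_identity N \<open>N \<ge> 0\<close> PQ' HHn by linarith
  have "H l = 0" if "l \<in> I7" for l
    using HH0 that unfolding HH_def by (subst (asm) sum_nonneg_eq_0_iff) auto
  then have "HW = 0"
    unfolding HW_def by simp
  moreover have "TT \<ge> 0"
    unfolding TT_def S3_nested by (intro sum_nonneg) simp
  ultimately show "TT = 0"
    using main_identity PQ' HH0 by linarith
qed

lemma T_zero:
  assumes "i \<in> I7" "j \<in> I7" "k \<in> I7"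
  shows "T i j k = 0"
proof -
  have "(\<Sum>(i, j, k) \<in> I7 \<times> I7 \<times> I7. T i j k * T i j k) = 0"
    using T_H_zero(1) unfolding TT_def S3_def .
  then have "(case (i, j, k) of (i, j, k) \<Rightarrow> T i j k * T i j k) = 0"
    by (subst (asm) sum_nonneg_eq_0_iff) (use assms in auto)
  then show ?thesis by simp
qed

text \<open>Once T = 0, c is the skew part of \<open>Gam\<close>, so d\<phi> is the alternation of
  \<nabla>\<phi>. The four groups of terms correspond to the direction of differentiation, and each
  vanishes by \<open>ph_derivation_g2\<close>.\<close>

theorem ce3_ph_zero:
  assumes I: "i \<in> I7" "j \<in> I7" "k \<in> I7" "l \<in> I7"
  shows "ce3 c ph i j k l = 0"
proof -
  note D = ph_derivation_g2[of "Gam _", OF Gam_antisym Gam_g2]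
  have "ce3 c ph i j k l =
     - ((\<Sum>m\<in>I7. Gam i j m * ph m k l) + (\<Sum>m\<in>I7. Gam i k m * ph j m l) + (\<Sum>m\<in>I7. Gam i l m * ph j k m))
     + ((\<Sum>m\<in>I7. Gam j i m * ph m k l) + (\<Sum>m\<in>I7. Gam j k m * ph i m l) + (\<Sum>m\<in>I7. Gam j l m * ph i k m))
     - ((\<Sum>m\<in>I7. Gam k i m * ph m j l) + (\<Sum>m\<in>I7. Gam k j m * ph i m l) + (\<Sum>m\<in>I7. Gam k l m * ph i j m))
     + ((\<Sum>m\<in>I7. Gam l i m * ph m j k) + (\<Sum>m\<in>I7. Gam l j m * ph i m k) + (\<Sum>m\<in>I7. Gam l k m * ph i j m))"
    unfolding ce3_def sum.distrib[symmetric] sum_negf[symmetric] sum_subtractf[symmetric]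
  proof (rule sum.cong[OF refl])
    fix m assume m: "m \<in> I7"
    have p: "ph j m l = - ph m j l" "ph j k m = ph m j k" "ph i m l = - ph m i l" "ph i k m = ph m i k" "ph i j m = ph m i j" "ph i m k = - ph m i k"
      using ph_antisym(1)[of m j l] ph_antisym(1)[of m i l] ph_antisym(1)[of m i k] ph_cyc[of m j k] ph_cyc[of m i k] ph_cyc[of m i j] I m by auto
    show "- c i j m * ph m k l + c i k m * ph m j l - c i l m * ph m j k - c j k m * ph m i l + c j l m * ph m i k - c k l m * ph m i j =
     - (Gam i j m * ph m k l + Gam i k m * ph j m l + Gam i l m * ph j k m)
     + (Gam j i m * ph m k l + Gam j k m * ph i m l + Gam j l m * ph i k m)
     - (Gam k i m * ph m j l + Gam k j m * ph i m l + Gam k l m * ph i j m)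
     + (Gam l i m * ph m j k + Gam l j m * ph i m k + Gam l k m * ph i j m)"
      unfolding p c_Gam[of _ _ m] using I m by (simp add: T_zero algebra_simps)
  qed
  then show ?thesis
    using D I by simp
qed

theorem ce4_ps_zero:
  assumes I: "i \<in> I7" "j \<in> I7" "k \<in> I7" "l \<in> I7" "n \<in> I7"
  shows "ce4 c ps i j k l n = 0"
proof -
  note D = ps_derivation_g2[of "Gam _", OF Gam_antisym Gam_g2]
  let ?D = "\<lambda>a b d e f. (\<Sum>m\<in>I7. Gam a b m * ps m d e f) + (\<Sum>m\<in>I7. Gam a d m * ps b m e f)
     + (\<Sum>m\<in>I7. Gam a e m * ps b d m f) + (\<Sum>m\<in>I7. Gam a f m * ps b d e m)"
  have "ce4 c ps i j k l n = - ?D i j k l n + ?D j i k l n - ?D k i j l n + ?D l i j k n - ?D n i j k l"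
    unfolding ce4_def sum.distrib[symmetric] sum_negf[symmetric] sum_subtractf[symmetric]
  proof (rule sum.cong[OF refl])
    fix m assume m: "m \<in> I7"
    have p: "ps x m y z = - ps m x y z" "ps x y m z = ps m x y z" "ps x y z m = - ps m x y z"
      if "x \<in> I7" "y \<in> I7" "z \<in> I7" for x y z
      using ps_perms(6)[of m x y z] ps_perms(8)[of m x y z] ps_perms(9)[of m x y z] that m by blast+
    let ?E = "\<lambda>a b d e f. Gam a b m * ps m d e f + Gam a d m * ps b m e f + Gam a e m * ps b d m f + Gam a f m * ps b d e m"
    show "- c i j m * ps m k l n + c i k m * ps m j l n - c i l m * ps m j k n + c i n m * ps m j k l
     - c j k m * ps m i l n + c j l m * ps m i k n - c j n m * ps m i k l - c k l m * ps m i j n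
     + c k n m * ps m i j l - c l n m * ps m i j k
     = - ?E i j k l n + ?E j i k l n - ?E k i j l n + ?E l i j k n - ?E n i j k l"
      unfolding c_Gam[of _ _ m] using I m by (simp add: T_zero p algebra_simps)
  qed
  then show ?thesis
    using D I by simp
qed

end

section \<open>Alternating forms and the Hodge operator\<close>

text \<open>\<open>alt_form\<close> without the alternation. It is the natural hypothesis for
  expansion in a frame and for the factors of a wedge, which alternates by itself; the first factor
  in \<open>Om\<close> is only multilinear.\<close>

definition multilin :: "nat \<Rightarrow> 'v::real_vector mform \<Rightarrow> bool" where
  "multilin k \<alpha> \<longleftrightarrow> (\<forall>v w. (\<forall>i<k. v i = w i) \<longrightarrow> \<alpha> v = \<alpha> w) \<and> (\<forall>v. \<forall>i<k. linear (\<lambda>x. \<alpha> (v(i := x))))"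

lemma alt_form_multilin: "alt_form k \<alpha> \<Longrightarrow> multilin k \<alpha>"
  by (simp add: alt_form_def multilin_def)

lemma alt_formI:
  assumes "multilin k \<alpha>" "\<And>v i j. i < j \<Longrightarrow> j < k \<Longrightarrow> v i = v j \<Longrightarrow> \<alpha> v = 0"
  shows "alt_form k \<alpha>"
  using assms by (auto simp: alt_form_def multilin_def)

lemma multilin_cong: "multilin k \<alpha> \<Longrightarrow> (\<And>i. i < k \<Longrightarrow> v i = w i) \<Longrightarrow> \<alpha> v = \<alpha> w"
  by (simp add: multilin_def)

lemma multilin_linear: "multilin k \<alpha> \<Longrightarrow> i < k \<Longrightarrow> linear (\<lambda>x. \<alpha> (v(i := x)))"
  by (simp add: multilin_def)

lemma alt_form_eq_0: "alt_form k \<alpha> \<Longrightarrow> i < k \<Longrightarrow> j < k \<Longrightarrow> i \<noteq> j \<Longrightarrow> v i = v j \<Longrightarrow> \<alpha> v = 0"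
  unfolding alt_form_def by (metis nat_neq_iff)

lemma alt_form_transpose:
  assumes a: "alt_form k \<alpha>" and ij: "i < k" "j < k" "i \<noteq> j"
  shows "\<alpha> (v \<circ> Transposition.transpose i j) = - \<alpha> v"
proof -
  let ?f = "\<lambda>x y. \<alpha> (v(i := x, j := y))"
  have l1: "linear (\<lambda>x. ?f x y)" for y
    using multilin_linear[OF alt_form_multilin[OF a] ij(1), of "v(j := y)"] ij(3) by (simp add: fun_upd_twist)
  have l2: "linear (\<lambda>y. ?f x y)" for x
    using multilin_linear[OF alt_form_multilin[OF a] ij(2), of "v(i := x)"] by simp
  have d: "?f x x = 0" for x
    using ij by (intro alt_form_eq_0[OF a ij]) auto
  have "0 = ?f (v i + v j) (v i + v j)"
    by (simp add: d)
  also have "\<dots> = ?f (v i) (v i) + ?f (v i) (v j) + (?f (v j) (v i) + ?f (v j) (v j))"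
    by (simp only: linear_add[OF l1] linear_add[OF l2])
  finally have "?f (v j) (v i) = - ?f (v i) (v j)"
    by (simp add: d del: fun_upd_triv)
  moreover have "v \<circ> Transposition.transpose i j = v(i := v j, j := v i)"
    using ij by (auto simp: fun_eq_iff Transposition.transpose_def)
  ultimately show ?thesis
    by simp
qed

lemma sign_transpose_compose:
  assumes "finite S" "p permutes S" "a \<in> S" "b \<in> S" "a \<noteq> b"
  shows "sign (p \<circ> Transposition.transpose a b) = - sign p"
proof -
  have "permutation p" "permutation (Transposition.transpose a b)"
    using permutes_imp_permutation[OF assms(1,2)] permutation_swap_id by simp_all
  then show ?thesis
    using assms by (simp add: sign_compose sign_swap_id)
qed

text \<open>Stated for a functional that alternates on some index set, rather than for forms,
  because \<open>wedge_1\<close> applies it to the shifted slots 1, ..., l of a sequence.\<close>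

lemma alternating_permute:
  fixes F :: "('a \<Rightarrow> 'b) \<Rightarrow> real"
  assumes F: "\<And>w a b. a \<in> S \<Longrightarrow> b \<in> S \<Longrightarrow> a \<noteq> b \<Longrightarrow> F (w \<circ> Transposition.transpose a b) = - F w"
    and p: "finite S" "p permutes S"
  shows "F (w \<circ> p) = of_int (sign p) * F w"
  using p
proof (induction p rule: permutes_rev_induct)
  case id
  show ?case by simp
next
  case (swap a b p)
  have "F (w \<circ> (p \<circ> Transposition.transpose a b)) = - F (w \<circ> p)"
    using F[OF swap(1-3), of "w \<circ> p"] by (simp add: o_assoc)
  also have "\<dots> = - (of_int (sign p) * F w)"
    by (simp only: \<open>F (w \<circ> p) = of_int (sign p) * F w\<close>)
  also have "\<dots> = of_int (sign (p \<circ> Transposition.transpose a b)) * F w"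
    by (simp only: sign_transpose_compose[OF p(1) \<open>p permutes S\<close> \<open>a \<in> S\<close> \<open>b \<in> S\<close> \<open>a \<noteq> b\<close>] of_int_minus mult_minus_left)
  finally show ?case .
qed

lemma alt_form_permute:
  assumes "alt_form k \<alpha>" "p permutes {..<k}"
  shows "\<alpha> (v \<circ> p) = of_int (sign p) * \<alpha> v"
  by (rule alternating_permute[OF alt_form_transpose[OF assms(1)] _ assms(2)]) auto

lemma sum_PiE_Suc:
  "(\<Sum>s\<in>{..<Suc n} \<rightarrow>\<^sub>E A. f s) = (\<Sum>s\<in>{..<n} \<rightarrow>\<^sub>E A. \<Sum>j\<in>A. f (s(n := j)))"
  unfolding sum.cartesian_product
proof (rule sum.reindex_bij_witness[of _ "\<lambda>(s, j). s(n := j)" "\<lambda>s. (s(n := undefined), s n)"])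
  fix a assume a: "a \<in> {..<Suc n} \<rightarrow>\<^sub>E A"
  show "(case (a(n := undefined), a n) of (s, j) \<Rightarrow> s(n := j)) = a"
    by simp
  show "(a(n := undefined), a n) \<in> ({..<n} \<rightarrow>\<^sub>E A) \<times> A"
    using a by (auto simp: PiE_iff extensional_def)
  show "(case (a(n := undefined), a n) of (s, j) \<Rightarrow> f (s(n := j))) = f a"
    by simp
next
  fix c assume c: "c \<in> ({..<n} \<rightarrow>\<^sub>E A) \<times> A"
  obtain s j where sj: "c = (s, j)" by (cases c)
  have "s n = undefined"
    using c sj by (auto simp: PiE_iff extensional_def)
  then have "s(n := undefined) = s"
    by (auto simp: fun_eq_iff)
  then show "(\<lambda>s. (s(n := undefined), s n)) (case c of (s, j) \<Rightarrow> s(n := j)) = c"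
    using sj by simp
  show "(case c of (s, j) \<Rightarrow> s(n := j)) \<in> {..<Suc n} \<rightarrow>\<^sub>E A"
    using c sj by (auto simp: PiE_iff extensional_def less_Suc_eq)
qed

lemma sum_PiE_0: "(\<Sum>s\<in>{..<0::nat} \<rightarrow>\<^sub>E A. f s) = f (\<lambda>_. undefined)"
  by simp

lemma multilin_wedge:
  assumes a: "multilin k \<alpha>" and b: "multilin l \<beta>"
  shows "multilin (k + l) (wedge k l \<alpha> \<beta>)"
  unfolding multilin_def
proof (intro conjI allI impI)
  fix v w :: "nat \<Rightarrow> 'a" assume vw: "\<forall>i<k + l. v i = w i"
  show "wedge k l \<alpha> \<beta> v = wedge k l \<alpha> \<beta> w"
    unfolding wedge_def
  proof (intro arg_cong2[where f = "(/)"] sum.cong refl)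
    fix \<sigma> assume "\<sigma> \<in> {\<sigma>. \<sigma> permutes {..<k + l}}"
    then have s: "\<sigma> i < k + l" if "i < k + l" for i
      using permutes_in_image[of \<sigma> "{..<k + l}" i] that by auto
    have "\<alpha> (\<lambda>i. v (\<sigma> i)) = \<alpha> (\<lambda>i. w (\<sigma> i))" "\<beta> (\<lambda>i. v (\<sigma> (k + i))) = \<beta> (\<lambda>i. w (\<sigma> (k + i)))"
      using s vw by (auto intro!: multilin_cong[OF a] multilin_cong[OF b])
    then show "of_int (sign \<sigma>) * \<alpha> (\<lambda>i. v (\<sigma> i)) * \<beta> (\<lambda>i. v (\<sigma> (k + i)))
        = of_int (sign \<sigma>) * \<alpha> (\<lambda>i. w (\<sigma> i)) * \<beta> (\<lambda>i. w (\<sigma> (k + i)))" by simp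
  qed
next
  fix v :: "nat \<Rightarrow> 'a" and i assume i: "i < k + l"
  have lin: "linear (\<lambda>x. of_int (sign \<sigma>) * \<alpha> (\<lambda>m. (v(i := x)) (\<sigma> m)) * \<beta> (\<lambda>m. (v(i := x)) (\<sigma> (k + m))))"
    if s: "\<sigma> permutes {..<k + l}" for \<sigma>
  proof -
    obtain j where j: "\<sigma> j = i" "j < k + l"
      using permutes_surj[OF s] permutes_in_image[OF s] i by (metis lessThan_iff surjD)
    have inj: "\<sigma> m = i \<longleftrightarrow> m = j" for m
      using permutes_inj[OF s] j by (auto dest: injD)
    show ?thesis
    proof (cases "j < k")
      case True
      have 1: "(\<lambda>m. (v(i := x)) (\<sigma> m)) = (\<lambda>m. v (\<sigma> m))(j := x)" for x
        using inj j by (auto simp: fun_eq_iff)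
      have 2: "(\<lambda>m. (v(i := x)) (\<sigma> (k + m))) = (\<lambda>m. v (\<sigma> (k + m)))" for x
        using inj True by (auto simp: fun_eq_iff)
      have 3: "(\<lambda>x. of_int (sign \<sigma>) * \<alpha> (\<lambda>m. (v(i := x)) (\<sigma> m)) * \<beta> (\<lambda>m. (v(i := x)) (\<sigma> (k + m))))
        = (\<lambda>x. (of_int (sign \<sigma>) * \<beta> (\<lambda>m. v (\<sigma> (k + m)))) *\<^sub>R \<alpha> ((\<lambda>m. v (\<sigma> m))(j := x)))"
        unfolding 1 2 by (simp only: real_scaleR_def mult_ac)
      show ?thesis
        unfolding 3 by (rule linear_compose_scale_right) (rule multilin_linear[OF a True])
    next
      case False
      then have jk: "j - k < l" using j by simp
      have 1: "(\<lambda>m. (v(i := x)) (\<sigma> (k + m))) = (\<lambda>m. v (\<sigma> (k + m)))(j - k := x)" for x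
        using inj False j by (auto simp: fun_eq_iff)
      have 2: "\<alpha> (\<lambda>m. (v(i := x)) (\<sigma> m)) = \<alpha> (\<lambda>m. v (\<sigma> m))" for x
        by (rule multilin_cong[OF a]) (use inj False in auto)
      have 3: "(\<lambda>x. of_int (sign \<sigma>) * \<alpha> (\<lambda>m. (v(i := x)) (\<sigma> m)) * \<beta> (\<lambda>m. (v(i := x)) (\<sigma> (k + m))))
        = (\<lambda>x. (of_int (sign \<sigma>) * \<alpha> (\<lambda>m. v (\<sigma> m))) *\<^sub>R \<beta> ((\<lambda>m. v (\<sigma> (k + m)))(j - k := x)))"
        unfolding 1 2 by (simp only: real_scaleR_def mult_ac)
      show ?thesis
        unfolding 3 by (rule linear_compose_scale_right) (rule multilin_linear[OF b jk])
    qed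
  qed
  have "linear (\<lambda>x. (1 / (fact k * fact l)) *\<^sub>R (\<Sum>\<sigma> | \<sigma> permutes {..<k + l}. of_int (sign \<sigma>) * \<alpha> (\<lambda>m. (v(i := x)) (\<sigma> m)) * \<beta> (\<lambda>m. (v(i := x)) (\<sigma> (k + m)))))"
    by (intro linear_compose_scale_right linear_compose_sum) (use lin in blast)
  then show "linear (\<lambda>x. wedge k l \<alpha> \<beta> (v(i := x)))"
    unfolding wedge_def by simp
qed

lemma alt_form_wedge:
  assumes a: "multilin k \<alpha>" and b: "multilin l \<beta>"
  shows "alt_form (k + l) (wedge k l \<alpha> \<beta>)"
proof (rule alt_formI[OF multilin_wedge[OF assms]])
  fix v :: "nat \<Rightarrow> 'a" and i j assume ij: "i < j" "j < k + l" "v i = v j"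
  let ?t = "Transposition.transpose i j"
  have t: "?t permutes {..<k + l}"
    using ij by (intro permutes_swap_id) auto
  have vt: "v (?t x) = v x" for x
    using ij by (auto simp: Transposition.transpose_def)
  let ?f = "\<lambda>\<sigma>. real_of_int (sign \<sigma>) * \<alpha> (\<lambda>m. v (\<sigma> m)) * \<beta> (\<lambda>m. v (\<sigma> (k + m)))"
  have "(\<Sum>\<sigma> | \<sigma> permutes {..<k + l}. ?f \<sigma>) = (\<Sum>\<sigma> | \<sigma> permutes {..<k + l}. ?f (?t \<circ> \<sigma>))"
    by (rule setum_permutations_compose_left[OF t])
  also have "\<dots> = (\<Sum>\<sigma> | \<sigma> permutes {..<k + l}. - ?f \<sigma>)"
  proof (intro sum.cong refl)
    fix \<sigma> assume "\<sigma> \<in> {\<sigma>. \<sigma> permutes {..<k + l}}"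
    then have "permutation \<sigma>" "permutation ?t"
      using permutes_imp_permutation[of "{..<k + l}" \<sigma>] permutation_swap_id by simp_all
    then have "sign (?t \<circ> \<sigma>) = - sign \<sigma>"
      using ij by (simp add: sign_compose sign_swap_id)
    then show "?f (?t \<circ> \<sigma>) = - ?f \<sigma>"
      by (simp add: vt)
  qed
  finally have "(\<Sum>\<sigma> | \<sigma> permutes {..<k + l}. ?f \<sigma>) = 0"
    by (simp add: sum_negf)
  then show "wedge k l \<alpha> \<beta> v = 0"
    unfolding wedge_def by simp
qed

text \<open>Every permutation of {0, ..., l} is uniquely a transposition (0 i) composed with a
  permutation fixing 0. The l! permutations of the latter kind contribute equally, which cancels the
  factorial. In the i-th term v 0 takes the slot vacated by v i instead of shifting all entries, so
  every sign with i > 0 is -1.\<close>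

lemma wedge_1:
  assumes a: "multilin 1 \<alpha>" and b: "alt_form l \<beta>"
  shows "wedge 1 l \<alpha> \<beta> v = (\<Sum>i\<le>l. (if i = 0 then 1 else - 1) *
    \<alpha> (\<lambda>m. v i) * \<beta> (\<lambda>m. v (Transposition.transpose 0 i (Suc m))))"
proof -
  let ?S = "{1..l}"
  let ?T = "Transposition.transpose :: nat \<Rightarrow> _"
  let ?f = "\<lambda>\<sigma>. real_of_int (sign \<sigma>) * \<alpha> (\<lambda>m. v (\<sigma> m)) * \<beta> (\<lambda>m. v (\<sigma> (1 + m)))"
  have S: "{..<1 + l} = insert 0 ?S" "0 \<notin> ?S" "finite ?S" "insert 0 ?S = {..l}"
    by auto
  have *: "?f (?T 0 i \<circ> q) = (if i = 0 then 1 else - 1) * \<alpha> (\<lambda>m. v i) * \<beta> (\<lambda>m. v (?T 0 i (Suc m)))"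
    if q: "q permutes ?S" and i: "i \<le> l" for q i
  proof -
    have q0: "q 0 = 0"
      using q permutes_not_in[OF q, of 0] by simp
    have "permutation q" "permutation (?T 0 i)"
      using permutes_imp_permutation[OF S(3) q] permutation_swap_id by simp_all
    then have sg: "sign (?T 0 i \<circ> q) = (if i = 0 then 1 else - 1) * sign q"
      by (simp add: sign_compose sign_swap_id)
    have "\<alpha> (\<lambda>m. v ((?T 0 i \<circ> q) m)) = \<alpha> (\<lambda>m. v i)"
      by (rule multilin_cong[OF a]) (simp add: q0)
    moreover have "\<beta> (\<lambda>m. v ((?T 0 i \<circ> q) (1 + m))) = of_int (sign q) * \<beta> (\<lambda>m. v (?T 0 i (Suc m)))"
    proof -
      let ?F = "\<lambda>w. \<beta> (\<lambda>m. w (Suc m))"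
      have "?F ((v \<circ> ?T 0 i) \<circ> q) = of_int (sign q) * ?F (v \<circ> ?T 0 i)"
      proof (rule alternating_permute[OF _ S(3) q])
        fix w :: "nat \<Rightarrow> 'a" and x y assume xy: "x \<in> ?S" "y \<in> ?S" "x \<noteq> y"
        have "(\<lambda>m. (w \<circ> ?T x y) (Suc m)) = (\<lambda>m. w (Suc m)) \<circ> ?T (x - 1) (y - 1)"
          using xy by (auto simp: fun_eq_iff Transposition.transpose_def)
        then show "\<beta> (\<lambda>m. (w \<circ> ?T x y) (Suc m)) = - \<beta> (\<lambda>m. w (Suc m))"
          using alt_form_transpose[OF b, of "x - 1" "y - 1" "\<lambda>m. w (Suc m)"] xy by auto
      qed
      then show ?thesis by (simp add: o_def plus_1_eq_Suc)
    qed
    moreover have "real_of_int (sign q) * real_of_int (sign q) = 1"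
      by (metis of_int_1 of_int_mult sign_idempotent)
    ultimately show ?thesis
      unfolding sg by simp
  qed
  have "(\<Sum>\<sigma> | \<sigma> permutes {..<1 + l}. ?f \<sigma>) = (\<Sum>i\<in>insert 0 ?S. \<Sum>q | q permutes ?S. ?f (?T 0 i \<circ> q))"
    unfolding S(1) by (rule sum_over_permutations_insert[OF S(3,2)])
  also have "\<dots> = (\<Sum>i\<le>l. fact l * ((if i = 0 then 1 else - 1) * \<alpha> (\<lambda>m. v i) * \<beta> (\<lambda>m. v (?T 0 i (Suc m)))))"
    unfolding S(4)
  proof (rule sum.cong[OF refl])
    fix i assume "i \<in> {..l}"
    then have "(\<Sum>q | q permutes ?S. ?f (?T 0 i \<circ> q)) = (\<Sum>q | q permutes ?S. (if i = 0 then 1 else - 1) * \<alpha> (\<lambda>m. v i) * \<beta> (\<lambda>m. v (?T 0 i (Suc m))))"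
      by (intro sum.cong refl *) auto
    then show "(\<Sum>q | q permutes ?S. ?f (?T 0 i \<circ> q)) = fact l * ((if i = 0 then 1 else - 1) * \<alpha> (\<lambda>m. v i) * \<beta> (\<lambda>m. v (?T 0 i (Suc m))))"
      by (simp only: sum_constant card_permutations[of ?S l] card_atLeastAtMost finite_atLeastAtMost) (simp add: card_permutations)
  qed
  finally show ?thesis
    unfolding wedge_def by (simp add: sum_distrib_left[symmetric])
qed

lemma alt_form_const: "alt_form 0 (\<lambda>v. r)"
  by (simp add: alt_form_def)

lemma multilin_1: "linear f \<Longrightarrow> multilin 1 (\<lambda>v. f (v 0))"
  by (auto simp: multilin_def)

lemma alt_form_wedge_list:
  assumes "\<And>i. i \<in> set is \<Longrightarrow> linear (e i)"
  shows "alt_form (length is) (wedge_list e is)"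
  using assms
proof (induction "is")
  case Nil
  then show ?case by (simp add: alt_form_const)
next
  case (Cons i "is")
  then have "alt_form (1 + length is) (wedge 1 (length is) (\<lambda>v. e i (v 0)) (wedge_list e is))"
    by (intro alt_form_wedge multilin_1 alt_form_multilin) auto
  then show ?case by (simp add: plus_1_eq_Suc)
qed

lemma wedge_list_dual:
  assumes "\<And>i. i \<in> set is \<Longrightarrow> linear (e i)" "distinct is"
    and "\<And>i j. i \<in> set is \<Longrightarrow> j \<in> set is \<Longrightarrow> e i (b j) = of_bool (i = j)"
  shows "wedge_list e is (\<lambda>m. b (is ! m)) = 1"
  using assms
proof (induction "is")
  case Nil
  then show ?case by simp
next
  case (Cons i "is")
  have "wedge_list e (i # is) (\<lambda>m. b ((i # is) ! m)) = (\<Sum>m\<le>length is. (if m = 0 then 1 else - 1) *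
      e i (b ((i # is) ! m)) * wedge_list e is (\<lambda>x. b ((i # is) ! Transposition.transpose 0 m (Suc x))))"
    using Cons by (simp, subst wedge_1) (auto intro!: multilin_1 alt_form_wedge_list)
  also have "\<dots> = (\<Sum>m\<le>length is. if m = 0 then wedge_list e is (\<lambda>x. b (is ! x)) else 0)"
  proof (intro sum.cong refl)
    fix m assume "m \<in> {..length is}"
    then have "e i (b ((i # is) ! m)) = of_bool (m = 0)"
      using Cons.prems by (cases m) (auto simp: nth_Cons')
    then show "(if m = 0 then 1 else - 1) * e i (b ((i # is) ! m)) * wedge_list e is (\<lambda>x. b ((i # is) ! Transposition.transpose 0 m (Suc x)))
       = (if m = 0 then wedge_list e is (\<lambda>x. b (is ! x)) else 0)"
      by (simp add: Transposition.transpose_def)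
  qed
  also have "\<dots> = 1"
    using Cons by simp
  finally show ?case .
qed

section \<open>Dual frames, expansion of multilinear forms, and the volume form\<close>

locale frame =
  fixes e :: "nat \<Rightarrow> real^7 \<Rightarrow> real"
  assumes coframe: "coframe e"
begin

abbreviation "b \<equiv> dual_frame e"

lemma e_linear: "i \<in> I7 \<Longrightarrow> linear (e i)"
  using coframe by (simp add: coframe_def I7_def)

lemma dual_frame_exists: "i \<in> I7 \<Longrightarrow> \<exists>!v. \<forall>j\<in>{1..7}. e j v = (if j = i then 1 else 0)"
proof -
  assume i: "i \<in> I7"
  have "card (UNIV :: 7 set) = card I7"
    by (simp add: I7_def)
  then obtain h :: "7 \<Rightarrow> nat" where h: "bij_betw h UNIV I7"
    using finite_same_card_bij[of "UNIV :: 7 set" I7] by auto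
  define E where "E v = (\<chi> k. e (h k) v)" for v
  have hI: "h k \<in> I7" for k
    using h by (auto simp: bij_betw_def)
  have lin: "linear E"
    unfolding E_def using linear_add[OF e_linear[OF hI]] linear_cmul[OF e_linear[OF hI]]
    by (intro linearI) (simp_all add: vec_eq_iff)
  have hs: "\<exists>k. j = h k" if "j \<in> I7" for j
    using h that by (auto simp: bij_betw_def)
  have z: "v = 0" if "E v = 0" for v
  proof -
    have "e j v = 0" if "j \<in> I7" for j
      using hs[OF that] \<open>E v = 0\<close> by (auto simp: E_def vec_eq_iff)
    then show ?thesis
      using coframe by (simp add: coframe_def I7_def)
  qed
  then have inj: "inj E"
    using linear_injective_0[OF lin] by blast
  then have "surj E"
    using linear_injective_imp_surjective[OF lin] by blast
  then obtain v where v: "E v = (\<chi> k. if h k = i then 1 else 0)"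
    by (metis surjD)
  have "e j v = (if j = i then 1 else 0)" if "j \<in> {1..7}" for j
    using hs[of j] that v by (auto simp: E_def vec_eq_iff I7_def)
  moreover have "w = v" if "\<forall>j\<in>{1..7}. e j w = (if j = i then 1 else 0)" for w
  proof -
    have "E w = E v"
      unfolding v using that hI by (auto simp: E_def vec_eq_iff I7_def)
    then show ?thesis using inj by (simp add: injD)
  qed
  ultimately show ?thesis by blast
qed

lemma e_b: "i \<in> I7 \<Longrightarrow> j \<in> I7 \<Longrightarrow> e j (b i) = of_bool (j = i)"
  using theI'[OF dual_frame_exists[of i]] unfolding dual_frame_def[symmetric] by (simp add: I7_def)

lemma e_sum: "i \<in> I7 \<Longrightarrow> e i (\<Sum>j\<in>I7. f j *\<^sub>R b j) = f i"
  by (simp add: linear_sum[OF e_linear] linear_cmul[OF e_linear] e_b if_distrib[of "\<lambda>x. _ * x"] sum_I7_delta(2) del: sum_mult_of_bool_eq)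

lemma expand: "v = (\<Sum>j\<in>I7. e j v *\<^sub>R b j)"
proof -
  have "e i (v - (\<Sum>j\<in>I7. e j v *\<^sub>R b j)) = 0" if "i \<in> I7" for i
    using that by (simp add: linear_diff[OF e_linear] e_sum)
  then have "v - (\<Sum>j\<in>I7. e j v *\<^sub>R b j) = 0"
    using coframe unfolding coframe_def I7_def by blast
  then show ?thesis by simp
qed

lemma multilin_expand:
  assumes a: "multilin k \<alpha>"
  shows "\<alpha> v = (\<Sum>s\<in>{..<k} \<rightarrow>\<^sub>E I7. (\<Prod>i<k. e (s i) (v i)) * \<alpha> (\<lambda>i. b (s i)))"
proof -
  have main: "\<alpha> v = (\<Sum>s\<in>{..<n} \<rightarrow>\<^sub>E I7. (\<Prod>i<n. e (s i) (v i)) * \<alpha> (\<lambda>i. if i < n then b (s i) else v i))" if "n \<le> k" for n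
    using that
  proof (induction n)
    case 0
    show ?case by simp
  next
    case (Suc n)
    have "\<alpha> v = (\<Sum>s\<in>{..<n} \<rightarrow>\<^sub>E I7. (\<Prod>i<n. e (s i) (v i)) * \<alpha> (\<lambda>i. if i < n then b (s i) else v i))"
      using Suc by simp
    also have "\<dots> = (\<Sum>s\<in>{..<n} \<rightarrow>\<^sub>E I7. \<Sum>j\<in>I7. (\<Prod>i<n. e (s i) (v i)) * e j (v n) * \<alpha> (\<lambda>i. if i < Suc n then b ((s(n := j)) i) else v i))"
    proof (rule sum.cong[OF refl])
      fix s
      let ?w = "\<lambda>i. if i < n then b (s i) else v i"
      have l: "linear (\<lambda>x. \<alpha> (?w(n := x)))"
        using Suc by (intro multilin_linear[OF a]) simp
      have "\<alpha> ?w = \<alpha> (?w(n := v n))"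
        by (rule arg_cong[where f = \<alpha>]) auto
      also have "\<dots> = \<alpha> (?w(n := (\<Sum>j\<in>I7. e j (v n) *\<^sub>R b j)))"
        using expand[of "v n"] by simp
      also have "\<dots> = (\<Sum>j\<in>I7. e j (v n) * \<alpha> (?w(n := b j)))"
        using linear_sum[OF l, of "\<lambda>j. e j (v n) *\<^sub>R b j" I7] by (simp add: linear_cmul[OF l])
      finally have 1: "\<alpha> ?w = (\<Sum>j\<in>I7. e j (v n) * \<alpha> (?w(n := b j)))" .
      have 2: "?w(n := b j) = (\<lambda>i. if i < Suc n then b ((s(n := j)) i) else v i)" for j
        by auto
      show "(\<Prod>i<n. e (s i) (v i)) * \<alpha> ?w = (\<Sum>j\<in>I7. (\<Prod>i<n. e (s i) (v i)) * e j (v n) * \<alpha> (\<lambda>i. if i < Suc n then b ((s(n := j)) i) else v i))"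
        unfolding 1 2 by (simp add: sum_distrib_left mult.assoc)
    qed
    also have "\<dots> = (\<Sum>s\<in>{..<Suc n} \<rightarrow>\<^sub>E I7. (\<Prod>i<Suc n. e (s i) (v i)) * \<alpha> (\<lambda>i. if i < Suc n then b (s i) else v i))"
      unfolding sum_PiE_Suc by simp
    finally show ?case .
  qed
  have "\<alpha> (\<lambda>i. if i < k then b (s i) else v i) = \<alpha> (\<lambda>i. b (s i))" for s
    by (rule multilin_cong[OF a]) simp
  then show ?thesis
    using main[OF order_refl] by (simp only:)
qed

lemma multilin_eqI:
  assumes "multilin k \<alpha>" "multilin k \<beta>"
    and "\<And>s. (\<And>i. i < k \<Longrightarrow> s i \<in> I7) \<Longrightarrow> \<alpha> (\<lambda>i. b (s i)) = \<beta> (\<lambda>i. b (s i))"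
  shows "\<alpha> = \<beta>"
proof
  fix v
  have "\<alpha> (\<lambda>i. b (s i)) = \<beta> (\<lambda>i. b (s i))" if "s \<in> {..<k} \<rightarrow>\<^sub>E I7" for s
    using that by (intro assms(3)) (auto simp: PiE_iff)
  then show "\<alpha> v = \<beta> v"
    unfolding multilin_expand[OF assms(1), of v] multilin_expand[OF assms(2), of v] by (intro sum.cong refl) simp
qed

definition "vol = wedge_list e [1,2,3,4,5,6,7]"

lemma set_7: "set [1,2,3,4,5,6,7] = I7"
  by (simp add: I7_eq)

lemma alt_form_vol: "alt_form 7 vol"
proof -
  have "alt_form (length [1,2,3,4,5,6,7::nat]) vol"
    unfolding vol_def by (rule alt_form_wedge_list) (simp only: set_7 e_linear)
  then show ?thesis by (simp add: numeral_eq_Suc)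
qed

text \<open>Argument slots are counted from 0 and frame vectors from 1, hence the shift by
  \<open>Suc\<close>.\<close>

lemma vol_b: "vol (\<lambda>m. b (Suc m)) = 1"
proof -
  have "vol (\<lambda>m. b (Suc m)) = vol (\<lambda>m. b ([1,2,3,4,5,6,7] ! m))"
  proof (rule multilin_cong[OF alt_form_multilin[OF alt_form_vol]])
    fix i :: nat assume "i < 7"
    then have "i \<in> {0, 1, 2, 3, 4, 5, 6}" by auto
    then show "b (Suc i) = b ([1,2,3,4,5,6,7] ! i)" by (auto simp: numeral_eq_Suc One_nat_def)
  qed
  also have "\<dots> = 1"
    unfolding vol_def by (rule wedge_list_dual) (simp_all only: set_7 e_linear e_b, simp)
  finally show ?thesis .
qed

end

section \<open>Linear combinations of forms, and signs of sorted argument lists\<close>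

lemma multilinI:
  assumes "\<And>v w. (\<And>i. i < k \<Longrightarrow> v i = w i) \<Longrightarrow> \<alpha> v = \<alpha> w" "\<And>v i. i < k \<Longrightarrow> linear (\<lambda>x. \<alpha> (v(i := x)))"
  shows "multilin k \<alpha>"
  using assms unfolding multilin_def by blast

lemma multilin_add:
  assumes "multilin k \<alpha>" "multilin k \<beta>"
  shows "multilin k (\<lambda>v. \<alpha> v + \<beta> v)"
proof (rule multilinI)
  fix v w :: "nat \<Rightarrow> 'a" assume "\<And>i. i < k \<Longrightarrow> v i = w i"
  then show "\<alpha> v + \<beta> v = \<alpha> w + \<beta> w"
    using multilin_cong[OF assms(1), of v w] multilin_cong[OF assms(2), of v w] by simp
next
  fix v :: "nat \<Rightarrow> 'a" and i assume "i < k"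
  then show "linear (\<lambda>x. \<alpha> (v(i := x)) + \<beta> (v(i := x)))"
    by (intro linear_compose_add multilin_linear[OF assms(1)] multilin_linear[OF assms(2)])
qed

lemma multilin_diff:
  assumes "multilin k \<alpha>" "multilin k \<beta>"
  shows "multilin k (\<lambda>v. \<alpha> v - \<beta> v)"
proof (rule multilinI)
  fix v w :: "nat \<Rightarrow> 'a" assume "\<And>i. i < k \<Longrightarrow> v i = w i"
  then show "\<alpha> v - \<beta> v = \<alpha> w - \<beta> w"
    using multilin_cong[OF assms(1), of v w] multilin_cong[OF assms(2), of v w] by simp
next
  fix v :: "nat \<Rightarrow> 'a" and i assume "i < k"
  then show "linear (\<lambda>x. \<alpha> (v(i := x)) - \<beta> (v(i := x)))"
    by (intro linear_compose_sub multilin_linear[OF assms(1)] multilin_linear[OF assms(2)])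
qed

lemma multilin_cmult:
  assumes "multilin k \<alpha>"
  shows "multilin k (\<lambda>v. r * \<alpha> v)"
proof (rule multilinI)
  fix v w :: "nat \<Rightarrow> 'a" assume "\<And>i. i < k \<Longrightarrow> v i = w i"
  then show "r * \<alpha> v = r * \<alpha> w"
    using multilin_cong[OF assms, of v w] by simp
next
  fix v :: "nat \<Rightarrow> 'a" and i assume "i < k"
  then show "linear (\<lambda>x. r * \<alpha> (v(i := x)))"
    using linear_compose_scale_right[OF multilin_linear[OF assms], of i r v] by simp
qed

lemma alt_form_add:
  assumes "alt_form k \<alpha>" "alt_form k \<beta>"
  shows "alt_form k (\<lambda>v. \<alpha> v + \<beta> v)"
proof (rule alt_formI[OF multilin_add[OF assms[THEN alt_form_multilin]]])
  fix v :: "nat \<Rightarrow> 'a" and i j assume "i < j" "j < k" "v i = v j"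
  then have "\<alpha> v = 0" "\<beta> v = 0"
    using assms[THEN alt_form_eq_0, of i j v] by auto
  then show "\<alpha> v + \<beta> v = 0" by simp
qed

lemma alt_form_diff:
  assumes "alt_form k \<alpha>" "alt_form k \<beta>"
  shows "alt_form k (\<lambda>v. \<alpha> v - \<beta> v)"
proof (rule alt_formI[OF multilin_diff[OF assms[THEN alt_form_multilin]]])
  fix v :: "nat \<Rightarrow> 'a" and i j assume "i < j" "j < k" "v i = v j"
  then have "\<alpha> v = 0" "\<beta> v = 0"
    using assms[THEN alt_form_eq_0, of i j v] by auto
  then show "\<alpha> v - \<beta> v = 0" by simp
qed

lemma alt_form_cmult:
  assumes "alt_form k \<alpha>"
  shows "alt_form k (\<lambda>v. r * \<alpha> v)"
proof (rule alt_formI[OF multilin_cmult[OF assms[THEN alt_form_multilin]]])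
  fix v :: "nat \<Rightarrow> 'a" and i j assume "i < j" "j < k" "v i = v j"
  then have "\<alpha> v = 0"
    using assms[THEN alt_form_eq_0, of i j v] by auto
  then show "r * \<alpha> v = 0" by simp
qed

text \<open>Insertion moves x past exactly the entries smaller than x, with one change of sign each.
  The prefix \<open>pre\<close> carries the part of the list that has been passed, so that the swap
  hypothesis always concerns full lists of length n.\<close>

lemma alternating_insort:
  fixes G :: "nat list \<Rightarrow> real"
  assumes sw: "\<And>pre x y post. length (pre @ x # y # post) = n \<Longrightarrow> G (pre @ x # y # post) = - G (pre @ y # x # post)"
  shows "sorted ys \<Longrightarrow> x \<notin> set ys \<Longrightarrow> length (pre @ x # ys) = n \<Longrightarrow>
    G (pre @ x # ys) = (if even (length (filter (\<lambda>y. y < x) ys)) then 1 else - 1) * G (pre @ insort x ys)"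
proof (induction ys arbitrary: pre)
  case Nil
  then show ?case by simp
next
  case (Cons y ys)
  show ?case
  proof (cases "x \<le> y")
    case True
    then have "filter (\<lambda>y. y < x) (y # ys) = []"
      using Cons.prems(1) by (auto simp: filter_empty_conv)
    then show ?thesis
      using True by simp
  next
    case False
    have "G (pre @ x # y # ys) = - G ((pre @ [y]) @ x # ys)"
      using sw[of pre x y ys] Cons.prems by simp
    then show ?thesis
      using Cons.IH[of "pre @ [y]"] Cons.prems False by simp
  qed
qed

lemma alternating_sort:
  fixes G :: "nat list \<Rightarrow> real"
  assumes sw: "\<And>pre x y post. length (pre @ x # y # post) = n \<Longrightarrow> G (pre @ x # y # post) = - G (pre @ y # x # post)"
  shows "distinct xs \<Longrightarrow> length (pre @ xs) = n \<Longrightarrow> G (pre @ xs) = list_sign xs * G (pre @ sort xs)"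
proof (induction xs arbitrary: pre)
  case Nil
  then show ?case by simp
next
  case (Cons x xs)
  have "length (filter (\<lambda>y. y < x) (sort xs)) = length (filter (\<lambda>y. y < x) xs)"
    by (metis filter_sort length_sort)
  then show ?case
    using Cons alternating_insort[where G = G and n = n and ys = "sort xs" and x = x and pre = pre, OF sw] Cons.IH[of "pre @ [x]"] by simp
qed

lemma alt_form_list_swap:
  assumes "alt_form n F" "length (pre @ x # y # post) = n"
  shows "F (\<lambda>i. b ((pre @ x # y # post) ! i)) = - F (\<lambda>i. b ((pre @ y # x # post) ! i))"
proof -
  let ?p = "length pre"
  have "F (\<lambda>i. b ((pre @ x # y # post) ! i)) = F ((\<lambda>i. b ((pre @ y # x # post) ! i)) \<circ> Transposition.transpose ?p (Suc ?p))"
  proof (rule multilin_cong[OF alt_form_multilin[OF assms(1)]])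
    fix i
    consider "i < ?p" | "i = ?p" | "i = Suc ?p" | "Suc ?p < i" by linarith
    then have "(pre @ x # y # post) ! i = (pre @ y # x # post) ! (Transposition.transpose ?p (Suc ?p) i)"
      by cases (auto simp: nth_append nth_Cons' Transposition.transpose_def)
    then show "b ((pre @ x # y # post) ! i) = ((\<lambda>i. b ((pre @ y # x # post) ! i)) \<circ> Transposition.transpose ?p (Suc ?p)) i"
      by simp
  qed
  also have "\<dots> = - F (\<lambda>i. b ((pre @ y # x # post) ! i))"
    using assms by (intro alt_form_transpose) auto
  finally show ?thesis .
qed

lemma alt_form_sort:
  assumes "alt_form (length xs) F" "distinct xs"
  shows "F (\<lambda>i. b (xs ! i)) = list_sign xs * F (\<lambda>i. b (sort xs ! i))"
  using alternating_sort[where G = "\<lambda>xs. F (\<lambda>i. b (xs ! i))" and n = "length xs" and xs = xs and pre = "[]", OF alt_form_list_swap[OF assms(1)]] assms(2) by simp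

section \<open>The Hodge operator on frame vectors\<close>

context frame
begin

lemma vol_list:
  assumes "distinct xs" "set xs = I7"
  shows "vol (\<lambda>i. b (xs ! i)) = list_sign xs"
proof -
  have len: "length xs = 7"
    using distinct_card[OF assms(1)] assms(2) by (simp add: I7_def)
  have "sort xs = [1,2,3,4,5,6,7]"
    using assms by (intro sorted_distinct_set_unique) (auto simp: I7_eq)
  moreover have "vol (\<lambda>i. b ([1,2,3,4,5,6,7] ! i)) = 1"
    unfolding vol_def by (rule wedge_list_dual) (simp_all only: set_7 e_linear e_b, simp)
  ultimately show ?thesis
    using alt_form_sort[of xs vol b] alt_form_vol assms(1) len by simp
qed

lemma hodge_eq: "hodge e k \<alpha> v = (\<Sum>s \<in> {..<k} \<rightarrow>\<^sub>E I7. \<alpha> (\<lambda>i. b (s i)) * vol (\<lambda>i. if i < k then b (s i) else v (i - k))) / fact k"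
  unfolding hodge_def vol_def I7_def ..

lemma hodge_cong:
  assumes "\<And>i. i < 7 - k \<Longrightarrow> v i = w i"
  shows "hodge e k \<alpha> v = hodge e k \<alpha> w"
proof -
  have "vol (\<lambda>i. if i < k then b (s i) else v (i - k)) = vol (\<lambda>i. if i < k then b (s i) else w (i - k))" for s
    using assms by (intro multilin_cong[OF alt_form_multilin[OF alt_form_vol]]) auto
  then show ?thesis
    by (simp add: hodge_eq)
qed

lemma alt_form_hodge: "alt_form (7 - k) (hodge e k \<alpha>)"
proof (rule alt_formI)
  show "multilin (7 - k) (hodge e k \<alpha>)"
    unfolding multilin_def
  proof (intro conjI allI impI)
    fix v :: "nat \<Rightarrow> real^7" and i assume i: "i < 7 - k"
    have "linear (\<lambda>x. (1 / fact k) *\<^sub>R (\<Sum>s \<in> {..<k} \<rightarrow>\<^sub>E I7. \<alpha> (\<lambda>i. b (s i)) *\<^sub>R vol ((\<lambda>m. if m < k then b (s m) else v (m - k))(i + k := x))))"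
      using i by (intro linear_compose_scale_right linear_compose_sum ballI multilin_linear[OF alt_form_multilin[OF alt_form_vol]]) auto
    moreover have "(\<lambda>m. if m < k then b (s m) else (v(i := x)) (m - k)) = (\<lambda>m. if m < k then b (s m) else v (m - k))(i + k := x)" for s x
      by (auto simp: fun_eq_iff)
    ultimately show "linear (\<lambda>x. hodge e k \<alpha> (v(i := x)))"
      unfolding hodge_eq by simp
  qed (rule hodge_cong, simp)
  fix v :: "nat \<Rightarrow> real^7" and i j assume ij: "i < j" "j < 7 - k" "v i = v j"
  have "vol (\<lambda>m. if m < k then b (s m) else v (m - k)) = 0" for s
    using ij by (intro alt_form_eq_0[OF alt_form_vol, of "i + k" "j + k"]) auto
  then show "hodge e k \<alpha> v = 0"
    by (simp add: hodge_eq)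
qed

text \<open>With u prescribed on the slots from k on, a summand survives only if s completes it to
  an injection into \<open>I7\<close>. Then s has the same values as u on the first k slots in
  another order. For k = 7 this turns a sum over all index functions into a sum over
  permutations.\<close>

lemma sum_bij_functions:
  assumes u: "bij_betw u {..<7::nat} I7" and k: "k \<le> 7"
    and z: "\<And>s i j. s \<in> {..<k} \<rightarrow>\<^sub>E I7 \<Longrightarrow> i < j \<Longrightarrow> j < 7 \<Longrightarrow>
      (if i < k then s i else u i) = (if j < k then s j else u j) \<Longrightarrow> F s = 0"
  shows "(\<Sum>s \<in> {..<k} \<rightarrow>\<^sub>E I7. F s) = (\<Sum>\<tau> | \<tau> permutes {..<k}. F (restrict (u \<circ> \<tau>) {..<k}))"
proof -
  let ?h = "\<lambda>\<tau>. restrict (u \<circ> \<tau>) {..<k}"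
  let ?P = "{\<tau>. \<tau> permutes {..<k}}"
  have ui: "u i = u j \<longleftrightarrow> i = j" if "i < 7" "j < 7" for i j
    using u that by (auto simp: bij_betw_def inj_on_def)
  have uI: "u i \<in> I7" if "i < 7" for i
    using u that by (auto simp: bij_betw_def)
  have tk: "\<tau> i < k" if "\<tau> permutes {..<k}" "i < k" for \<tau> i
    using permutes_in_image[OF that(1), of i] that(2) by simp
  have sub: "?h ` ?P \<subseteq> {..<k} \<rightarrow>\<^sub>E I7"
  proof (clarify, rule PiE_I)
    fix \<tau> i assume "\<tau> permutes {..<k}" "i \<in> {..<k}"
    then show "?h \<tau> i \<in> I7"
      using tk[of \<tau> i] uI[of "\<tau> i"] k by simp
  qed simp
  have "F s = 0" if s: "s \<in> ({..<k} \<rightarrow>\<^sub>E I7) - ?h ` ?P" for s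
  proof (rule ccontr)
    assume nz: "F s \<noteq> 0"
    have sI: "s i \<in> I7" if "i < k" for i
      using s that by (auto simp: PiE_iff)
    let ?w = "\<lambda>i. if i < k then s i else u i"
    have winj: "?w i \<noteq> ?w j" if "i < j" "j < 7" for i j
      using z[of s i j] s nz that by auto
    define g where "g = inv_into {..<7} u"
    have g: "g x < 7" "u (g x) = x" if "x \<in> I7" for x
    proof -
      have "x \<in> u ` {..<7}"
        using u that by (simp add: bij_betw_def)
      then show "g x < 7" "u (g x) = x"
        using inv_into_into[of x u "{..<7}"] f_inv_into_f[of x u "{..<7}"] by (simp_all add: g_def)
    qed
    define \<tau> where "\<tau> = (\<lambda>i. if i < k then g (s i) else i)"
    have ran: "g (s i) < k" if i: "i < k" for i
    proof (rule ccontr)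
      assume "\<not> g (s i) < k"
      then show False
        using winj[of i "g (s i)"] g[OF sI[OF i]] i by (metis leI less_le_trans)
    qed
    have "inj_on \<tau> {..<k}"
    proof (rule inj_onI)
      fix i j assume ij: "i \<in> {..<k}" "j \<in> {..<k}" "\<tau> i = \<tau> j"
      then have "s i = s j"
        using g(2)[OF sI[of i]] g(2)[OF sI[of j]] unfolding \<tau>_def by (metis lessThan_iff)
      then show "i = j"
        using winj[of i j] winj[of j i] ij k by (metis lessThan_iff less_le_trans nat_neq_iff)
    qed
    moreover have "\<tau> ` {..<k} \<subseteq> {..<k}"
      using ran by (auto simp: \<tau>_def)
    ultimately have "bij_betw \<tau> {..<k} {..<k}"
      by (simp add: bij_betw_def endo_inj_surj)
    then have "\<tau> permutes {..<k}"
      by (rule bij_imp_permutes) (simp add: \<tau>_def)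
    moreover have "s = ?h \<tau>"
    proof
      fix i show "s i = ?h \<tau> i"
        using s g(2)[OF sI, of i] by (cases "i < k") (auto simp: \<tau>_def PiE_iff extensional_def)
    qed
    ultimately show False using s by blast
  qed
  then have "(\<Sum>s \<in> {..<k} \<rightarrow>\<^sub>E I7. F s) = (\<Sum>s \<in> ?h ` ?P. F s)"
    by (intro sum.mono_neutral_right sub finite_PiE) auto
  also have "\<dots> = (\<Sum>\<tau>\<in>?P. F (?h \<tau>))"
  proof (rule sum.reindex_cong[OF _ refl refl])
    show "inj_on ?h ?P"
    proof (rule inj_onI, rule ext)
      fix \<tau> \<tau>' i assume t: "\<tau> \<in> ?P" "\<tau>' \<in> ?P" "?h \<tau> = ?h \<tau>'"
      show "\<tau> i = \<tau>' i"
      proof (cases "i < k")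
        case True
        then have "u (\<tau> i) = u (\<tau>' i)"
          using fun_cong[OF t(3), of i] by simp
        then show ?thesis
          using ui[of "\<tau> i" "\<tau>' i"] tk[of \<tau> i] tk[of \<tau>' i] True t k by simp
      next
        case False
        then show ?thesis
          using t permutes_not_in[of \<tau> "{..<k}" i] permutes_not_in[of \<tau>' "{..<k}" i] by simp
      qed
    qed
  qed
  finally show ?thesis .
qed

text \<open>Reordering the first k frame vectors changes \<alpha> and \<open>vol\<close> by the same
  sign, so the k! surviving terms of the definition are equal and cancel its denominator.\<close>

lemma hodge_bij:
  assumes u: "bij_betw u {..<7} I7" and k: "k \<le> 7" and a: "alt_form k \<alpha>"
  shows "hodge e k \<alpha> (\<lambda>i. b (u (i + k))) = \<alpha> (\<lambda>i. b (u i)) * vol (\<lambda>i. b (u i))"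
proof -
  let ?F = "\<lambda>s. \<alpha> (\<lambda>i. b (s i)) * vol (\<lambda>i. if i < k then b (s i) else b (u (i - k + k)))"
  have "(\<Sum>s \<in> {..<k} \<rightarrow>\<^sub>E I7. ?F s) = (\<Sum>\<tau> | \<tau> permutes {..<k}. ?F (restrict (u \<circ> \<tau>) {..<k}))"
  proof (rule sum_bij_functions[OF u k])
    fix s i j assume "i < j" "j < (7::nat)" "(if i < k then s i else u i) = (if j < k then s j else u j)"
    then have "vol (\<lambda>i. if i < k then b (s i) else b (u (i - k + k))) = 0"
      by (intro alt_form_eq_0[OF alt_form_vol, of i j]) (auto split: if_splits)
    then show "?F s = 0" by simp
  qed
  also have "\<dots> = (\<Sum>\<tau> | \<tau> permutes {..<k}. \<alpha> (\<lambda>i. b (u i)) * vol (\<lambda>i. b (u i)))"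
  proof (rule sum.cong[OF refl])
    fix \<tau> assume "\<tau> \<in> {\<tau>. \<tau> permutes {..<k}}"
    then have t: "\<tau> permutes {..<k}" by simp
    then have t7: "\<tau> permutes {..<7}"
      using k by (intro permutes_subset[OF t]) auto
    have "\<alpha> (\<lambda>i. b (restrict (u \<circ> \<tau>) {..<k} i)) = \<alpha> ((\<lambda>i. b (u i)) \<circ> \<tau>)"
      by (rule multilin_cong[OF alt_form_multilin[OF a]]) simp
    moreover have "vol (\<lambda>i. if i < k then b (restrict (u \<circ> \<tau>) {..<k} i) else b (u (i - k + k))) = vol ((\<lambda>i. b (u i)) \<circ> \<tau>)"
      using permutes_not_in[OF t] by (intro arg_cong[where f = vol]) (auto simp: fun_eq_iff)
    moreover have "real_of_int (sign \<tau>) * real_of_int (sign \<tau>) = 1"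
      by (metis of_int_1 of_int_mult sign_idempotent)
    ultimately show "?F (restrict (u \<circ> \<tau>) {..<k}) = \<alpha> (\<lambda>i. b (u i)) * vol (\<lambda>i. b (u i))"
      by (simp only: alt_form_permute[OF a t] alt_form_permute[OF alt_form_vol t7]) (simp add: algebra_simps)
  qed
  finally show ?thesis
    unfolding hodge_eq by (simp add: card_permutations)
qed

lemma bij_nth_I7:
  assumes "distinct xs" "set xs = I7"
  shows "bij_betw ((!) xs) {..<7} I7"
proof -
  have "length xs = 7"
    using distinct_card[OF assms(1)] assms(2) by (simp add: I7_def)
  then show ?thesis
    using bij_betw_nth[OF assms(1), of "{..<7}" I7] assms by auto
qed

lemma hodge_list:
  assumes "distinct (xs @ ys)" "set (xs @ ys) = I7" "alt_form (length xs) \<alpha>"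
  shows "hodge e (length xs) \<alpha> (\<lambda>i. b (ys ! i)) = list_sign (xs @ ys) * \<alpha> (\<lambda>i. b (xs ! i))"
proof -
  have len: "length xs + length ys = 7"
    using distinct_card[OF assms(1)] assms(2) by (simp add: I7_def)
  have "hodge e (length xs) \<alpha> (\<lambda>i. b (ys ! i)) = hodge e (length xs) \<alpha> (\<lambda>i. b ((xs @ ys) ! (i + length xs)))"
    by (rule hodge_cong) (simp add: nth_append)
  also have "\<dots> = \<alpha> (\<lambda>i. b ((xs @ ys) ! i)) * vol (\<lambda>i. b ((xs @ ys) ! i))"
    using len by (intro hodge_bij[OF bij_nth_I7[OF assms(1,2)] _ assms(3)]) simp
  also have "\<alpha> (\<lambda>i. b ((xs @ ys) ! i)) = \<alpha> (\<lambda>i. b (xs ! i))"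
    by (rule multilin_cong[OF alt_form_multilin[OF assms(3)]]) (simp add: nth_append)
  finally show ?thesis
    by (simp add: vol_list[OF assms(1,2)])
qed

end

section \<open>Wedge products of low degree and the coefficients of the model forms\<close>

lemma multilin_list:
  assumes "multilin k \<alpha>" "length xs = k" "\<And>i. i < k \<Longrightarrow> v i = xs ! i"
  shows "\<alpha> v = \<alpha> ((!) xs)"
  using assms by (intro multilin_cong[OF assms(1)]) auto

lemma less_numerals:
  "i < (2::nat) \<longleftrightarrow> i = 0 \<or> i = 1" "i < (3::nat) \<longleftrightarrow> i = 0 \<or> i = 1 \<or> i = 2"
  "i < (4::nat) \<longleftrightarrow> i = 0 \<or> i = 1 \<or> i = 2 \<or> i = 3" "i < (1::nat) \<longleftrightarrow> i = 0"
  "i < (5::nat) \<longleftrightarrow> i = 0 \<or> i = 1 \<or> i = 2 \<or> i = 3 \<or> i = 4"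
  by auto

lemma sum_atMost_numerals:
  "(\<Sum>i\<le>1::nat. f i) = f 0 + f 1" "(\<Sum>i\<le>2::nat. f i) = f 0 + f 1 + f 2"
  "(\<Sum>i\<le>3::nat. f i) = f 0 + f 1 + f 2 + f 3" "(\<Sum>i\<le>4::nat. f i) = f 0 + f 1 + f 2 + f 3 + f 4"
  by (simp_all add: numeral_eq_Suc One_nat_def)

lemma Suc_numerals: "Suc 0 = 1" "Suc 1 = 2" "Suc 2 = 3" "Suc 3 = 4" "Suc 4 = 5"
  by simp_all

lemma wedge_1_1:
  assumes "linear f" "linear g"
  shows "wedge 1 1 (\<lambda>v. f (v 0)) (\<lambda>v. g (v 0)) v = f (v 0) * g (v 1) - f (v 1) * g (v 0)"
proof -
  have "alt_form 1 (\<lambda>v. g (v 0))"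
    using multilin_1[OF assms(2)] by (rule alt_formI) auto
  then show ?thesis
    by (subst wedge_1[OF multilin_1[OF assms(1)]])
      (simp_all add: sum_atMost_numerals Transposition.transpose_def Suc_numerals)
qed

lemma wedge_1_2:
  assumes "linear f" "alt_form 2 \<beta>"
  shows "wedge 1 2 (\<lambda>v. f (v 0)) \<beta> v = f (v 0) * \<beta> ((!) [v 1, v 2]) - f (v 1) * \<beta> ((!) [v 0, v 2]) - f (v 2) * \<beta> ((!) [v 1, v 0])"
proof -
  have "\<beta> (\<lambda>m. v (Transposition.transpose 0 0 (Suc m))) = \<beta> ((!) [v 1, v 2])"
    "\<beta> (\<lambda>m. v (Transposition.transpose 0 1 (Suc m))) = \<beta> ((!) [v 0, v 2])"
    "\<beta> (\<lambda>m. v (Transposition.transpose 0 2 (Suc m))) = \<beta> ((!) [v 1, v 0])"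
    by (rule multilin_list[OF alt_form_multilin[OF assms(2)]]; auto simp: less_numerals Transposition.transpose_def Suc_numerals)+
  then show ?thesis
    by (subst wedge_1[OF multilin_1[OF assms(1)] assms(2)]) (simp add: sum_atMost_numerals)
qed

lemma wedge_1_3:
  assumes "linear f" "alt_form 3 \<beta>"
  shows "wedge 1 3 (\<lambda>v. f (v 0)) \<beta> v = f (v 0) * \<beta> ((!) [v 1, v 2, v 3]) - f (v 1) * \<beta> ((!) [v 0, v 2, v 3])
    - f (v 2) * \<beta> ((!) [v 1, v 0, v 3]) - f (v 3) * \<beta> ((!) [v 1, v 2, v 0])"
proof -
  have "\<beta> (\<lambda>m. v (Transposition.transpose 0 0 (Suc m))) = \<beta> ((!) [v 1, v 2, v 3])"
    "\<beta> (\<lambda>m. v (Transposition.transpose 0 1 (Suc m))) = \<beta> ((!) [v 0, v 2, v 3])"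
    "\<beta> (\<lambda>m. v (Transposition.transpose 0 2 (Suc m))) = \<beta> ((!) [v 1, v 0, v 3])"
    "\<beta> (\<lambda>m. v (Transposition.transpose 0 3 (Suc m))) = \<beta> ((!) [v 1, v 2, v 0])"
    by (rule multilin_list[OF alt_form_multilin[OF assms(2)]]; auto simp: less_numerals Transposition.transpose_def Suc_numerals)+
  then show ?thesis
    by (subst wedge_1[OF multilin_1[OF assms(1)] assms(2)]) (simp add: sum_atMost_numerals)
qed

lemma wedge_1_4:
  assumes "linear f" "alt_form 4 \<beta>"
  shows "wedge 1 4 (\<lambda>v. f (v 0)) \<beta> v = f (v 0) * \<beta> ((!) [v 1, v 2, v 3, v 4]) - f (v 1) * \<beta> ((!) [v 0, v 2, v 3, v 4])
    - f (v 2) * \<beta> ((!) [v 1, v 0, v 3, v 4]) - f (v 3) * \<beta> ((!) [v 1, v 2, v 0, v 4]) - f (v 4) * \<beta> ((!) [v 1, v 2, v 3, v 0])"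
proof -
  have "\<beta> (\<lambda>m. v (Transposition.transpose 0 0 (Suc m))) = \<beta> ((!) [v 1, v 2, v 3, v 4])"
    "\<beta> (\<lambda>m. v (Transposition.transpose 0 1 (Suc m))) = \<beta> ((!) [v 0, v 2, v 3, v 4])"
    "\<beta> (\<lambda>m. v (Transposition.transpose 0 2 (Suc m))) = \<beta> ((!) [v 1, v 0, v 3, v 4])"
    "\<beta> (\<lambda>m. v (Transposition.transpose 0 3 (Suc m))) = \<beta> ((!) [v 1, v 2, v 0, v 4])"
    "\<beta> (\<lambda>m. v (Transposition.transpose 0 4 (Suc m))) = \<beta> ((!) [v 1, v 2, v 3, v 0])"
    by (rule multilin_list[OF alt_form_multilin[OF assms(2)]]; auto simp: less_numerals Transposition.transpose_def Suc_numerals)+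
  then show ?thesis
    by (subst wedge_1[OF multilin_1[OF assms(1)] assms(2)]) (simp add: sum_atMost_numerals)
qed

lemma wedge_list_1:
  assumes "linear (e i)"
  shows "wedge_list e [i] = (\<lambda>v. e i (v 0))"
  by (rule ext) (use wedge_1[OF multilin_1[OF assms] alt_form_const[of 1]] in simp)

lemma wedge_list_2:
  assumes "linear (e i)" "linear (e j)"
  shows "wedge_list e [i, j] v = e i (v 0) * e j (v 1) - e i (v 1) * e j (v 0)"
proof -
  have "wedge_list e [i, j] v = wedge 1 1 (\<lambda>v. e i (v 0)) (wedge_list e [j]) v"
    by (subst wedge_list.simps(2)) (simp add: Suc_numerals del: wedge_list.simps)
  then show ?thesis
    using wedge_1_1[OF assms, of v] wedge_list_1[of e j, OF assms(2)] by simp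
qed

lemma alt_form_wedge_list_2: "linear (e i) \<Longrightarrow> linear (e j) \<Longrightarrow> alt_form 2 (wedge_list e [i, j])"
  using alt_form_wedge_list[of "[i, j]" e] by (auto simp: Suc_numerals simp del: wedge_list.simps)

lemma wedge_list_3:
  assumes "linear (e i)" "linear (e j)" "linear (e k)"
  shows "wedge_list e [i, j, k] v = e i (v 0) * wedge_list e [j, k] ((!) [v 1, v 2]) - e i (v 1) * wedge_list e [j, k] ((!) [v 0, v 2])
    - e i (v 2) * wedge_list e [j, k] ((!) [v 1, v 0])"
proof -
  have "wedge_list e [i, j, k] v = wedge 1 2 (\<lambda>v. e i (v 0)) (wedge_list e [j, k]) v"
    by (subst wedge_list.simps(2)) (simp add: Suc_numerals del: wedge_list.simps)
  then show ?thesis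
    using wedge_1_2[OF assms(1) alt_form_wedge_list_2[of e, OF assms(2,3)]] by simp
qed

lemma length_4: "length xs = 4 \<Longrightarrow> \<exists>i j k l. xs = [i, j, k, l]"
  by (auto simp: length_Suc_conv numeral_eq_Suc)

context frame
begin

lemmas I7_linear = e_linear[OF I7_mem(1)] e_linear[OF I7_mem(2)] e_linear[OF I7_mem(3)] e_linear[OF I7_mem(4)]
  e_linear[OF I7_mem(5)] e_linear[OF I7_mem(6)] e_linear[OF I7_mem(7)]

lemma alt_form_g2_model: "alt_form 3 (g2_model e)"
proof -
  have w: "alt_form 3 (wedge 1 2 (wedge_list e [i]) \<beta>)" if "linear (e i)" "alt_form 2 \<beta>" for i \<beta>
    using alt_form_wedge[OF multilin_1[OF that(1)] alt_form_multilin[OF that(2)]] by (simp add: wedge_list_1[of e i, OF that(1)] del: wedge_list.simps)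
  have w3: "alt_form 3 (wedge_list e [1, 2, 3])"
    using alt_form_wedge_list[of "[1,2,3]" e] I7_linear by (auto simp: Suc_numerals simp del: wedge_list.simps)
  show ?thesis
    unfolding g2_model_def
    by (intro alt_form_add alt_form_diff w w3 alt_form_wedge_list_2 I7_linear)
qed

lemma g2_model_expand:
  "g2_model e v = wedge_list e [1,2,3] v
    + (e 1 (v 0) * (wedge_list e [4,5] ((!) [v 1, v 2]) + wedge_list e [6,7] ((!) [v 1, v 2]))
      - e 1 (v 1) * (wedge_list e [4,5] ((!) [v 0, v 2]) + wedge_list e [6,7] ((!) [v 0, v 2]))
      - e 1 (v 2) * (wedge_list e [4,5] ((!) [v 1, v 0]) + wedge_list e [6,7] ((!) [v 1, v 0])))
    + (e 2 (v 0) * (wedge_list e [4,6] ((!) [v 1, v 2]) - wedge_list e [5,7] ((!) [v 1, v 2]))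
      - e 2 (v 1) * (wedge_list e [4,6] ((!) [v 0, v 2]) - wedge_list e [5,7] ((!) [v 0, v 2]))
      - e 2 (v 2) * (wedge_list e [4,6] ((!) [v 1, v 0]) - wedge_list e [5,7] ((!) [v 1, v 0])))
    - (e 3 (v 0) * (wedge_list e [4,7] ((!) [v 1, v 2]) + wedge_list e [5,6] ((!) [v 1, v 2]))
      - e 3 (v 1) * (wedge_list e [4,7] ((!) [v 0, v 2]) + wedge_list e [5,6] ((!) [v 0, v 2]))
      - e 3 (v 2) * (wedge_list e [4,7] ((!) [v 1, v 0]) + wedge_list e [5,6] ((!) [v 1, v 0])))"
proof -
  have a: "alt_form 2 (\<lambda>w. wedge_list e [i, j] w + wedge_list e [k, l] w)" "alt_form 2 (\<lambda>w. wedge_list e [i, j] w - wedge_list e [k, l] w)"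
    if "linear (e i)" "linear (e j)" "linear (e k)" "linear (e l)" for i j k l
    using that by (intro alt_form_add alt_form_diff alt_form_wedge_list_2; simp)+
  show ?thesis
    unfolding g2_model_def wedge_list_1[of e 1, OF I7_linear(1)] wedge_list_1[of e 2, OF I7_linear(2)] wedge_list_1[of e 3, OF I7_linear(3)]
      wedge_1_2[OF I7_linear(1) a(1)[OF I7_linear(4) I7_linear(5) I7_linear(6) I7_linear(7)]]
      wedge_1_2[OF I7_linear(2) a(2)[OF I7_linear(4) I7_linear(6) I7_linear(5) I7_linear(7)]]
      wedge_1_2[OF I7_linear(3) a(1)[OF I7_linear(4) I7_linear(7) I7_linear(5) I7_linear(6)]]
    by simp
qed

lemma g2_model_frame:
  assumes "i \<in> I7" "j \<in> I7" "k \<in> I7"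
  shows "g2_model e ((!) [b i, b j, b k]) = ph i j k"
proof -
  have lists: "[x, y, z] ! 0 = x" "[x, y, z] ! 1 = y" "[x, y, z] ! 2 = z" "[x, y] ! 0 = x" "[x, y] ! 1 = y" for x y z :: "real^7"
    by (simp_all add: nth_Cons' )
  \<comment> \<open>On frame vectors the model form is a polynomial in Kronecker deltas. Comparing
    this polynomial with \<open>ph\<close> in all 343 cases beforehand keeps the forms themselves
    out of the case analysis.\<close>
  have "\<forall>i\<in>I7. \<forall>j\<in>I7. \<forall>k\<in>I7.
      of_bool (1 = i) * (of_bool (2 = j) * of_bool (3 = k) - of_bool (2 = k) * of_bool (3 = j))
    - of_bool (1 = j) * (of_bool (2 = i) * of_bool (3 = k) - of_bool (2 = k) * of_bool (3 = i))
    - of_bool (1 = k) * (of_bool (2 = j) * of_bool (3 = i) - of_bool (2 = i) * of_bool (3 = j))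
    + (of_bool (1 = i) * ((of_bool (4 = j) * of_bool (5 = k) - of_bool (4 = k) * of_bool (5 = j)) + (of_bool (6 = j) * of_bool (7 = k) - of_bool (6 = k) * of_bool (7 = j)))
      - of_bool (1 = j) * ((of_bool (4 = i) * of_bool (5 = k) - of_bool (4 = k) * of_bool (5 = i)) + (of_bool (6 = i) * of_bool (7 = k) - of_bool (6 = k) * of_bool (7 = i)))
      - of_bool (1 = k) * ((of_bool (4 = j) * of_bool (5 = i) - of_bool (4 = i) * of_bool (5 = j)) + (of_bool (6 = j) * of_bool (7 = i) - of_bool (6 = i) * of_bool (7 = j))))
    + (of_bool (2 = i) * ((of_bool (4 = j) * of_bool (6 = k) - of_bool (4 = k) * of_bool (6 = j)) - (of_bool (5 = j) * of_bool (7 = k) - of_bool (5 = k) * of_bool (7 = j)))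
      - of_bool (2 = j) * ((of_bool (4 = i) * of_bool (6 = k) - of_bool (4 = k) * of_bool (6 = i)) - (of_bool (5 = i) * of_bool (7 = k) - of_bool (5 = k) * of_bool (7 = i)))
      - of_bool (2 = k) * ((of_bool (4 = j) * of_bool (6 = i) - of_bool (4 = i) * of_bool (6 = j)) - (of_bool (5 = j) * of_bool (7 = i) - of_bool (5 = i) * of_bool (7 = j))))
    - (of_bool (3 = i) * ((of_bool (4 = j) * of_bool (7 = k) - of_bool (4 = k) * of_bool (7 = j)) + (of_bool (5 = j) * of_bool (6 = k) - of_bool (5 = k) * of_bool (6 = j)))
      - of_bool (3 = j) * ((of_bool (4 = i) * of_bool (7 = k) - of_bool (4 = k) * of_bool (7 = i)) + (of_bool (5 = i) * of_bool (6 = k) - of_bool (5 = k) * of_bool (6 = i)))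
      - of_bool (3 = k) * ((of_bool (4 = j) * of_bool (7 = i) - of_bool (4 = i) * of_bool (7 = j)) + (of_bool (5 = j) * of_bool (6 = i) - of_bool (5 = i) * of_bool (6 = j)))) = ph i j k"
    unfolding ball_I7 by (simp add: ph_def oct_table)
  from this[rule_format, OF assms] show ?thesis
    using assms unfolding g2_model_expand
    by (simp only: wedge_list_3[of e, OF I7_linear(1) I7_linear(2) I7_linear(3)] wedge_list_2[of e] I7_linear lists e_b I7_mem)
qed

lemma g2_model_frame':
  assumes "i \<in> I7" "j \<in> I7" "k \<in> I7"
  shows "g2_model e (\<lambda>m. b ([i, j, k] ! m)) = ph i j k"
proof -
  have "g2_model e (\<lambda>m. b ([i, j, k] ! m)) = g2_model e ((!) [b i, b j, b k])"
    by (rule multilin_list[OF alt_form_multilin[OF alt_form_g2_model]]) (auto simp: less_numerals)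
  then show ?thesis
    using g2_model_frame[OF assms] by simp
qed

text \<open>Both sides alternate in the four indices. It suffices to treat the 35 increasing
  quadruples, where \<open>hodge_list\<close> reduces the Hodge dual to the value of \<phi> on the
  complementary triple.\<close>

lemma hodge_g2_frame':
  assumes I: "i \<in> I7" "j \<in> I7" "k \<in> I7" "l \<in> I7"
  shows "hodge e 3 (g2_model e) (\<lambda>m. b ([i, j, k, l] ! m)) = ps i j k l"
proof -
  define G1 where "G1 xs = hodge e 3 (g2_model e) (\<lambda>m. b (xs ! m))" for xs
  \<comment> \<open>The default 0 makes the swap rule true for every list of length 4, also with
    entries outside \<open>I7\<close>, as \<open>alternating_sort\<close> demands.\<close>
  define G2 where "G2 xs = (if set xs \<subseteq> I7 then ps (xs ! 0) (xs ! 1) (xs ! 2) (xs ! 3) else 0)" for xs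
  have a4: "alt_form 4 (hodge e 3 (g2_model e))"
    using alt_form_hodge[of 3] by simp
  show ?thesis
  proof (cases "distinct [i, j, k, l]")
    case False
    have "ps i j k l = 0"
      using False I ps_antisym(1)[of i i k l] ps_antisym(2)[of i j j l] ps_antisym(3)[of i j k k]
        ps_antisym(2)[of i j i l] ps_antisym(1)[of i i j l] ps_antisym(3)[of i j k j] ps_antisym(2)[of i j j k]
        ps_antisym(3)[of i j k i] ps_antisym(2)[of i j i k] ps_antisym(1)[of i i j k]
      by auto
    moreover have len4: "length [i, j, k, l] = 4"
      by simp
    have "\<exists>m n. m < 4 \<and> n < 4 \<and> m \<noteq> n \<and> [i, j, k, l] ! m = [i, j, k, l] ! n"
      using False len4 unfolding distinct_conv_nth by (metis (no_types))
    then have "hodge e 3 (g2_model e) (\<lambda>m. b ([i, j, k, l] ! m)) = 0"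
      using alt_form_eq_0[OF a4] by metis
    ultimately show ?thesis by simp
  next
    case True
    have 1: "G1 ([] @ [i, j, k, l]) = list_sign [i, j, k, l] * G1 ([] @ sort [i, j, k, l])"
      unfolding G1_def by (rule alternating_sort[OF alt_form_list_swap[OF a4]]) (use True in auto)
    have 2: "G2 ([] @ [i, j, k, l]) = list_sign [i, j, k, l] * G2 ([] @ sort [i, j, k, l])"
    proof (rule alternating_sort[where n = 4])
      fix pre post :: "nat list" and x y assume len: "length (pre @ x # y # post) = 4"
      consider u v where "pre = []" "post = [u, v]" | u v where "pre = [u]" "post = [v]" | u v where "pre = [u, v]" "post = []"
        using len by (cases pre; cases post; auto simp: length_Suc_conv numeral_eq_Suc)
      then show "G2 (pre @ x # y # post) = - G2 (pre @ y # x # post)"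
        by cases (auto simp: G2_def insert_commute intro: ps_antisym)
    qed (use True in auto)
    have f: "hodge e 3 (g2_model e) (\<lambda>m. b ([i, j, k, l] ! m)) = list_sign [p, q, r, i, j, k, l] * ph p q r"
      if "distinct [p, q, r, i, j, k, l]" "set [p, q, r, i, j, k, l] = I7" for p q r i j k l
      using hodge_list[of "[p, q, r]" "[i, j, k, l]" "g2_model e"] that alt_form_g2_model g2_model_frame'[of p q r]
      by (auto simp: Suc_numerals simp del: list_sign.simps)
    have sorted: "\<forall>i\<in>I7. \<forall>j\<in>I7. \<forall>k\<in>I7. \<forall>l\<in>I7. i < j \<and> j < k \<and> k < l \<longrightarrow>
      hodge e 3 (g2_model e) (\<lambda>m. b ([i, j, k, l] ! m)) = ps i j k l"
      unfolding ball_I7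
      by (simp add: ps_table ph_def oct_table I7_eq insert_commute
      f[where p = 5 and q = 6 and r = 7 and i = 1 and j = 2 and k = 3 and l = 4]
      f[where p = 4 and q = 6 and r = 7 and i = 1 and j = 2 and k = 3 and l = 5]
      f[where p = 4 and q = 5 and r = 7 and i = 1 and j = 2 and k = 3 and l = 6]
      f[where p = 4 and q = 5 and r = 6 and i = 1 and j = 2 and k = 3 and l = 7]
      f[where p = 3 and q = 6 and r = 7 and i = 1 and j = 2 and k = 4 and l = 5]
      f[where p = 3 and q = 5 and r = 7 and i = 1 and j = 2 and k = 4 and l = 6]
      f[where p = 3 and q = 5 and r = 6 and i = 1 and j = 2 and k = 4 and l = 7]
      f[where p = 3 and q = 4 and r = 7 and i = 1 and j = 2 and k = 5 and l = 6]
      f[where p = 3 and q = 4 and r = 6 and i = 1 and j = 2 and k = 5 and l = 7]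
      f[where p = 3 and q = 4 and r = 5 and i = 1 and j = 2 and k = 6 and l = 7]
      f[where p = 2 and q = 6 and r = 7 and i = 1 and j = 3 and k = 4 and l = 5]
      f[where p = 2 and q = 5 and r = 7 and i = 1 and j = 3 and k = 4 and l = 6]
      f[where p = 2 and q = 5 and r = 6 and i = 1 and j = 3 and k = 4 and l = 7]
      f[where p = 2 and q = 4 and r = 7 and i = 1 and j = 3 and k = 5 and l = 6]
      f[where p = 2 and q = 4 and r = 6 and i = 1 and j = 3 and k = 5 and l = 7]
      f[where p = 2 and q = 4 and r = 5 and i = 1 and j = 3 and k = 6 and l = 7]
      f[where p = 2 and q = 3 and r = 7 and i = 1 and j = 4 and k = 5 and l = 6]
      f[where p = 2 and q = 3 and r = 6 and i = 1 and j = 4 and k = 5 and l = 7]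
      f[where p = 2 and q = 3 and r = 5 and i = 1 and j = 4 and k = 6 and l = 7]
      f[where p = 2 and q = 3 and r = 4 and i = 1 and j = 5 and k = 6 and l = 7]
      f[where p = 1 and q = 6 and r = 7 and i = 2 and j = 3 and k = 4 and l = 5]
      f[where p = 1 and q = 5 and r = 7 and i = 2 and j = 3 and k = 4 and l = 6]
      f[where p = 1 and q = 5 and r = 6 and i = 2 and j = 3 and k = 4 and l = 7]
      f[where p = 1 and q = 4 and r = 7 and i = 2 and j = 3 and k = 5 and l = 6]
      f[where p = 1 and q = 4 and r = 6 and i = 2 and j = 3 and k = 5 and l = 7]
      f[where p = 1 and q = 4 and r = 5 and i = 2 and j = 3 and k = 6 and l = 7]
      f[where p = 1 and q = 3 and r = 7 and i = 2 and j = 4 and k = 5 and l = 6]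
      f[where p = 1 and q = 3 and r = 6 and i = 2 and j = 4 and k = 5 and l = 7]
      f[where p = 1 and q = 3 and r = 5 and i = 2 and j = 4 and k = 6 and l = 7]
      f[where p = 1 and q = 3 and r = 4 and i = 2 and j = 5 and k = 6 and l = 7]
      f[where p = 1 and q = 2 and r = 7 and i = 3 and j = 4 and k = 5 and l = 6]
      f[where p = 1 and q = 2 and r = 6 and i = 3 and j = 4 and k = 5 and l = 7]
      f[where p = 1 and q = 2 and r = 5 and i = 3 and j = 4 and k = 6 and l = 7]
      f[where p = 1 and q = 2 and r = 4 and i = 3 and j = 5 and k = 6 and l = 7]
      f[where p = 1 and q = 2 and r = 3 and i = 4 and j = 5 and k = 6 and l = 7])
    have "length (sort [i, j, k, l]) = 4"
      by (simp only: length_sort) simp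
    from length_4[OF this] obtain i' j' k' l' where s: "sort [i, j, k, l] = [i', j', k', l']"
      by blast
    have "set [i', j', k', l'] = set [i, j, k, l]" "sorted [i', j', k', l']" "distinct [i', j', k', l']"
      using True unfolding s[symmetric] by (simp_all only: set_sort sorted_sort distinct_sort)
    then have I': "i' \<in> I7" "j' \<in> I7" "k' \<in> I7" "l' \<in> I7" and lt: "i' < j' \<and> j' < k' \<and> k' < l'"
      using I by auto
    have "G1 [i', j', k', l'] = G2 [i', j', k', l']"
      using sorted[rule_format, OF I' lt] I' unfolding G1_def G2_def by (simp add: numeral_2_eq_2 numeral_3_eq_3 One_nat_def)
    then have "G1 [i, j, k, l] = G2 [i, j, k, l]"
      using 1 2 s by simp
    then show ?thesis
      using I unfolding G1_def G2_def by (simp add: numeral_2_eq_2 numeral_3_eq_3 One_nat_def)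
  qed
qed


section \<open>Forms of top degree and the pairing of a wedge with the Hodge operator\<close>

lemma vol_move:
  "length (pre @ x # ys @ post) = 7 \<Longrightarrow>
    vol (\<lambda>i. b ((pre @ x # ys @ post) ! i)) = (- 1) ^ length ys * vol (\<lambda>i. b ((pre @ ys @ x # post) ! i))"
proof (induction ys arbitrary: pre)
  case Nil
  then show ?case by simp
next
  case (Cons y ys)
  have "vol (\<lambda>i. b ((pre @ x # y # ys @ post) ! i)) = - vol (\<lambda>i. b (((pre @ [y]) @ x # ys @ post) ! i))"
    using alt_form_list_swap[OF alt_form_vol, of pre x y "ys @ post" b] Cons.prems by simp
  then show ?case
    using Cons.IH[of "pre @ [y]"] Cons.prems by simp
qed

text \<open>Three vectors pass four others: twelve transpositions, an even number. So for 3-forms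
  and 4-forms in dimension seven it is immaterial which block of complementary indices comes
  first.\<close>

lemma vol_rotate: "vol (\<lambda>m. b ([p, q, r, i, j, k, l] ! m)) = vol (\<lambda>m. b ([i, j, k, l, p, q, r] ! m))"
  using vol_move[of "[p, q]" r "[i, j, k, l]" "[]"] vol_move[of "[p]" q "[i, j, k, l]" "[r]"] vol_move[of "[]" p "[i, j, k, l]" "[q, r]"]
  by simp

lemma hodge_3_sum:
  assumes "\<And>v w. (\<And>i. i < 3 \<Longrightarrow> v i = w i) \<Longrightarrow> \<beta> v = \<beta> w"
  shows "hodge e 3 \<beta> (\<lambda>m. b ([i, j, k, l] ! m)) =
    (\<Sum>p\<in>I7. \<Sum>q\<in>I7. \<Sum>r\<in>I7. \<beta> (\<lambda>m. b ([p, q, r] ! m)) * vol (\<lambda>m. b ([i, j, k, l, p, q, r] ! m))) / 6"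
proof -
  define F where "F s = \<beta> (\<lambda>i. b (s i)) * vol (\<lambda>m. if m < 3 then b (s m) else b ([i, j, k, l] ! (m - 3)))" for s
  have F: "F ((\<lambda>_. undefined)(0 := p, 1 := q, 2 := r)) = \<beta> (\<lambda>m. b ([p, q, r] ! m)) * vol (\<lambda>m. b ([i, j, k, l, p, q, r] ! m))" for p q r
  proof -
    have 1: "\<beta> (\<lambda>x. b (((\<lambda>_. undefined)(0 := p, 1 := q, 2 := r)) x)) = \<beta> (\<lambda>m. b ([p, q, r] ! m))"
      by (rule assms) (auto simp: less_numerals)
    have "vol (\<lambda>m. if m < 3 then b (((\<lambda>_. undefined)(0 := p, 1 := q, 2 := r)) m) else b ([i, j, k, l] ! (m - 3)))
        = vol (\<lambda>m. b ([p, q, r, i, j, k, l] ! m))"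
    proof (rule multilin_cong[OF alt_form_multilin[OF alt_form_vol]])
      fix x :: nat assume "x < 7"
      then consider "x = 0" | "x = 1" | "x = 2" | "3 \<le> x" by linarith
      then show "(if x < 3 then b (((\<lambda>_. undefined)(0 := p, 1 := q, 2 := r)) x) else b ([i, j, k, l] ! (x - 3))) = b ([p, q, r, i, j, k, l] ! x)"
      proof cases
        case 4
        then obtain y where "x = Suc (Suc (Suc y))"
          by (metis add_Suc le_Suc_ex numeral_3_eq_3 plus_nat.add_0)
        then show ?thesis by (simp add: numeral_3_eq_3)
      qed (simp_all)
    qed
    then show ?thesis
      unfolding F_def 1 vol_rotate by simp
  qed
  have "(\<Sum>s \<in> {..<3} \<rightarrow>\<^sub>E I7. F s) = (\<Sum>p\<in>I7. \<Sum>q\<in>I7. \<Sum>r\<in>I7. F ((\<lambda>_. undefined)(0 := p, 1 := q, 2 := r)))"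
    unfolding numeral_3_eq_3 sum_PiE_Suc sum_PiE_0 by (simp only: Suc_numerals)
  then show ?thesis
    unfolding hodge_eq F_def[symmetric] F by (simp add: numeral_3_eq_3 fact_Suc)
qed

text \<open>The identity \<alpha> \<and> \<beta> = <\<alpha>, \<star>\<beta>> vol on the frame; the
  factor 1/24 accounts for the orderings of four indices. Only dependence on the first slots is
  assumed, so that the non-alternating factor of \<open>Om\<close> is covered.\<close>

lemma wedge_4_3_frame:
  assumes a: "\<And>v w. (\<And>i. i < 4 \<Longrightarrow> v i = w i) \<Longrightarrow> \<alpha> v = \<alpha> w"
    and b: "\<And>v w. (\<And>i. i < 3 \<Longrightarrow> v i = w i) \<Longrightarrow> \<beta> v = \<beta> w"
  shows "wedge 4 3 \<alpha> \<beta> (\<lambda>m. b (Suc m)) =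
    (\<Sum>i\<in>I7. \<Sum>j\<in>I7. \<Sum>k\<in>I7. \<Sum>l\<in>I7. \<alpha> (\<lambda>m. b ([i, j, k, l] ! m)) * hodge e 3 \<beta> (\<lambda>m. b ([i, j, k, l] ! m))) / 24"
proof -
  define F where "F s = \<alpha> (\<lambda>i. b (s i)) * (\<beta> (\<lambda>i. b (s (4 + i))) * vol (\<lambda>i. b (s i)))" for s
  have u: "bij_betw Suc {..<7} I7"
    unfolding I7_def bij_betw_def by (auto simp: image_Suc_lessThan One_nat_def)
  have "(\<Sum>s \<in> {..<7} \<rightarrow>\<^sub>E I7. F s) = (\<Sum>\<tau> | \<tau> permutes {..<7}. F (restrict (Suc \<circ> \<tau>) {..<7}))"
  proof (rule sum_bij_functions[OF u order_refl])
    fix s i j assume "i < j" "j < (7::nat)" "(if i < 7 then s i else Suc i) = (if j < 7 then s j else Suc j)"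
    then have "vol (\<lambda>i. b (s i)) = 0"
      by (intro alt_form_eq_0[OF alt_form_vol, of i j]) (auto split: if_splits)
    then show "F s = 0" by (simp add: F_def)
  qed
  also have "\<dots> = (\<Sum>\<tau> | \<tau> permutes {..<7}. of_int (sign \<tau>) * \<alpha> (\<lambda>i. b (Suc (\<tau> i))) * \<beta> (\<lambda>i. b (Suc (\<tau> (4 + i)))))"
  proof (rule sum.cong[OF refl])
    fix \<tau> assume "\<tau> \<in> {\<tau>. \<tau> permutes {..<7::nat}}"
    then have t: "\<tau> permutes {..<7}" by simp
    have 1: "\<alpha> (\<lambda>i. b (restrict (Suc \<circ> \<tau>) {..<7} i)) = \<alpha> (\<lambda>i. b (Suc (\<tau> i)))"
      by (rule a) simp
    have 2: "\<beta> (\<lambda>i. b (restrict (Suc \<circ> \<tau>) {..<7} (4 + i))) = \<beta> (\<lambda>i. b (Suc (\<tau> (4 + i))))"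
      by (rule b) simp
    have "vol (\<lambda>i. b (restrict (Suc \<circ> \<tau>) {..<7} i)) = vol ((\<lambda>i. b (Suc i)) \<circ> \<tau>)"
      by (rule multilin_cong[OF alt_form_multilin[OF alt_form_vol]]) simp
    also have "\<dots> = of_int (sign \<tau>)"
      by (simp only: alt_form_permute[OF alt_form_vol t] vol_b mult_1_right)
    finally show "F (restrict (Suc \<circ> \<tau>) {..<7}) = of_int (sign \<tau>) * \<alpha> (\<lambda>i. b (Suc (\<tau> i))) * \<beta> (\<lambda>i. b (Suc (\<tau> (4 + i))))"
      unfolding F_def 1 2 by simp
  qed
  \<comment> \<open>Here 144 = 4! * 3!. The inner sum over p, q, r is 6 times a Hodge dual by
    \<open>hodge_3_sum\<close>, which leaves 24.\<close>
  finally have 1: "wedge 4 3 \<alpha> \<beta> (\<lambda>m. b (Suc m)) = (\<Sum>s \<in> {..<7} \<rightarrow>\<^sub>E I7. F s) / 144"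
    unfolding wedge_def by (simp add: numeral_eq_Suc fact_Suc)
  have F: "F ((\<lambda>_. undefined)(0 := i, 1 := j, 2 := k, 3 := l, 4 := p, 5 := q, 6 := r)) =
      \<alpha> (\<lambda>m. b ([i, j, k, l] ! m)) * (\<beta> (\<lambda>m. b ([p, q, r] ! m)) * vol (\<lambda>m. b ([i, j, k, l, p, q, r] ! m)))" for i j k l p q r
  proof -
    let ?s = "(\<lambda>_. undefined)(0 := i, 1 := j, 2 := k, 3 := l, 4 := p, 5 := q, 6 := r)"
    have "\<alpha> (\<lambda>x. b (?s x)) = \<alpha> (\<lambda>m. b ([i, j, k, l] ! m))"
      by (rule a) (auto simp: less_numerals)
    moreover have "\<beta> (\<lambda>x. b (?s (4 + x))) = \<beta> (\<lambda>m. b ([p, q, r] ! m))"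
      by (rule b) (auto simp: less_numerals)
    moreover have "vol (\<lambda>x. b (?s x)) = vol (\<lambda>m. b ([i, j, k, l, p, q, r] ! m))"
    proof (rule multilin_cong[OF alt_form_multilin[OF alt_form_vol]])
      fix x :: nat assume "x < 7"
      then have "x = 0 \<or> x = 1 \<or> x = 2 \<or> x = 3 \<or> x = 4 \<or> x = 5 \<or> x = 6" by linarith
      then show "b (?s x) = b ([i, j, k, l, p, q, r] ! x)" by auto
    qed
    ultimately show ?thesis
      unfolding F_def by simp
  qed
  have h: "hodge e 3 \<beta> (\<lambda>m. b ([i, j, k, l] ! m)) =
    (\<Sum>p\<in>I7. \<Sum>q\<in>I7. \<Sum>r\<in>I7. \<beta> (\<lambda>m. b ([p, q, r] ! m)) * vol (\<lambda>m. b ([i, j, k, l, p, q, r] ! m))) / 6" for i j k l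
    by (rule hodge_3_sum) (rule b, blast)
  have "(\<Sum>s \<in> {..<7} \<rightarrow>\<^sub>E I7. F s) = (\<Sum>i\<in>I7. \<Sum>j\<in>I7. \<Sum>k\<in>I7. \<Sum>l\<in>I7. \<Sum>p\<in>I7. \<Sum>q\<in>I7. \<Sum>r\<in>I7.
      F ((\<lambda>_. undefined)(0 := i, 1 := j, 2 := k, 3 := l, 4 := p, 5 := q, 6 := r)))"
  proof -
    have 7: "(7::nat) = Suc (Suc (Suc (Suc (Suc (Suc (Suc 0))))))" by simp
    have *: "Suc 5 = 6" by simp
    show ?thesis
      unfolding 7 sum_PiE_Suc sum_PiE_0 by (simp only: Suc_numerals *)
  qed
  also have "\<dots> = 6 * (\<Sum>i\<in>I7. \<Sum>j\<in>I7. \<Sum>k\<in>I7. \<Sum>l\<in>I7. \<alpha> (\<lambda>m. b ([i, j, k, l] ! m)) * hodge e 3 \<beta> (\<lambda>m. b ([i, j, k, l] ! m)))"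
    unfolding F h sum_distrib_left by (simp add: sum_divide_distrib[symmetric] sum_distrib_left mult_ac)
  finally show ?thesis
    unfolding 1 by simp
qed

lemma alt_form_7: "alt_form 7 \<beta> \<Longrightarrow> \<beta> v = \<beta> (\<lambda>m. b (Suc m)) * vol v"
proof -
  assume a: "alt_form 7 \<beta>"
  have u: "bij_betw Suc {..<7} I7"
    unfolding I7_def bij_betw_def by (auto simp: image_Suc_lessThan One_nat_def)
  have *: "\<gamma> (\<lambda>i. b (s i)) = \<gamma> (\<lambda>m. b (Suc m)) * vol (\<lambda>i. b (s i))" if g: "alt_form 7 \<gamma>" and s: "\<And>i. i < 7 \<Longrightarrow> s i \<in> I7" for \<gamma> s
  proof (cases "inj_on s {..<7}")
    case False
    then obtain i j where "i < 7" "j < 7" "i \<noteq> j" "s i = s j"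
      by (auto simp: inj_on_def)
    then show ?thesis
      using alt_form_eq_0[OF g, of i j "\<lambda>i. b (s i)"] alt_form_eq_0[OF alt_form_vol, of i j "\<lambda>i. b (s i)"] by simp
  next
    case True
    define \<tau> where "\<tau> i = (if i < 7 then s i - 1 else i)" for i
    have s1: "1 \<le> s i \<and> s i \<le> 7" if "i < 7" for i
      using s[OF that] by (simp add: I7_def)
    have "inj_on \<tau> {..<7}"
    proof (rule inj_onI)
      fix i j assume ij: "i \<in> {..<7}" "j \<in> {..<7}" "\<tau> i = \<tau> j"
      have "s i = s j"
        using ij s1[of i] s1[of j] by (simp add: \<tau>_def) linarith
      then show "i = j"
        using inj_onD[OF True, of i j] ij by simp
    qed
    moreover have "\<tau> ` {..<7} \<subseteq> {..<7}"
    proof (rule image_subsetI)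
      fix i :: nat assume "i \<in> {..<7}"
      then show "\<tau> i \<in> {..<7}" using s1[of i] by (auto simp: \<tau>_def)
    qed
    ultimately have "bij_betw \<tau> {..<7} {..<7}"
      by (simp add: bij_betw_def endo_inj_surj)
    then have t: "\<tau> permutes {..<7}"
      by (rule bij_imp_permutes) (simp add: \<tau>_def)
    have "\<delta> (\<lambda>i. b (s i)) = of_int (sign \<tau>) * \<delta> (\<lambda>i. b (Suc i))" if "alt_form 7 \<delta>" for \<delta>
    proof -
      have "\<delta> (\<lambda>i. b (s i)) = \<delta> ((\<lambda>i. b (Suc i)) \<circ> \<tau>)"
      proof (rule multilin_cong[OF alt_form_multilin[OF that]])
        fix i :: nat assume "i < 7"
        then have "Suc (s i - 1) = s i"
          using s1[of i] by linarith
        then show "b (s i) = ((\<lambda>i. b (Suc i)) \<circ> \<tau>) i"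
          using \<open>i < 7\<close> by (simp add: \<tau>_def)
      qed
      then show ?thesis
        using alt_form_permute[OF that t] by simp
    qed
    from this[OF g] this[OF alt_form_vol] show ?thesis
      by (simp add: vol_b)
  qed
  have "multilin 7 (\<lambda>v. \<beta> (\<lambda>m. b (Suc m)) * vol v)"
    by (intro multilin_cmult alt_form_multilin alt_form_vol)
  then have "\<beta> = (\<lambda>v. \<beta> (\<lambda>m. b (Suc m)) * vol v)"
    by (intro multilin_eqI[OF alt_form_multilin[OF a]]) (use *[OF a] in auto)
  then show ?thesis by metis
qed

lemma hodge_7:
  assumes a: "alt_form 7 \<beta>"
  shows "hodge e 7 \<beta> v = \<beta> (\<lambda>m. b (Suc m))"
proof -
  have u: "bij_betw Suc {..<7} I7"
    unfolding I7_def bij_betw_def by (auto simp: image_Suc_lessThan One_nat_def)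
  have "hodge e 7 \<beta> v = hodge e 7 \<beta> (\<lambda>i. b (Suc (i + 7)))"
    by (rule hodge_cong) simp
  then show ?thesis
    using hodge_bij[OF u order_refl a] by (simp add: vol_b)
qed

end

section \<open>The metric and the orientation determined by \<phi>\<close>

lemma multilin_3_linear:
  assumes "multilin 3 \<phi>"
  shows "linear (\<lambda>x. \<phi> ((!) [x, u, v]))" "linear (\<lambda>x. \<phi> ((!) [u, x, v]))" "linear (\<lambda>x. \<phi> ((!) [u, v, x]))"
proof -
  have "\<phi> ((!) [x, u, v]) = \<phi> (((!) [0, u, v])(0 := x))" "\<phi> ((!) [u, x, v]) = \<phi> (((!) [u, 0, v])(1 := x))"
    "\<phi> ((!) [u, v, x]) = \<phi> (((!) [u, v, 0])(2 := x))" for x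
    by (rule multilin_cong[OF assms]; auto simp: less_numerals)+
  then show "linear (\<lambda>x. \<phi> ((!) [x, u, v]))" "linear (\<lambda>x. \<phi> ((!) [u, x, v]))" "linear (\<lambda>x. \<phi> ((!) [u, v, x]))"
    using multilin_linear[OF assms] by simp_all
qed

text \<open>The form \<open>\<iota>\<^sub>u\<phi> \<and> \<iota>\<^sub>v\<phi> \<and> \<phi>\<close> (up to a factor), from which \<open>\<phi>\<close> determines its metric and orientation.\<close>

definition Om :: "'v::real_vector mform \<Rightarrow> 'v \<Rightarrow> 'v \<Rightarrow> 'v mform" where
  "Om \<phi> u v = wedge 4 3 (\<lambda>w. \<phi> ((!) [u, w 0, w 1]) * \<phi> ((!) [v, w 2, w 3])) \<phi>"

lemma alt_form_Om:
  assumes "multilin 3 \<phi>"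
  shows "alt_form 7 (Om \<phi> u v)"
proof -
  have "multilin 4 (\<lambda>w. \<phi> ((!) [u, w 0, w 1]) * \<phi> ((!) [v, w 2, w 3]))"
  proof (rule multilinI)
    fix w :: "nat \<Rightarrow> 'a" and i :: nat assume "i < 4"
    then consider "i = 0" | "i = 1" | "i = 2" | "i = 3" by linarith
    then show "linear (\<lambda>x. \<phi> ((!) [u, (w(i := x)) 0, (w(i := x)) 1]) * \<phi> ((!) [v, (w(i := x)) 2, (w(i := x)) 3]))"
    proof cases
      case 1
      then show ?thesis
        using linear_compose_scale_right[OF multilin_3_linear(2)[OF assms, of u "w 1"], of "\<phi> ((!) [v, w 2, w 3])"] by (simp add: mult.commute)
    next
      case 2
      then show ?thesis
        using linear_compose_scale_right[OF multilin_3_linear(3)[OF assms, of u "w 0"], of "\<phi> ((!) [v, w 2, w 3])"] by (simp add: mult.commute)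
    next
      case 3
      then show ?thesis
        using linear_compose_scale_right[OF multilin_3_linear(2)[OF assms, of v "w 3"], of "\<phi> ((!) [u, w 0, w 1])"] by (simp add: mult.commute)
    next
      case 4
      then show ?thesis
        using linear_compose_scale_right[OF multilin_3_linear(3)[OF assms, of v "w 2"], of "\<phi> ((!) [u, w 0, w 1])"] by (simp add: mult.commute)
    qed
  qed simp
  from alt_form_wedge[OF this assms] show ?thesis
    unfolding Om_def by simp
qed

context frame
begin

definition "g u v = (\<Sum>i\<in>I7. e i u * e i v)"

lemma linear_expand: "linear f \<Longrightarrow> f v = (\<Sum>j\<in>I7. e j v * f (b j))" for f :: "real^7 \<Rightarrow> real"
  using linear_sum[of f "\<lambda>j. e j v *\<^sub>R b j" I7] expand[of v] by (simp add: linear_cmul)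

text \<open>On the frame the wedge becomes a contraction of two copies of \<phi> with \<star>\<phi>.
  Eigenvalue 4 (\<open>ph_ps_contract\<close>) and then \<open>ph_norm\<close> give 4 * 6 / 24 = 1,
  and a 7-form is determined by its value on the frame.\<close>

lemma Om_frame: "Om (g2_model e) u v w = g u v * vol w"
proof -
  let ?\<phi> = "g2_model e"
  have m: "multilin 3 ?\<phi>"
    by (rule alt_form_multilin[OF alt_form_g2_model])
  have uu: "?\<phi> ((!) [x, b i, b j]) = (\<Sum>n\<in>I7. e n x * ph i j n)" if "i \<in> I7" "j \<in> I7" for x i j
    unfolding linear_expand[OF multilin_3_linear(1)[OF m], of x "b i" "b j"]
    using that by (intro sum.cong refl) (simp add: g2_model_frame ph_cyc)
  have "Om ?\<phi> u v (\<lambda>m. b (Suc m)) = (\<Sum>i\<in>I7. \<Sum>j\<in>I7. \<Sum>k\<in>I7. \<Sum>l\<in>I7.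
      (?\<phi> ((!) [u, b i, b j]) * ?\<phi> ((!) [v, b k, b l])) * ps i j k l) / 24"
    unfolding Om_def
    by (subst wedge_4_3_frame) (auto simp: multilin_def hodge_g2_frame' intro: multilin_cong[OF m] cong: sum.cong)
  also have "(\<Sum>i\<in>I7. \<Sum>j\<in>I7. \<Sum>k\<in>I7. \<Sum>l\<in>I7. (?\<phi> ((!) [u, b i, b j]) * ?\<phi> ((!) [v, b k, b l])) * ps i j k l)
     = (\<Sum>i\<in>I7. \<Sum>j\<in>I7. \<Sum>k\<in>I7. \<Sum>l\<in>I7. \<Sum>m\<in>I7. \<Sum>n\<in>I7. e m u * e n v * (ph i j m * ps i j k l * ph k l n))"
    by (intro sum.cong refl) (simp only: uu, simp only: sum_product, simp only: sum_distrib_right, simp add: mult_ac)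
  \<comment> \<open>The following exchanges move the sums over i and j inside those over m, k and l,
    where \<open>ph_ps_contract\<close> can evaluate them.\<close>
  also have "\<dots> = (\<Sum>i\<in>I7. \<Sum>j\<in>I7. \<Sum>k\<in>I7. \<Sum>m\<in>I7. \<Sum>l\<in>I7. \<Sum>n\<in>I7. e m u * e n v * (ph i j m * ps i j k l * ph k l n))"
    by (rule sum.cong[OF refl], rule sum.cong[OF refl], rule sum.cong[OF refl], rule sum.swap)
  also have "\<dots> = (\<Sum>i\<in>I7. \<Sum>j\<in>I7. \<Sum>m\<in>I7. \<Sum>k\<in>I7. \<Sum>l\<in>I7. \<Sum>n\<in>I7. e m u * e n v * (ph i j m * ps i j k l * ph k l n))"
    by (rule sum.cong[OF refl], rule sum.cong[OF refl], rule sum.swap)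
  also have "\<dots> = (\<Sum>i\<in>I7. \<Sum>m\<in>I7. \<Sum>j\<in>I7. \<Sum>k\<in>I7. \<Sum>l\<in>I7. \<Sum>n\<in>I7. e m u * e n v * (ph i j m * ps i j k l * ph k l n))"
    by (rule sum.cong[OF refl], rule sum.swap)
  also have "\<dots> = (\<Sum>m\<in>I7. \<Sum>i\<in>I7. \<Sum>j\<in>I7. \<Sum>k\<in>I7. \<Sum>l\<in>I7. \<Sum>n\<in>I7. e m u * e n v * (ph i j m * ps i j k l * ph k l n))"
    by (rule sum.swap)
  also have "\<dots> = (\<Sum>m\<in>I7. \<Sum>i\<in>I7. \<Sum>k\<in>I7. \<Sum>j\<in>I7. \<Sum>l\<in>I7. \<Sum>n\<in>I7. e m u * e n v * (ph i j m * ps i j k l * ph k l n))"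
    by (rule sum.cong[OF refl], rule sum.cong[OF refl], rule sum.swap)
  also have "\<dots> = (\<Sum>m\<in>I7. \<Sum>k\<in>I7. \<Sum>i\<in>I7. \<Sum>j\<in>I7. \<Sum>l\<in>I7. \<Sum>n\<in>I7. e m u * e n v * (ph i j m * ps i j k l * ph k l n))"
    by (rule sum.cong[OF refl], rule sum.swap)
  also have "\<dots> = (\<Sum>m\<in>I7. \<Sum>k\<in>I7. \<Sum>i\<in>I7. \<Sum>l\<in>I7. \<Sum>j\<in>I7. \<Sum>n\<in>I7. e m u * e n v * (ph i j m * ps i j k l * ph k l n))"
    by (rule sum.cong[OF refl], rule sum.cong[OF refl], rule sum.cong[OF refl], rule sum.swap)
  also have "\<dots> = (\<Sum>m\<in>I7. \<Sum>k\<in>I7. \<Sum>l\<in>I7. \<Sum>i\<in>I7. \<Sum>j\<in>I7. \<Sum>n\<in>I7. e m u * e n v * (ph i j m * ps i j k l * ph k l n))"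
    by (rule sum.cong[OF refl], rule sum.cong[OF refl], rule sum.swap)
  also have "\<dots> = (\<Sum>m\<in>I7. \<Sum>k\<in>I7. \<Sum>l\<in>I7. (\<Sum>n\<in>I7. e m u * e n v * ph k l n) * (\<Sum>i\<in>I7. \<Sum>j\<in>I7. ph i j m * ps i j k l))"
    by (simp only: sum_distrib_left, simp only: sum_distrib_right, simp add: mult_ac)
  also have "\<dots> = (\<Sum>m\<in>I7. \<Sum>k\<in>I7. \<Sum>l\<in>I7. \<Sum>n\<in>I7. 4 * e m u * e n v * (ph k l m * ph k l n))"
  proof (intro sum.cong refl)
    fix m k l assume I: "m \<in> I7" "k \<in> I7" "l \<in> I7"
    have "(\<Sum>i\<in>I7. \<Sum>j\<in>I7. ph i j m * ps i j k l) = 4 * ph k l m"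
      using I by (simp add: ph_ps_contract ph_cyc)
    then show "(\<Sum>n\<in>I7. e m u * e n v * ph k l n) * (\<Sum>i\<in>I7. \<Sum>j\<in>I7. ph i j m * ps i j k l)
        = (\<Sum>n\<in>I7. 4 * e m u * e n v * (ph k l m * ph k l n))"
      unfolding sum_distrib_right by (simp add: mult_ac)
  qed
  also have "\<dots> = (\<Sum>m\<in>I7. \<Sum>k\<in>I7. \<Sum>n\<in>I7. \<Sum>l\<in>I7. 4 * e m u * e n v * (ph k l m * ph k l n))"
    by (rule sum.cong[OF refl], rule sum.cong[OF refl], rule sum.swap)
  also have "\<dots> = (\<Sum>m\<in>I7. \<Sum>n\<in>I7. \<Sum>k\<in>I7. \<Sum>l\<in>I7. 4 * e m u * e n v * (ph k l m * ph k l n))"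
    by (rule sum.cong[OF refl], rule sum.swap)
  also have "\<dots> = (\<Sum>m\<in>I7. \<Sum>n\<in>I7. (24 * (e m u * e n v)) * of_bool (m = n))"
    by (intro sum.cong refl) (simp add: sum_distrib_left[symmetric] ph_norm)
  also have "\<dots> = (\<Sum>m\<in>I7. 24 * (e m u * e m v))"
    by (intro sum.cong refl sum_I7_delta(2))
  finally have "Om ?\<phi> u v (\<lambda>m. b (Suc m)) = g u v"
    unfolding g_def by (simp add: sum_distrib_left[symmetric])
  then show ?thesis
    using alt_form_7[OF alt_form_Om[OF m], of u v w] by simp
qed

lemma g_b: "i \<in> I7 \<Longrightarrow> g (b i) v = e i v"
  unfolding g_def by (simp add: e_b sum_I7_delta(3) del: sum_of_bool_mult_eq)

text \<open>By \<open>ph_norm\<close> the value is 7 * 6. What matters later is that it is nonzero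
  and the same for every coframe.\<close>

lemma norm_g2_model: "(\<Sum>s\<in>{..<3} \<rightarrow>\<^sub>E I7. g2_model e (\<lambda>i. b (s i)) * g2_model e (\<lambda>i. b (s i))) = 42"
proof -
  have *: "g2_model e (\<lambda>m. b (((\<lambda>_. undefined)(0 := i, 1 := j, 2 := k)) m)) = ph i j k" if "i \<in> I7" "j \<in> I7" "k \<in> I7" for i j k
  proof -
    have "g2_model e (\<lambda>m. b (((\<lambda>_. undefined)(0 := i, 1 := j, 2 := k)) m)) = g2_model e ((!) [b i, b j, b k])"
      by (rule multilin_list[OF alt_form_multilin[OF alt_form_g2_model]]) (auto simp: less_numerals)
    then show ?thesis
      using g2_model_frame[OF that] by simp
  qed
  have "(\<Sum>s\<in>{..<3} \<rightarrow>\<^sub>E I7. g2_model e (\<lambda>i. b (s i)) * g2_model e (\<lambda>i. b (s i))) =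
    (\<Sum>i\<in>I7. \<Sum>j\<in>I7. \<Sum>k\<in>I7. g2_model e (\<lambda>m. b (((\<lambda>_. undefined)(0 := i, 1 := j, 2 := k)) m)) *
       g2_model e (\<lambda>m. b (((\<lambda>_. undefined)(0 := i, 1 := j, 2 := k)) m)))"
    unfolding numeral_3_eq_3 sum_PiE_Suc sum_PiE_0 by (simp only: Suc_numerals)
  also have "\<dots> = (\<Sum>i\<in>I7. \<Sum>j\<in>I7. \<Sum>k\<in>I7. ph i j k * ph i j k)"
    by (intro sum.cong refl) (simp only: *)
  also have "\<dots> = (\<Sum>k\<in>I7. \<Sum>i\<in>I7. \<Sum>j\<in>I7. ph i j k * ph i j k)"
    by (subst sum.swap[of _ I7 I7], subst (2) sum.swap) (rule refl)
  also have "\<dots> = 42"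
    by (simp add: ph_norm) (simp add: I7_def)
  finally show ?thesis .
qed

end

text \<open>The frame dual to e' is orthogonal for the metric of e, with all squared lengths equal
  to \<kappa>. A contraction over k slots therefore picks up k factors \<kappa>.\<close>

lemma frame_change_sum:
  assumes e: "frame e" and e': "frame e'" and ab: "multilin k \<alpha>" "multilin k \<beta>"
    and g: "\<And>u v. frame.g e u v = \<kappa> * frame.g e' u v"
  shows "(\<Sum>s\<in>{..<k} \<rightarrow>\<^sub>E I7. \<alpha> (\<lambda>i. dual_frame e' (s i)) * \<beta> (\<lambda>i. dual_frame e' (s i)))
    = \<kappa> ^ k * (\<Sum>s\<in>{..<k} \<rightarrow>\<^sub>E I7. \<alpha> (\<lambda>i. dual_frame e (s i)) * \<beta> (\<lambda>i. dual_frame e (s i)))"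
proof -
  interpret E: frame e by (rule e)
  interpret F: frame e' by (rule e')
  let ?b = "dual_frame e" and ?c = "dual_frame e'"
  have ec: "e j (?c k) = \<kappa> * e' k (?b j)" if "j \<in> I7" "k \<in> I7" for j k
    using E.g_b[OF that(1), of "?c k"] F.g_b[OF that(2), of "?b j"] g[of "?b j" "?c k"]
    by (simp add: E.g_def F.g_def mult.commute)
  have delta: "(\<Sum>k\<in>I7. e i (?c k) * e j (?c k)) = \<kappa> * of_bool (i = j)" if ij: "i \<in> I7" "j \<in> I7" for i j
  proof -
    have "(\<Sum>k\<in>I7. e i (?c k) * e j (?c k)) = \<kappa> * (\<Sum>k\<in>I7. e' k (?b j) * e i (?c k))"
      unfolding sum_distrib_left by (intro sum.cong refl) (simp add: ec[OF ij(2)] mult_ac)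
    also have "\<dots> = \<kappa> * e i (?b j)"
      using F.linear_expand[OF E.e_linear[OF ij(1)], of "?b j"] by simp
    finally show ?thesis
      using E.e_b[OF ij(2,1)] by simp
  qed
  let ?S = "{..<k} \<rightarrow>\<^sub>E I7"
  have fin: "finite ?S" by (intro finite_PiE) auto
  have "(\<Sum>s\<in>?S. \<alpha> (\<lambda>i. ?c (s i)) * \<beta> (\<lambda>i. ?c (s i))) =
      (\<Sum>s\<in>?S. \<Sum>t\<in>?S. \<Sum>t'\<in>?S. (\<alpha> (\<lambda>i. ?b (t i)) * \<beta> (\<lambda>i. ?b (t' i))) * (\<Prod>i<k. e (t i) (?c (s i)) * e (t' i) (?c (s i))))"
    unfolding E.multilin_expand[OF ab(1), of "\<lambda>i. ?c (_ i)"] E.multilin_expand[OF ab(2), of "\<lambda>i. ?c (_ i)"]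
    by (simp add: sum_product prod.distrib mult_ac)
  also have "\<dots> = (\<Sum>t\<in>?S. \<Sum>t'\<in>?S. \<Sum>s\<in>?S. (\<alpha> (\<lambda>i. ?b (t i)) * \<beta> (\<lambda>i. ?b (t' i))) * (\<Prod>i<k. e (t i) (?c (s i)) * e (t' i) (?c (s i))))"
    by (subst sum.swap, rule sum.cong[OF refl], rule sum.swap)
  also have "\<dots> = (\<Sum>t\<in>?S. \<Sum>t'\<in>?S. if t' = t then \<kappa> ^ k * (\<alpha> (\<lambda>i. ?b (t i)) * \<beta> (\<lambda>i. ?b (t i))) else 0)"
  proof (intro sum.cong refl)
    fix t t' assume t: "t \<in> ?S" "t' \<in> ?S"
    have "(\<Sum>s\<in>?S. (\<alpha> (\<lambda>i. ?b (t i)) * \<beta> (\<lambda>i. ?b (t' i))) * (\<Prod>i<k. e (t i) (?c (s i)) * e (t' i) (?c (s i))))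
      = (\<alpha> (\<lambda>i. ?b (t i)) * \<beta> (\<lambda>i. ?b (t' i))) * (\<Prod>i<k. \<Sum>j\<in>I7. e (t i) (?c j) * e (t' i) (?c j))"
      unfolding sum_distrib_left[symmetric] by (subst prod_sum_PiE) auto
    also have "(\<Prod>i<k. \<Sum>j\<in>I7. e (t i) (?c j) * e (t' i) (?c j)) = (\<Prod>i<k. \<kappa> * of_bool (t i = t' i))"
      using t by (intro prod.cong refl delta) (auto simp: PiE_iff)
    also have "\<dots> = (if t' = t then \<kappa> ^ k else 0)"
    proof (cases "t' = t")
      case False
      then obtain i where "i < k" "t i \<noteq> t' i"
        using t by (metis PiE_ext lessThan_iff)
      then show ?thesis
        using False by (auto intro!: prod_zero)
    qed simp
    finally show "(\<Sum>s\<in>?S. (\<alpha> (\<lambda>i. ?b (t i)) * \<beta> (\<lambda>i. ?b (t' i))) * (\<Prod>i<k. e (t i) (?c (s i)) * e (t' i) (?c (s i))))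
      = (if t' = t then \<kappa> ^ k * (\<alpha> (\<lambda>i. ?b (t i)) * \<beta> (\<lambda>i. ?b (t i))) else 0)"
      by simp
  qed
  finally show ?thesis
    using fin by (simp add: sum_distrib_left)
qed

text \<open>\<open>Om\<close> yields \<open>g \<otimes> vol\<close>, which two adapted coframes therefore share; the constant norm of \<open>\<phi>\<close>
  excludes that \<open>g\<close> and \<open>vol\<close> are rescaled by inverse factors.\<close>

theorem hodge_independent:
  assumes e: "adapted_coframe \<phi> e" and e': "adapted_coframe \<phi> e'" and a: "multilin k \<alpha>" and k: "k \<le> 7"
  shows "hodge e k \<alpha> = hodge e' k \<alpha>"
proof
  fix v
  interpret E: frame e using e by unfold_locales (simp add: adapted_coframe_def)
  interpret F: frame e' using e' by unfold_locales (simp add: adapted_coframe_def)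
  have p: "g2_model e = \<phi>" "g2_model e' = \<phi>"
    using e e' by (simp_all add: adapted_coframe_def)
  \<comment> \<open>\<kappa> is the ratio of the two volume forms. Evaluating \<open>Om\<close> on
    the frame of e by \<open>Om_frame\<close> for e and for e' shows that it also relates the
    metrics.\<close>
  define \<kappa> where "\<kappa> = F.vol (\<lambda>m. dual_frame e (Suc m))"
  have g: "E.g u v = \<kappa> * F.g u v" for u v
    using E.Om_frame[of u v "\<lambda>m. dual_frame e (Suc m)"] F.Om_frame[of u v "\<lambda>m. dual_frame e (Suc m)"]
    by (simp add: p E.vol_b \<kappa>_def)
  have m: "multilin 3 \<phi>"
    using alt_form_multilin[OF E.alt_form_g2_model] p by simp
  have "\<kappa> ^ 3 = 1"
    using frame_change_sum[OF E.frame_axioms F.frame_axioms m m g] E.norm_g2_model F.norm_g2_model unfolding p by simp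
  then have "(\<kappa> - 1) * (\<kappa> * \<kappa> + \<kappa> + 1) = 0"
    by (simp add: algebra_simps power3_eq_cube)
  moreover have "\<kappa> * \<kappa> + \<kappa> + 1 = (\<kappa> + 1 / 2)\<^sup>2 + 3 / 4"
    by (simp add: power2_eq_square algebra_simps)
  then have "\<kappa> * \<kappa> + \<kappa> + 1 \<noteq> 0"
    using zero_le_power2[of "\<kappa> + 1 / 2"] by linarith
  ultimately have k1: "\<kappa> = 1"
    by simp
  have vol: "F.vol = E.vol"
    using E.alt_form_7[OF F.alt_form_vol] k1 unfolding \<kappa>_def by (intro ext) simp
  \<comment> \<open>Seen as a function of its first k slots, \<open>vol\<close> is a k-linear form.
    So the Hodge operator is a sum of the kind that \<open>frame_change_sum\<close> transforms, now
    with factor 1.\<close>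
  have n: "multilin k (\<lambda>w. E.vol (\<lambda>i. if i < k then w i else v (i - k)))"
  proof (rule multilinI)
    fix w w' :: "nat \<Rightarrow> real^7" assume "\<And>i. i < k \<Longrightarrow> w i = w' i"
    then have "(\<lambda>i. if i < k then w i else v (i - k)) = (\<lambda>i. if i < k then w' i else v (i - k))"
      by auto
    then show "E.vol (\<lambda>i. if i < k then w i else v (i - k)) = E.vol (\<lambda>i. if i < k then w' i else v (i - k))"
      by simp
  next
    fix w :: "nat \<Rightarrow> real^7" and i assume i: "i < k"
    have eq: "(\<lambda>m. if m < k then (w(i := x)) m else v (m - k)) = (\<lambda>m. if m < k then w m else v (m - k))(i := x)" for x
      using i by auto
    show "linear (\<lambda>x. E.vol (\<lambda>m. if m < k then (w(i := x)) m else v (m - k)))"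
      unfolding eq using i k by (intro multilin_linear[OF alt_form_multilin[OF E.alt_form_vol]]) simp
  qed
  show "hodge e k \<alpha> v = hodge e' k \<alpha> v"
    using frame_change_sum[OF E.frame_axioms F.frame_axioms a n g]
    unfolding E.hodge_eq F.hodge_eq vol k1 by (simp cong: if_cong)
qed

section \<open>Forms on a solvable Lie algebra\<close>

text \<open>Both sides are the inner product of the functionals f and g, which every orthonormal
  basis computes (Parseval). It is used slot by slot to change the basis in quadratic expressions of
  structure constants.\<close>

lemma bilinear_orthonormal_sum:
  fixes B :: "'a::euclidean_space set" and f g :: "'a \<Rightarrow> real"
  assumes B: "finite B" "pairwise orthogonal B" "\<And>x. x \<in> B \<Longrightarrow> norm x = 1" "span B = UNIV"
    and f: "linear f" and g: "linear g"
  shows "(\<Sum>x\<in>B. f x * g x) = (\<Sum>i\<in>Basis. f i * g i)"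
proof -
  have ex: "h x = (\<Sum>i\<in>Basis. (x \<bullet> i) * h i)" if "linear h" for h :: "'a \<Rightarrow> real" and x
    using linear_sum[OF that, of "\<lambda>i. (x \<bullet> i) *\<^sub>R i" Basis] by (simp add: euclidean_representation linear_cmul[OF that])
  have parseval: "(\<Sum>x\<in>B. (x \<bullet> i) * (x \<bullet> j)) = i \<bullet> j" for i j
  proof -
    have "(\<Sum>x\<in>B. (i \<bullet> x) *\<^sub>R x) = i"
      using orthonormal_basis_expand[OF B(2,3) _ B(1), of i] B(4) by simp
    then have "i \<bullet> j = (\<Sum>x\<in>B. (i \<bullet> x) *\<^sub>R x) \<bullet> j" by simp
    also have "\<dots> = (\<Sum>x\<in>B. (i \<bullet> x) * (x \<bullet> j))"
      by (simp only: inner_sum_left inner_scaleR_left)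
    finally show ?thesis
      by (simp only: inner_commute[of i])
  qed
  have "(\<Sum>x\<in>B. f x * g x) = (\<Sum>x\<in>B. \<Sum>i\<in>Basis. \<Sum>j\<in>Basis. ((x \<bullet> i) * (x \<bullet> j)) * (f i * g j))"
    by (subst ex[OF f], subst ex[OF g]) (simp add: sum_product mult_ac)
  also have "\<dots> = (\<Sum>i\<in>Basis. \<Sum>j\<in>Basis. \<Sum>x\<in>B. ((x \<bullet> i) * (x \<bullet> j)) * (f i * g j))"
    by (subst sum.swap, rule sum.cong[OF refl], rule sum.swap)
  also have "\<dots> = (\<Sum>i\<in>Basis. \<Sum>j\<in>Basis. (i \<bullet> j) * (f i * g j))"
    unfolding sum_distrib_right[symmetric] parseval ..
  also have "\<dots> = (\<Sum>i\<in>Basis. f i * g i)"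
    by (intro sum.cong refl) (simp add: inner_Basis if_distrib[of "\<lambda>x. x * _"] cong: if_cong)
  finally show ?thesis .
qed

text \<open>Induction on the length of the chain: a basis adapted to the chain starting at T 1 is
  extended by an orthonormal basis of the orthogonal complement of T 1 in T 0.\<close>

lemma adapted_orthonormal_basis:
  fixes T :: "nat \<Rightarrow> 'a::euclidean_space set"
  assumes "\<And>k. subspace (T k)" "\<And>k. T (Suc k) \<subseteq> T k" "T n = {0}"
  shows "\<exists>B. finite B \<and> pairwise orthogonal B \<and> (\<forall>x\<in>B. norm x = 1) \<and> B \<subseteq> T 0 \<and> span B = T 0 \<and>
    (\<forall>x\<in>B. \<forall>k. x \<in> T k \<or> (\<forall>y\<in>T k. orthogonal x y))"
  using assms
proof (induction n arbitrary: T)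
  case 0
  then have "x \<in> T k \<Longrightarrow> x = 0" for x k
    by (induction k) auto
  then show ?case
    using 0 by (intro exI[of _ "{}"]) auto
next
  case (Suc n)
  have "\<exists>B. finite B \<and> pairwise orthogonal B \<and> (\<forall>x\<in>B. norm x = 1) \<and> B \<subseteq> T (Suc 0) \<and> span B = T (Suc 0) \<and>
    (\<forall>x\<in>B. \<forall>k. x \<in> T (Suc k) \<or> (\<forall>y\<in>T (Suc k). orthogonal x y))"
    using Suc.IH[of "\<lambda>k. T (Suc k)"] Suc.prems by simp
  then obtain B where B: "finite B" "pairwise orthogonal B" "\<forall>x\<in>B. norm x = 1" "B \<subseteq> T (Suc 0)" "span B = T (Suc 0)"
    "\<forall>x\<in>B. \<forall>k. x \<in> T (Suc k) \<or> (\<forall>y\<in>T (Suc k). orthogonal x y)"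
    by blast
  define P where "P = {x \<in> T 0. \<forall>y\<in>T (Suc 0). orthogonal x y}"
  have "subspace P"
    unfolding P_def subspace_def using Suc.prems(1)[of 0]
    by (auto simp: orthogonal_def inner_add_left subspace_0 subspace_add subspace_scale)
  obtain C where C: "C \<subseteq> P" "pairwise orthogonal C" "\<And>x. x \<in> C \<Longrightarrow> norm x = 1" "independent C" "span C = P"
    using orthonormal_basis_subspace[OF \<open>subspace P\<close>] by metis
  have fC: "finite C"
    using C(4) independent_imp_finite by blast
  have down: "T (Suc k) \<subseteq> T (Suc 0)" for k
  proof (induction k)
    case (Suc k)
    then show ?case using Suc.prems \<open>\<And>k. T (Suc k) \<subseteq> T k\<close> by blast
  qed simp
  have "T 0 \<subseteq> span (B \<union> C)"
  proof
    fix x assume x: "x \<in> T 0"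
    obtain y z where yz: "y \<in> span (T (Suc 0))" "\<And>w. w \<in> span (T (Suc 0)) \<Longrightarrow> orthogonal z w" "x = y + z"
      using orthogonal_subspace_decomp_exists[of "T (Suc 0)" x] by metis
    have sp: "span (T (Suc 0)) = T (Suc 0)"
      using Suc.prems(1) by (simp add: span_eq_iff)
    have "z \<in> T 0"
      using yz sp x Suc.prems(1,2)[of 0] by (metis add_diff_cancel_left' subsetD subspace_diff)
    then have "z \<in> P"
      using yz(2) sp by (simp add: P_def)
    then have "z \<in> span (B \<union> C)" "y \<in> span (B \<union> C)"
      using C(5) B(5) yz(1) sp span_mono[of B "B \<union> C"] span_mono[of C "B \<union> C"] by auto
    then show "x \<in> span (B \<union> C)"
      using yz(3) span_add by blast
  qed
  moreover have sub: "B \<union> C \<subseteq> T 0"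
    using B(4) C(1) Suc.prems(2)[of 0] by (auto simp: P_def)
  ultimately have "span (B \<union> C) = T 0"
    using Suc.prems(1)[of 0] span_minimal by blast
  moreover have "pairwise orthogonal (B \<union> C)"
  proof -
    have "orthogonal x y \<and> orthogonal y x" if "x \<in> B" "y \<in> C" for x y
      using that B(4) C(1) orthogonal_commute unfolding P_def by blast
    then show ?thesis
      using B(2) C(2) by (auto simp: pairwise_def)
  qed
  moreover have "x \<in> T k \<or> (\<forall>y\<in>T k. orthogonal x y)" if "x \<in> B \<union> C" for x k
  proof (cases k)
    case 0
    then show ?thesis using sub that by auto
  next
    case (Suc m)
    then show ?thesis
      using that B(6) C(1) down[of m] by (auto simp: P_def)
  qed
  ultimately show ?case
    using B(1,3) C(3) fC sub by (intro exI[of _ "B \<union> C"]) auto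
qed

text \<open>In an orthonormal basis adapted to the chain, \<open>[x, y]\<close> lies strictly deeper than \<open>x\<close> and \<open>y\<close>, so the
  mixed products vanish; the expression does not depend on the orthonormal basis.\<close>

lemma solvable_structure_constants:
  fixes br :: "'a::euclidean_space \<Rightarrow> 'a \<Rightarrow> 'a"
  assumes br: "bilinear br"
    and T: "\<And>k. subspace (T k)" "T 0 = UNIV" "\<And>k. T (Suc k) \<subseteq> T k" "T n = {0}"
      "\<And>k x y. x \<in> T k \<Longrightarrow> y \<in> T k \<Longrightarrow> br x y \<in> T (Suc k)"
  shows "0 \<le> (\<Sum>i\<in>Basis. \<Sum>j\<in>Basis. \<Sum>k\<in>Basis. (br i j \<bullet> k)\<^sup>2 - 2 * ((br i j \<bullet> k) * (br j k \<bullet> i)))"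
proof -
  obtain B where B: "finite B" "pairwise orthogonal B" "\<And>x. x \<in> B \<Longrightarrow> norm x = 1" "span B = UNIV"
    and ad: "\<And>x k. x \<in> B \<Longrightarrow> x \<in> T k \<or> (\<forall>y\<in>T k. orthogonal x y)"
    using adapted_orthonormal_basis[OF T(1,3,4)] T(2) by metis
  have T1: "linear (\<lambda>x. br x y \<bullet> z)" "linear (\<lambda>x. br y x \<bullet> z)" "linear (\<lambda>x. br y z \<bullet> x)" for y z
    by (auto intro!: linearI simp: bilinear_ladd[OF br] bilinear_radd[OF br] bilinear_lmul[OF br] bilinear_rmul[OF br]
      inner_add_left inner_add_right)
  note O = bilinear_orthonormal_sum[OF B]
  define c where "c i j k = br i j \<bullet> k" for i j k
  have chg: "(\<Sum>i\<in>B. \<Sum>j\<in>B. \<Sum>k\<in>B. f1 i j k * f2 i j k) = (\<Sum>i\<in>Basis. \<Sum>j\<in>Basis. \<Sum>k\<in>Basis. f1 i j k * f2 i j k)"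
    if l: "\<And>j k. linear (\<lambda>i. f1 i j k)" "\<And>i k. linear (\<lambda>j. f1 i j k)" "\<And>i j. linear (\<lambda>k. f1 i j k)"
      "\<And>j k. linear (\<lambda>i. f2 i j k)" "\<And>i k. linear (\<lambda>j. f2 i j k)" "\<And>i j. linear (\<lambda>k. f2 i j k)" for f1 f2 :: "'a \<Rightarrow> 'a \<Rightarrow> 'a \<Rightarrow> real"
  proof -
    have "(\<Sum>i\<in>B. \<Sum>j\<in>B. \<Sum>k\<in>B. f1 i j k * f2 i j k) = (\<Sum>i\<in>B. \<Sum>j\<in>B. \<Sum>k\<in>Basis. f1 i j k * f2 i j k)"
      by (intro sum.cong refl O l)
    also have "\<dots> = (\<Sum>i\<in>B. \<Sum>k\<in>Basis. \<Sum>j\<in>B. f1 i j k * f2 i j k)"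
      by (rule sum.cong[OF refl], rule sum.swap)
    also have "\<dots> = (\<Sum>i\<in>B. \<Sum>k\<in>Basis. \<Sum>j\<in>Basis. f1 i j k * f2 i j k)"
      by (intro sum.cong refl O l)
    also have "\<dots> = (\<Sum>k\<in>Basis. \<Sum>j\<in>Basis. \<Sum>i\<in>B. f1 i j k * f2 i j k)"
      by (subst sum.swap, rule sum.cong[OF refl], rule sum.swap)
    also have "\<dots> = (\<Sum>k\<in>Basis. \<Sum>j\<in>Basis. \<Sum>i\<in>Basis. f1 i j k * f2 i j k)"
      by (intro sum.cong refl O l)
    also have "\<dots> = (\<Sum>i\<in>Basis. \<Sum>j\<in>Basis. \<Sum>k\<in>Basis. f1 i j k * f2 i j k)"
      by (subst (2) sum.swap, subst sum.swap, subst (2) sum.swap) (rule refl)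
    finally show ?thesis .
  qed
  have p: "(\<Sum>i\<in>B. \<Sum>j\<in>B. \<Sum>k\<in>B. c i j k * c i j k) = (\<Sum>i\<in>Basis. \<Sum>j\<in>Basis. \<Sum>k\<in>Basis. c i j k * c i j k)"
    by (rule chg) (auto simp: c_def T1)
  have q: "(\<Sum>i\<in>B. \<Sum>j\<in>B. \<Sum>k\<in>B. c i j k * c j k i) = (\<Sum>i\<in>Basis. \<Sum>j\<in>Basis. \<Sum>k\<in>Basis. c i j k * c j k i)"
    by (rule chg) (auto simp: c_def T1)
  have cyc: "(\<Sum>i\<in>B. \<Sum>j\<in>B. \<Sum>k\<in>B. h j k i) = (\<Sum>i\<in>B. \<Sum>j\<in>B. \<Sum>k\<in>B. h i j k)" for h :: "'a \<Rightarrow> 'a \<Rightarrow> 'a \<Rightarrow> real"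
    by (subst sum.swap, rule sum.cong[OF refl], rule sum.swap)
  \<comment> \<open>Take the first level m that does not contain k. Then i and j lie in level m - 1,
    so [i, j] lies in level m, and k is orthogonal to that level.\<close>
  have zero: "c i j k = 0" if ijk: "i \<in> B" "j \<in> B" "k \<in> B" and kmin: "\<And>m. k \<in> T m \<Longrightarrow> i \<in> T m \<and> j \<in> T m" for i j k
  proof -
    have "k \<noteq> 0" using B(3)[OF ijk(3)] by auto
    then have "\<not> k \<in> T n" using T(4) by simp
    define m where "m = (LEAST m. k \<notin> T m)"
    have km: "k \<notin> T m"
      unfolding m_def using \<open>\<not> k \<in> T n\<close> by (rule LeastI)
    then obtain l where l: "m = Suc l"
      using T(2) by (cases m) auto
    have "k \<in> T l"
      using not_less_Least[of l "\<lambda>m. k \<notin> T m"] l unfolding m_def by auto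
    then have "br i j \<in> T m"
      using kmin T(5) l by auto
    then show ?thesis
      using ad[OF ijk(3), of m] km by (auto simp: c_def orthogonal_def inner_commute)
  qed
  \<comment> \<open>Of three basis vectors one lies least deep in the chain, and the coefficient of
    the bracket of the other two along it vanishes. If one of x, y, z is zero, then x^2 + y^2 + z^2
    - 2 (x y + y z + z x) is the square of a difference.\<close>
  have nn: "0 \<le> c i j k * c i j k + c j k i * c j k i + c k i j * c k i j - 2 * (c i j k * c j k i + c j k i * c k i j + c k i j * c i j k)"
    if ijk: "i \<in> B" "j \<in> B" "k \<in> B" for i j k
  proof -
    have chain: "T m \<subseteq> T l" if "l \<le> m" for l m
      using that by (induction rule: dec_induct) (use T(3) in auto)
    have lin: "(\<forall>m. x \<in> T m \<longrightarrow> y \<in> T m) \<or> (\<forall>m. y \<in> T m \<longrightarrow> x \<in> T m)" for x y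
      using chain by (metis nat_le_linear subsetD)
    consider "\<forall>m. k \<in> T m \<longrightarrow> i \<in> T m \<and> j \<in> T m" | "\<forall>m. i \<in> T m \<longrightarrow> j \<in> T m \<and> k \<in> T m" | "\<forall>m. j \<in> T m \<longrightarrow> k \<in> T m \<and> i \<in> T m"
      using lin[of i j] lin[of j k] lin[of i k] by blast
    then have "c i j k = 0 \<or> c j k i = 0 \<or> c k i j = 0"
      using zero[of i j k] zero[of j k i] zero[of k i j] ijk by cases auto
    moreover have "0 \<le> (x - y)\<^sup>2" for x y :: real by simp
    note this[of "c i j k" "c j k i"] this[of "c j k i" "c k i j"] this[of "c k i j" "c i j k"]
    ultimately show ?thesis
      by (auto simp: power2_eq_square algebra_simps)
  qed
  let ?S = "\<lambda>h. (\<Sum>i\<in>B. \<Sum>j\<in>B. \<Sum>k\<in>B. h i j k) :: real"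
  have "0 \<le> ?S (\<lambda>i j k. c i j k * c i j k + c j k i * c j k i + c k i j * c k i j - 2 * (c i j k * c j k i + c j k i * c k i j + c k i j * c i j k))"
    by (intro sum_nonneg nn)
  also have "\<dots> = ?S (\<lambda>i j k. c i j k * c i j k) + ?S (\<lambda>i j k. c j k i * c j k i) + ?S (\<lambda>i j k. c k i j * c k i j)
     - 2 * (?S (\<lambda>i j k. c i j k * c j k i) + ?S (\<lambda>i j k. c j k i * c k i j) + ?S (\<lambda>i j k. c k i j * c i j k))"
    by (simp add: sum.distrib sum_subtractf sum_distrib_left)
  also have "\<dots> = 3 * (?S (\<lambda>i j k. c i j k * c i j k) - 2 * ?S (\<lambda>i j k. c i j k * c j k i))"
    using cyc[of "\<lambda>i j k. c i j k * c i j k"] cyc[of "\<lambda>i j k. c j k i * c j k i"]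
      cyc[of "\<lambda>i j k. c i j k * c j k i"] cyc[of "\<lambda>i j k. c j k i * c k i j"] by simp
  finally have "0 \<le> ?S (\<lambda>i j k. c i j k * c i j k) - 2 * ?S (\<lambda>i j k. c i j k * c j k i)"
    by simp
  also have "\<dots> = (\<Sum>i\<in>Basis. \<Sum>j\<in>Basis. \<Sum>k\<in>Basis. (c i j k)\<^sup>2 - 2 * (c i j k * c j k i))"
    unfolding p q by (simp add: sum_subtractf sum_distrib_left power2_eq_square)
  finally show ?thesis
    unfolding c_def .
qed

section \<open>The Chevalley-Eilenberg differential in a frame\<close>

lemma alternating4_perms:
  fixes F :: "nat \<Rightarrow> nat \<Rightarrow> nat \<Rightarrow> nat \<Rightarrow> real"
  assumes "\<And>i j k l. F j i k l = - F i j k l" "\<And>i j k l. F i k j l = - F i j k l" "\<And>i j k l. F i j l k = - F i j k l"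
  shows
    "F i j l k = - F i j k l"
    "F i k j l = - F i j k l"
    "F i k l j = F i j k l"
    "F i l j k = F i j k l"
    "F i l k j = - F i j k l"
    "F j i k l = - F i j k l"
    "F j i l k = F i j k l"
    "F j k i l = F i j k l"
    "F j k l i = - F i j k l"
    "F j l i k = - F i j k l"
    "F j l k i = F i j k l"
    "F k i j l = F i j k l"
    "F k i l j = - F i j k l"
    "F k j i l = - F i j k l"
    "F k j l i = F i j k l"
    "F k l i j = F i j k l"
    "F k l j i = - F i j k l"
    "F l i j k = - F i j k l"
    "F l i k j = F i j k l"
    "F l j i k = F i j k l"
    "F l j k i = - F i j k l"
    "F l k i j = - F i j k l"
    "F l k j i = F i j k l"
  using assms(1)[of i j k l]
    assms(1)[of i j l k]
    assms(1)[of i k j l]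
    assms(1)[of i k l j]
    assms(1)[of i l j k]
    assms(1)[of i l k j]
    assms(1)[of j k i l]
    assms(1)[of j k l i]
    assms(1)[of j l i k]
    assms(1)[of j l k i]
    assms(1)[of k l i j]
    assms(1)[of k l j i]
    assms(2)[of i j k l]
    assms(2)[of i j l k]
    assms(2)[of i k l j]
    assms(2)[of j i k l]
    assms(2)[of j i l k]
    assms(2)[of j k l i]
    assms(2)[of k i l j]
    assms(2)[of k j l i]
    assms(3)[of i j k l]
    assms(3)[of i k j l]
    assms(3)[of j i k l]
    assms(3)[of j k i l]
    assms(3)[of k i j l]
    assms(3)[of k j i l]
  by linarith+

text \<open>\<star>\<phi> has seven nonzero coefficients up to reordering, and each is met in 4! =
  24 orders. This is the origin of the seven terms in the formula for \<open>tau\<close>.\<close>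

lemma sum_alternating_ps:
  fixes F :: "nat \<Rightarrow> nat \<Rightarrow> nat \<Rightarrow> nat \<Rightarrow> real"
  assumes F: "\<And>i j k l. F j i k l = - F i j k l" "\<And>i j k l. F i k j l = - F i j k l" "\<And>i j k l. F i j l k = - F i j k l"
  shows "(\<Sum>i\<in>I7. \<Sum>j\<in>I7. \<Sum>k\<in>I7. \<Sum>l\<in>I7. F i j k l * ps i j k l) = 24 * (- F 1 2 4 7 - F 1 2 5 6 - F 1 3 4 6 + F 1 3 5 7 + F 2 3 4 5 + F 2 3 6 7 + F 4 5 6 7)"
proof -
  show ?thesis
    unfolding sum_I7 ps_table ph_def oct_table
    by (simp add: alternating4_perms[where F = F and i = 1 and j = 2 and k = 4 and l = 7, OF F]
    alternating4_perms[where F = F and i = 1 and j = 2 and k = 5 and l = 6, OF F]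
    alternating4_perms[where F = F and i = 1 and j = 3 and k = 4 and l = 6, OF F]
    alternating4_perms[where F = F and i = 1 and j = 3 and k = 5 and l = 7, OF F]
    alternating4_perms[where F = F and i = 2 and j = 3 and k = 4 and l = 5, OF F]
    alternating4_perms[where F = F and i = 2 and j = 3 and k = 6 and l = 7, OF F]
    alternating4_perms[where F = F and i = 4 and j = 5 and k = 6 and l = 7, OF F])
qed

text \<open>The Chevalley--Eilenberg differential on 3-forms and 4-forms.\<close>

definition CE3 :: "('v::real_vector \<Rightarrow> 'v \<Rightarrow> 'v) \<Rightarrow> 'v mform \<Rightarrow> 'v mform" where
  "CE3 br \<alpha> v = - \<alpha> ((!) [br (v 0) (v 1), v 2, v 3]) + \<alpha> ((!) [br (v 0) (v 2), v 1, v 3]) - \<alpha> ((!) [br (v 0) (v 3), v 1, v 2])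
     - \<alpha> ((!) [br (v 1) (v 2), v 0, v 3]) + \<alpha> ((!) [br (v 1) (v 3), v 0, v 2]) - \<alpha> ((!) [br (v 2) (v 3), v 0, v 1])"

definition CE4 :: "('v::real_vector \<Rightarrow> 'v \<Rightarrow> 'v) \<Rightarrow> 'v mform \<Rightarrow> 'v mform" where
  "CE4 br \<alpha> v = - \<alpha> ((!) [br (v 0) (v 1), v 2, v 3, v 4]) + \<alpha> ((!) [br (v 0) (v 2), v 1, v 3, v 4])
     - \<alpha> ((!) [br (v 0) (v 3), v 1, v 2, v 4]) + \<alpha> ((!) [br (v 0) (v 4), v 1, v 2, v 3])
     - \<alpha> ((!) [br (v 1) (v 2), v 0, v 3, v 4]) + \<alpha> ((!) [br (v 1) (v 3), v 0, v 2, v 4])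
     - \<alpha> ((!) [br (v 1) (v 4), v 0, v 2, v 3]) - \<alpha> ((!) [br (v 2) (v 3), v 0, v 1, v 4])
     + \<alpha> ((!) [br (v 2) (v 4), v 0, v 1, v 3]) - \<alpha> ((!) [br (v 3) (v 4), v 0, v 1, v 2])"

lemma alt_form_list_swaps:
  assumes "alt_form 3 \<alpha>"
  shows "\<alpha> ((!) [y, x, z]) = - \<alpha> ((!) [x, y, z])" "\<alpha> ((!) [x, z, y]) = - \<alpha> ((!) [x, y, z])"
  using alt_form_list_swap[OF assms, of "[]" y x "[z]" "\<lambda>x. x"] alt_form_list_swap[OF assms, of "[x]" z y "[]" "\<lambda>x. x"] by simp_all

lemma alt_form_list_swaps_4:
  assumes "alt_form 4 \<alpha>"
  shows "\<alpha> ((!) [y, x, z, w]) = - \<alpha> ((!) [x, y, z, w])" "\<alpha> ((!) [x, z, y, w]) = - \<alpha> ((!) [x, y, z, w])"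
    "\<alpha> ((!) [x, y, w, z]) = - \<alpha> ((!) [x, y, z, w])"
  using alt_form_list_swap[OF assms, of "[]" y x "[z, w]" "\<lambda>x. x"] alt_form_list_swap[OF assms, of "[x]" z y "[w]" "\<lambda>x. x"]
    alt_form_list_swap[OF assms, of "[x, y]" w z "[]" "\<lambda>x. x"] by simp_all

lemma alt_form_CE3:
  assumes br: "bilinear br" "\<And>x y. br y x = - br x y" and a: "alt_form 3 \<alpha>"
  shows "alt_form 4 (CE3 br \<alpha>)"
proof (rule alt_formI)
  note m = alt_form_multilin[OF a]
  note l = multilin_3_linear[OF m]
  have l1: "linear (\<lambda>x. \<alpha> ((!) [br x y, u, v]))" "linear (\<lambda>x. \<alpha> ((!) [br y x, u, v]))" for y u v
    using linear_compose[of "\<lambda>x. br x y" "\<lambda>x. \<alpha> ((!) [x, u, v])"] linear_compose[of "br y" "\<lambda>x. \<alpha> ((!) [x, u, v])"] l(1) br(1)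
    by (auto simp: bilinear_def o_def)
  show "multilin 4 (CE3 br \<alpha>)"
  proof (rule multilinI)
    fix v w :: "nat \<Rightarrow> 'a" assume "\<And>i. i < 4 \<Longrightarrow> v i = w i"
    from this[of 0] this[of 1] this[of 2] this[of 3] show "CE3 br \<alpha> v = CE3 br \<alpha> w"
      unfolding CE3_def by simp
  next
    fix v :: "nat \<Rightarrow> 'a" and i :: nat assume "i < 4"
    then consider "i = 0" | "i = 1" | "i = 2" | "i = 3" by linarith
    then show "linear (\<lambda>x. CE3 br \<alpha> (v(i := x)))"
      unfolding CE3_def
      by cases (simp, intro linear_compose_add linear_compose_sub linear_compose_neg l l1)+
  qed
  note s = alt_form_list_swaps[OF a]
  fix v :: "nat \<Rightarrow> 'a" and i j :: nat assume ij: "i < j" "j < 4" "v i = v j"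
  have z: "\<alpha> ((!) [x, y, y]) = 0" for x y
    using s(2)[of x y y] by simp
  have b0: "br x x = 0" for x
  proof -
    have "2 *\<^sub>R br x x = 0"
      using br(2)[of x x] by (simp add: scaleR_2 eq_neg_iff_add_eq_0)
    then show ?thesis by simp
  qed
  have a0: "\<alpha> ((!) [0, y, z]) = 0" for y z
    using linear_0[OF l(1)] .
  have an: "\<alpha> ((!) [- x, y, z]) = - \<alpha> ((!) [x, y, z])" for x y z
    using linear_neg[OF l(1)] .
  consider "i = 0" "j = 1" | "i = 0" "j = 2" | "i = 0" "j = 3" | "i = 1" "j = 2" | "i = 1" "j = 3" | "i = 2" "j = 3"
    using ij(1,2) by linarith
  then show "CE3 br \<alpha> v = 0"
  proof cases
    case 1
    then show ?thesis using ij(3) unfolding CE3_def by (simp add: z b0 a0)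
  next
    case 2
    then show ?thesis using ij(3) s(2)[of "br (v 0) (v 3)" "v 0" "v 1"] br(2)[of "v 0" "v 1"] unfolding CE3_def
      by (simp add: z b0 a0 an)
  next
    case 3
    then show ?thesis using ij(3) br(2)[of "v 0" "v 1"] br(2)[of "v 0" "v 2"] s(2)[of "br (v 0) (v 1)" "v 0" "v 2"] s(2)[of "br (v 0) (v 2)" "v 0" "v 1"] unfolding CE3_def
      by (simp add: z b0 a0 an)
  next
    case 4
    then show ?thesis using ij(3) unfolding CE3_def by (simp add: z b0 a0)
  next
    case 5
    then show ?thesis using ij(3) br(2)[of "v 1" "v 2"] s(2)[of "br (v 0) (v 1)" "v 1" "v 2"] unfolding CE3_def
      by (simp add: z b0 a0 an)
  next
    case 6
    then show ?thesis using ij(3) unfolding CE3_def by (simp add: z b0 a0)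
  qed
qed


context frame
begin

text \<open>The value 0 for k outside \<open>I7\<close> makes skewness in i and j hold for all
  indices, as the coefficient locale demands: e k is known to be linear for k in \<open>I7\<close>
  only.\<close>

definition "cc br i j k = (if k \<in> I7 then e k (br (b i) (b j)) else 0)"

lemma linear_br_frame: "linear f \<Longrightarrow> f (br (b i) (b j)) = (\<Sum>m\<in>I7. cc br i j m * f (b m))" for f :: "real^7 \<Rightarrow> real"
  unfolding linear_expand[of f "br (b i) (b j)"] by (simp add: cc_def)

lemma CE3_frame:
  assumes "multilin 3 \<alpha>"
  shows "CE3 br \<alpha> ((!) [b i, b j, b k, b l]) = ce3 (cc br) (\<lambda>i j k. \<alpha> ((!) [b i, b j, b k])) i j k l"
  unfolding CE3_def ce3_def
  by (simp add: linear_br_frame[OF multilin_3_linear(1)[OF assms]] sum.distrib sum_subtractf sum_negf)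

lemma multilin_4_linear:
  assumes "multilin 4 \<alpha>"
  shows "linear (\<lambda>x. \<alpha> ((!) [x, u, v, w]))"
proof -
  have "\<alpha> ((!) [x, u, v, w]) = \<alpha> (((!) [0, u, v, w])(0 := x))" for x
    by (rule multilin_cong[OF assms]) (auto simp: less_numerals)
  then show ?thesis
    using multilin_linear[OF assms] by simp
qed

lemma CE4_frame:
  assumes "multilin 4 \<alpha>"
  shows "CE4 br \<alpha> ((!) [b i, b j, b k, b l, b n]) = ce4 (cc br) (\<lambda>i j k l. \<alpha> ((!) [b i, b j, b k, b l])) i j k l n"
  unfolding CE4_def ce4_def
  by (simp add: linear_br_frame[OF multilin_4_linear[OF assms]] sum.distrib sum_subtractf sum_negf)

lemma ce3_cong: "(\<And>i j k. \<lbrakk>i \<in> I7; j \<in> I7; k \<in> I7\<rbrakk> \<Longrightarrow> \<alpha> i j k = \<beta> i j k) \<Longrightarrow> i \<in> I7 \<Longrightarrow> j \<in> I7 \<Longrightarrow> k \<in> I7 \<Longrightarrow> l \<in> I7 \<Longrightarrow>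
    ce3 c \<alpha> i j k l = ce3 c \<beta> i j k l"
  unfolding ce3_def by (intro sum.cong refl) simp

lemma ce4_cong: "(\<And>i j k l. \<lbrakk>i \<in> I7; j \<in> I7; k \<in> I7; l \<in> I7\<rbrakk> \<Longrightarrow> \<alpha> i j k l = \<beta> i j k l) \<Longrightarrow>
    i \<in> I7 \<Longrightarrow> j \<in> I7 \<Longrightarrow> k \<in> I7 \<Longrightarrow> l \<in> I7 \<Longrightarrow> n \<in> I7 \<Longrightarrow> ce4 c \<alpha> i j k l n = ce4 c \<beta> i j k l n"
  unfolding ce4_def by (intro sum.cong refl) simp

text \<open>The map E sends the dual frame to the standard basis, hence is an isometry from the
  metric of the frame to the Euclidean one. Carrying the bracket and the chain along it reduces the
  claim to \<open>solvable_structure_constants\<close>.\<close>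

lemma cc_PQ:
  fixes br :: "real^7 \<Rightarrow> real^7 \<Rightarrow> real^7"
  assumes br: "bilinear br"
    and T: "\<And>k. subspace (T k)" "T 0 = UNIV" "\<And>k. T (Suc k) \<subseteq> T k" "T n = {0}"
      "\<And>k x y. x \<in> T k \<Longrightarrow> y \<in> T k \<Longrightarrow> br x y \<in> T (Suc k)"
  shows "0 \<le> (\<Sum>i\<in>I7. \<Sum>j\<in>I7. \<Sum>k\<in>I7. (cc br i j k)\<^sup>2 - 2 * (cc br i j k * cc br j k i))"
proof -
  have "card I7 = card (Basis :: (real^7) set)"
    by (simp add: I7_def)
  then obtain h where h: "bij_betw h I7 (Basis :: (real^7) set)"
    using finite_same_card_bij[of I7 "Basis :: (real^7) set"] by auto
  define E where "E v = (\<Sum>i\<in>I7. e i v *\<^sub>R h i)" for v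
  define E' where "E' w = (\<Sum>i\<in>I7. (w \<bullet> h i) *\<^sub>R b i)" for w
  have hB: "h i \<in> Basis" if "i \<in> I7" for i
    using h that by (auto simp: bij_betw_def)
  have hh: "h i \<bullet> h j = of_bool (i = j)" if "i \<in> I7" "j \<in> I7" for i j
    using h that hB by (auto simp: inner_Basis bij_betw_def inj_on_def)
  have Eh: "E v \<bullet> h j = e j v" if "j \<in> I7" for v j
    unfolding E_def using that by (simp add: inner_sum_left hh sum_I7_delta(1) del: sum_mult_of_bool_eq)
  have E'E: "E' (E v) = v" for v
    unfolding E'_def using expand[of v] by (simp add: Eh cong: sum.cong)
  have Eb: "E (b i) = h i" if "i \<in> I7" for i
  proof -
    have "E (b i) = (\<Sum>j\<in>I7. if j = i then h j else 0)"
      unfolding E_def using that by (intro sum.cong refl) (simp add: e_b)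
    then show ?thesis using that by simp
  qed
  have E'h: "E' (h i) = b i" if "i \<in> I7" for i
    using E'E[of "b i"] Eb[OF that] by simp
  have linE: "linear E"
    unfolding E_def by (intro linear_compose_sum ballI linearI) (simp_all add: linear_add[OF e_linear] linear_cmul[OF e_linear] algebra_simps)
  have linE': "linear E'"
    unfolding E'_def by (intro linear_compose_sum ballI linearI) (simp_all add: inner_add_left algebra_simps)
  have EE': "E (E' w) = w" for w
  proof -
    have "E (E' w) = (\<Sum>i\<in>I7. (w \<bullet> h i) *\<^sub>R h i)"
      unfolding E'_def by (simp add: linear_sum[OF linE] linear_cmul[OF linE] Eb)
    also have "\<dots> = (\<Sum>x\<in>Basis. (w \<bullet> x) *\<^sub>R x)"
      by (rule sum.reindex_bij_betw[OF h])
    finally show ?thesis by (simp add: euclidean_representation)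
  qed
  define br' where "br' x y = E (br (E' x) (E' y))" for x y
  have "bilinear br'"
    unfolding br'_def bilinear_def using br linE linE'
    by (auto intro!: linearI simp: linear_add linear_cmul bilinear_ladd bilinear_radd bilinear_lmul bilinear_rmul)
  moreover have "subspace (E ` T k)" for k
    using linear_subspace_image[OF linE T(1)] .
  moreover have "E ` T 0 = UNIV"
    unfolding T(2) using EE' by (metis surjI)
  moreover have "E ` T (Suc k) \<subseteq> E ` T k" for k
    using T(3) by blast
  moreover have "E ` T n = {0}"
    unfolding T(4) using linear_0[OF linE] by simp
  moreover have "br' x y \<in> E ` T (Suc k)" if "x \<in> E ` T k" "y \<in> E ` T k" for x y k
    using that T(5)[of _ k] by (auto simp: br'_def E'E)
  ultimately have "0 \<le> (\<Sum>i\<in>Basis. \<Sum>j\<in>Basis. \<Sum>k\<in>Basis. (br' i j \<bullet> k)\<^sup>2 - 2 * ((br' i j \<bullet> k) * (br' j k \<bullet> i)))"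
    by (rule solvable_structure_constants[of br' "\<lambda>k. E ` T k" n])
  also have "\<dots> = (\<Sum>i\<in>I7. \<Sum>j\<in>I7. \<Sum>k\<in>I7. (br' (h i) (h j) \<bullet> h k)\<^sup>2 - 2 * ((br' (h i) (h j) \<bullet> h k) * (br' (h j) (h k) \<bullet> h i)))"
    by (simp only: sum.reindex_bij_betw[OF h, symmetric])
  also have "\<dots> = (\<Sum>i\<in>I7. \<Sum>j\<in>I7. \<Sum>k\<in>I7. (cc br i j k)\<^sup>2 - 2 * (cc br i j k * cc br j k i))"
    by (intro sum.cong refl) (simp add: br'_def E'h Eh cc_def)
  finally show ?thesis .
qed


lemma list_frame: "length is = k \<Longrightarrow> multilin k \<alpha> \<Longrightarrow> \<alpha> (\<lambda>m. b (is ! m)) = \<alpha> ((!) (map b is))"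
  by (rule multilin_list) auto

lemma one_form_linear:
  assumes \<theta>: "multilin 1 \<theta>"
  shows "linear (\<lambda>x. \<theta> (\<lambda>_. x))" "\<theta> = (\<lambda>v. \<theta> (\<lambda>_. v 0))"
proof -
  have "\<theta> (\<lambda>_. x) = \<theta> ((\<lambda>_. 0)(0 := x))" for x
    by (rule multilin_cong[OF \<theta>]) auto
  then show "linear (\<lambda>x. \<theta> (\<lambda>_. x))"
    using multilin_linear[OF \<theta>, of 0] by simp
  show "\<theta> = (\<lambda>v. \<theta> (\<lambda>_. v 0))"
    by (intro ext multilin_cong[OF \<theta>]) auto
qed

lemma hodge_g2_frame:
  assumes "i \<in> I7" "j \<in> I7" "k \<in> I7" "l \<in> I7"
  shows "hodge e 3 (g2_model e) ((!) [b i, b j, b k, b l]) = ps i j k l"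
  using hodge_g2_frame'[OF assms] list_frame[of "[i, j, k, l]" 4 "hodge e 3 (g2_model e)"]
    alt_form_multilin[OF alt_form_hodge[of 3 "g2_model e"]] by simp

lemma alt_form_torsion:
  "alt_form 3 (\<lambda>v. 1 / 6 * hodge e 7 \<beta> v * g2_model e v - hodge e 4 \<gamma> v + hodge e 4 \<delta> v)"
proof -
  define r where "r = hodge e 7 \<beta> (\<lambda>_. 0)"
  have r: "hodge e 7 \<beta> = (\<lambda>v. r)"
    unfolding r_def by (intro ext hodge_cong) simp
  have "alt_form 3 (hodge e 4 \<alpha>)" for \<alpha>
    using alt_form_hodge[of 4 \<alpha>] by simp
  then show ?thesis
    unfolding r by (intro alt_form_add alt_form_diff alt_form_cmult alt_form_g2_model)
qed

text \<open>The passage between forms and coefficients: evaluating the hypotheses on frame vectors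
  gives the locale assumptions, and the coefficient identities obtained there determine the forms by
  \<open>multilin_eqI\<close>.\<close>

lemma strong_parallel_algebra:
  fixes br :: "real^7 \<Rightarrow> real^7 \<Rightarrow> real^7" and \<theta> :: "(real^7) mform"
  defines "\<phi> \<equiv> g2_model e"
  defines "\<psi> \<equiv> hodge e 3 \<phi>"
  defines "Tor \<equiv> \<lambda>v. 1 / 6 * hodge e 7 (wedge 4 3 (CE3 br \<phi>) \<phi>) v * \<phi> v - hodge e 4 (CE3 br \<phi>) v + hodge e 4 (wedge 1 3 \<theta> \<phi>) v"
  assumes br: "bilinear br" "\<And>x y. br y x = - br x y"
    and jacobi: "\<And>x y z. br (br x y) z + br (br y z) x + br (br z x) y = 0"
    and S: "\<And>k. subspace (S k)" "S 0 = UNIV" "\<And>k. S (Suc k) \<subseteq> S k" "S N = {0}"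
      "\<And>k x y. x \<in> S k \<Longrightarrow> y \<in> S k \<Longrightarrow> br x y \<in> S (Suc k)"
    and \<theta>: "multilin 1 \<theta>"
    and Lee: "CE4 br \<psi> = wedge 1 4 \<theta> \<psi>"
    and dT: "CE3 br Tor = (\<lambda>v. 0)"
  shows "CE3 br \<phi> = (\<lambda>v. 0)" "CE4 br \<psi> = (\<lambda>v. 0)"
proof -
  define f where "f x = \<theta> (\<lambda>_. x)" for x
  have f: "linear f" and \<theta>f: "\<theta> = (\<lambda>v. f (v 0))"
    using one_form_linear[OF \<theta>] unfolding f_def by blast+
  have a\<phi>: "alt_form 3 \<phi>"
    unfolding \<phi>_def by (rule alt_form_g2_model)
  have a\<psi>: "alt_form 4 \<psi>"
    using alt_form_hodge[of 3 \<phi>] unfolding \<psi>_def by simp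
  note m\<phi> = alt_form_multilin[OF a\<phi>] and m\<psi> = alt_form_multilin[OF a\<psi>]
  have ad\<phi>: "alt_form 4 (CE3 br \<phi>)"
    by (rule alt_form_CE3[OF br a\<phi>])
  have a\<theta>\<phi>: "alt_form 4 (wedge 1 3 \<theta> \<phi>)"
    using alt_form_wedge[OF \<theta> m\<phi>] by simp
  have aTor: "alt_form 3 Tor"
    unfolding Tor_def \<phi>_def by (rule alt_form_torsion)
  have \<phi>_frame: "\<phi> ((!) [b i, b j, b k]) = ph i j k" if "i \<in> I7" "j \<in> I7" "k \<in> I7" for i j k
    unfolding \<phi>_def by (rule g2_model_frame[OF that])
  have \<psi>_frame: "\<psi> ((!) [b i, b j, b k, b l]) = ps i j k l" if "i \<in> I7" "j \<in> I7" "k \<in> I7" "l \<in> I7" for i j k l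
    unfolding \<psi>_def \<phi>_def by (rule hodge_g2_frame[OF that])
  let ?c = "cc br"
  define th where "th i = f (b i)" for i
  define T where "T i j k = Tor ((!) [b i, b j, b k])" for i j k
  \<comment> \<open>A 0-form is a constant function of the argument sequence, so any argument
    serves.\<close>
  define tau where "tau = hodge e 7 (wedge 4 3 (CE3 br \<phi>) \<phi>) (\<lambda>_. 0)"
  define F where "F i j k l = CE3 br \<phi> ((!) [b i, b j, b k, b l])" for i j k l
  have F_eq: "F i j k l = ce3 ?c ph i j k l" if "i \<in> I7" "j \<in> I7" "k \<in> I7" "l \<in> I7" for i j k l
    unfolding F_def CE3_frame[OF m\<phi>] by (rule ce3_cong[OF \<phi>_frame that])
  have Lee_frame: "ce4 ?c ps i j k l n = th i * ps j k l n - th j * ps i k l n + th k * ps i j l n - th l * ps i j k n + th n * ps i j k l"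
    if I: "i \<in> I7" "j \<in> I7" "k \<in> I7" "l \<in> I7" "n \<in> I7" for i j k l n
  proof -
    have "ce4 ?c ps i j k l n = CE4 br \<psi> ((!) [b i, b j, b k, b l, b n])"
      unfolding CE4_frame[OF m\<psi>] by (rule ce4_cong[OF \<psi>_frame[symmetric] I])
    also have "\<dots> = th i * ps j k l n - th j * ps i k l n - th k * ps j i l n - th l * ps j k i n - th n * ps j k l i"
      unfolding Lee \<theta>f wedge_1_4[OF f a\<psi>] using I by (simp add: \<psi>_frame th_def)
    finally show ?thesis
      using ps_perms(6)[of i j l n] ps_perms(8)[of i j k n] ps_perms(9)[of i j k l] I by simp
  qed
  have "g2t_coefficients ?c th T tau"
  proof
    show "?c j i k = - ?c i j k" for i j k
      unfolding cc_def using br(2)[of "b i" "b j"] linear_neg[OF e_linear] by simp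
    show "T j i k = - T i j k" "T i k j = - T i j k" for i j k
      unfolding T_def by (rule alt_form_list_swaps[OF aTor])+
    have "tau = wedge 4 3 (CE3 br \<phi>) \<phi> (\<lambda>m. b (Suc m))"
      unfolding tau_def using alt_form_wedge[OF alt_form_multilin[OF ad\<phi>] m\<phi>] by (intro hodge_7) simp
    also have "\<dots> = (\<Sum>i\<in>I7. \<Sum>j\<in>I7. \<Sum>k\<in>I7. \<Sum>l\<in>I7. CE3 br \<phi> (\<lambda>m. b ([i, j, k, l] ! m)) * \<psi> (\<lambda>m. b ([i, j, k, l] ! m))) / 24"
      unfolding \<psi>_def by (rule wedge_4_3_frame) (use multilin_cong[OF alt_form_multilin[OF ad\<phi>]] multilin_cong[OF m\<phi>] in blast)+
    also have "(\<Sum>i\<in>I7. \<Sum>j\<in>I7. \<Sum>k\<in>I7. \<Sum>l\<in>I7. CE3 br \<phi> (\<lambda>m. b ([i, j, k, l] ! m)) * \<psi> (\<lambda>m. b ([i, j, k, l] ! m)))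
       = (\<Sum>i\<in>I7. \<Sum>j\<in>I7. \<Sum>k\<in>I7. \<Sum>l\<in>I7. F i j k l * ps i j k l)"
    proof (intro sum.cong refl)
      fix i j k l assume "i \<in> I7" "j \<in> I7" "k \<in> I7" "l \<in> I7"
      then show "CE3 br \<phi> (\<lambda>m. b ([i, j, k, l] ! m)) * \<psi> (\<lambda>m. b ([i, j, k, l] ! m)) = F i j k l * ps i j k l"
        using list_frame[of "[i, j, k, l]" 4 "CE3 br \<phi>"] list_frame[of "[i, j, k, l]" 4 \<psi>] alt_form_multilin[OF ad\<phi>] m\<psi>
        by (simp add: F_def \<psi>_frame)
    qed
    also have "\<dots> = 24 * (- F 1 2 4 7 - F 1 2 5 6 - F 1 3 4 6 + F 1 3 5 7 + F 2 3 4 5 + F 2 3 6 7 + F 4 5 6 7)"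
      unfolding F_def by (rule sum_alternating_ps) (rule alt_form_list_swaps_4[OF ad\<phi>])+
    finally show "tau = - ce3 ?c ph 1 2 4 7 - ce3 ?c ph 1 2 5 6 - ce3 ?c ph 1 3 4 6 + ce3 ?c ph 1 3 5 7 + ce3 ?c ph 2 3 4 5
        + ce3 ?c ph 2 3 6 7 + ce3 ?c ph 4 5 6 7"
      by (simp add: F_eq I7_mem)
    fix i j k l p q r assume d: "distinct [i, j, k, l, p, q, r]" "{i, j, k, l, p, q, r} = I7"
    then have I: "i \<in> I7" "j \<in> I7" "k \<in> I7" "l \<in> I7" "p \<in> I7" "q \<in> I7" "r \<in> I7" by blast+
    have h: "hodge e 4 \<alpha> ((!) [b p, b q, b r]) = list_sign [i, j, k, l, p, q, r] * \<alpha> ((!) [b i, b j, b k, b l])"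
      if "alt_form 4 \<alpha>" for \<alpha>
    proof -
      have len: "length [i, j, k, l] = 4" by simp
      have "hodge e 4 \<alpha> ((!) [b p, b q, b r]) = hodge e (length [i, j, k, l]) \<alpha> (\<lambda>m. b ([p, q, r] ! m))"
        unfolding len by (rule hodge_cong) (auto simp: less_numerals)
      also have "\<dots> = list_sign ([i, j, k, l] @ [p, q, r]) * \<alpha> (\<lambda>m. b ([i, j, k, l] ! m))"
      proof (rule hodge_list)
        show "distinct ([i, j, k, l] @ [p, q, r])" "set ([i, j, k, l] @ [p, q, r]) = I7"
          using d by simp_all
        show "alt_form (length [i, j, k, l]) \<alpha>"
          unfolding len by (rule that)
      qed
      also have "\<alpha> (\<lambda>m. b ([i, j, k, l] ! m)) = \<alpha> ((!) [b i, b j, b k, b l])"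
        using list_frame[of "[i, j, k, l]" 4 \<alpha>] alt_form_multilin[OF that] by simp
      finally show ?thesis
        by (simp only: append.simps)
    qed
    have t: "hodge e 7 (wedge 4 3 (CE3 br \<phi>) \<phi>) v = tau" for v
      unfolding tau_def by (rule hodge_cong) simp
    have w: "wedge 1 3 \<theta> \<phi> ((!) [b i, b j, b k, b l]) = th i * ph j k l - th j * ph i k l + th k * ph i j l - th l * ph i j k"
      unfolding \<theta>f wedge_1_3[OF f a\<phi>] using I ph_antisym(1)[of i j l] ph_cyc[of i j k] by (simp add: \<phi>_frame th_def)
    show "T p q r = tau / 6 * ph p q r + list_sign [i, j, k, l, p, q, r] *
        (th i * ph j k l - th j * ph i k l + th k * ph i j l - th l * ph i j k - ce3 ?c ph i j k l)"
      unfolding T_def Tor_def t h[OF ad\<phi>] h[OF a\<theta>\<phi>] w F_def[symmetric] F_eq[OF I(1-4)] \<phi>_frame[OF I(5-7)]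
      by (simp only: right_diff_distrib distrib_left)
  qed (rule Lee_frame)
  then interpret C: g2t_coefficients ?c th T tau .
  interpret C: strong_g2t_coefficients ?c th T tau
  proof
    show "(\<Sum>m\<in>I7. ?c i j m * ?c m k l + ?c j k m * ?c m i l + ?c k i m * ?c m j l) = 0"
      if I: "i \<in> I7" "j \<in> I7" "k \<in> I7" "l \<in> I7" for i j k l
    proof -
      have *: "e l (br (br (b i) (b j)) (b k)) = (\<Sum>m\<in>I7. ?c i j m * ?c m k l)" for i j k
      proof -
        have "linear (\<lambda>x. e l (br x (b k)))"
          using linear_compose[of "\<lambda>x. br x (b k)" "e l"] br(1) e_linear[OF I(4)] by (simp add: bilinear_def o_def)
        then show ?thesis
          using linear_br_frame[of "\<lambda>x. e l (br x (b k))" br i j] I by (simp add: cc_def[of br _ _ l])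
      qed
      have "e l (br (br (b i) (b j)) (b k) + br (br (b j) (b k)) (b i) + br (br (b k) (b i)) (b j)) = 0"
        unfolding jacobi using linear_0[OF e_linear[OF I(4)]] .
      then show ?thesis
        by (simp add: linear_add[OF e_linear[OF I(4)]] * sum.distrib)
    qed
    show "ce3 ?c T i j k l = 0" for i j k l
      using CE3_frame[OF alt_form_multilin[OF aTor], of br i j k l] unfolding dT T_def by simp
    show "0 \<le> (\<Sum>i\<in>I7. \<Sum>j\<in>I7. \<Sum>k\<in>I7. (?c i j k)\<^sup>2 - 2 * (?c i j k * ?c j k i))"
      by (rule cc_PQ[OF br(1) S])
  qed
  show "CE3 br \<phi> = (\<lambda>v. 0)"
  proof (rule multilin_eqI[OF alt_form_multilin[OF ad\<phi>]])
    show "multilin 4 (\<lambda>v::nat \<Rightarrow> real^7. 0)"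
      using multilin_cmult[OF alt_form_multilin[OF ad\<phi>], of 0] by simp
    fix s :: "nat \<Rightarrow> nat" assume s: "\<And>i. i < 4 \<Longrightarrow> s i \<in> I7"
    have "CE3 br \<phi> (\<lambda>i. b (s i)) = F (s 0) (s 1) (s 2) (s 3)"
      unfolding F_def by (rule multilin_list[OF alt_form_multilin[OF ad\<phi>]]) (auto simp: less_numerals)
    then show "CE3 br \<phi> (\<lambda>i. b (s i)) = 0"
      using F_eq C.ce3_ph_zero s by simp
  qed
  \<comment> \<open>That the differential of \<psi> is multilinear is read off from the Lee
    equation, which identifies it with a wedge product.\<close>
  have m5: "multilin 5 (CE4 br \<psi>)"
    unfolding Lee using multilin_wedge[OF \<theta> m\<psi>] by simp
  show "CE4 br \<psi> = (\<lambda>v. 0)"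
  proof (rule multilin_eqI[OF m5])
    show "multilin 5 (\<lambda>v::nat \<Rightarrow> real^7. 0)"
      using multilin_cmult[OF m5, of 0] by simp
    fix s :: "nat \<Rightarrow> nat" assume s: "\<And>i. i < 5 \<Longrightarrow> s i \<in> I7"
    have "CE4 br \<psi> (\<lambda>i. b (s i)) = CE4 br \<psi> ((!) [b (s 0), b (s 1), b (s 2), b (s 3), b (s 4)])"
      by (rule multilin_list[OF m5]) (auto simp: less_numerals)
    also have "\<dots> = ce4 ?c ps (s 0) (s 1) (s 2) (s 3) (s 4)"
      unfolding CE4_frame[OF m\<psi>] using s by (intro ce4_cong[OF \<psi>_frame]) auto
    finally show "CE4 br \<psi> (\<lambda>i. b (s i)) = 0"
      using C.ce4_ps_zero s by simp
  qed
qed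

end

section \<open>Smooth maps and invariant coframes\<close>

lemma frechet_derivative_cong:
  assumes "open S" "x \<in> S" "\<And>y. y \<in> S \<Longrightarrow> f y = g y"
  shows "frechet_derivative f (at x) = frechet_derivative g (at x)"
proof -
  have "(f has_derivative D) (at x) \<longleftrightarrow> (g has_derivative D) (at x)" for D
    using has_derivative_transform_within_open[OF _ assms(1,2), of f D UNIV g]
      has_derivative_transform_within_open[OF _ assms(1,2), of g D UNIV f] assms(3) by auto
  then show ?thesis
    unfolding frechet_derivative_def by simp
qed

lemma differentiable_cong:
  assumes "open S" "x \<in> S" "\<And>y. y \<in> S \<Longrightarrow> f y = g y" "f differentiable (at x)"
  shows "g differentiable (at x)"
  using assms has_derivative_transform_within_open[OF _ assms(1,2), of f _ UNIV g] unfolding differentiable_def by blast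

lemma Ck_on_cong:
  assumes "open S" "\<And>y. y \<in> S \<Longrightarrow> f y = g y" "Ck_on k S f"
  shows "Ck_on k S g"
  using assms
proof (induction k arbitrary: f g)
  case 0
  then show ?case by (simp cong: continuous_on_cong)
next
  case (Suc k)
  have "g differentiable at x" if "x \<in> S" for x
    using differentiable_cong[OF Suc.prems(1) that Suc.prems(2)] Suc.prems(3) that by auto
  moreover have "Ck_on k S (\<lambda>x. frechet_derivative g (at x) v)" for v
  proof (rule Suc.IH[OF Suc.prems(1)])
    show "Ck_on k S (\<lambda>x. frechet_derivative f (at x) v)"
      using Suc.prems(3) by simp
    show "frechet_derivative f (at y) v = frechet_derivative g (at y) v" if "y \<in> S" for y
      using frechet_derivative_cong[OF Suc.prems(1) that Suc.prems(2)] by simp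
  qed
  ultimately show ?case by simp
qed

lemma Ck_on_SucD: "Ck_on (Suc k) S f \<Longrightarrow> Ck_on k S f"
proof (induction k arbitrary: f)
  case 0
  then show ?case
    by (auto intro!: continuous_at_imp_continuous_on differentiable_imp_continuous_within)
next
  case (Suc k)
  then show ?case
    by (metis Ck_on.simps(2))
qed

lemma Ck_on_subset: "Ck_on k S f \<Longrightarrow> T \<subseteq> S \<Longrightarrow> Ck_on k T f"
  by (induction k arbitrary: f) (auto intro: continuous_on_subset)

lemma Ck_on_local:
  assumes "\<And>x. x \<in> S \<Longrightarrow> \<exists>T. open T \<and> x \<in> T \<and> Ck_on k T f"
  shows "Ck_on k S f"
  using assms
proof (induction k arbitrary: f)
  case 0
  then show ?case
    by (metis Ck_on.simps(1) continuous_at_imp_continuous_on continuous_on_eq_continuous_at)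
next
  case (Suc k)
  have "f differentiable at x" if "x \<in> S" for x
    using Suc.prems[OF that] by auto
  moreover have "Ck_on k S (\<lambda>x. frechet_derivative f (at x) v)" for v
    using Suc.prems by (intro Suc.IH) fastforce
  ultimately show ?case by simp
qed

lemma Ck_on_const: "Ck_on k S (\<lambda>x. c)"
proof (induction k arbitrary: c)
  case (Suc k)
  have "frechet_derivative (\<lambda>x. c) (at x) = (\<lambda>v. 0)" for x :: 'a
    by (metis has_derivative_const frechet_derivative_at)
  then show ?case using Suc by simp
qed simp

lemma bounded_linear_Ck_on:
  assumes "bounded_linear L"
  shows "Ck_on k S L"
proof (cases k)
  case 0
  then show ?thesis using assms by (simp add: linear_continuous_on)
next
  case (Suc m)
  have "(L has_derivative L) (at x)" for x
    using assms by (rule bounded_linear_imp_has_derivative)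
  then have "frechet_derivative L (at x) = L" "L differentiable (at x)" for x
    by (metis frechet_derivative_at, metis differentiable_def)
  then show ?thesis
    using Suc by (simp add: Ck_on_const)
qed

lemma Ck_on_add:
  assumes "open S" "Ck_on k S f" "Ck_on k S g"
  shows "Ck_on k S (\<lambda>x. f x + g x)"
  using assms(2,3)
proof (induction k arbitrary: f g)
  case 0
  then show ?case by (simp add: continuous_on_add)
next
  case (Suc k)
  have D: "((\<lambda>x. f x + g x) has_derivative (\<lambda>v. frechet_derivative f (at x) v + frechet_derivative g (at x) v)) (at x)" if "x \<in> S" for x
    using Suc.prems that by (intro has_derivative_add) (auto simp: frechet_derivative_works[symmetric])
  have "Ck_on k S (\<lambda>x. frechet_derivative (\<lambda>x. f x + g x) (at x) v)" for v
  proof (rule Ck_on_cong[OF assms(1)])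
    show "Ck_on k S (\<lambda>y. frechet_derivative f (at y) v + frechet_derivative g (at y) v)"
      using Suc.prems Suc.IH[of "\<lambda>x. frechet_derivative f (at x) v" "\<lambda>x. frechet_derivative g (at x) v"] by simp
    show "frechet_derivative f (at y) v + frechet_derivative g (at y) v = frechet_derivative (\<lambda>x. f x + g x) (at y) v" if "y \<in> S" for y
      using frechet_derivative_at[OF D[OF that]] by metis
  qed
  then show ?case
    using D by (auto simp: differentiable_def)
qed

lemma Ck_on_bounded_linear:
  assumes "open S" "bounded_linear L" "Ck_on k S f"
  shows "Ck_on k S (\<lambda>x. L (f x))"
  using assms(3)
proof (induction k arbitrary: f)
  case 0
  then show ?case using bounded_linear.continuous_on[OF assms(2)] by simp
next
  case (Suc k)
  have D: "((\<lambda>x. L (f x)) has_derivative (\<lambda>v. L (frechet_derivative f (at x) v))) (at x)" if "x \<in> S" for x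
    using Suc.prems that by (intro bounded_linear.has_derivative[OF assms(2)]) (auto simp: frechet_derivative_works[symmetric])
  have "Ck_on k S (\<lambda>x. frechet_derivative (\<lambda>x. L (f x)) (at x) v)" for v
  proof (rule Ck_on_cong[OF assms(1)])
    show "Ck_on k S (\<lambda>y. L (frechet_derivative f (at y) v))"
      using Suc.prems Suc.IH[of "\<lambda>x. frechet_derivative f (at x) v"] by simp
    show "L (frechet_derivative f (at y) v) = frechet_derivative (\<lambda>x. L (f x)) (at y) v" if "y \<in> S" for y
      using frechet_derivative_at[OF D[OF that]] by metis
  qed
  then show ?case
    using D by (auto simp: differentiable_def)
qed

lemma Ck_on_scaleR:
  fixes f :: "'a::euclidean_space \<Rightarrow> real"
  assumes "open S" "Ck_on k S f" "Ck_on k S g"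
  shows "Ck_on k S (\<lambda>x. f x *\<^sub>R g x)"
  using assms(2,3)
proof (induction k arbitrary: f g)
  case 0
  then show ?case by (simp add: continuous_on_scaleR)
next
  case (Suc k)
  have D: "((\<lambda>x. f x *\<^sub>R g x) has_derivative (\<lambda>v. f x *\<^sub>R frechet_derivative g (at x) v + frechet_derivative f (at x) v *\<^sub>R g x)) (at x)" if "x \<in> S" for x
    using Suc.prems that by (intro has_derivative_scaleR) (auto simp: frechet_derivative_works[symmetric])
  have "Ck_on k S (\<lambda>x. frechet_derivative (\<lambda>x. f x *\<^sub>R g x) (at x) v)" for v
  proof (rule Ck_on_cong[OF assms(1)])
    show "Ck_on k S (\<lambda>x. f x *\<^sub>R frechet_derivative g (at x) v + frechet_derivative f (at x) v *\<^sub>R g x)"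
      using Suc.prems Ck_on_SucD[OF Suc.prems(1)] Ck_on_SucD[OF Suc.prems(2)] by (intro Ck_on_add[OF assms(1)] Suc.IH) auto
    show "f y *\<^sub>R frechet_derivative g (at y) v + frechet_derivative f (at y) v *\<^sub>R g y = frechet_derivative (\<lambda>x. f x *\<^sub>R g x) (at y) v" if "y \<in> S" for y
      using frechet_derivative_at[OF D[OF that]] by metis
  qed
  then show ?case
    using D by (auto simp: differentiable_def)
qed

lemma Ck_on_sum:
  assumes "open S" "\<And>i. i \<in> I \<Longrightarrow> Ck_on k S (f i)"
  shows "Ck_on k S (\<lambda>x. \<Sum>i\<in>I. f i x)"
  using assms(2) by (induction I rule: infinite_finite_induct) (auto intro: Ck_on_const Ck_on_add[OF assms(1)])

lemma Ck_on_compose: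
  fixes f :: "'a::euclidean_space \<Rightarrow> 'b::euclidean_space"
  assumes "open S" "open T" "Ck_on k S f" "Ck_on k T g" "\<And>x. x \<in> S \<Longrightarrow> f x \<in> T"
  shows "Ck_on k S (\<lambda>x. g (f x))"
  using assms(3,4)
proof (induction k arbitrary: g)
  case 0
  then show ?case using assms(5) by (auto intro: continuous_on_compose2)
next
  case (Suc k)
  have D: "((\<lambda>x. g (f x)) has_derivative (\<lambda>v. frechet_derivative g (at (f x)) (frechet_derivative f (at x) v))) (at x)" if "x \<in> S" for x
    using Suc.prems that assms(5) by (intro has_derivative_compose[of f _ _ _ g]) (auto simp: frechet_derivative_works[symmetric])
  \<comment> \<open>The chain rule differentiates g in a direction that varies with x, whereas
    \<open>Ck_on\<close> speaks of fixed directions. Expansion in a basis gives a finite sum of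
    products to which the induction hypothesis applies.\<close>
  have E: "frechet_derivative (\<lambda>x. g (f x)) (at x) v
      = (\<Sum>i\<in>Basis. (frechet_derivative f (at x) v \<bullet> i) *\<^sub>R frechet_derivative g (at (f x)) i)" if x: "x \<in> S" for x v
  proof -
    have lin: "linear (frechet_derivative g (at (f x)))"
      using Suc.prems(2) assms(5)[OF x] by (intro linear_frechet_derivative) auto
    have "frechet_derivative (\<lambda>x. g (f x)) (at x) v = frechet_derivative g (at (f x)) (\<Sum>i\<in>Basis. (frechet_derivative f (at x) v \<bullet> i) *\<^sub>R i)"
      using frechet_derivative_at[OF D[OF x]] by (metis euclidean_representation)
    then show ?thesis
      by (simp only: linear_sum[OF lin] linear_cmul[OF lin])
  qed
  have "Ck_on k S (\<lambda>x. frechet_derivative (\<lambda>x. g (f x)) (at x) v)" for v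
  proof (rule Ck_on_cong[OF assms(1)])
    show "Ck_on k S (\<lambda>x. \<Sum>i\<in>Basis. (frechet_derivative f (at x) v \<bullet> i) *\<^sub>R frechet_derivative g (at (f x)) i)"
      using Suc.prems Ck_on_SucD[OF Suc.prems(1)]
      by (intro Ck_on_sum[OF assms(1)] Ck_on_scaleR[OF assms(1)] Suc.IH Ck_on_bounded_linear[OF assms(1) bounded_linear_inner_left]) auto
    show "(\<Sum>i\<in>Basis. (frechet_derivative f (at y) v \<bullet> i) *\<^sub>R frechet_derivative g (at (f y)) i) = frechet_derivative (\<lambda>x. g (f x)) (at y) v" if "y \<in> S" for y
      using E[OF that] by simp
  qed
  then show ?case
    using D by (auto simp: differentiable_def)
qed

lemma smooth_on_cong: "open S \<Longrightarrow> (\<And>y. y \<in> S \<Longrightarrow> f y = g y) \<Longrightarrow> smooth_on S f \<Longrightarrow> smooth_on S g"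
  unfolding smooth_on_def using Ck_on_cong by metis

lemma smooth_on_subset: "smooth_on S f \<Longrightarrow> T \<subseteq> S \<Longrightarrow> smooth_on T f"
  unfolding smooth_on_def using Ck_on_subset by blast

lemma smooth_on_local:
  assumes "\<And>x. x \<in> S \<Longrightarrow> \<exists>T. open T \<and> x \<in> T \<and> smooth_on T f"
  shows "smooth_on S f"
  using assms unfolding smooth_on_def by (meson Ck_on_local)

lemma bounded_linear_smooth_on: "bounded_linear L \<Longrightarrow> smooth_on S L"
  unfolding smooth_on_def using bounded_linear_Ck_on by blast

lemma smooth_on_const: "smooth_on S (\<lambda>x. c)"
  unfolding smooth_on_def using Ck_on_const by blast

lemma smooth_on_add: "open S \<Longrightarrow> smooth_on S f \<Longrightarrow> smooth_on S g \<Longrightarrow> smooth_on S (\<lambda>x. f x + g x)"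
  unfolding smooth_on_def using Ck_on_add by blast

lemma smooth_on_bounded_linear: "open S \<Longrightarrow> bounded_linear L \<Longrightarrow> smooth_on S f \<Longrightarrow> smooth_on S (\<lambda>x. L (f x))"
  unfolding smooth_on_def using Ck_on_bounded_linear by blast

lemma smooth_on_compose:
  fixes f :: "'a::euclidean_space \<Rightarrow> 'b::euclidean_space"
  shows "open S \<Longrightarrow> open T \<Longrightarrow> smooth_on S f \<Longrightarrow> smooth_on T g \<Longrightarrow> (\<And>x. x \<in> S \<Longrightarrow> f x \<in> T) \<Longrightarrow> smooth_on S (\<lambda>x. g (f x))"
  unfolding smooth_on_def using Ck_on_compose by blast

lemma smooth_on_Pair:
  assumes "open S" "smooth_on S f" "smooth_on S g"
  shows "smooth_on S (\<lambda>x. (f x, g x))"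
proof -
  have b: "bounded_linear (\<lambda>x. (x, 0))" "bounded_linear (\<lambda>y. (0, y))"
    by (intro bounded_linear_Pair bounded_linear_ident bounded_linear_zero)+
  have "smooth_on S (\<lambda>x. (f x, 0) + (0, g x))"
    by (intro smooth_on_add assms smooth_on_bounded_linear[OF assms(1) b(1)] smooth_on_bounded_linear[OF assms(1) b(2)])
  then show ?thesis by simp
qed

lemma smooth_on_continuous: "smooth_on S f \<Longrightarrow> continuous_on S f"
  unfolding smooth_on_def by (metis Ck_on.simps(1))

lemma smooth_on_derivative: "smooth_on S f \<Longrightarrow> smooth_on S (\<lambda>x. frechet_derivative f (at x) v)"
  unfolding smooth_on_def by (metis Ck_on.simps(2))

lemma smooth_on_differentiable: "smooth_on S f \<Longrightarrow> x \<in> S \<Longrightarrow> f differentiable (at x)"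
  unfolding smooth_on_def by (metis Ck_on.simps(2))

lemma smooth_on_has_derivative: "smooth_on S f \<Longrightarrow> x \<in> S \<Longrightarrow> (f has_derivative frechet_derivative f (at x)) (at x)"
  using smooth_on_differentiable frechet_derivative_works by blast

text \<open>The mean value theorem twice: along u for the increment of f in the direction v, then
  along v for the derivative of f in the direction u.\<close>

lemma second_difference:
  fixes f :: "'a::euclidean_space \<Rightarrow> real"
  assumes f: "smooth_on S f" and h: "0 < h"
    and sub: "\<And>s t. 0 \<le> s \<Longrightarrow> s \<le> h \<Longrightarrow> 0 \<le> t \<Longrightarrow> t \<le> h \<Longrightarrow> x + s *\<^sub>R u + t *\<^sub>R v \<in> S"
  shows "\<exists>s t. 0 \<le> s \<and> s \<le> h \<and> 0 \<le> t \<and> t \<le> h \<and> f (x + h *\<^sub>R u + h *\<^sub>R v) - f (x + h *\<^sub>R u) - f (x + h *\<^sub>R v) + f x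
     = h * h * frechet_derivative (\<lambda>y. frechet_derivative f (at y) u) (at (x + s *\<^sub>R u + t *\<^sub>R v)) v"
proof -
  have line: "((\<lambda>s. g (a + s *\<^sub>R w)) has_real_derivative frechet_derivative g (at (a + s *\<^sub>R w)) w) (at s)"
    if "smooth_on S g" "a + s *\<^sub>R w \<in> S" for g :: "'a \<Rightarrow> real" and a w s
  proof -
    have d: "((\<lambda>s. a + s *\<^sub>R w) has_derivative (\<lambda>t. t *\<^sub>R w)) (at s)"
      by (auto intro!: derivative_eq_intros)
    have g: "(g has_derivative frechet_derivative g (at (a + s *\<^sub>R w))) (at (a + s *\<^sub>R w))"
      by (rule smooth_on_has_derivative[OF that])
    have lin: "linear (frechet_derivative g (at (a + s *\<^sub>R w)))"
      using g has_derivative_linear by blast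
    show ?thesis
      unfolding has_field_derivative_def using has_derivative_compose[OF d g]
      by (rule has_derivative_eq_rhs) (auto simp: linear_cmul[OF lin] mult.commute)
  qed
  have p: "x + s *\<^sub>R u \<in> S" if "0 \<le> s" "s \<le> h" for s
    using sub[of s 0] that h by simp
  let ?\<phi> = "\<lambda>s. f ((x + h *\<^sub>R v) + s *\<^sub>R u) - f (x + s *\<^sub>R u)"
  have "\<exists>s. 0 < s \<and> s < h \<and> ?\<phi> h - ?\<phi> 0 = (h - 0) * (frechet_derivative f (at ((x + h *\<^sub>R v) + s *\<^sub>R u)) u - frechet_derivative f (at (x + s *\<^sub>R u)) u)"
  proof (rule MVT2[OF h])
    fix s assume s: "0 \<le> s" "s \<le> h"
    have "(x + h *\<^sub>R v) + s *\<^sub>R u \<in> S"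
      using sub[of s h] s h by (simp add: algebra_simps)
    then show "(?\<phi> has_real_derivative frechet_derivative f (at ((x + h *\<^sub>R v) + s *\<^sub>R u)) u - frechet_derivative f (at (x + s *\<^sub>R u)) u) (at s)"
      using p[OF s] by (intro DERIV_diff line[OF f])
  qed
  then obtain s where s: "0 < s" "s < h" "?\<phi> h - ?\<phi> 0 = h * (frechet_derivative f (at ((x + h *\<^sub>R v) + s *\<^sub>R u)) u - frechet_derivative f (at (x + s *\<^sub>R u)) u)"
    by auto
  let ?\<psi> = "\<lambda>t. frechet_derivative f (at ((x + s *\<^sub>R u) + t *\<^sub>R v)) u"
  have "\<exists>t. 0 < t \<and> t < h \<and> ?\<psi> h - ?\<psi> 0 = (h - 0) * frechet_derivative (\<lambda>y. frechet_derivative f (at y) u) (at ((x + s *\<^sub>R u) + t *\<^sub>R v)) v"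
    using sub[of s] s h
    by (intro MVT2) (auto intro!: line[OF smooth_on_derivative[OF f]])
  then obtain t where t: "0 < t" "t < h" "?\<psi> h - ?\<psi> 0 = h * frechet_derivative (\<lambda>y. frechet_derivative f (at y) u) (at ((x + s *\<^sub>R u) + t *\<^sub>R v)) v"
    by auto
  have "f (x + h *\<^sub>R u + h *\<^sub>R v) - f (x + h *\<^sub>R u) - f (x + h *\<^sub>R v) + f x = ?\<phi> h - ?\<phi> 0"
    by (simp add: algebra_simps)
  also have "\<dots> = h * (?\<psi> h - ?\<psi> 0)"
    unfolding s(3) by (simp add: algebra_simps)
  finally show ?thesis
    unfolding t(3) using s t by (intro exI[of _ s] exI[of _ t]) (simp add: mult.assoc)
qed

text \<open>The second difference is symmetric in u and v, so by \<open>second_difference\<close>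
  the two mixed derivatives agree at two points arbitrarily close to x. Continuity of both gives
  equality at x.\<close>

lemma symmetric_second_derivative_real:
  fixes f :: "'a::euclidean_space \<Rightarrow> real"
  assumes S: "open S" and f: "smooth_on S f" and x: "x \<in> S"
  shows "frechet_derivative (\<lambda>y. frechet_derivative f (at y) u) (at x) v = frechet_derivative (\<lambda>y. frechet_derivative f (at y) v) (at x) u"
proof -
  define A where "A y = frechet_derivative (\<lambda>y. frechet_derivative f (at y) u) (at y) v" for y
  define B where "B y = frechet_derivative (\<lambda>y. frechet_derivative f (at y) v) (at y) u" for y
  have "continuous_on S A" "continuous_on S B"
    unfolding A_def B_def by (intro smooth_on_continuous smooth_on_derivative f)+
  then have cont: "isCont A x" "isCont B x"
    using S x continuous_on_eq_continuous_at by blast+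
  have "\<bar>A x - B x\<bar> < 2 * r" if "r > 0" for r
  proof -
    obtain d1 where d1: "d1 > 0" "\<And>y. dist y x < d1 \<Longrightarrow> dist (A y) (A x) < r"
      using cont(1) \<open>r > 0\<close> unfolding continuous_at_eps_delta by (metis dist_norm)
    obtain d2 where d2: "d2 > 0" "\<And>y. dist y x < d2 \<Longrightarrow> dist (B y) (B x) < r"
      using cont(2) \<open>r > 0\<close> unfolding continuous_at_eps_delta by (metis dist_norm)
    obtain d3 where d3: "d3 > 0" "ball x d3 \<subseteq> S"
      using S x openE by blast
    define d where "d = min d1 (min d2 d3)"
    have d: "d > 0" "d \<le> d1" "d \<le> d2" "d \<le> d3"
      using d1 d2 d3 by (auto simp: d_def)
    \<comment> \<open>Small enough for the whole parallelogram to stay within distance d of x; the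
      summand 1 keeps the denominator positive when u = v = 0.\<close>
    define h where "h = d / (2 * (norm u + norm v + 1))"
    have n0: "norm u + norm v + 1 > 0"
      by (simp add: add_nonneg_pos)
    then have h: "h > 0" using d by (simp add: h_def)
    have near: "dist (x + s *\<^sub>R a + t *\<^sub>R b) x < d"
      if "0 \<le> s" "s \<le> h" "0 \<le> t" "t \<le> h" "norm a + norm b = norm u + norm v" for s t and a b :: 'a
    proof -
      have "dist (x + s *\<^sub>R a + t *\<^sub>R b) x \<le> s * norm a + t * norm b"
        using that norm_triangle_ineq[of "s *\<^sub>R a" "t *\<^sub>R b"] by (simp add: dist_norm add.assoc)
      also have "\<dots> \<le> h * norm a + h * norm b"
        using that by (intro add_mono mult_right_mono) auto
      also have "\<dots> = h * (norm u + norm v)"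
        using that(5) by (simp add: distrib_left[symmetric])
      also have "\<dots> < h * (2 * (norm u + norm v + 1))"
        using h n0 by (intro mult_strict_left_mono) auto
      also have "\<dots> = d"
        using n0 by (simp add: h_def)
      finally show ?thesis .
    qed
    then have inS: "x + s *\<^sub>R a + t *\<^sub>R b \<in> S"
      if "0 \<le> s" "s \<le> h" "0 \<le> t" "t \<le> h" "norm a + norm b = norm u + norm v" for s t and a b :: 'a
    proof -
      have "dist x (x + s *\<^sub>R a + t *\<^sub>R b) < d3"
        using near[OF that] d(4) by (simp add: dist_commute)
      then show ?thesis
        using d3(2) by auto
    qed
    obtain s t where 1: "0 \<le> s" "s \<le> h" "0 \<le> t" "t \<le> h" "f (x + h *\<^sub>R u + h *\<^sub>R v) - f (x + h *\<^sub>R u) - f (x + h *\<^sub>R v) + f x = h * h * A (x + s *\<^sub>R u + t *\<^sub>R v)"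
      using second_difference[OF f h, of x u v] inS[of _ _ u v] unfolding A_def by auto
    obtain s' t' where 2: "0 \<le> s'" "s' \<le> h" "0 \<le> t'" "t' \<le> h" "f (x + h *\<^sub>R v + h *\<^sub>R u) - f (x + h *\<^sub>R v) - f (x + h *\<^sub>R u) + f x = h * h * B (x + s' *\<^sub>R v + t' *\<^sub>R u)"
      using second_difference[OF f h, of x v u] inS[of _ _ v u] unfolding B_def by (auto simp: add.commute)
    have "h * h * A (x + s *\<^sub>R u + t *\<^sub>R v) = h * h * B (x + s' *\<^sub>R v + t' *\<^sub>R u)"
      unfolding 1(5)[symmetric] 2(5)[symmetric] by (simp add: algebra_simps)
    then have "A (x + s *\<^sub>R u + t *\<^sub>R v) = B (x + s' *\<^sub>R v + t' *\<^sub>R u)"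
      using h by simp
    moreover have "dist (A (x + s *\<^sub>R u + t *\<^sub>R v)) (A x) < r" "dist (B (x + s' *\<^sub>R v + t' *\<^sub>R u)) (B x) < r"
      using near[of s t u v] near[of s' t' v u] 1 2 d1 d2 d by (force simp: add.commute)+
    ultimately show ?thesis
      by (auto simp: dist_real_def)
  qed
  from this[of "\<bar>A x - B x\<bar> / 2"] have "A x = B x"
    by (cases "A x = B x") auto
  then show ?thesis
    unfolding A_def B_def .
qed

lemma symmetric_second_derivative:
  fixes f :: "'a::euclidean_space \<Rightarrow> 'b::euclidean_space"
  assumes S: "open S" and f: "smooth_on S f" and x: "x \<in> S"
  shows "frechet_derivative (\<lambda>y. frechet_derivative f (at y) u) (at x) v = frechet_derivative (\<lambda>y. frechet_derivative f (at y) v) (at x) u"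
proof (rule euclidean_eqI)
  fix i :: 'b assume "i \<in> Basis"
  have sm: "smooth_on S (\<lambda>y. f y \<bullet> i)"
    by (rule smooth_on_bounded_linear[OF S bounded_linear_inner_left f])
  have 1: "frechet_derivative (\<lambda>y. g y \<bullet> i) (at y) w = frechet_derivative g (at y) w \<bullet> i" if "smooth_on S g" "y \<in> S" for g :: "'a \<Rightarrow> 'b" and y w
  proof -
    have "((\<lambda>y. g y \<bullet> i) has_derivative (\<lambda>w. frechet_derivative g (at y) w \<bullet> i)) (at y)"
      by (rule bounded_linear.has_derivative[OF bounded_linear_inner_left smooth_on_has_derivative[OF that]])
    then show ?thesis
      by (metis frechet_derivative_at)
  qed
  have 2: "frechet_derivative (\<lambda>y. frechet_derivative (\<lambda>y. f y \<bullet> i) (at y) u) (at x) v = frechet_derivative (\<lambda>y. frechet_derivative f (at y) u) (at x) v \<bullet> i" for u v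
  proof -
    have "frechet_derivative (\<lambda>y. frechet_derivative (\<lambda>y. f y \<bullet> i) (at y) u) (at x) = frechet_derivative (\<lambda>y. frechet_derivative f (at y) u \<bullet> i) (at x)"
      by (rule frechet_derivative_cong[OF S x]) (simp add: 1[OF f])
    then show ?thesis
      by (simp add: 1[OF smooth_on_derivative[OF f] x])
  qed
  show "frechet_derivative (\<lambda>y. frechet_derivative f (at y) u) (at x) v \<bullet> i = frechet_derivative (\<lambda>y. frechet_derivative f (at y) v) (at x) u \<bullet> i"
    using symmetric_second_derivative_real[OF S sm x, of u v] unfolding 2 .
qed

section \<open>Exterior derivatives of forms with constant coefficients in a moving coframe\<close>

context frame
begin

text \<open>The Leibniz rule. Expansion in the frame turns \<alpha> into a polynomial in the
  components of its arguments, so the rule for products applies.\<close>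

lemma multilin_has_derivative:
  fixes w :: "'x::real_normed_vector \<Rightarrow> nat \<Rightarrow> real^7"
  assumes a: "multilin k \<alpha>" and w: "\<And>i. i < k \<Longrightarrow> ((\<lambda>y. w y i) has_derivative w' i) (at y0)"
  shows "((\<lambda>y. \<alpha> (w y)) has_derivative (\<lambda>u. \<Sum>j<k. \<alpha> ((w y0)(j := w' j u)))) (at y0)"
proof -
  let ?S = "{..<k} \<rightarrow>\<^sub>E I7"
  have 1: "((\<lambda>y. \<Sum>s\<in>?S. (\<Prod>i<k. e (s i) (w y i)) * \<alpha> (\<lambda>i. b (s i))) has_derivative
      (\<lambda>u. \<Sum>s\<in>?S. (\<Sum>j<k. e (s j) (w' j u) * (\<Prod>i\<in>{..<k} - {j}. e (s i) (w y0 i))) * \<alpha> (\<lambda>i. b (s i)))) (at y0)"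
  proof (intro has_derivative_sum has_derivative_mult_left has_derivative_prod)
    fix s i assume s: "s \<in> ?S" and i: "i \<in> {..<k}"
    then have "bounded_linear (e (s i))"
      using e_linear[of "s i"] linear_conv_bounded_linear by (auto simp: PiE_iff)
    from bounded_linear.has_derivative[OF this w[of i]] show "((\<lambda>y. e (s i) (w y i)) has_derivative (\<lambda>u. e (s i) (w' i u))) (at y0)"
      using i by simp
  qed
  have 2: "(\<Sum>s\<in>?S. (\<Sum>j<k. e (s j) (w' j u) * (\<Prod>i\<in>{..<k} - {j}. e (s i) (w y0 i))) * \<alpha> (\<lambda>i. b (s i)))
     = (\<Sum>j<k. \<alpha> ((w y0)(j := w' j u)))" for u
  proof -
    have "\<alpha> ((w y0)(j := w' j u)) = (\<Sum>s\<in>?S. (e (s j) (w' j u) * (\<Prod>i\<in>{..<k} - {j}. e (s i) (w y0 i))) * \<alpha> (\<lambda>i. b (s i)))"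
      if j: "j < k" for j
      unfolding multilin_expand[OF a, of "(w y0)(j := w' j u)"] using j
      by (intro sum.cong refl arg_cong2[where f = "(*)"]) (simp add: prod.remove[of "{..<k}" j])
    then show ?thesis
      unfolding sum_distrib_right by (subst sum.swap) (intro sum.cong refl, simp)
  qed
  show ?thesis
    using 1 unfolding 2 multilin_expand[OF a, symmetric] .
qed

lemma ext_d_multilin:
  fixes E :: "real^7 \<Rightarrow> real^7 \<Rightarrow> real^7" and \<omega> :: "('m, real^7) form"
  assumes a: "multilin k \<alpha>" and N: "open N" "y0 \<in> N"
    and \<omega>: "\<And>y v. y \<in> N \<Longrightarrow> \<omega> c y v = \<alpha> (\<lambda>i. E y (v i))"
    and n: "\<And>v. ((\<lambda>y. E y v) has_derivative (\<lambda>u. n u v)) (at y0)"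
  shows "ext_d k \<omega> c y0 v = (\<Sum>i\<le>k. (-1) ^ i * (\<Sum>j<k. \<alpha> ((\<lambda>m. E y0 (if m < i then v m else v (Suc m)))
      (j := n (v i) (if j < i then v j else v (Suc j))))))"
  unfolding ext_d_def
proof (intro sum.cong refl arg_cong2[where f = "(*)"])
  fix i
  let ?w = "\<lambda>j. if j < i then v j else v (Suc j)"
  have "frechet_derivative (\<lambda>y. \<omega> c y ?w) (at y0) = frechet_derivative (\<lambda>y. \<alpha> (\<lambda>j. E y (?w j))) (at y0)"
    by (rule frechet_derivative_cong[OF N \<omega>])
  moreover have "((\<lambda>y. \<alpha> (\<lambda>j. E y (?w j))) has_derivative (\<lambda>u. \<Sum>j<k. \<alpha> ((\<lambda>j. E y0 (?w j))(j := n u (?w j))))) (at y0)"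
    by (rule multilin_has_derivative[OF a n])
  note frechet_derivative_at[OF this]
  ultimately show "frechet_derivative (\<lambda>y. \<omega> c y ?w) (at y0) (v i) = (\<Sum>j<k. \<alpha> ((\<lambda>m. E y0 (?w m))(j := n (v i) (?w j))))"
    by (simp add: fun_eq_iff)
qed

text \<open>The hypothesis on \<open>n\<close> is the structure equation dE = - [E, E] of the
  vector-valued 1-form E. By the Leibniz rule each pair of arguments enters d\<omega> only through
  the skew part of \<open>n\<close>, which the equation replaces by a bracket.\<close>

lemma ext_d_3:
  fixes E :: "real^7 \<Rightarrow> real^7 \<Rightarrow> real^7" and \<omega> :: "('m, real^7) form"
  assumes a: "alt_form 3 \<alpha>" and N: "open N" "y0 \<in> N"
    and \<omega>: "\<And>y v. y \<in> N \<Longrightarrow> \<omega> c y v = \<alpha> (\<lambda>i. E y (v i))"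
    and n: "\<And>v. ((\<lambda>y. E y v) has_derivative (\<lambda>u. n u v)) (at y0)"
    and br: "\<And>u v. n u v - n v u = - br (E y0 u) (E y0 v)"
  shows "ext_d 3 \<omega> c y0 v = CE3 br \<alpha> (\<lambda>i. E y0 (v i))"
proof -
  define A where "A x y z = \<alpha> ((!) [x, y, z])" for x y z
  have A: "\<alpha> f = A (f 0) (f 1) (f 2)" for f
    unfolding A_def by (rule multilin_list[OF alt_form_multilin[OF a]]) (auto simp: less_numerals)
  have mid: "A x z y = - A z x y" for x y z
    unfolding A_def by (rule alt_form_list_swaps[OF a])
  have last: "A x y z = A z x y" for x y z
    using alt_form_list_swaps[OF a] unfolding A_def by (metis minus_minus)
  have D: "A (br (E y0 u) (E y0 w)) x y = A (n w u) x y - A (n u w) x y" for u w x y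
  proof -
    have "br (E y0 u) (E y0 w) = n w u - n u w"
      using br[of u w] by (metis minus_diff_eq minus_minus)
    then show ?thesis
      using linear_diff[OF multilin_3_linear(1)[OF alt_form_multilin[OF a]]] unfolding A_def by simp
  qed
  have s3: "(\<Sum>j<3. f j) = f 0 + f 1 + f 2" for f :: "nat \<Rightarrow> real"
    by (simp add: numeral_eq_Suc One_nat_def)
  let ?E = "\<lambda>i. E y0 (v i)" and ?n = "\<lambda>i j. n (v i) (v j)"
  have ext: "ext_d 3 \<omega> c y0 v = (\<Sum>i\<le>3. (-1) ^ i * (\<Sum>j<3. \<alpha> ((\<lambda>m. E y0 (if m < i then v m else v (Suc m)))
      (j := n (v i) (if j < i then v j else v (Suc j))))))"
    by (rule ext_d_multilin[where E = E and n = n, OF alt_form_multilin[OF a] N _ n]) (rule \<omega>)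
  show ?thesis
    unfolding ext CE3_def sum_atMost_numerals s3 A_def[symmetric] D
    unfolding A
    using mid[of "?E 1" "?n 0 2" "?E 3"] last[of "?E 1" "?E 2" "?n 0 3"] mid[of "?E 0" "?n 1 2" "?E 3"] last[of "?E 0" "?E 2" "?n 1 3"]
      mid[of "?E 0" "?n 2 1" "?E 3"] last[of "?E 0" "?E 1" "?n 2 3"] mid[of "?E 0" "?n 3 1" "?E 2"] last[of "?E 0" "?E 1" "?n 3 2"]
    by (simp add: Suc_numerals)
qed

lemma ext_d_4:
  fixes E :: "real^7 \<Rightarrow> real^7 \<Rightarrow> real^7" and \<omega> :: "('m, real^7) form"
  assumes a: "alt_form 4 \<alpha>" and N: "open N" "y0 \<in> N"
    and \<omega>: "\<And>y v. y \<in> N \<Longrightarrow> \<omega> c y v = \<alpha> (\<lambda>i. E y (v i))"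
    and n: "\<And>v. ((\<lambda>y. E y v) has_derivative (\<lambda>u. n u v)) (at y0)"
    and br: "\<And>u v. n u v - n v u = - br (E y0 u) (E y0 v)"
  shows "ext_d 4 \<omega> c y0 v = CE4 br \<alpha> (\<lambda>i. E y0 (v i))"
proof -
  define A where "A x y z w = \<alpha> ((!) [x, y, z, w])" for x y z w
  have A: "\<alpha> f = A (f 0) (f 1) (f 2) (f 3)" for f
    unfolding A_def by (rule multilin_list[OF alt_form_multilin[OF a]]) (auto simp: less_numerals)
  have m2: "A x z y w = - A z x y w" for x y z w
    unfolding A_def by (rule alt_form_list_swaps_4[OF a])
  have m3: "A x y z w = A z x y w" for x y z w
    using alt_form_list_swaps_4(1,2)[OF a] unfolding A_def by (metis minus_minus)
  have m4: "A x y w z = - A z x y w" for x y z w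
    using alt_form_list_swaps_4(3)[OF a] m3 unfolding A_def by metis
  have D: "A (br (E y0 u) (E y0 t)) x y z = A (n t u) x y z - A (n u t) x y z" for u t x y z
  proof -
    have "br (E y0 u) (E y0 t) = n t u - n u t"
      using br[of u t] by (metis minus_diff_eq minus_minus)
    then show ?thesis
      using linear_diff[OF multilin_4_linear[OF alt_form_multilin[OF a]]] unfolding A_def by simp
  qed
  have s4: "(\<Sum>j<4. f j) = f 0 + f 1 + f 2 + f 3" for f :: "nat \<Rightarrow> real"
    by (simp add: numeral_eq_Suc One_nat_def)
  let ?E = "\<lambda>i. E y0 (v i)" and ?n = "\<lambda>i j. n (v i) (v j)"
  have ext: "ext_d 4 \<omega> c y0 v = (\<Sum>i\<le>4. (-1) ^ i * (\<Sum>j<4. \<alpha> ((\<lambda>m. E y0 (if m < i then v m else v (Suc m)))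
      (j := n (v i) (if j < i then v j else v (Suc j))))))"
    by (rule ext_d_multilin[where E = E and n = n, OF alt_form_multilin[OF a] N _ n]) (rule \<omega>)
  show ?thesis
    unfolding ext CE4_def sum_atMost_numerals s4 A_def[symmetric] D
    unfolding A
    using m2[of "?E 1" "?n 0 2" "?E 3" "?E 4"] m3[of "?E 1" "?E 2" "?n 0 3" "?E 4"] m4[of "?E 1" "?E 2" "?E 3" "?n 0 4"]
      m2[of "?E 0" "?n 1 2" "?E 3" "?E 4"] m3[of "?E 0" "?E 2" "?n 1 3" "?E 4"] m4[of "?E 0" "?E 2" "?E 3" "?n 1 4"]
      m2[of "?E 0" "?n 2 1" "?E 3" "?E 4"] m3[of "?E 0" "?E 1" "?n 2 3" "?E 4"] m4[of "?E 0" "?E 1" "?E 3" "?n 2 4"]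
      m2[of "?E 0" "?n 3 1" "?E 2" "?E 4"] m3[of "?E 0" "?E 1" "?n 3 2" "?E 4"] m4[of "?E 0" "?E 1" "?E 2" "?n 3 4"]
      m2[of "?E 0" "?n 4 1" "?E 2" "?E 3"] m3[of "?E 0" "?E 1" "?n 4 2" "?E 3"] m4[of "?E 0" "?E 1" "?E 2" "?n 4 3"]
    by (simp add: Suc_numerals)
qed

end

text \<open>For \<open>\<mu>(z, y) = h(z)\<inverse> h(y)\<close> the fibre derivative is the Maurer--Cartan form.\<close>

definition fibre_derivative :: "('a::euclidean_space \<times> 'a \<Rightarrow> 'a) \<Rightarrow> 'a \<Rightarrow> 'a \<Rightarrow> 'a" where
  "fibre_derivative \<mu> y v = frechet_derivative \<mu> (at (y, y)) (0, v)"

text \<open>The second derivative once in each variable, at a diagonal point; the first vector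
  belongs to the first variable. For the map sending (x, y) to x^-1 y in a chart at the identity its
  skew part yields the Lie bracket.\<close>

definition mixed_derivative :: "('a::euclidean_space \<times> 'a \<Rightarrow> 'a) \<Rightarrow> 'a \<Rightarrow> 'a \<Rightarrow> 'a \<Rightarrow> 'a" where
  "mixed_derivative \<nu> x0 a b = frechet_derivative (\<lambda>p. frechet_derivative \<nu> (at p) (0, b)) (at (x0, x0)) (a, 0)"

section \<open>Derivatives of group operations read in a chart\<close>

lemma has_derivative_pair_left: "((\<lambda>s. (s, c)) has_derivative (\<lambda>a. (a, 0))) (at x)"
  by (auto intro!: derivative_eq_intros)

lemma has_derivative_pair_right: "((\<lambda>s. (c, s)) has_derivative (\<lambda>a. (0, a))) (at x)"
  by (auto intro!: derivative_eq_intros)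

lemma has_derivative_pair_diag: "((\<lambda>s. (s, s)) has_derivative (\<lambda>a. (a, a))) (at x)"
  by (auto intro!: derivative_eq_intros)

lemma smooth_on_partial:
  fixes f :: "'a::euclidean_space \<times> 'a \<Rightarrow> 'a"
  assumes "smooth_on D f" "(x, y) \<in> D"
  shows "((\<lambda>s. f (s, y)) has_derivative (\<lambda>a. frechet_derivative f (at (x, y)) (a, 0))) (at x)"
    "((\<lambda>s. f (x, s)) has_derivative (\<lambda>a. frechet_derivative f (at (x, y)) (0, a))) (at y)"
  using has_derivative_compose[OF has_derivative_pair_left smooth_on_has_derivative[OF assms]]
    has_derivative_compose[OF has_derivative_pair_right smooth_on_has_derivative[OF assms]] by auto

lemma smooth_on_diagonal:
  fixes f :: "'a::euclidean_space \<times> 'a \<Rightarrow> 'a"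
  assumes "smooth_on D f" "(x, x) \<in> D"
  shows "((\<lambda>s. f (s, s)) has_derivative (\<lambda>a. frechet_derivative f (at (x, x)) (a, a))) (at x)"
  using has_derivative_compose[OF has_derivative_pair_diag smooth_on_has_derivative[OF assms]] by auto

lemma frechet_derivative_pair_add:
  fixes f :: "'a::euclidean_space \<times> 'a \<Rightarrow> 'a"
  assumes "smooth_on D f" "p \<in> D"
  shows "frechet_derivative f (at p) (a, c) = frechet_derivative f (at p) (a, 0) + frechet_derivative f (at p) (0, c)"
  using linear_add[OF linear_frechet_derivative[OF smooth_on_differentiable[OF assms]], of "(a, 0)" "(0, c)"] by simp

lemma fibre_derivative_has_derivative:
  assumes D: "open D" and \<mu>: "smooth_on D \<mu>" and y: "(y, y) \<in> D"
  shows "((\<lambda>y. fibre_derivative \<mu> y v) has_derivative (\<lambda>u. frechet_derivative (\<lambda>p. frechet_derivative \<mu> (at p) (0, v)) (at (y, y)) (u, u))) (at y)"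
  unfolding fibre_derivative_def by (rule smooth_on_diagonal[OF smooth_on_derivative[OF \<mu>] y])

text \<open>The quotient h(z)^-1 h(y) does not change when h is translated by h(y0)^-1, so near (y0,
  y0) the map \<mu> is \<nu> composed with k in both variables. In the skew part of \<open>n\<close>
  the second derivative in the fibre variable drops out by symmetry, and the chain rule expresses
  the remaining mixed derivatives through \<nu>.\<close>

lemma fibre_derivative_structure:
  fixes \<mu> \<nu> :: "'a::euclidean_space \<times> 'a \<Rightarrow> 'a"
  assumes D: "open D" and \<mu>: "smooth_on D \<mu>" and D': "open D'" and \<nu>: "smooth_on D' \<nu>"
    and K: "open K" "y0 \<in> K" "\<And>z y. z \<in> K \<Longrightarrow> y \<in> K \<Longrightarrow> (z, y) \<in> D"
    and k: "\<And>y. y \<in> K \<Longrightarrow> k y = \<mu> (y0, y)" "k y0 = x0"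
    and eq: "\<And>z y. z \<in> K \<Longrightarrow> y \<in> K \<Longrightarrow> (k z, k y) \<in> D' \<and> \<mu> (z, y) = \<nu> (k z, k y)"
    and n: "\<And>u v. n u v = frechet_derivative (\<lambda>y. fibre_derivative \<mu> y v) (at y0) u"
  shows "n u v - n v u = mixed_derivative \<nu> x0 (fibre_derivative \<mu> y0 u) (fibre_derivative \<mu> y0 v)
     - mixed_derivative \<nu> x0 (fibre_derivative \<mu> y0 v) (fibre_derivative \<mu> y0 u)"
proof -
  let ?m = "\<lambda>v p. frechet_derivative \<mu> (at p) (0, v)"
  let ?E = "fibre_derivative \<mu> y0"
  have y0: "(y0, y0) \<in> D" using K by blast
  have x0: "(x0, x0) \<in> D'" using eq[OF K(2,2)] k(2) by simp
  have m: "smooth_on D (?m v)" for v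
    by (rule smooth_on_derivative[OF \<mu>])
  have nm: "n u v = frechet_derivative (?m v) (at (y0, y0)) (u, 0) + frechet_derivative (?m v) (at (y0, y0)) (0, u)" for u v
  proof -
    have "n u v = frechet_derivative (?m v) (at (y0, y0)) (u, u)"
      unfolding n frechet_derivative_at[OF fibre_derivative_has_derivative[OF D \<mu> y0], symmetric] ..
    then show ?thesis
      by (rule trans[OF _ frechet_derivative_pair_add[OF m y0]])
  qed
  have Dk: "(k has_derivative ?E) (at y0)"
  proof (rule has_derivative_transform_within_open[OF _ K(1,2)])
    show "((\<lambda>y. \<mu> (y0, y)) has_derivative ?E) (at y0)"
      using smooth_on_partial(2)[OF \<mu> y0] by (simp add: fibre_derivative_def[abs_def])
  qed (use k(1) in auto)
  have mixed: "frechet_derivative (?m v) (at (y0, y0)) (u, 0) = mixed_derivative \<nu> x0 (?E u) (?E v)" for u v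
  proof -
    let ?b = "\<lambda>s. frechet_derivative \<nu> (at (s, x0)) (0, ?E v)"
    have 1: "?m v (z, y0) = ?b (k z)" if z: "z \<in> K" for z
    proof -
      have "((\<lambda>y. \<nu> (k z, y)) has_derivative (\<lambda>a. frechet_derivative \<nu> (at (k z, k y0)) (0, a))) (at (k y0))"
        using eq[OF z K(2)] by (intro smooth_on_partial(2)[OF \<nu>]) simp
      from has_derivative_compose[OF Dk this]
      have "((\<lambda>y. \<nu> (k z, k y)) has_derivative (\<lambda>a. frechet_derivative \<nu> (at (k z, x0)) (0, ?E a))) (at y0)"
        by (simp add: k(2))
      then have "((\<lambda>y. \<mu> (z, y)) has_derivative (\<lambda>a. frechet_derivative \<nu> (at (k z, x0)) (0, ?E a))) (at y0)"
        by (rule has_derivative_transform_within_open[OF _ K(1,2)]) (use eq[OF z] in auto)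
      from has_derivative_unique[OF smooth_on_partial(2)[OF \<mu> K(3)[OF z K(2)]] this]
      show ?thesis by (simp add: fun_eq_iff)
    qed
    have "((\<lambda>s. ?b s) has_derivative (\<lambda>a. mixed_derivative \<nu> x0 a (?E v))) (at (k y0))"
      unfolding k(2) mixed_derivative_def by (rule smooth_on_partial(1)[OF smooth_on_derivative[OF \<nu>] x0])
    from has_derivative_compose[OF Dk this]
    have "((\<lambda>z. ?m v (z, y0)) has_derivative (\<lambda>a. mixed_derivative \<nu> x0 (?E a) (?E v))) (at y0)"
      by (rule has_derivative_transform_within_open[OF _ K(1,2)]) (use 1 in auto)
    from has_derivative_unique[OF smooth_on_partial(1)[OF m y0] this]
    show ?thesis by (simp add: fun_eq_iff)
  qed
  show ?thesis
    unfolding nm mixed using symmetric_second_derivative[OF D \<mu> y0, of "(0, v)" "(0, u)"] by simp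
qed

lemma bilinear_mixed_derivative:
  assumes D: "open D" and \<nu>: "smooth_on D \<nu>" and x: "(x, x) \<in> D"
  shows "bilinear (mixed_derivative \<nu> x)"
  unfolding bilinear_def
proof (intro conjI allI)
  have lin: "linear (frechet_derivative (\<lambda>p. frechet_derivative \<nu> (at p) (0, b)) (at (x, x)))" for b
    by (rule linear_frechet_derivative[OF smooth_on_differentiable[OF smooth_on_derivative[OF \<nu>] x]])
  show "linear (\<lambda>a. mixed_derivative \<nu> x a b)" for b
    unfolding mixed_derivative_def using linear_compose[OF _ lin, of "\<lambda>a. (a, 0)"]
    by (simp add: o_def linear_iff)
  have sym: "mixed_derivative \<nu> x a b = frechet_derivative (\<lambda>p. frechet_derivative \<nu> (at p) (a, 0)) (at (x, x)) (0, b)" for a b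
    unfolding mixed_derivative_def by (rule symmetric_second_derivative[OF D \<nu> x])
  have lin': "linear (frechet_derivative (\<lambda>p. frechet_derivative \<nu> (at p) (a, 0)) (at (x, x)))" for a
    by (rule linear_frechet_derivative[OF smooth_on_differentiable[OF smooth_on_derivative[OF \<nu>] x]])
  show "linear (mixed_derivative \<nu> x a)" for a
    using linear_compose[OF _ lin', of "\<lambda>b. (0, b)"] unfolding sym[abs_def]
    by (simp add: o_def linear_iff)
qed

text \<open>Differentiate the structure equation at x0, where E is the identity, and sum cyclically.
  The second derivatives of E cancel by their symmetry (d d E = 0), and the first derivatives
  recombine to double brackets.\<close>

lemma jacobi_of_structure:
  fixes E :: "'a::euclidean_space \<Rightarrow> 'a \<Rightarrow> 'a"
  assumes N: "open N" "x0 \<in> N" and E: "\<And>v. smooth_on N (\<lambda>y. E y v)" and id: "\<And>v. E x0 v = v"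
    and br: "bilinear br"
    and st: "\<And>y u v. y \<in> N \<Longrightarrow> frechet_derivative (\<lambda>y. E y v) (at y) u - frechet_derivative (\<lambda>y. E y u) (at y) v = - br (E y u) (E y v)"
  shows "br (br u v) w + br (br v w) u + br (br w u) v = 0"
proof -
  define n where "n u v = frechet_derivative (\<lambda>y. E y v) (at x0) u" for u v
  define H where "H v u w = frechet_derivative (\<lambda>y. frechet_derivative (\<lambda>y. E y v) (at y) u) (at x0) w" for u v w
  have Hs: "H v u w = H v w u" for u v w
    unfolding H_def by (rule symmetric_second_derivative[OF N(1) E N(2)])
  have bb: "bounded_bilinear br"
    using br bilinear_conv_bounded_bilinear by blast
  have main: "H v u w - H u v w = - (br (n w u) v + br u (n w v))" for u v w
  proof -
    have dE: "((\<lambda>y. E y v) has_derivative (\<lambda>w. n w v)) (at x0)" for v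
      unfolding n_def by (rule smooth_on_has_derivative[OF E N(2)])
    have "((\<lambda>y. - br (E y u) (E y v)) has_derivative (\<lambda>w. - (br (E x0 u) (n w v) + br (n w u) (E x0 v)))) (at x0)"
      by (intro has_derivative_minus bounded_bilinear.FDERIV[OF bb] dE)
    then have "((\<lambda>y. frechet_derivative (\<lambda>y. E y v) (at y) u - frechet_derivative (\<lambda>y. E y u) (at y) v)
        has_derivative (\<lambda>w. - (br (E x0 u) (n w v) + br (n w u) (E x0 v)))) (at x0)"
      by (rule has_derivative_transform_within_open[OF _ N]) (use st in auto)
    moreover have "((\<lambda>y. frechet_derivative (\<lambda>y. E y v) (at y) u - frechet_derivative (\<lambda>y. E y u) (at y) v)
        has_derivative (\<lambda>w. H v u w - H u v w)) (at x0)"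
      unfolding H_def by (intro has_derivative_diff smooth_on_has_derivative[OF smooth_on_derivative[OF E] N(2)])
    ultimately show ?thesis
      using has_derivative_unique[of _ "\<lambda>w. H v u w - H u v w" x0] unfolding id by (metis (no_types, lifting) add.commute)
  qed
  have anti: "br y x = - br x y" for x y
    using st[OF N(2), of x y] st[OF N(2), of y x] unfolding id by (metis minus_diff_eq minus_minus)
  have n: "br x y = n y x - n x y" for x y
    using st[OF N(2), of y x] unfolding id n_def by (metis minus_diff_eq minus_minus)
  have "0 = (H v u w - H u v w) + (H w v u - H v w u) + (H u w v - H w u v)"
    using Hs[of v u w] Hs[of u v w] Hs[of w v u] by simp
  also have "\<dots> = - (br (n w u) v + br u (n w v)) - (br (n u v) w + br v (n u w)) - (br (n v w) u + br w (n v u))"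
    unfolding main by simp
  also have "\<dots> = br (n v u - n u v) w + br (n w v - n v w) u + br (n u w - n w u) v"
    unfolding bilinear_lsub[OF br] anti[of "n w v" u] anti[of "n u w" v] anti[of "n v u" w] by simp
  finally show ?thesis
    unfolding n[symmetric] by simp
qed

text \<open>A product rule for E y applied to Q y, where differentiability of E is known on each
  fixed vector only; hence the expansion in a basis.\<close>

lemma linear_family_has_derivative:
  fixes E :: "'a::euclidean_space \<Rightarrow> 'a \<Rightarrow> 'a"
  assumes N: "open N" "x0 \<in> N" and lin: "\<And>y. y \<in> N \<Longrightarrow> linear (E y)"
    and E: "\<And>v. ((\<lambda>y. E y v) has_derivative (\<lambda>u. n u v)) (at x0)"
    and Q: "(Q has_derivative Q') (at x0)"
  shows "((\<lambda>y. E y (Q y)) has_derivative (\<lambda>a. n a (Q x0) + E x0 (Q' a))) (at x0)"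
proof -
  have ex: "E y v = (\<Sum>i\<in>Basis. (v \<bullet> i) *\<^sub>R E y i)" if "y \<in> N" for y v
    using linear_sum[OF lin[OF that], of "\<lambda>i. (v \<bullet> i) *\<^sub>R i" Basis] by (simp add: euclidean_representation linear_cmul[OF lin[OF that]])
  have nx: "n a v = (\<Sum>i\<in>Basis. (v \<bullet> i) *\<^sub>R n a i)" for a v
  proof -
    have "((\<lambda>y. \<Sum>i\<in>Basis. (v \<bullet> i) *\<^sub>R E y i) has_derivative (\<lambda>a. \<Sum>i\<in>Basis. (v \<bullet> i) *\<^sub>R n a i)) (at x0)"
      by (intro has_derivative_sum has_derivative_scaleR_right E)
    then have "((\<lambda>y. E y v) has_derivative (\<lambda>a. \<Sum>i\<in>Basis. (v \<bullet> i) *\<^sub>R n a i)) (at x0)"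
      by (rule has_derivative_transform_within_open[OF _ N]) (use ex in auto)
    from has_derivative_unique[OF E this] show ?thesis
      by (simp add: fun_eq_iff)
  qed
  have "((\<lambda>y. \<Sum>i\<in>Basis. (Q y \<bullet> i) *\<^sub>R E y i) has_derivative (\<lambda>a. \<Sum>i\<in>Basis. (Q x0 \<bullet> i) *\<^sub>R n a i + (Q' a \<bullet> i) *\<^sub>R E x0 i)) (at x0)"
    by (intro has_derivative_sum has_derivative_scaleR E has_derivative_inner_left Q)
  then have "((\<lambda>y. \<Sum>i\<in>Basis. (Q y \<bullet> i) *\<^sub>R E y i) has_derivative (\<lambda>a. n a (Q x0) + E x0 (Q' a))) (at x0)"
    unfolding nx[of _ "Q x0"] ex[OF N(2), of "Q' _"] sum.distrib .
  then show ?thesis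
    by (rule has_derivative_transform_within_open[OF _ N]) (use ex in auto)
qed

text \<open>\<open>W s b\<close> is the velocity at the identity of the commutator s^-1 q^-1 s q
  along a curve q with velocity b. In the proof P and Q are the left and right translates of b by s,
  and W = b - E s (Q b s), which is b - Ad(s^-1) b. Its derivative in s is the bracket.\<close>

lemma commutator_derivative:
  fixes \<nu> m :: "'a::euclidean_space \<times> 'a \<Rightarrow> 'a"
  assumes D: "open D" and \<nu>: "smooth_on D \<nu>" and D': "open D'" and m: "smooth_on D' m"
    and N: "open N" "x0 \<in> N"
    and mem: "\<And>s. s \<in> N \<Longrightarrow> (s, s) \<in> D \<and> (s, x0) \<in> D' \<and> (x0, s) \<in> D'"
    and unit: "\<And>s. s \<in> N \<Longrightarrow> m (s, x0) = s \<and> m (x0, s) = s"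
    and \<nu>1: "\<And>s. s \<in> N \<Longrightarrow> \<nu> (s, s) = x0"
    and \<nu>2: "\<And>s t. s \<in> N \<Longrightarrow> t \<in> N \<Longrightarrow> \<nu> (s, m (s, t)) = t"
    and id: "\<And>v. fibre_derivative \<nu> x0 v = v"
    and n: "\<And>u v. n u v = frechet_derivative (\<lambda>y. fibre_derivative \<nu> y v) (at x0) u"
  defines "W \<equiv> \<lambda>s b. frechet_derivative \<nu> (at (s, s)) (frechet_derivative m (at (x0, s)) (b, 0), frechet_derivative m (at (s, x0)) (0, b))"
  shows "W x0 b = 0" "((\<lambda>s. W s b) has_derivative (\<lambda>a. n b a - n a b)) (at x0)"
proof -
  let ?E = "fibre_derivative \<nu>"
  define P where "P b s = frechet_derivative m (at (s, x0)) (0, b)" for b s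
  define Q where "Q b s = frechet_derivative m (at (x0, s)) (b, 0)" for b s
  have xx: "(x0, x0) \<in> D" "(x0, x0) \<in> D'"
    using mem[OF N(2)] by auto
  have lin: "linear (?E s)" if "s \<in> N" for s
    unfolding fibre_derivative_def
    using linear_compose[OF _ linear_frechet_derivative[OF smooth_on_differentiable[OF \<nu>]], of "\<lambda>a. (0, a)" "(s, s)"] mem[OF that]
    by (simp add: o_def linear_iff)
  have dE: "((\<lambda>y. ?E y v) has_derivative (\<lambda>u. n u v)) (at x0)" for v
    unfolding n frechet_derivative_at[OF fibre_derivative_has_derivative[OF D \<nu> xx(1)], symmetric]
    by (rule fibre_derivative_has_derivative[OF D \<nu> xx(1)])
  have left: "frechet_derivative \<nu> (at (s, s)) (a, 0) = - ?E s a" if s: "s \<in> N" for s a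
  proof -
    have "((\<lambda>s. \<nu> (s, s)) has_derivative (\<lambda>a. 0)) (at s)"
      by (rule has_derivative_transform_within_open[OF has_derivative_const N(1) s]) (use \<nu>1 in auto)
    from has_derivative_unique[OF smooth_on_diagonal[OF \<nu>] this] mem[OF s]
    have "frechet_derivative \<nu> (at (s, s)) (a, a) = 0" by (simp add: fun_eq_iff)
    then show ?thesis
      using frechet_derivative_pair_add[OF \<nu>, of "(s, s)" a a] mem[OF s]
      by (simp add: fibre_derivative_def eq_neg_iff_add_eq_0)
  qed
  have EP: "?E s (P b s) = b" if s: "s \<in> N" for s b
  proof -
    have 1: "((\<lambda>t. m (s, t)) has_derivative (\<lambda>a. P a s)) (at x0)"
      unfolding P_def using mem[OF s] by (intro smooth_on_partial(2)[OF m]) auto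
    have 2: "((\<lambda>t. \<nu> (s, t)) has_derivative ?E s) (at (m (s, x0)))"
      using smooth_on_partial(2)[OF \<nu>, of s s] mem[OF s] unit[OF s] by (simp add: fibre_derivative_def[abs_def])
    have "((\<lambda>t. \<nu> (s, m (s, t))) has_derivative (\<lambda>a. ?E s (P a s))) (at x0)"
      by (rule has_derivative_compose[OF 1 2])
    moreover have "((\<lambda>t. \<nu> (s, m (s, t))) has_derivative (\<lambda>a. a)) (at x0)"
      by (rule has_derivative_transform_within_open[OF has_derivative_ident N]) (use \<nu>2[OF s] in auto)
    ultimately have "(\<lambda>a. ?E s (P a s)) = (\<lambda>a. a)"
      by (rule has_derivative_unique)
    then show ?thesis
      by (simp add: fun_eq_iff)
  qed
  have W: "W s b = b - ?E s (Q b s)" if s: "s \<in> N" for s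
  proof -
    have "W s b = frechet_derivative \<nu> (at (s, s)) (Q b s, 0) + ?E s (P b s)"
      unfolding W_def P_def Q_def fibre_derivative_def using mem[OF s] by (intro frechet_derivative_pair_add[OF \<nu>]) auto
    then show ?thesis
      using left[OF s] EP[OF s] by simp
  qed
  have Q0: "Q b x0 = b"
  proof -
    have "((\<lambda>s. m (s, x0)) has_derivative (\<lambda>a. a)) (at x0)"
      by (rule has_derivative_transform_within_open[OF has_derivative_ident N]) (use unit in auto)
    from has_derivative_unique[OF smooth_on_partial(1)[OF m xx(2)] this]
    show ?thesis by (simp add: Q_def fun_eq_iff)
  qed
  show "W x0 b = 0"
    using W[OF N(2)] Q0 id by simp
  have dP: "(P a has_derivative (\<lambda>u. frechet_derivative (\<lambda>p. frechet_derivative m (at p) (0, a)) (at (x0, x0)) (u, 0))) (at x0)" for a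
    unfolding P_def[abs_def] by (rule smooth_on_partial(1)[OF smooth_on_derivative[OF m] xx(2)])
  \<comment> \<open>Differentiating \<open>EP\<close> at the identity expresses a mixed second
    derivative of the multiplication through \<open>n\<close>. Symmetry of second derivatives then
    transfers this from P to Q.\<close>
  have "n u a + frechet_derivative (\<lambda>p. frechet_derivative m (at p) (0, a)) (at (x0, x0)) (u, 0) = 0" for u a
  proof -
    have "((\<lambda>s. ?E s (P a s)) has_derivative (\<lambda>u. n u (P a x0) + ?E x0 (frechet_derivative (\<lambda>p. frechet_derivative m (at p) (0, a)) (at (x0, x0)) (u, 0)))) (at x0)"
      by (rule linear_family_has_derivative[OF N lin dE dP])
    moreover have "((\<lambda>s. ?E s (P a s)) has_derivative (\<lambda>u. 0)) (at x0)"
      by (rule has_derivative_transform_within_open[OF has_derivative_const N]) (use EP in auto)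
    ultimately have "(\<lambda>u. n u (P a x0) + ?E x0 (frechet_derivative (\<lambda>p. frechet_derivative m (at p) (0, a)) (at (x0, x0)) (u, 0))) = (\<lambda>u. 0)"
      by (rule has_derivative_unique)
    moreover have "P a x0 = a"
      using EP[OF N(2)] id by metis
    ultimately have "(\<lambda>u. n u a + frechet_derivative (\<lambda>p. frechet_derivative m (at p) (0, a)) (at (x0, x0)) (u, 0)) = (\<lambda>u. 0)"
      unfolding id by simp
    then show ?thesis
      by (simp add: fun_eq_iff)
  qed
  then have mix: "frechet_derivative (\<lambda>p. frechet_derivative m (at p) (0, a)) (at (x0, x0)) (u, 0) = - n u a" for u a
    by (metis add.commute eq_neg_iff_add_eq_0)
  have "(Q b has_derivative (\<lambda>u. frechet_derivative (\<lambda>p. frechet_derivative m (at p) (b, 0)) (at (x0, x0)) (0, u))) (at x0)"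
    unfolding Q_def[abs_def] by (rule smooth_on_partial(2)[OF smooth_on_derivative[OF m] xx(2)])
  then have dQ: "(Q b has_derivative (\<lambda>u. - n b u)) (at x0)"
    unfolding symmetric_second_derivative[OF D' m xx(2), of "(b, 0)"] mix .
  have "((\<lambda>s. b - ?E s (Q b s)) has_derivative (\<lambda>a. 0 - (n a (Q b x0) + ?E x0 (- n b a)))) (at x0)"
    by (intro has_derivative_diff has_derivative_const linear_family_has_derivative[OF N lin dE dQ])
  then have "((\<lambda>s. b - ?E s (Q b s)) has_derivative (\<lambda>a. n b a - n a b)) (at x0)"
    unfolding Q0 id by simp
  then show "((\<lambda>s. W s b) has_derivative (\<lambda>a. n b a - n a b)) (at x0)"
    by (rule has_derivative_transform_within_open[OF _ N]) (use W in auto)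
qed

section \<open>Lie groups\<close>

lemma atlas_chart:
  assumes "smooth_atlas A" "(U, f) \<in> A"
  shows "open U" "open (f ` U)" "continuous_on U f" "continuous_on (f ` U) (inv_into U f)" "inj_on f U"
proof -
  have 1: "open U \<and> open (f ` U) \<and> homeomorphism U (f ` U) f (inv_into U f)"
    using assms unfolding smooth_atlas_def by fast
  then show "open U" "open (f ` U)" "continuous_on U f" "continuous_on (f ` U) (inv_into U f)"
    by (auto simp: homeomorphism_def)
  show "inj_on f U"
    using 1 unfolding homeomorphism_def by (metis inj_on_def)
qed

lemma atlas_cover: "smooth_atlas A \<Longrightarrow> \<exists>U f. (U, f) \<in> A \<and> p \<in> U"
  unfolding smooth_atlas_def by blast

lemma open_chart_image:
  assumes A: "smooth_atlas A" "(U, f) \<in> A" and W: "open W" "W \<subseteq> U"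
  shows "open (f ` W)"
proof -
  have "f ` W = inv_into U f -` W \<inter> f ` U"
    using W(2) atlas_chart(5)[OF A] by (auto simp: inv_into_f_f subset_iff)
  then show ?thesis
    using continuous_on_open_vimage[OF atlas_chart(2)[OF A]] atlas_chart(4)[OF A] W(1) by metis
qed

text \<open>A map from a Euclidean domain into a manifold does not need an atlas on its domain.\<close>

definition smooth_into ::
  "('m::topological_space, 'v::euclidean_space) chart set \<Rightarrow> 'b::euclidean_space set \<Rightarrow> ('b \<Rightarrow> 'm) \<Rightarrow> bool" where
  "smooth_into A S h \<longleftrightarrow> continuous_on S h \<and> (\<forall>(U, f)\<in>A. smooth_on (S \<inter> h -` U) (\<lambda>x. f (h x)))"

lemma smooth_intoD: "smooth_into A S h \<Longrightarrow> (U, f) \<in> A \<Longrightarrow> smooth_on (S \<inter> h -` U) (\<lambda>x. f (h x))"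
  unfolding smooth_into_def by fast

lemma smooth_into_open: "smooth_into A S h \<Longrightarrow> open S \<Longrightarrow> open U \<Longrightarrow> open (S \<inter> h -` U)"
  unfolding smooth_into_def using continuous_on_open_vimage by (metis inf_commute)

lemma smooth_into_subset: "smooth_into A S h \<Longrightarrow> T \<subseteq> S \<Longrightarrow> smooth_into A T h"
  unfolding smooth_into_def by (auto intro: continuous_on_subset smooth_on_subset)

lemma smooth_into_const: "smooth_into A S (\<lambda>x. c)"
  unfolding smooth_into_def by (auto intro: smooth_on_const)

lemma smooth_into_inv_chart:
  assumes A: "smooth_atlas A" "(U, f) \<in> A"
  shows "smooth_into A (f ` U) (inv_into U f)"
  unfolding smooth_into_def
proof (intro conjI ballI)
  show "continuous_on (f ` U) (inv_into U f)"
    by (rule atlas_chart(4)[OF A])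
  fix c assume c: "c \<in> A"
  obtain V g where [simp]: "c = (V, g)" by (cases c)
  have "smooth_on (f ` (U \<inter> V)) (g \<circ> inv_into U f)"
    using A c unfolding smooth_atlas_def by fastforce
  moreover have "f ` U \<inter> inv_into U f -` V \<subseteq> f ` (U \<inter> V)"
    using atlas_chart(5)[OF A] by auto
  ultimately show "case c of (V, g) \<Rightarrow> smooth_on (f ` U \<inter> inv_into U f -` V) (\<lambda>x. g (inv_into U f x))"
    using smooth_on_subset by (fastforce simp: o_def)
qed

lemma smooth_into_reparam:
  fixes r :: "'a::euclidean_space \<Rightarrow> 'b::euclidean_space"
  assumes A: "smooth_atlas A" and S: "open S" "open T" and r: "smooth_on T r" "r ` T \<subseteq> S" and h: "smooth_into A S h"
  shows "smooth_into A T (\<lambda>x. h (r x))"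
  unfolding smooth_into_def
proof (intro conjI ballI)
  have cr: "continuous_on T r"
    by (rule smooth_on_continuous[OF r(1)])
  then show c: "continuous_on T (\<lambda>x. h (r x))"
    using h r(2) continuous_on_compose2 unfolding smooth_into_def by blast
  fix c assume cA: "c \<in> A"
  obtain U f where [simp]: "c = (U, f)" by (cases c)
  have U: "open U"
    using atlas_chart(1)[OF A] cA by simp
  have "smooth_on (T \<inter> (\<lambda>x. h (r x)) -` U) (\<lambda>x. f (h (r x)))"
  proof (rule smooth_on_compose[OF _ smooth_into_open[OF h S(1) U] _ smooth_intoD[OF h]])
    show "open (T \<inter> (\<lambda>x. h (r x)) -` U)"
      using continuous_on_open_vimage[OF S(2)] c U by (metis inf_commute)
    show "smooth_on (T \<inter> (\<lambda>x. h (r x)) -` U) r"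
      using r(1) by (rule smooth_on_subset) auto
  qed (use r(2) cA in auto)
  then show "case c of (U, f) \<Rightarrow> smooth_on (T \<inter> (\<lambda>x. h (r x)) -` U) (\<lambda>x. f (h (r x)))"
    by simp
qed

text \<open>The atlas of the source is only required to be a system of charts, so that the lemma applies to
  \<open>product_atlas\<close> without proving that it is smooth.\<close>

lemma smooth_into_map_aux:
  fixes F :: "'m::topological_space \<Rightarrow> 'n::topological_space" and h :: "'b::euclidean_space \<Rightarrow> 'm"
    and A :: "('m, 'v::euclidean_space) chart set" and B :: "('n, 'w::euclidean_space) chart set"
  assumes cover: "\<And>p. \<exists>U f. (U, f) \<in> A \<and> p \<in> U"
    and chart: "\<And>U f W. (U, f) \<in> A \<Longrightarrow> open U \<and> inj_on f U \<and> (open W \<longrightarrow> W \<subseteq> U \<longrightarrow> open (f ` W))"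
    and B: "\<And>V g. (V, g) \<in> B \<Longrightarrow> open V"
    and F: "smooth_map_on A B S F" and S: "open S" "open T" and h: "smooth_into A T h" "h ` T \<subseteq> S"
  shows "smooth_into B T (\<lambda>x. F (h x))"
  unfolding smooth_into_def
proof (intro conjI ballI)
  have cF: "continuous_on S F"
    using F unfolding smooth_map_on_def by blast
  show c: "continuous_on T (\<lambda>x. F (h x))"
    using h continuous_on_compose2[OF cF] unfolding smooth_into_def by blast
  fix c assume cB: "c \<in> B"
  obtain V g where [simp]: "c = (V, g)" by (cases c)
  have V: "open V"
    using B cB by auto
  have "smooth_on (T \<inter> (\<lambda>x. F (h x)) -` V) (\<lambda>x. g (F (h x)))"
  proof (rule smooth_on_local)
    fix x assume x: "x \<in> T \<inter> (\<lambda>x. F (h x)) -` V"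
    obtain U f where U: "(U, f) \<in> A" "h x \<in> U" using cover by blast
    let ?N = "(T \<inter> h -` U) \<inter> (T \<inter> (\<lambda>x. F (h x)) -` V)"
    let ?W = "f ` (U \<inter> S \<inter> F -` V)"
    have N: "open ?N"
      using smooth_into_open[OF h(1) S(2)] chart[OF U(1)] continuous_on_open_vimage[OF S(2)] c V
      by (metis inf_commute open_Int)
    have "open (F -` V \<inter> S)"
      using continuous_on_open_vimage[OF S(1)] cF V by blast
    then have "open (U \<inter> S \<inter> F -` V)"
      using chart[OF U(1)] by (metis inf_assoc inf_commute open_Int)
    then have W: "open ?W"
      using chart[OF U(1), of "U \<inter> S \<inter> F -` V"] by blast
    have g: "smooth_on ?W (g \<circ> F \<circ> inv_into U f)"
      using F U(1) cB unfolding smooth_map_on_def by fastforce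
    have f: "smooth_on ?N (\<lambda>x. f (h x))"
      using smooth_intoD[OF h(1) U(1)] by (rule smooth_on_subset) auto
    have "smooth_on ?N (\<lambda>x. (g \<circ> F \<circ> inv_into U f) (f (h x)))"
      by (rule smooth_on_compose[OF N W f g]) (use h(2) in auto)
    then have "smooth_on ?N (\<lambda>x. g (F (h x)))"
      by (rule smooth_on_cong[OF N, rotated]) (use chart[OF U(1)] in auto)
    then show "\<exists>N. open N \<and> x \<in> N \<and> smooth_on N (\<lambda>x. g (F (h x)))"
      using N x U(2) by blast
  qed
  then show "case c of (V, g) \<Rightarrow> smooth_on (T \<inter> (\<lambda>x. F (h x)) -` V) (\<lambda>x. g (F (h x)))"
    by simp
qed

lemma smooth_into_map:
  assumes A: "smooth_atlas A" and B: "smooth_atlas B"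
    and F: "smooth_map_on A B S F" and S: "open S" "open T" and h: "smooth_into A T h" "h ` T \<subseteq> S"
  shows "smooth_into B T (\<lambda>x. F (h x))"
  by (rule smooth_into_map_aux[OF _ _ _ F S h])
    (use atlas_cover[OF A] atlas_chart[OF A] open_chart_image[OF A] atlas_chart(1)[OF B] in auto)

lemma smooth_into_pair:
  assumes T: "open T" and h: "smooth_into A T h" and k: "smooth_into B T k"
    and A: "\<And>U f. (U, f) \<in> A \<Longrightarrow> open U" and B: "\<And>U f. (U, f) \<in> B \<Longrightarrow> open U"
  shows "smooth_into (product_atlas A B) T (\<lambda>x. (h x, k x))"
  unfolding smooth_into_def
proof (intro conjI ballI)
  show "continuous_on T (\<lambda>x. (h x, k x))"
    using h k unfolding smooth_into_def by (blast intro: continuous_on_Pair)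
  fix c assume "c \<in> product_atlas A B"
  then obtain U f V g where c: "c = (U \<times> V, map_prod f g)" "(U, f) \<in> A" "(V, g) \<in> B"
    unfolding product_atlas_def by auto
  let ?N = "(T \<inter> h -` U) \<inter> (T \<inter> k -` V)"
  have N: "open ?N"
    using smooth_into_open[OF h T A[OF c(2)]] smooth_into_open[OF k T B[OF c(3)]] by blast
  have "smooth_on ?N (\<lambda>x. (f (h x), g (k x)))"
    by (intro smooth_on_Pair[OF N] smooth_on_subset[OF smooth_intoD[OF h c(2)]] smooth_on_subset[OF smooth_intoD[OF k c(3)]]) auto
  moreover have "?N = T \<inter> (\<lambda>x. (h x, k x)) -` (U \<times> V)"
    by auto
  ultimately show "case c of (W, p) \<Rightarrow> smooth_on (T \<inter> (\<lambda>x. (h x, k x)) -` W) (\<lambda>x. p (h x, k x))"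
    unfolding c by simp
qed

lemma smooth_into_map2:
  fixes A :: "('m::{t2_space,second_countable_topology}, 'v::euclidean_space) chart set"
    and F :: "'m \<times> 'm \<Rightarrow> 'm"
  assumes A: "smooth_atlas A" and F: "smooth_map_on (product_atlas A A) A UNIV F"
    and T: "open T" and h: "smooth_into A T h" and k: "smooth_into A T k"
  shows "smooth_into A T (\<lambda>x. F (h x, k x))"
proof (rule smooth_into_map_aux[OF _ _ _ F _ T smooth_into_pair[OF T h k]])
  show "\<exists>U f. (U, f) \<in> product_atlas A A \<and> p \<in> U" for p
  proof -
    obtain U f V g where "(U, f) \<in> A" "fst p \<in> U" "(V, g) \<in> A" "snd p \<in> V"
      using atlas_cover[OF A] by metis
    then have "(U \<times> V, map_prod f g) \<in> product_atlas A A" "p \<in> U \<times> V"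
      unfolding product_atlas_def by (auto simp: mem_Times_iff)
    then show ?thesis by blast
  qed
  fix W :: "('m \<times> 'm) set" and D :: "('m \<times> 'm) set" and p :: "'m \<times> 'm \<Rightarrow> 'v \<times> 'v"
  assume "(D, p) \<in> product_atlas A A"
  then obtain U f V g where c: "D = U \<times> V" "p = map_prod f g" and UV: "(U, f) \<in> A" "(V, g) \<in> A"
    unfolding product_atlas_def by auto
  note U = atlas_chart[OF A UV(1)] open_chart_image[OF A UV(1)]
  note V = atlas_chart[OF A UV(2)] open_chart_image[OF A UV(2)]
  have "open (p ` W)" if W: "open W" "W \<subseteq> D"
  proof (subst openin_subopen[of euclidean, simplified], intro ballI)
    fix y assume "y \<in> p ` W"
    then obtain a b where ab: "(a, b) \<in> W" "y = (f a, g b)"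
      unfolding c by auto
    obtain X Y where XY: "open X" "open Y" "(a, b) \<in> X \<times> Y" "X \<times> Y \<subseteq> W"
      using open_prod_elim[OF W(1) ab(1)] by blast
    then have "open (f ` X \<times> g ` Y)"
      using W(2) unfolding c by (intro open_Times U(6) V(6)) auto
    moreover have "y \<in> f ` X \<times> g ` Y" "f ` X \<times> g ` Y \<subseteq> p ` W"
      using XY ab unfolding c by force+
    ultimately show "\<exists>T. open T \<and> y \<in> T \<and> T \<subseteq> p ` W" by blast
  qed
  then show "open D \<and> inj_on p D \<and> (open W \<longrightarrow> W \<subseteq> D \<longrightarrow> open (p ` W))"
    using U V unfolding c by (auto intro: open_Times map_prod_inj_on)
qed (use atlas_chart(1)[OF A] in auto)

section \<open>The Lie algebra of the group in a chart around the identity\<close>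

locale lie_group_chart =
  fixes G :: "('g::{t2_space,second_countable_topology}) monoid" (structure)
    and A :: "('g, 'v::euclidean_space) chart set" and U0 :: "'g set" and f0 :: "'g \<Rightarrow> 'v"
  assumes lie: "lie_group G A" and U0: "(U0, f0) \<in> A" "\<one> \<in> U0"
begin

sublocale group G
  using lie unfolding lie_group_def by blast

lemma in_carrier [simp]: "x \<in> carrier G"
  using lie unfolding lie_group_def by simp

lemma atlas: "smooth_atlas A"
  using lie unfolding lie_group_def by blast

abbreviation "X \<equiv> f0 ` U0"
abbreviation "F \<equiv> inv_into U0 f0"
abbreviation "x0 \<equiv> f0 \<one>"

definition quotient_map :: "('v \<Rightarrow> 'g) \<Rightarrow> 'v \<times> 'v \<Rightarrow> 'v" where
  "quotient_map h p = f0 (inv (h (fst p)) \<otimes> h (snd p))"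

definition quotient_domain :: "'v set \<Rightarrow> ('v \<Rightarrow> 'g) \<Rightarrow> ('v \<times> 'v) set" where
  "quotient_domain S h = {p \<in> S \<times> S. inv (h (fst p)) \<otimes> h (snd p) \<in> U0}"

definition product_map :: "'v \<times> 'v \<Rightarrow> 'v" where
  "product_map p = f0 (F (fst p) \<otimes> F (snd p))"

definition product_domain :: "('v \<times> 'v) set" where
  "product_domain = {p \<in> X \<times> X. F (fst p) \<otimes> F (snd p) \<in> U0}"

text \<open>The mixed derivative of x^-1 y at the identity is minus that of the product x y, hence
  the order of the two terms: this is the skew part of the second-order term of the
  multiplication.\<close>

definition bracket :: "'v \<Rightarrow> 'v \<Rightarrow> 'v" where
  "bracket a b = mixed_derivative (quotient_map F) x0 b a - mixed_derivative (quotient_map F) x0 a b"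

lemmas U0_chart = atlas_chart[OF atlas U0(1)]

lemma F_f0 [simp]: "x \<in> U0 \<Longrightarrow> F (f0 x) = x"
  using U0_chart(5) by simp

lemma x0 [simp]: "x0 \<in> X" "F x0 = \<one>"
  using U0(2) by auto

lemma smooth_into_mult:
  assumes "open T" "smooth_into A T h" "smooth_into A T k"
  shows "smooth_into A T (\<lambda>x. h x \<otimes> k x)"
proof -
  have "smooth_map_on (product_atlas A A) A UNIV (\<lambda>(x, y). x \<otimes> y)"
    using lie unfolding lie_group_def by blast
  from smooth_into_map2[OF atlas this assms] show ?thesis by simp
qed

lemma smooth_into_inv:
  assumes "open T" "smooth_into A T h"
  shows "smooth_into A T (\<lambda>x. inv (h x))"
proof -
  have "smooth_map_on A A UNIV (\<lambda>x. inv x)"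
    using lie unfolding lie_group_def by blast
  from smooth_into_map[OF atlas atlas this _ assms] show ?thesis by simp
qed

lemma smooth_into_F: "smooth_into A X F"
  by (rule smooth_into_inv_chart[OF atlas U0(1)])

lemma smooth_into_proj:
  assumes S: "open S" and h: "smooth_into A S h"
  shows "smooth_into A (S \<times> S) (\<lambda>p. h (fst p))" "smooth_into A (S \<times> S) (\<lambda>p. h (snd p))"
proof -
  have S2: "open (S \<times> S)" by (intro open_Times S)
  show "smooth_into A (S \<times> S) (\<lambda>p. h (fst p))"
    by (rule smooth_into_reparam[OF atlas S S2 bounded_linear_smooth_on[OF bounded_linear_fst] _ h]) auto
  show "smooth_into A (S \<times> S) (\<lambda>p. h (snd p))"
    by (rule smooth_into_reparam[OF atlas S S2 bounded_linear_smooth_on[OF bounded_linear_snd] _ h]) auto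
qed

lemma quotient_map_smooth:
  assumes S: "open S" and h: "smooth_into A S h"
  shows "open (quotient_domain S h)" "smooth_on (quotient_domain S h) (quotient_map h)"
proof -
  have S2: "open (S \<times> S)" by (intro open_Times S)
  note p = smooth_into_proj[OF S h]
  note q = smooth_into_mult[OF S2 smooth_into_inv[OF S2 p(1)] p(2)]
  have eq: "quotient_domain S h = (S \<times> S) \<inter> (\<lambda>p. inv (h (fst p)) \<otimes> h (snd p)) -` U0"
    unfolding quotient_domain_def by auto
  show "open (quotient_domain S h)"
    unfolding eq by (rule smooth_into_open[OF q S2 U0_chart(1)])
  show "smooth_on (quotient_domain S h) (quotient_map h)"
    unfolding eq quotient_map_def[abs_def] by (rule smooth_intoD[OF q U0(1)])
qed

lemma product_map_smooth: "open product_domain" "smooth_on product_domain product_map"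
proof -
  note S = U0_chart(2)
  have S2: "open (X \<times> X)" by (intro open_Times S)
  note p = smooth_into_proj[OF S smooth_into_F]
  note q = smooth_into_mult[OF S2 p]
  have eq: "product_domain = (X \<times> X) \<inter> (\<lambda>p. F (fst p) \<otimes> F (snd p)) -` U0"
    unfolding product_domain_def by auto
  show "open product_domain"
    unfolding eq by (rule smooth_into_open[OF q S2 U0_chart(1)])
  show "smooth_on product_domain product_map"
    unfolding eq product_map_def[abs_def] by (rule smooth_intoD[OF q U0(1)])
qed

lemmas quotient_F = quotient_map_smooth[OF U0_chart(2) smooth_into_F]

lemma diag_quotient_domain: "y \<in> S \<Longrightarrow> (y, y) \<in> quotient_domain S h"
  using U0(2) unfolding quotient_domain_def by simp

lemma quotient_map_F_x0: "t \<in> X \<Longrightarrow> quotient_map F (x0, t) = t"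
  unfolding quotient_map_def by (auto simp: f_inv_into_f)

lemma inv_mult_quotient: "inv (inv a \<otimes> b) \<otimes> (inv a \<otimes> c) = inv b \<otimes> c"
  by (metis in_carrier inv_closed inv_inv inv_mult_group inv_solve_left m_assoc)

text \<open>The Maurer-Cartan equation, for an arbitrary smooth map h into the group, so that it
  applies both to the chart at the identity and to local sections over the quotient.\<close>

theorem structure_equation:
  assumes S: "open S" "y0 \<in> S" and h: "smooth_into A S h"
    and n: "\<And>u v. n u v = frechet_derivative (\<lambda>y. fibre_derivative (quotient_map h) y v) (at y0) u"
  shows "n u v - n v u = - bracket (fibre_derivative (quotient_map h) y0 u) (fibre_derivative (quotient_map h) y0 v)"
proof -
  obtain P Q where PQ: "open P" "open Q" "(y0, y0) \<in> P \<times> Q" "P \<times> Q \<subseteq> quotient_domain S h"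
    using open_prod_elim[OF quotient_map_smooth(1)[OF S(1) h] diag_quotient_domain[OF S(2)]] by blast
  let ?K = "P \<inter> Q"
  have K: "(z, y) \<in> quotient_domain S h" if "z \<in> ?K" "y \<in> ?K" for z y
    using that PQ(4) by auto
  have U: "inv (h z) \<otimes> h y \<in> U0" if "z \<in> ?K" "y \<in> ?K" for z y
    using K[OF that] unfolding quotient_domain_def by simp
  have y0: "y0 \<in> ?K" using PQ(3) by auto
  let ?k = "\<lambda>y. quotient_map h (y0, y)"
  have Fk: "F (?k y) = inv (h y0) \<otimes> h y" if "y \<in> ?K" for y
    unfolding quotient_map_def using U[OF y0 that] by simp
  have kX: "?k y \<in> X" if "y \<in> ?K" for y
    unfolding quotient_map_def using U[OF y0 that] by simp
  have "n u v - n v u = mixed_derivative (quotient_map F) x0 (fibre_derivative (quotient_map h) y0 u) (fibre_derivative (quotient_map h) y0 v)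
     - mixed_derivative (quotient_map F) x0 (fibre_derivative (quotient_map h) y0 v) (fibre_derivative (quotient_map h) y0 u)"
  proof (rule fibre_derivative_structure[OF quotient_map_smooth[OF S(1) h] quotient_F, of ?K y0 ?k])
    show "open ?K" using PQ by blast
    show "(?k z, ?k y) \<in> quotient_domain X F \<and> quotient_map h (z, y) = quotient_map F (?k z, ?k y)"
      if "z \<in> ?K" "y \<in> ?K" for z y
      using U[OF that] Fk[OF that(1)] Fk[OF that(2)] kX[OF that(1)] kX[OF that(2)]
      unfolding quotient_domain_def by (simp add: inv_mult_quotient quotient_map_def[of F] quotient_map_def[of h "(z, y)"])
    show "?k y0 = x0"
      unfolding quotient_map_def by simp
  qed (use K y0 n in auto)
  then show ?thesis
    unfolding bracket_def by simp
qed

lemma fibre_derivative_x0: "fibre_derivative (quotient_map F) x0 v = v"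
proof -
  have "((\<lambda>s. quotient_map F (x0, s)) has_derivative (\<lambda>a. a)) (at x0)"
    by (rule has_derivative_transform_within_open[OF has_derivative_ident U0_chart(2) x0(1)]) (simp add: quotient_map_F_x0)
  from has_derivative_unique[OF smooth_on_partial(2)[OF quotient_F(2) diag_quotient_domain[OF x0(1)]] this]
  show ?thesis
    unfolding fibre_derivative_def by (simp add: fun_eq_iff)
qed

lemma smooth_on_fibre_derivative:
  assumes S: "open S" and h: "smooth_into A S h"
  shows "smooth_on S (\<lambda>y. fibre_derivative (quotient_map h) y v)"
proof -
  have d: "smooth_on S (\<lambda>y. (y, y))"
    by (rule bounded_linear_smooth_on) (intro bounded_linear_Pair bounded_linear_ident)
  show ?thesis
    unfolding fibre_derivative_def
    by (rule smooth_on_compose[OF S quotient_map_smooth(1)[OF S h] d smooth_on_derivative[OF quotient_map_smooth(2)[OF S h]]])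
      (rule diag_quotient_domain)
qed

lemma bilinear_bracket: "bilinear bracket"
proof -
  have b: "bilinear (mixed_derivative (quotient_map F) x0)"
    by (rule bilinear_mixed_derivative[OF quotient_F diag_quotient_domain[OF x0(1)]])
  then show ?thesis
    unfolding bilinear_def bracket_def linear_iff by (simp add: algebra_simps)
qed

lemma bracket_antisym: "bracket b a = - bracket a b"
  unfolding bracket_def by simp

lemma jacobi: "bracket (bracket u v) w + bracket (bracket v w) u + bracket (bracket w u) v = 0"
  by (rule jacobi_of_structure[where E = "fibre_derivative (quotient_map F)", OF U0_chart(2) x0(1)
      smooth_on_fibre_derivative[OF U0_chart(2) smooth_into_F] fibre_derivative_x0 bilinear_bracket])
    (rule structure_equation[OF U0_chart(2) _ smooth_into_F refl])

text \<open>Velocities at the identity of curves in \<open>K\<close>. This needs no closedness of \<open>K\<close>, which the derived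
  subgroups may lack.\<close>

definition tangent :: "'g set \<Rightarrow> 'v set" where
  "tangent K = {w. \<exists>q. q 0 = x0 \<and> (\<forall>\<^sub>F t in nhds 0. F (q t) \<in> K) \<and> (q has_vector_derivative w) (at (0::real))}"

section \<open>Tangent spaces of subgroups and of the derived series\<close>

lemma tangentI:
  "q 0 = x0 \<Longrightarrow> (\<forall>\<^sub>F t in nhds 0. F (q t) \<in> K) \<Longrightarrow> (q has_vector_derivative w) (at (0::real)) \<Longrightarrow> w \<in> tangent K"
  unfolding tangent_def by blast

lemma eventually_curve:
  fixes q :: "real \<Rightarrow> 'b::real_normed_vector"
  assumes "(q has_vector_derivative w) (at 0)" "open S" "q 0 \<in> S"
  shows "\<forall>\<^sub>F t in nhds 0. q t \<in> S"
proof -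
  have "isCont q 0"
    using assms(1) has_vector_derivative_continuous by blast
  then have "(q \<longlongrightarrow> q 0) (nhds 0)"
    by (simp add: isCont_def tendsto_at_iff_tendsto_nhds)
  then show ?thesis
    using assms(2,3) by (rule topological_tendstoD)
qed

lemma curve_pair_compose:
  assumes f: "smooth_on D f" "(q1 0, q2 0) \<in> D"
    and q: "(q1 has_vector_derivative a) (at 0)" "(q2 has_vector_derivative b) (at 0)"
  shows "((\<lambda>t. f (q1 t, q2 t)) has_vector_derivative frechet_derivative f (at (q1 0, q2 0)) (a, b)) (at 0)"
proof -
  have "((\<lambda>t. (q1 t, q2 t)) has_derivative (\<lambda>t. (t *\<^sub>R a, t *\<^sub>R b))) (at 0)"
    using q unfolding has_vector_derivative_def by (rule has_derivative_Pair)
  from has_derivative_compose[OF this smooth_on_has_derivative[OF f]]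
  show ?thesis
    using linear_cmul[OF linear_frechet_derivative[OF smooth_on_differentiable[OF f]], of _ "(a, b)"]
    unfolding has_vector_derivative_def by simp
qed

lemma quotient_diag_derivative:
  assumes "s \<in> X"
  shows "frechet_derivative (quotient_map F) (at (s, s)) (a, 0) = - fibre_derivative (quotient_map F) s a"
proof -
  have "((\<lambda>s. quotient_map F (s, s)) has_derivative (\<lambda>a. 0)) (at s)"
    by (rule has_derivative_transform_within_open[OF has_derivative_const U0_chart(2) assms]) (simp add: quotient_map_def)
  from has_derivative_unique[OF smooth_on_diagonal[OF quotient_F(2) diag_quotient_domain[OF assms]] this]
  have "frechet_derivative (quotient_map F) (at (s, s)) (a, a) = 0"
    by (simp add: fun_eq_iff)
  then show ?thesis
    using frechet_derivative_pair_add[OF quotient_F(2) diag_quotient_domain[OF assms], of a a]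
    by (simp add: fibre_derivative_def eq_neg_iff_add_eq_0)
qed

text \<open>For curves p and q in K with velocities a and b, the curve p^-1 q has velocity b - a.
  Differences give sums, and scalar multiples come from reparametrising t to c t.\<close>

lemma subspace_tangent:
  assumes K: "subgroup K G"
  shows "subspace (tangent K)"
proof (rule subspaceI)
  show z: "0 \<in> tangent K"
    using subgroup.one_closed[OF K] by (intro tangentI[of "\<lambda>t. x0"]) auto
  have diff: "b - a \<in> tangent K" if ab: "a \<in> tangent K" "b \<in> tangent K" for a b
  proof -
    obtain p where p: "p 0 = x0" "\<forall>\<^sub>F t in nhds 0. F (p t) \<in> K" "(p has_vector_derivative a) (at 0)"
      using ab(1) unfolding tangent_def by blast
    obtain q where q: "q 0 = x0" "\<forall>\<^sub>F t in nhds 0. F (q t) \<in> K" "(q has_vector_derivative b) (at 0)"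
      using ab(2) unfolding tangent_def by blast
    note xx = diag_quotient_domain[OF x0(1), of F]
    have "((\<lambda>t. (p t, q t)) has_vector_derivative (a, b)) (at 0)"
      using p(3) q(3) unfolding has_vector_derivative_def by (auto intro!: derivative_eq_intros)
    from eventually_curve[OF this quotient_F(1)] have "\<forall>\<^sub>F t in nhds 0. (p t, q t) \<in> quotient_domain X F"
      using p(1) q(1) xx by simp
    with p(2) q(2) have "\<forall>\<^sub>F t in nhds 0. F (quotient_map F (p t, q t)) \<in> K"
    proof eventually_elim
      case (elim t)
      then show ?case
        unfolding quotient_domain_def quotient_map_def
        by (simp add: subgroup.m_closed[OF K] subgroup.m_inv_closed[OF K])
    qed
    moreover have "((\<lambda>t. quotient_map F (p t, q t)) has_vector_derivative b - a) (at 0)"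
      using curve_pair_compose[OF quotient_F(2) _ p(3) q(3)] p(1) q(1) xx
        frechet_derivative_pair_add[OF quotient_F(2) xx, of a b] quotient_diag_derivative[OF x0(1), of a]
        fibre_derivative_x0[of a] fibre_derivative_x0[of b]
      by (simp add: fibre_derivative_def)
    moreover have "quotient_map F (p 0, q 0) = x0"
      using p(1) q(1) by (simp add: quotient_map_F_x0)
    ultimately show ?thesis
      by (intro tangentI)
  qed
  show "a + b \<in> tangent K" if "a \<in> tangent K" "b \<in> tangent K" for a b
    using diff[OF diff[OF that(1) z] that(2)] by (simp add: add.commute)
  show "c *\<^sub>R a \<in> tangent K" if a: "a \<in> tangent K" for c a
  proof -
    obtain p where p: "p 0 = x0" "\<forall>\<^sub>F t in nhds 0. F (p t) \<in> K" "(p has_vector_derivative a) (at 0)"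
      using a unfolding tangent_def by blast
    have c: "((\<lambda>t. c * t) \<longlongrightarrow> 0) (nhds 0)"
      by (auto intro!: tendsto_eq_intros filterlim_ident)
    have "\<forall>\<^sub>F t in nhds 0. F (p (c * t)) \<in> K"
      by (rule eventually_compose_filterlim[OF p(2) c])
    moreover have "((\<lambda>t. p (c * t)) has_vector_derivative c *\<^sub>R a) (at 0)"
    proof -
      have "((\<lambda>t. c * t) has_derivative (\<lambda>t. c * t)) (at (0::real))"
        by (auto intro!: derivative_eq_intros)
      from has_derivative_compose[OF this, of p "\<lambda>t. t *\<^sub>R a"] p(3)
      show ?thesis
        unfolding has_vector_derivative_def by (simp add: mult.commute)
    qed
    ultimately show ?thesis
      using p(1) by (intro tangentI[of "\<lambda>t. p (c * t)"]) auto
  qed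
qed

lemma tangent_UNIV: "tangent UNIV = UNIV"
proof -
  have "w \<in> tangent UNIV" for w
    by (rule tangentI[of "\<lambda>t. x0 + t *\<^sub>R w"]) (auto intro!: derivative_eq_intros)
  then show ?thesis by blast
qed

lemma tangent_one: "tangent {\<one>} = {0}"
proof -
  have "w = 0" if w: "w \<in> tangent {\<one>}" for w
  proof -
    obtain q where q: "q 0 = x0" "\<forall>\<^sub>F t in nhds 0. F (q t) \<in> {\<one>}" "(q has_vector_derivative w) (at 0)"
      using w unfolding tangent_def by blast
    have "\<forall>\<^sub>F t in nhds 0. q t \<in> X"
      by (rule eventually_curve[OF q(3) U0_chart(2)]) (use q(1) in auto)
    with q(2) have "\<forall>\<^sub>F t in nhds 0. q t = x0"
      by eventually_elim (metis f_inv_into_f singletonD)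
    then have "(q has_vector_derivative 0) (at 0)"
      using has_vector_derivative_transform_within_open[of "\<lambda>t. x0" 0 0 _ q] unfolding eventually_nhds by auto
    then show ?thesis
      using vector_derivative_unique_at[OF q(3)] by simp
  qed
  moreover have "0 \<in> tangent {\<one>}"
    by (rule tangentI[of "\<lambda>t. x0"]) auto
  ultimately show ?thesis by blast
qed

lemma tangent_mono: "K \<subseteq> L \<Longrightarrow> tangent K \<subseteq> tangent L"
  unfolding tangent_def subset_iff by (blast intro: eventually_mono)

text \<open>The velocity of a commutator of a fixed element with a curve lies in the tangent space of the derived
  group; differentiate it once more in the fixed element.\<close>

lemma tangent_derived:
  assumes K: "subgroup K G" and ab: "a \<in> tangent K" "b \<in> tangent K"
  shows "bracket a b \<in> tangent (derived G K)"
proof -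
  obtain p where p: "p 0 = x0" "\<forall>\<^sub>F t in nhds 0. F (p t) \<in> K" "(p has_vector_derivative a) (at 0)"
    using ab(1) unfolding tangent_def by blast
  obtain q where q: "q 0 = x0" "\<forall>\<^sub>F t in nhds 0. F (q t) \<in> K" "(q has_vector_derivative b) (at 0)"
    using ab(2) unfolding tangent_def by blast
  have "(x0, x0) \<in> product_domain"
    using U0(2) unfolding product_domain_def by simp
  then obtain P Q where PQ: "open P" "open Q" "(x0, x0) \<in> P \<times> Q" "P \<times> Q \<subseteq> product_domain"
    using open_prod_elim[OF product_map_smooth(1)] by blast
  define N where "N = P \<inter> Q \<inter> X"
  have N: "open N" "x0 \<in> N"
    using PQ U0_chart(2) U0(2) unfolding N_def by auto
  have NX: "s \<in> X" if "s \<in> N" for s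
    using that unfolding N_def by simp
  have NN: "(s, t) \<in> product_domain" if "s \<in> N" "t \<in> N" for s t
    using that PQ(4) unfolding N_def by auto
  have mem: "(s, s) \<in> quotient_domain X F \<and> (s, x0) \<in> product_domain \<and> (x0, s) \<in> product_domain" if "s \<in> N" for s
    using diag_quotient_domain[OF NX[OF that]] NN[OF that N(2)] NN[OF N(2) that] by blast
  have unit: "product_map (s, x0) = s \<and> product_map (x0, s) = s" if "s \<in> N" for s
    using NX[OF that] unfolding product_map_def by (auto simp: f_inv_into_f)
  have \<nu>1: "quotient_map F (s, s) = x0" for s
    unfolding quotient_map_def by simp
  have F_product: "F (product_map (s, t)) = F s \<otimes> F t" if "(s, t) \<in> product_domain" for s t
    using that unfolding product_domain_def product_map_def by simp
  have \<nu>2: "quotient_map F (s, product_map (s, t)) = t" if "s \<in> N" "t \<in> N" for s t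
    using F_product[OF NN[OF that]] NX[OF that(2)] unfolding quotient_map_def
    by (simp add: m_assoc[symmetric] f_inv_into_f)
  define n where "n u v = frechet_derivative (\<lambda>y. fibre_derivative (quotient_map F) y v) (at x0) u" for u v
  define W where "W s b = frechet_derivative (quotient_map F) (at (s, s))
      (frechet_derivative product_map (at (x0, s)) (b, 0), frechet_derivative product_map (at (s, x0)) (0, b))" for s b
  have W: "W x0 b = 0" "((\<lambda>s. W s b) has_derivative (\<lambda>a. n b a - n a b)) (at x0)"
    unfolding W_def
    by (rule commutator_derivative[OF quotient_F product_map_smooth N mem unit \<nu>1 \<nu>2 fibre_derivative_x0 n_def]; assumption)+
  have n: "n b a - n a b = bracket a b"
    using structure_equation[OF U0_chart(2) x0(1) smooth_into_F n_def, of b a] bracket_antisym[of a b]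
    by (simp add: fibre_derivative_x0)
  let ?V = "tangent (derived G K)"
  have K': "subgroup (derived G K) G"
    by (rule derived_is_subgroup) auto
  have WV: "W s b \<in> ?V" if s: "s \<in> N" "F s \<in> K" for s
  proof (rule tangentI)
    let ?m1 = "\<lambda>t. product_map (q t, s)" and ?m2 = "\<lambda>t. product_map (s, q t)"
    have m1: "(?m1 has_vector_derivative frechet_derivative product_map (at (x0, s)) (b, 0)) (at 0)"
      using curve_pair_compose[OF product_map_smooth(2) _ q(3) has_vector_derivative_const[of s]] mem[OF s(1)] q(1) by simp
    have m2: "(?m2 has_vector_derivative frechet_derivative product_map (at (s, x0)) (0, b)) (at 0)"
      using curve_pair_compose[OF product_map_smooth(2) _ has_vector_derivative_const[of s] q(3)] mem[OF s(1)] q(1) by simp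
    have 0: "?m1 0 = s" "?m2 0 = s"
      using unit[OF s(1)] q(1) by auto
    show "((\<lambda>t. quotient_map F (?m1 t, ?m2 t)) has_vector_derivative W s b) (at 0)"
      using curve_pair_compose[OF quotient_F(2) _ m1 m2] mem[OF s(1)] unfolding 0 W_def by simp
    show "quotient_map F (?m1 0, ?m2 0) = x0"
      unfolding 0 by (rule \<nu>1)
    have "((\<lambda>t. (?m1 t, ?m2 t)) has_vector_derivative (frechet_derivative product_map (at (x0, s)) (b, 0), frechet_derivative product_map (at (s, x0)) (0, b))) (at 0)"
      using has_derivative_Pair[OF m1[unfolded has_vector_derivative_def] m2[unfolded has_vector_derivative_def]]
      unfolding has_vector_derivative_def by simp
    from eventually_curve[OF this quotient_F(1)] have e1: "\<forall>\<^sub>F t in nhds 0. (?m1 t, ?m2 t) \<in> quotient_domain X F"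
      using mem[OF s(1)] unfolding 0 by simp
    have e2: "\<forall>\<^sub>F t in nhds 0. q t \<in> N"
      using eventually_curve[OF q(3) N(1)] N(2) q(1) by simp
    show "\<forall>\<^sub>F t in nhds 0. F (quotient_map F (?m1 t, ?m2 t)) \<in> derived G K"
      using e1 e2 q(2)
    proof eventually_elim
      case (elim t)
      have "F (quotient_map F (?m1 t, ?m2 t)) = inv (F (q t) \<otimes> F s) \<otimes> (F s \<otimes> F (q t))"
        using elim(1) F_product[OF NN[OF elim(2) s(1)]] F_product[OF NN[OF s(1) elim(2)]]
        unfolding quotient_domain_def quotient_map_def by simp
      \<comment> \<open>\<open>derived\<close> is generated by elements x y x^-1 y^-1; the
        expression fits this pattern with the inverses of \<open>F s\<close> and
        \<open>F (q t)\<close> as x and y.\<close>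
      also have "\<dots> = inv (F s) \<otimes> inv (F (q t)) \<otimes> inv (inv (F s)) \<otimes> inv (inv (F (q t)))"
        by (simp add: inv_mult_group m_assoc)
      also have "\<dots> \<in> derived G K"
        unfolding derived_def
        using subgroup.m_inv_closed[OF K s(2)] subgroup.m_inv_closed[OF K elim(3)] by (intro generate.incl) blast
      finally show ?case .
    qed
  qed
  have "((\<lambda>t. W (p t) b) has_vector_derivative bracket a b) (at 0)"
  proof -
    have "linear (\<lambda>a. n b a - n a b)"
      using W(2) has_derivative_linear by blast
    moreover have "((\<lambda>t. W (p t) b) has_derivative (\<lambda>t. n b (t *\<^sub>R a) - n (t *\<^sub>R a) b)) (at 0)"
      using has_derivative_compose[OF p(3)[unfolded has_vector_derivative_def], of "\<lambda>s. W s b"] W(2) p(1) by simp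
    ultimately show ?thesis
      unfolding has_vector_derivative_def n[symmetric] using linear_cmul by force
  qed
  \<comment> \<open>As W vanishes at the identity, the bracket is the limit of W (p t) b / t. These
    quotients lie in the tangent space of the derived group for small t, and a subspace of a
    finite-dimensional space is closed.\<close>
  then have "((\<lambda>t. norm (W (p t) b - t *\<^sub>R bracket a b) / norm t) \<longlongrightarrow> 0) (at 0)"
    using W(1) p(1) unfolding has_vector_derivative_def has_derivative_at by simp
  then have "((\<lambda>t. norm ((1 / t) *\<^sub>R W (p t) b - bracket a b)) \<longlongrightarrow> 0) (at 0)"
  proof (rule Lim_transform_eventually)
    have "norm (w - t *\<^sub>R v) / norm t = norm ((1 / t) *\<^sub>R w - v)" if "t \<noteq> 0" for t and v w :: 'v
    proof -
      have "(1 / t) *\<^sub>R w - v = (1 / t) *\<^sub>R (w - t *\<^sub>R v)"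
        using that by (simp add: scaleR_diff_right)
      then show ?thesis by simp
    qed
    then show "\<forall>\<^sub>F t in at 0. norm (W (p t) b - t *\<^sub>R bracket a b) / norm t = norm ((1 / t) *\<^sub>R W (p t) b - bracket a b)"
      by (auto simp: eventually_at_filter)
  qed
  then have lim: "((\<lambda>t. (1 / t) *\<^sub>R W (p t) b) \<longlongrightarrow> bracket a b) (at 0)"
    by (rule LIM_zero_cancel[OF tendsto_norm_zero_cancel])
  have "\<forall>\<^sub>F t in nhds 0. p t \<in> N"
    by (rule eventually_curve[OF p(3) N(1)]) (use N(2) p(1) in simp)
  with p(2) have "\<forall>\<^sub>F t in nhds 0. (1 / t) *\<^sub>R W (p t) b \<in> ?V"
    by eventually_elim (intro subspace_scale[OF subspace_tangent[OF K']] WV)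
  then have "\<forall>\<^sub>F t in at 0. (1 / t) *\<^sub>R W (p t) b \<in> ?V"
    by (simp add: eventually_nhds_conv_at)
  from Lim_in_closed_set[OF closed_subspace[OF subspace_tangent[OF K']] this _ lim]
  show ?thesis by simp
qed

text \<open>The chain consists of the tangent spaces of the derived series of the group. Solvability
  is given for the group, and this choice avoids a comparison with the derived series of the Lie
  algebra.\<close>

theorem solvable_chain:
  assumes "solvable G"
  shows "\<exists>S N. (\<forall>k. subspace (S k)) \<and> S 0 = UNIV \<and> (\<forall>k. S (Suc k) \<subseteq> S k) \<and> S N = {0} \<and>
    (\<forall>k. \<forall>x\<in>S k. \<forall>y\<in>S k. bracket x y \<in> S (Suc k))"
proof -
  define K where "K k = (derived G ^^ k) (carrier G)" for k
  have K: "subgroup (K k) G" for k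
    unfolding K_def by (rule exp_of_derived_is_subgroup[OF subgroup_self])
  have Suc: "K (Suc k) = derived G (K k)" for k
    unfolding K_def by simp
  obtain N where "K N = {\<one>}"
    using assms solvable_iff_trivial_derived_seq unfolding K_def by blast
  then have "tangent (K N) = {0}"
    by (simp add: tangent_one)
  moreover have "carrier G = UNIV"
    using lie unfolding lie_group_def by blast
  then have "tangent (K 0) = UNIV"
    by (simp add: K_def tangent_UNIV)
  moreover have "tangent (K (Suc k)) \<subseteq> tangent (K k)" for k
    unfolding Suc by (rule tangent_mono[OF derived_incl[OF subset_refl K]])
  moreover have "bracket x y \<in> tangent (K (Suc k))" if "x \<in> tangent (K k)" "y \<in> tangent (K k)" for k x y
    unfolding Suc using tangent_derived[OF K that] .
  ultimately show ?thesis
    using subspace_tangent[OF K] by (intro exI[of _ "\<lambda>k. tangent (K k)"] exI[of _ N]) blast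
qed

end

section \<open>Invariant structures on the quotient\<close>

definition pull :: "('a \<Rightarrow> 'b) \<Rightarrow> 'b mform \<Rightarrow> 'a mform" where
  "pull L \<alpha> = (\<lambda>v. \<alpha> (\<lambda>i. L (v i)))"

lemma pull_wedge: "wedge k l (pull L \<alpha>) (pull L \<beta>) = pull L (wedge k l \<alpha> \<beta>)"
  by (simp add: wedge_def pull_def)

lemma pull_wedge_list: "wedge_list (\<lambda>i v. e i (L v)) is = pull L (wedge_list e is)"
proof (induction "is")
  case Nil
  show ?case by (simp add: pull_def)
next
  case (Cons i "is")
  show ?case
    unfolding wedge_list.simps Cons pull_wedge[symmetric] by (simp add: pull_def)
qed

lemma pull_g2_model: "g2_model (\<lambda>i v. e i (L v)) = pull L (g2_model e)"
proof -
  have "(\<lambda>w. pull L \<alpha> w + pull L \<beta> w) = pull L (\<lambda>w. \<alpha> w + \<beta> w)"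
    "(\<lambda>w. pull L \<alpha> w - pull L \<beta> w) = pull L (\<lambda>w. \<alpha> w - \<beta> w)" for \<alpha> \<beta> :: "(real^7) mform"
    by (simp_all add: pull_def)
  then show ?thesis
    unfolding g2_model_def pull_wedge_list by (simp only: pull_wedge) (simp add: pull_def)
qed

lemma multilin_pull:
  assumes "multilin k \<alpha>" "linear L"
  shows "multilin k (pull L \<alpha>)"
  unfolding multilin_def
proof (intro conjI allI impI)
  show "pull L \<alpha> v = pull L \<alpha> w" if "\<forall>i<k. v i = w i" for v w
    unfolding pull_def by (rule multilin_cong[OF assms(1)]) (use that in simp)
  fix v and i assume i: "i < k"
  have "(\<lambda>x. pull L \<alpha> (v(i := x))) = (\<lambda>x. \<alpha> ((\<lambda>j. L (v j))(i := L x)))"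
    unfolding pull_def by (intro ext arg_cong[of _ _ \<alpha>]) auto
  then show "linear (\<lambda>x. pull L \<alpha> (v(i := x)))"
    using linear_compose[OF assms(2) multilin_linear[OF assms(1) i]] by (simp add: o_def)
qed

lemma pull_eqD:
  assumes "surj L" "pull L \<alpha> = pull L \<beta>"
  shows "\<alpha> = \<beta>"
proof
  fix v
  show "\<alpha> v = \<beta> v"
    using fun_cong[OF assms(2), of "\<lambda>i. inv_into UNIV L (v i)"] assms(1) by (simp add: pull_def surj_f_inv_f)
qed

text \<open>The coframe chosen by \<open>SOME\<close> is unrelated to the coframe at hand;
  \<open>hodge_independent\<close> allows the exchange. This is what makes the Hodge operator
  computable after a pullback.\<close>

lemma g2_hodge_adapted:
  assumes "adapted_coframe \<phi> e" "multilin k \<alpha>" "k \<le> 7"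
  shows "g2_hodge \<phi> k \<alpha> = hodge e k \<alpha>"
  unfolding g2_hodge_def by (rule hodge_independent[OF someI[of "adapted_coframe \<phi>", OF assms(1)] assms])

section \<open>Naturality of the Hodge operator, and the pointwise conclusion\<close>

context frame
begin

lemma coframe_pull:
  assumes "linear L" "inj L"
  shows "coframe (\<lambda>i v. e i (L v))"
  unfolding coframe_def
proof (intro conjI ballI allI impI)
  show "linear (\<lambda>v. e i (L v))" if "i \<in> {1..7}" for i
    using linear_compose[OF assms(1) e_linear] that by (simp add: o_def I7_def)
  show "v = 0" if "\<forall>i\<in>{1..7}. e i (L v) = 0" for v
    using that coframe assms unfolding coframe_def by (metis injD linear_0)
qed

lemma dual_frame_pull:
  assumes L: "linear L" "inj L" and j: "j \<in> I7"
  shows "L (dual_frame (\<lambda>i v. e i (L v)) j) = b j"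
proof -
  interpret L: frame "\<lambda>i v. e i (L v)"
    by unfold_locales (rule coframe_pull[OF L])
  have "e i (L (L.b j) - b j) = 0" if "i \<in> I7" for i
    using L.e_b[OF j that] e_b[OF j that] linear_diff[OF e_linear[OF that]] by simp
  then have "L (L.b j) - b j = 0"
    using coframe unfolding coframe_def I7_def by blast
  then show ?thesis by simp
qed

lemma hodge_pull:
  assumes L: "linear L" "inj L" and a: "multilin k \<alpha>"
  shows "hodge (\<lambda>i v. e i (L v)) k (pull L \<alpha>) = pull L (hodge e k \<alpha>)"
proof
  fix v
  let ?b' = "dual_frame (\<lambda>i v. e i (L v))"
  have "pull L \<alpha> (\<lambda>i. ?b' (s i)) * pull L vol (\<lambda>i. if i < k then ?b' (s i) else v (i - k))
    = \<alpha> (\<lambda>i. b (s i)) * vol (\<lambda>i. if i < k then b (s i) else L (v (i - k)))" if s: "s \<in> {..<k} \<rightarrow>\<^sub>E I7" for s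
  proof -
    have b: "L (?b' (s i)) = b (s i)" if "i < k" for i
      using dual_frame_pull[OF L] s that by (auto simp: PiE_iff)
    have "(\<lambda>i. L (if i < k then ?b' (s i) else v (i - k))) = (\<lambda>i. if i < k then b (s i) else L (v (i - k)))"
      using b by auto
    moreover have "\<alpha> (\<lambda>i. L (?b' (s i))) = \<alpha> (\<lambda>i. b (s i))"
      by (rule multilin_cong[OF a]) (use b in simp)
    ultimately show ?thesis
      unfolding pull_def by simp
  qed
  then show "hodge (\<lambda>i v. e i (L v)) k (pull L \<alpha>) v = pull L (hodge e k \<alpha>) v"
    unfolding pull_def[of L "hodge e k \<alpha>"] hodge_eq hodge_def[of "\<lambda>i v. e i (L v)"] pull_wedge_list vol_def[symmetric] I7_def[symmetric]
    by (intro arg_cong2[where f = "(/)"] sum.cong refl) blast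
qed

lemma g2_hodge_pull:
  assumes L: "linear L" "inj L" and a: "multilin k \<alpha>" and k: "k \<le> 7"
  shows "g2_hodge (pull L (g2_model e)) k (pull L \<alpha>) = pull L (hodge e k \<alpha>)"
proof -
  have "adapted_coframe (pull L (g2_model e)) (\<lambda>i v. e i (L v))"
    unfolding adapted_coframe_def pull_g2_model using coframe_pull[OF L] by simp
  from g2_hodge_adapted[OF this multilin_pull[OF a L(1)] k] show ?thesis
    unfolding hodge_pull[OF L a] .
qed

text \<open>The wedge with \<star>\<phi> is injective on 1-forms. For each i there is a quadruple
  without i on which \<star>\<phi> is nonzero, and no other quadruple among these five indices
  supports \<star>\<phi>, so that component of the wedge isolates the i-th coefficient.\<close>

lemma Lee_form_unique:
  assumes t: "multilin 1 \<theta>" "multilin 1 \<theta>'"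
    and eq: "wedge 1 4 \<theta> (hodge e 3 (g2_model e)) = wedge 1 4 \<theta>' (hodge e 3 (g2_model e))"
  shows "\<theta> = \<theta>'"
proof -
  let ?\<psi> = "hodge e 3 (g2_model e)"
  have a\<psi>: "alt_form 4 ?\<psi>"
    using alt_form_hodge[of 3 "g2_model e"] by simp
  have W: "wedge 1 4 \<theta> ?\<psi> ((!) [b i, b j, b k, b l, b n])
      = \<theta> (\<lambda>_. b i) * ps j k l n - \<theta> (\<lambda>_. b j) * ps i k l n - \<theta> (\<lambda>_. b k) * ps j i l n - \<theta> (\<lambda>_. b l) * ps j k i n - \<theta> (\<lambda>_. b n) * ps j k l i"
    if \<theta>: "multilin 1 \<theta>" and I: "i \<in> I7" "j \<in> I7" "k \<in> I7" "l \<in> I7" "n \<in> I7" for \<theta> i j k l n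
    by (subst one_form_linear(2)[OF \<theta>], subst wedge_1_4[OF one_form_linear(1)[OF \<theta>] a\<psi>])
      (use I in \<open>simp add: hodge_g2_frame\<close>)
  have same: "\<theta> (\<lambda>_. b i) * ps j k l n - \<theta> (\<lambda>_. b j) * ps i k l n - \<theta> (\<lambda>_. b k) * ps j i l n - \<theta> (\<lambda>_. b l) * ps j k i n - \<theta> (\<lambda>_. b n) * ps j k l i
      = \<theta>' (\<lambda>_. b i) * ps j k l n - \<theta>' (\<lambda>_. b j) * ps i k l n - \<theta>' (\<lambda>_. b k) * ps j i l n - \<theta>' (\<lambda>_. b l) * ps j k i n - \<theta>' (\<lambda>_. b n) * ps j k l i"
    if I: "i \<in> I7" "j \<in> I7" "k \<in> I7" "l \<in> I7" "n \<in> I7" for i j k l n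
    using W[OF t(1) I] W[OF t(2) I] eq by simp
  have same_b: "\<forall>i\<in>I7. \<theta> (\<lambda>_. b i) = \<theta>' (\<lambda>_. b i)"
    unfolding ball_I7
    using same[of 1 4 5 6 7] same[of 2 4 5 6 7] same[of 3 4 5 6 7] same[of 4 2 3 6 7] same[of 5 2 3 6 7]
      same[of 6 2 3 4 5] same[of 7 2 3 4 5]
    by (simp add: ps_table ph_def oct_table I7_mem)
  have 0: "\<theta> (\<lambda>i. b (s i)) = \<theta> (\<lambda>_. b (s 0))" "\<theta>' (\<lambda>i. b (s i)) = \<theta>' (\<lambda>_. b (s 0))" for s
    by (rule multilin_cong[OF t(1)], simp, rule multilin_cong[OF t(2)], simp)
  have "\<theta> (\<lambda>i. b (s i)) = \<theta>' (\<lambda>i. b (s i))" if "s 0 \<in> I7" for s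
    using that same_b 0[of s] by simp
  then show ?thesis
    by (intro multilin_eqI[OF t]) simp
qed

text \<open>A \<open>G\<^sub>2\<close>-structure with constant coefficients in the left-invariant coframe \<open>e \<circ> E y\<close>, whose
  structure equations are governed by \<open>br\<close>.\<close>

lemma local_parallel:
  fixes E :: "real^7 \<Rightarrow> real^7 \<Rightarrow> real^7" and \<phi> \<theta> :: "('m, real^7) form"
  assumes br: "bilinear br" "\<And>x y. br y x = - br x y"
    and jacobi: "\<And>x y z. br (br x y) z + br (br y z) x + br (br z x) y = 0"
    and S: "\<And>k. subspace (S k)" "S 0 = UNIV" "\<And>k. S (Suc k) \<subseteq> S k" "S K = {0}"
      "\<And>k x y. x \<in> S k \<Longrightarrow> y \<in> S k \<Longrightarrow> br x y \<in> S (Suc k)"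
    and N: "open N" "y0 \<in> N"
    and E: "\<And>y. y \<in> N \<Longrightarrow> linear (E y)" "\<And>y. y \<in> N \<Longrightarrow> inj (E y)"
    and n: "\<And>y v. y \<in> N \<Longrightarrow> ((\<lambda>y. E y v) has_derivative (\<lambda>u. n y u v)) (at y)"
    and st: "\<And>y u v. y \<in> N \<Longrightarrow> n y u v - n y v u = - br (E y u) (E y v)"
    and \<phi>: "\<And>y. y \<in> N \<Longrightarrow> \<phi> c y = pull (E y) (g2_model e)"
    and \<theta>: "\<And>y. y \<in> N \<Longrightarrow> multilin 1 (\<theta> c y)"
    and Lee: "\<And>y. y \<in> N \<Longrightarrow> ext_d 4 (star \<phi> 3 \<phi>) c y = wedge 1 4 (\<theta> c y) (star \<phi> 3 \<phi> c y)"
    and strong: "\<And>y. y \<in> N \<Longrightarrow> ext_d 3 (torsion_form \<phi> \<theta>) c y = (\<lambda>v. 0)"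
  shows "ext_d 3 \<phi> c y0 = (\<lambda>v. 0)" "ext_d 4 (star \<phi> 3 \<phi>) c y0 = (\<lambda>v. 0)"
proof -
  define p where "p = g2_model e"
  define \<psi> where "\<psi> = hodge e 3 p"
  have ap: "alt_form 3 p"
    unfolding p_def by (rule alt_form_g2_model)
  have a\<psi>: "alt_form 4 \<psi>"
    using alt_form_hodge[of 3 p] unfolding \<psi>_def by simp
  note mp = alt_form_multilin[OF ap] and m\<psi> = alt_form_multilin[OF a\<psi>]
  have surj: "surj (E y)" if "y \<in> N" for y
    using linear_injective_imp_surjective[OF E(1)[OF that]] E(2)[OF that] by blast
  have inv: "\<exists>L. linear L \<and> (\<forall>x. E y (L x) = x) \<and> (\<forall>x. L (E y x) = x)" if "y \<in> N" for y
    using linear_injective_isomorphism[OF E(1)[OF that]] E(2)[OF that] by (metis eucl.linear_injective_isomorphism linear_injective_isomorphism)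
  have ext3: "ext_d 3 \<omega> c y = pull (E y) (CE3 br \<alpha>)"
    if "y \<in> N" "alt_form 3 \<alpha>" "\<And>y. y \<in> N \<Longrightarrow> \<omega> c y = pull (E y) \<alpha>" for y \<alpha> and \<omega> :: "('m, real^7) form"
    unfolding pull_def by (rule ext, rule ext_d_3[OF that(2) N(1) that(1) _ n st]) (use that in \<open>auto simp: pull_def\<close>)
  have ext4: "ext_d 4 \<omega> c y = pull (E y) (CE4 br \<alpha>)"
    if "y \<in> N" "alt_form 4 \<alpha>" "\<And>y. y \<in> N \<Longrightarrow> \<omega> c y = pull (E y) \<alpha>" for y \<alpha> and \<omega> :: "('m, real^7) form"
    unfolding pull_def by (rule ext, rule ext_d_4[OF that(2) N(1) that(1) _ n st]) (use that in \<open>auto simp: pull_def\<close>)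
  have star: "star \<phi> k \<omega> c y = pull (E y) (hodge e k \<alpha>)"
    if "y \<in> N" "multilin k \<alpha>" "k \<le> 7" "\<omega> c y = pull (E y) \<alpha>" for y k \<alpha> and \<omega> :: "('m, real^7) form"
    unfolding star_def \<phi>[OF that(1)] that(4) by (rule g2_hodge_pull[OF E(1)[OF that(1)] E(2)[OF that(1)] that(2,3)])
  have \<phi>': "\<phi> c y = pull (E y) p" if "y \<in> N" for y
    using \<phi>[OF that] unfolding p_def .
  have d\<phi>: "ext_d 3 \<phi> c y = pull (E y) (CE3 br p)" if "y \<in> N" for y
    by (rule ext3[where \<omega> = \<phi>, OF that ap]) (rule \<phi>')
  have \<psi>: "star \<phi> 3 \<phi> c y = pull (E y) \<psi>" if "y \<in> N" for y
    unfolding \<psi>_def by (rule star[OF that mp]) (use \<phi>'[OF that] in auto)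
  have d\<psi>: "ext_d 4 (star \<phi> 3 \<phi>) c y = pull (E y) (CE4 br \<psi>)" if "y \<in> N" for y
    by (rule ext4[where \<omega> = "star \<phi> 3 \<phi>", OF that a\<psi>]) (rule \<psi>)
  \<comment> \<open>The Lee form is not assumed invariant. At each point it is the pullback of some
    constant form t, and t solves the Lee equation of the Lie algebra, which does not involve y.
    Hence t is the same at all points by \<open>Lee_form_unique\<close>.\<close>
  have Lee': "\<exists>t. multilin 1 t \<and> \<theta> c y = pull (E y) t \<and> CE4 br \<psi> = wedge 1 4 t \<psi>" if y: "y \<in> N" for y
  proof -
    obtain L where L: "linear L" "\<And>x. E y (L x) = x" "\<And>x. L (E y x) = x"
      using inv[OF y] by blast
    have \<theta>L: "\<theta> c y = pull (E y) (pull L (\<theta> c y))"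
      unfolding pull_def L(3) ..
    have "pull (E y) (CE4 br \<psi>) = pull (E y) (wedge 1 4 (pull L (\<theta> c y)) \<psi>)"
      unfolding pull_wedge[symmetric] \<theta>L[symmetric] \<psi>[OF y, symmetric] d\<psi>[OF y, symmetric] by (rule Lee[OF y])
    from pull_eqD[OF surj[OF y] this] show ?thesis
      using multilin_pull[OF \<theta>[OF y] L(1)] \<theta>L by blast
  qed
  then obtain t where t: "multilin 1 t" "CE4 br \<psi> = wedge 1 4 t \<psi>"
    using N(2) by blast
  have \<theta>': "\<theta> c y = pull (E y) t" if y: "y \<in> N" for y
  proof -
    obtain t' where t': "multilin 1 t'" "\<theta> c y = pull (E y) t'" "CE4 br \<psi> = wedge 1 4 t' \<psi>"
      using Lee'[OF y] by blast
    have "t' = t"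
      by (rule Lee_form_unique[OF t'(1) t(1)]) (use t(2) t'(3) in \<open>simp add: \<psi>_def p_def\<close>)
    then show ?thesis
      using t'(2) by simp
  qed
  define Tor where "Tor = (\<lambda>v. 1 / 6 * hodge e 7 (wedge 4 3 (CE3 br p) p) v * p v - hodge e 4 (CE3 br p) v + hodge e 4 (wedge 1 3 t p) v)"
  have aTor: "alt_form 3 Tor"
    unfolding Tor_def p_def by (rule alt_form_torsion)
  have m4: "multilin 4 (CE3 br p)"
    by (rule alt_form_multilin[OF alt_form_CE3[OF br ap]])
  have m7: "multilin 7 (wedge 4 3 (CE3 br p) p)"
    using multilin_wedge[OF m4 mp] by simp
  have m4': "multilin 4 (wedge 1 3 t p)"
    using multilin_wedge[OF t(1) mp] by simp
  have Tor: "torsion_form \<phi> \<theta> c y = pull (E y) Tor" if y: "y \<in> N" for y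
  proof -
    have "star \<phi> 7 (wedge_form 4 3 (ext_d 3 \<phi>) \<phi>) c y = pull (E y) (hodge e 7 (wedge 4 3 (CE3 br p) p))"
      by (rule star[OF y m7]) (simp_all add: wedge_form_def d\<phi>[OF y] \<phi>'[OF y] pull_wedge)
    moreover have "star \<phi> 4 (ext_d 3 \<phi>) c y = pull (E y) (hodge e 4 (CE3 br p))"
      by (rule star[OF y m4]) (simp_all add: d\<phi>[OF y])
    moreover have "star \<phi> 4 (wedge_form 1 3 \<theta> \<phi>) c y = pull (E y) (hodge e 4 (wedge 1 3 t p))"
      by (rule star[OF y m4']) (simp_all add: wedge_form_def \<theta>'[OF y] \<phi>'[OF y] pull_wedge)
    ultimately show ?thesis
      unfolding torsion_form_def Tor_def \<phi>'[OF y] by (simp add: pull_def)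
  qed
  have "ext_d 3 (torsion_form \<phi> \<theta>) c y0 = pull (E y0) (CE3 br Tor)"
    by (rule ext3[where \<omega> = "torsion_form \<phi> \<theta>", OF N(2) aTor]) (rule Tor)
  then have "pull (E y0) (CE3 br Tor) = (\<lambda>v. 0)"
    unfolding strong[OF N(2)] by (rule sym)
  also have "\<dots> = pull (E y0) (\<lambda>v. 0)"
    by (simp add: pull_def)
  finally have "pull (E y0) (CE3 br Tor) = pull (E y0) (\<lambda>v. 0)" .
  from pull_eqD[OF surj[OF N(2)] this] have dT: "CE3 br Tor = (\<lambda>v. 0)" .
  have "CE3 br p = (\<lambda>v. 0)" "CE4 br \<psi> = (\<lambda>v. 0)"
    using strong_parallel_algebra[OF br jacobi S t(1)] t(2) dT unfolding Tor_def p_def \<psi>_def by blast+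
  then show "ext_d 3 \<phi> c y0 = (\<lambda>v. 0)" "ext_d 4 (star \<phi> 3 \<phi>) c y0 = (\<lambda>v. 0)"
    unfolding d\<phi>[OF N(2)] d\<psi>[OF N(2)] by (simp_all add: pull_def)
qed

end

text \<open>In the chart \<open>(V, g)\<close> of the quotient the projection has a local section \<open>h\<close>, and the derivative of
  \<open>y' \<mapsto> (h y)\<inverse> h y'\<close> at \<open>y\<close> is the left-invariant (Maurer--Cartan) coframe.\<close>

locale quotient_chart = lie_group_chart G A U0 f0
  for G :: "('g::{t2_space,second_countable_topology}) monoid" (structure)
    and A :: "('g, real^7) chart set" and U0 :: "'g set" and f0 :: "'g \<Rightarrow> real^7" +
  fixes B :: "('m::{t2_space,second_countable_topology}, real^7) chart set" and \<pi> :: "'g \<Rightarrow> 'm"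
    and W :: "'g set" and V :: "'m set" and g :: "'m \<Rightarrow> real^7"
  assumes B: "smooth_atlas B" "(V, g) \<in> B"
    and W: "open W" "open (\<pi> ` W)" "inj_on \<pi> W" "smooth_map_on A B W \<pi>" "smooth_map_on B A (\<pi> ` W) (inv_into W \<pi>)"
begin

definition domain :: "(real^7) set" where
  "domain = g ` (V \<inter> \<pi> ` W)"

definition sect :: "real^7 \<Rightarrow> 'g" where
  "sect y = inv_into W \<pi> (inv_into V g y)"

definition invariant_coframe :: "real^7 \<Rightarrow> real^7 \<Rightarrow> real^7" where
  "invariant_coframe y = fibre_derivative (quotient_map sect) y"

lemmas V_chart = atlas_chart[OF B]

lemma domain_open: "open domain"
  unfolding domain_def by (rule open_chart_image[OF B]) (use V_chart(1) W(2) in auto)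

lemma sect:
  assumes "y \<in> domain"
  shows "sect y \<in> W" "\<pi> (sect y) \<in> V" "g (\<pi> (sect y)) = y"
proof -
  obtain w where w: "w \<in> W" "\<pi> w \<in> V" "y = g (\<pi> w)"
    using assms unfolding domain_def by blast
  then have "sect y = w"
    unfolding sect_def using V_chart(5) W(3) by simp
  then show "sect y \<in> W" "\<pi> (sect y) \<in> V" "g (\<pi> (sect y)) = y"
    using w by simp_all
qed

lemma smooth_into_sect: "smooth_into A domain sect"
  unfolding sect_def
proof (rule smooth_into_map[OF B(1) atlas W(5,2) domain_open])
  show "smooth_into B domain (inv_into V g)"
    by (rule smooth_into_subset[OF smooth_into_inv_chart[OF B]]) (auto simp: domain_def)
  show "inv_into V g ` domain \<subseteq> \<pi> ` W"
    using V_chart(5) by (auto simp: domain_def)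
qed

lemmas quotient_sect = quotient_map_smooth[OF domain_open smooth_into_sect]

lemma quotient_sect_has_derivative:
  "y \<in> domain \<Longrightarrow> ((\<lambda>y'. quotient_map sect (y, y')) has_derivative invariant_coframe y) (at y)"
  unfolding invariant_coframe_def fibre_derivative_def[abs_def]
  by (rule smooth_on_partial(2)[OF quotient_sect(2) diag_quotient_domain])

lemma invariant_coframe_linear: "y \<in> domain \<Longrightarrow> linear (invariant_coframe y)"
  by (rule has_derivative_linear[OF quotient_sect_has_derivative])

text \<open>In charts, \<open>q1\<close> is left translation by \<open>sect y\<close> and
  \<open>q2\<close> is the projection. Composed with the map sending y' to (sect y)^-1 sect y', they
  give the projection after its section, that is, the identity near y; now differentiate.\<close>

lemma left_inverse:
  assumes y: "y \<in> domain" and U: "(U, f) \<in> A" "sect y \<in> U"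
  defines "q1 \<equiv> f \<circ> (\<lambda>x. sect y \<otimes> x) \<circ> F" and "q2 \<equiv> g \<circ> \<pi> \<circ> inv_into U f"
  shows "frechet_derivative q2 (at (q1 x0)) (frechet_derivative q1 (at x0) (invariant_coframe y v)) = v"
proof -
  let ?a = "sect y" and ?k = "\<lambda>y'. quotient_map sect (y, y')"
  note U_chart = atlas_chart[OF atlas U(1)]
  have "smooth_into A X (\<lambda>t. ?a \<otimes> F t)"
    by (rule smooth_into_mult[OF U0_chart(2) smooth_into_const smooth_into_F])
  from smooth_on_has_derivative[OF smooth_intoD[OF this U(1)], of x0]
  have d1: "(q1 has_derivative frechet_derivative q1 (at x0)) (at x0)"
    using U(2) unfolding q1_def o_def by simp
  have q1: "q1 x0 = f ?a"
    unfolding q1_def by simp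
  have "smooth_on (f ` (U \<inter> W \<inter> \<pi> -` V)) q2"
    using W(4) U(1) B(2) unfolding smooth_map_on_def q2_def by fast
  from smooth_on_has_derivative[OF this, of "f ?a"]
  have d2: "(q2 has_derivative frechet_derivative q2 (at (q1 x0))) (at (q1 x0))"
    using U(2) sect[OF y] unfolding q1 by blast
  have k: "?k y = x0"
    unfolding quotient_map_def by simp
  have "((\<lambda>y'. q1 (?k y')) has_derivative (\<lambda>v. frechet_derivative q1 (at x0) (invariant_coframe y v))) (at y)"
    by (rule has_derivative_compose[OF quotient_sect_has_derivative[OF y]]) (use d1 k in simp)
  then have 1: "((\<lambda>y'. q2 (q1 (?k y'))) has_derivative
      (\<lambda>v. frechet_derivative q2 (at (q1 x0)) (frechet_derivative q1 (at x0) (invariant_coframe y v)))) (at y)"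
    by (rule has_derivative_compose) (use d2 k in simp)
  obtain P Q where PQ: "open P" "open Q" "(y, y) \<in> P \<times> Q" "P \<times> Q \<subseteq> quotient_domain domain sect"
    using open_prod_elim[OF quotient_sect(1) diag_quotient_domain[OF y]] by blast
  let ?N = "Q \<inter> (domain \<inter> sect -` U)"
  have N: "open ?N" "y \<in> ?N"
    using PQ smooth_into_open[OF smooth_into_sect domain_open U_chart(1)] y U(2) by auto
  have "q2 (q1 (?k y')) = y'" if y': "y' \<in> ?N" for y'
  proof -
    have "(y, y') \<in> quotient_domain domain sect"
      using y' PQ by blast
    then have "F (?k y') = inv ?a \<otimes> sect y'"
      unfolding quotient_domain_def quotient_map_def by simp
    then have "q1 (?k y') = f (sect y')"
      unfolding q1_def by (simp add: m_assoc[symmetric])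
    then show ?thesis
      unfolding q2_def using y' sect(3)[of y'] U_chart(5) by simp
  qed
  then have "((\<lambda>y'. q2 (q1 (?k y'))) has_derivative (\<lambda>v. v)) (at y)"
    by (intro has_derivative_transform_within_open[OF has_derivative_ident N]) simp
  from has_derivative_unique[OF 1 this] show ?thesis
    by (simp add: fun_eq_iff)
qed

lemma invariant_coframe_inj:
  assumes "y \<in> domain"
  shows "inj (invariant_coframe y)"
proof -
  obtain U f where "(U, f) \<in> A" "sect y \<in> U"
    using atlas_cover[OF atlas] by blast
  from left_inverse[OF assms this] show ?thesis
    by (metis injI)
qed

text \<open>Left invariance carries the value at the identity to the point \<open>sect y\<close>,
  and the pullback along \<pi> carries it to the chart of the quotient. By
  \<open>left_inverse\<close> the composite of these two derivatives undoes the invariant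
  coframe.\<close>

lemma invariant_form:
  assumes y: "y \<in> domain" and \<psi>: "left_invariant G A \<psi>" "is_pullback A B \<pi> \<phi> \<psi>"
  shows "\<phi> (V, g) y = pull (invariant_coframe y) (\<psi> (U0, f0) x0)"
proof
  fix v
  obtain U f where U: "(U, f) \<in> A" "sect y \<in> U"
    using atlas_cover[OF atlas] by blast
  note U_chart = atlas_chart[OF atlas U(1)]
  let ?a = "sect y"
  let ?q1 = "f \<circ> (\<lambda>x. ?a \<otimes> x) \<circ> F" and ?q2 = "g \<circ> \<pi> \<circ> inv_into U f"
  have q1: "?q1 x0 = f ?a" and q2: "?q2 (f ?a) = y"
    using U(2) U_chart(5) sect[OF y] by simp_all
  have "is_pullback A A (\<lambda>x. ?a \<otimes> x) \<psi> \<psi>"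
    using \<psi>(1) unfolding left_invariant_def by blast
  moreover have "x0 \<in> f0 ` (U0 \<inter> (\<lambda>x. ?a \<otimes> x) -` U)"
    using U0(2) U(2) by (intro imageI) simp
  ultimately have 1: "\<psi> (U0, f0) x0 w = \<psi> (U, f) (?q1 x0) (\<lambda>i. frechet_derivative ?q1 (at x0) (w i))" for w
    using U0(1) U(1) unfolding is_pullback_def by fast
  have "f ?a \<in> f ` (U \<inter> \<pi> -` V)"
    using U(2) sect[OF y] by blast
  then have 2: "\<psi> (U, f) (f ?a) w = \<phi> (V, g) (?q2 (f ?a)) (\<lambda>i. frechet_derivative ?q2 (at (f ?a)) (w i))" for w
    using \<psi>(2) U(1) B(2) unfolding is_pullback_def by fast
  have "pull (invariant_coframe y) (\<psi> (U0, f0) x0) v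
      = \<phi> (V, g) y (\<lambda>i. frechet_derivative ?q2 (at (?q1 x0)) (frechet_derivative ?q1 (at x0) (invariant_coframe y (v i))))"
    unfolding pull_def 1 unfolding q1 2 q2 ..
  also have "\<dots> = \<phi> (V, g) y v"
    unfolding left_inverse[OF y U] ..
  finally show "\<phi> (V, g) y v = pull (invariant_coframe y) (\<psi> (U0, f0) x0) v" ..
qed

end

theorem corollary3p3:
  fixes G :: "'g::{t2_space,second_countable_topology} monoid"
    and A :: "('g, real^7) chart set"
    and \<Gamma> :: "'g set"
    and B :: "('m::{t2_space,second_countable_topology}, real^7) chart set"
    and \<pi> :: "'g \<Rightarrow> 'm"
  assumes "compact_solvmanifold G A \<Gamma> B \<pi>"
  shows "\<not> (\<exists>\<phi>. invariant_G2_structure G A B \<pi> \<phi> \<and>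
                 strong_G2T_structure B \<phi> \<and> \<not> parallel_G2_structure B \<phi>)"
proof -
  have GA: "lie_group G A" "solvable G" and B: "smooth_atlas B" and \<pi>: "local_diffeomorphism A B \<pi>" "surj \<pi>"
    using assms unfolding compact_solvmanifold_def by auto
  have A: "smooth_atlas A"
    using GA(1) unfolding lie_group_def by blast
  obtain U0 f0 where U0: "(U0, f0) \<in> A" "\<one>\<^bsub>G\<^esub> \<in> U0"
    using atlas_cover[OF A] by blast
  interpret lie_group_chart G A U0 f0
    by unfold_locales (rule GA(1) U0)+
  obtain S K where S: "\<And>k. subspace (S k)" "S 0 = UNIV" "\<And>k. S (Suc k) \<subseteq> S k" "S K = {0}"
      "\<And>k x y. x \<in> S k \<Longrightarrow> y \<in> S k \<Longrightarrow> bracket x y \<in> S (Suc k)"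
    using solvable_chain[OF GA(2)] by metis
  have "parallel_G2_structure B \<phi>" if inv: "invariant_G2_structure G A B \<pi> \<phi>" and strong: "strong_G2T_structure B \<phi>" for \<phi>
  proof -
    obtain \<psi> where \<psi>: "G2_structure A \<psi>" "left_invariant G A \<psi>" "is_pullback A B \<pi> \<phi> \<psi>"
      using inv unfolding invariant_G2_structure_def by blast
    obtain \<theta> where \<theta>: "is_Lee_form B \<phi> \<theta>" "form_eq B (ext_d 3 (torsion_form \<phi> \<theta>)) zero_form"
      using strong unfolding strong_G2T_structure_def by blast
    have "x0 \<in> X" by simp
    \<comment> \<open>One adapted coframe at the identity is enough: the invariant coframes spread
      it over the group and, through local sections, over every chart of the quotient.\<close>
    then obtain e where e: "adapted_coframe (\<psi> (U0, f0) x0) e"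
      using \<psi>(1) U0(1) unfolding G2_structure_def by blast
    interpret e: frame e
      using e by unfold_locales (simp add: adapted_coframe_def)
    have main: "ext_d 3 \<phi> (V, g) y0 = (\<lambda>v. 0) \<and> ext_d 4 (star \<phi> 3 \<phi>) (V, g) y0 = (\<lambda>v. 0)"
      if V: "(V, g) \<in> B" and y0: "y0 \<in> g ` V" for V g y0
    proof -
      \<comment> \<open>A preimage of the given point selects a sheet W of the projection; the
        section over it is defined near y0, which suffices as both equations are local.\<close>
      obtain a where a: "\<pi> a = inv_into V g y0"
        using \<pi>(2) by (metis surjD)
      obtain W where W: "open W" "a \<in> W" "open (\<pi> ` W)" "inj_on \<pi> W" "smooth_map_on A B W \<pi>" "smooth_map_on B A (\<pi> ` W) (inv_into W \<pi>)"
        using \<pi>(1) unfolding local_diffeomorphism_def by blast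
      interpret Q: quotient_chart G A U0 f0 B \<pi> W V g
        by unfold_locales (rule B V W)+
      have "\<pi> a \<in> V" "g (\<pi> a) = y0"
        using y0 unfolding a by (auto simp: inv_into_into f_inv_into_f)
      then have yd: "y0 \<in> Q.domain"
        using W(2) unfolding Q.domain_def by blast
      have dV: "y \<in> g ` V" if "y \<in> Q.domain" for y
        using that unfolding Q.domain_def by blast
      have \<phi>: "\<phi> (V, g) y = pull (Q.invariant_coframe y) (g2_model e)" if "y \<in> Q.domain" for y
        using Q.invariant_form[OF that \<psi>(2,3)] e unfolding adapted_coframe_def by simp
      have m\<theta>: "multilin 1 (\<theta> (V, g) y)" if "y \<in> Q.domain" for y
        using \<theta>(1) V dV[OF that] alt_form_multilin unfolding is_Lee_form_def diff_form_def by blast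
      have Lee: "ext_d 4 (star \<phi> 3 \<phi>) (V, g) y = wedge 1 4 (\<theta> (V, g) y) (star \<phi> 3 \<phi> (V, g) y)" if "y \<in> Q.domain" for y
        using \<theta>(1) V dV[OF that] unfolding is_Lee_form_def form_eq_def wedge_form_def by blast
      have dT: "ext_d 3 (torsion_form \<phi> \<theta>) (V, g) y = (\<lambda>v. 0)" if "y \<in> Q.domain" for y
        using \<theta>(2) V dV[OF that] unfolding form_eq_def zero_form_def by blast
      let ?n = "\<lambda>y u v. frechet_derivative (\<lambda>y. Q.invariant_coframe y v) (at y) u"
      have n: "((\<lambda>y. Q.invariant_coframe y v) has_derivative (\<lambda>u. ?n y u v)) (at y)" if "y \<in> Q.domain" for y v
        using smooth_on_has_derivative[OF smooth_on_fibre_derivative[OF Q.domain_open Q.smooth_into_sect] that]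
        unfolding Q.invariant_coframe_def .
      have st: "?n y u v - ?n y v u = - bracket (Q.invariant_coframe y u) (Q.invariant_coframe y v)" if "y \<in> Q.domain" for y u v
        unfolding Q.invariant_coframe_def by (rule structure_equation[OF Q.domain_open that Q.smooth_into_sect refl])
      show ?thesis
        using e.local_parallel[where E = Q.invariant_coframe and n = ?n and \<phi> = \<phi> and \<theta> = \<theta>, OF bilinear_bracket bracket_antisym jacobi S Q.domain_open yd
            Q.invariant_coframe_linear Q.invariant_coframe_inj n st \<phi> m\<theta> Lee dT] by blast
    qed
    show ?thesis
      using inv main unfolding parallel_G2_structure_def invariant_G2_structure_def form_eq_def zero_form_def by blast
  qed
  then show ?thesis by blast
qed

end
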